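(* Let $K$ be a fixed quadratic number field with ring of integers $\mathscr{O}$, and for positive integers $n$ let $f_K(n)$ be the number of ideals $\mathfrak{a}\subseteq\mathscr{O}$ with norm $\mathrm{N}\mathfrak{a}=\#(\mathscr{O}/\mathfrak{a})=n$. Then, as $x\to\infty$, \[ \max_{n\le x}\log f_K(f_K(n)) = \frac{\sqrt{\log x}}{\log_2 x}\left(\frac{c}{\sqrt 2}+\mathcal{O}\!\left(\frac{\log_3 x}{\log_2 x}\right)\right), \qquad c=\left(8\sum_{l=1}^{\infty}\left(\log\left(1+\frac1l\right)\right)^2\right)^{1/2}, \] where the implied constant may depend on $K$.
   Context: $\log$ is the natural logarithm and $\log_k$ denotes the $k$-fold iterated natural logarithm. The maximum is over positive integers $n\le x$. Since no ideal has norm $0$, we put $f_K(0)=0$ and use the convention $\log 0=-\infty$ (such $n$ do not affect the maximum). *)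

theory Defs
  imports
    Complex_Main
    "HOL-Algebra.Embedded_Algebras"
    "HOL-Algebra.QuotRing"
    "HOL-Algebra.Algebraic_Closure_Type"
    "HOL-Library.Extended_Real"
    "HOL-Library.Landau_Symbols"
begin

text \<open>
  Number fields are taken as subfields of an arbitrary field of characteristic 0, given as a type.
  Taking \<open>K = UNIV\<close> covers types that are themselves quadratic fields.  The set \<open>\<rat>\<close> is the
  copy of the rationals inside the ambient type.
\<close>

definition quadratic_field :: "'a :: field_char_0 set \<Rightarrow> bool" where
  "quadratic_field K \<longleftrightarrow>
     subfield K ring_of_type_algebra \<and> ring.dimension ring_of_type_algebra 2 \<rat> K"

definition ring_of_integers :: "'a :: field_char_0 set \<Rightarrow> 'a ring" where
  "ring_of_integers K = ring_of_type_algebra \<lparr>carrier := {x \<in> K. algebraic_int x}\<rparr>"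

text \<open>
  An infinite quotient has \<^const>\<open>card\<close> equal to 0 (this happens for the zero ideal), hence
  the explicit value at \<open>n = 0\<close> in the counting function below.
\<close>

definition ideal_norm :: "'a :: field_char_0 set \<Rightarrow> 'a set \<Rightarrow> nat" where
  "ideal_norm K I = card (carrier (ring_of_integers K Quot I))"

definition ideal_count :: "'a :: field_char_0 set \<Rightarrow> nat \<Rightarrow> nat" where
  "ideal_count K n =
     (if n = 0 then 0 else card {I. ideal I (ring_of_integers K) \<and> ideal_norm K I = n})"

text \<open>The library sets \<open>ln 0 = 0\<close>; here the value at 0 is \<open>-\<infinity>\<close>.\<close>

definition ext_ln :: "nat \<Rightarrow> ereal" where
  "ext_ln m = (if m = 0 then -\<infinity> else ereal (ln (real m)))"

definition c_const :: real where
  "c_const = sqrt (8 * (\<Sum>l. (ln (1 + 1 / real (Suc l)))\<^sup>2))"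

end

theory Submission
  imports Defs "HOL-Complex_Analysis.Complex_Analysis" "HOL-Probability.Probability"
    "HOL-Number_Theory.Number_Theory" "HOL-Real_Asymp.Real_Asymp"
begin

text \<open>
  Write \<open>K = \<rat>(\<surd>d)\<close> with \<open>d\<close> squarefree.  In Hermite normal form the ideals of norm \<open>n\<close> are the pairs of
  a \<open>k\<close> with \<open>k\<^sup>2 m = n\<close> and a root modulo \<open>m\<close> of the minimal polynomial of the generator of the ring of
  integers.  Hence \<open>f\<^sub>K\<close> is multiplicative, \<open>f\<^sub>K(p\<^sup>a) = a + 1\<close> if \<open>p\<close> splits, and \<open>f\<^sub>K(p\<^sup>a) \<le> 1\<close> otherwise.

  By quadratic reciprocity the split primes are, up to finitely many, those with \<open>ch p = 1\<close> for a
  nonprincipal real character \<open>ch\<close>.  There are \<open>x / (2 log x) (1 + O(log\<^sub>2 x / log x))\<close> of them below \<open>x\<close>: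
  \<open>\<zeta>(s) L(s, ch)\<close> has nonnegative coefficients, so \<open>L(1, ch) \<noteq> 0\<close> by Landau's argument, and the 3-4-1
  inequality bounds its inverse near \<open>Re s = 1\<close> by a small power of \<open>Im s\<close>.  The third derivative of its
  logarithmic derivative is therefore \<open>6 / (s - 1)\<^sup>4 + O(\<bar>s\<bar>)\<close>, and smoothing with a narrow Gaussian
  followed by a monotonicity argument recovers the counting function.

  Let \<open>q\<close> range over split primes and let \<open>e\<^sub>q\<close> be the exponent of \<open>q\<close> in \<open>f\<^sub>K(n) = \<Prod> (a\<^sub>p + 1)\<close>.  Making
  \<open>f\<^sub>K(n)\<close> divisible by \<open>q\<^sup>e\<close> costs \<open>(q - 1) e\<close> prime factors of \<open>n\<close>, almost all of size
  \<open>(log x)\<^bsup>1/2 + o(1)\<^esup>\<close>, so one maximises \<open>\<Sum> log (1 + e\<^sub>q)\<close> subject to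
  \<open>\<Sum> (q - 1) e\<^sub>q \<le> 2 log x / log\<^sub>2 x\<close> approximately.  Raising \<open>e\<^sub>q\<close> from \<open>l\<close> to \<open>l + 1\<close> gains
  \<open>log (1 + 1/(l + 1))\<close>; with a Lagrange multiplier \<open>1/Y\<close> the step is worthwhile iff
  \<open>q - 1 \<le> Y log (1 + 1/(l + 1))\<close>, and summing over \<open>q\<close> and \<open>l\<close> yields the constant
  \<open>\<Sum> log (1 + 1/l)\<^sup>2\<close>.
\<close>

section \<open>Dirichlet series\<close>

text \<open>Taking \<open>\<zeta>(s) L(s, ch)\<close> as one function gives its logarithmic
  derivative the nonnegative weights \<open>1 + ch n\<close>: one 3-4-1 inequality and one simple
  pole suffice, and the prime sums are monotone, as the passage from smoothed averages back to sums
  requires.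

  The third derivative is dictated by that passage. Its transform, once divided by \<open>s\<close>,
  is only known to be bounded, so a Gaussian of width \<open>1/T\<close> leaves an error
  \<open>O(T)\<close> against a main term \<open>w^3\<close>, where \<open>w = log x\<close>. A
  relative error \<open>1/w\<close> allows \<open>T = w^2\<close>, and the shift \<open>1/w\<close>
  of the monotonicity argument then spans \<open>w\<close> Gaussian widths, which makes the tails
  harmless. With a main term \<open>w^2\<close>, \<open>T\<close> could only be \<open>w\<close> and
  the shift a single width. Lower bounds for the function are used only right of
  \<open>Re s = 1\<close>, so no zero-free region enters.

  This weak form of the prime number theorem is enough: the relevant \<open>q\<close> have size
  about \<open>sqrt (log x)\<close>, and a relative error \<open>log log q / log q\<close> at that
  height is the \<open>log_3 x / log_2 x\<close> of the theorem.\<close>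

definition dir_series :: "(nat \<Rightarrow> real) \<Rightarrow> complex \<Rightarrow> complex" where
  "dir_series c s = (\<Sum>n. of_real (c n) * of_nat n powr (-s))"

text \<open>As \<open>0 powr z = 0\<close>, both this and \<open>dir_series\<close> ignore the value
  \<open>c 0\<close>; the series effectively start at 1.\<close>

definition dir_summable :: "(nat \<Rightarrow> real) \<Rightarrow> bool" where
  "dir_summable c \<longleftrightarrow> (\<forall>\<sigma>>1. summable (\<lambda>n. \<bar>c n\<bar> * real n powr (-\<sigma>)))"

text \<open>At \<open>n = 0\<close> the divisors form an infinite set, so the sum takes its default
  value 0.\<close>

definition dir_conv :: "(nat \<Rightarrow> real) \<Rightarrow> (nat \<Rightarrow> real) \<Rightarrow> nat \<Rightarrow> real" where
  "dir_conv c d n = (\<Sum>k | k dvd n. c k * d (n div k))"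

lemma norm_nat_powr: "cmod (of_nat n powr s) = real n powr Re s"
  by (simp add: norm_powr_real_powr)

lemma nat_powr_exp: "n > 0 \<Longrightarrow> (of_nat n :: complex) powr s = exp (s * of_real (ln (real n)))"
  by (simp add: powr_def Ln_of_nat)

lemma dir_series_summable_norm:
  assumes "dir_summable c" "Re s > 1"
  shows "summable (\<lambda>n. cmod (of_real (c n) * of_nat n powr (-s)))"
  using assms by (simp add: dir_summable_def norm_mult norm_nat_powr)

lemma dir_series_sums:
  assumes "dir_summable c" "Re s > 1"
  shows "(\<lambda>n. of_real (c n) * of_nat n powr (-s)) sums dir_series c s"
  unfolding dir_series_def using summable_norm_cancel[OF dir_series_summable_norm[OF assms]] by (rule summable_sums)

lemma dir_summable_bounded:
  assumes "\<And>n. \<bar>c n\<bar> \<le> B"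
  shows "dir_summable c"
  unfolding dir_summable_def
proof (intro allI impI)
  fix \<sigma> :: real assume "\<sigma> > 1"
  have "summable (\<lambda>n. B * real n powr (-\<sigma>))"
    using \<open>\<sigma> > 1\<close> by (intro summable_mult) (simp add: summable_real_powr_iff)
  then show "summable (\<lambda>n. \<bar>c n\<bar> * real n powr (-\<sigma>))"
    by (rule summable_comparison_test') (use assms in \<open>auto intro: mult_right_mono\<close>)
qed

lemma dir_summable_le:
  assumes "dir_summable c" "\<And>n. \<bar>d n\<bar> \<le> \<bar>c n\<bar>"
  shows "dir_summable d"
  unfolding dir_summable_def
proof (intro allI impI)
  fix \<sigma> :: real assume "\<sigma> > 1"
  then have "summable (\<lambda>n. \<bar>c n\<bar> * real n powr (-\<sigma>))" using assms(1) by (auto simp: dir_summable_def)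
  then show "summable (\<lambda>n. \<bar>d n\<bar> * real n powr (-\<sigma>))"
    by (rule summable_comparison_test') (use assms(2) in \<open>auto intro: mult_right_mono\<close>)
qed

lemma dir_summable_ln:
  assumes "dir_summable c"
  shows "dir_summable (\<lambda>n. c n * ln (real n))"
  unfolding dir_summable_def
proof (intro allI impI)
  fix \<sigma> :: real assume s: "\<sigma> > 1"
  \<comment> \<open>Half of the distance to the line pays for the logarithm, through
    \<open>ln n \<le> n powr e / e\<close>.\<close>
  define e where "e = (\<sigma> - 1) / 2"
  have e: "e > 0" "\<sigma> - e > 1" using s by (auto simp: e_def field_simps)
  have "summable (\<lambda>n. (1/e) * (\<bar>c n\<bar> * real n powr (-(\<sigma> - e))))"
    using assms e by (intro summable_mult) (auto simp: dir_summable_def)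
  then show "summable (\<lambda>n. \<bar>c n * ln (real n)\<bar> * real n powr (-\<sigma>))"
  proof (rule summable_comparison_test'[where N = 1])
    fix n :: nat assume n: "n \<ge> 1"
    have "ln (real n) \<le> real n powr e / e" using ln_powr_bound[of "real n" e] n e by simp
    then have "\<bar>c n\<bar> * ln (real n) * real n powr (-\<sigma>) \<le> \<bar>c n\<bar> * (real n powr e / e) * real n powr (-\<sigma>)"
      by (intro mult_right_mono mult_left_mono) auto
    also have "\<dots> = (1/e) * (\<bar>c n\<bar> * real n powr (-(\<sigma> - e)))"
      by (simp add: powr_add[symmetric] algebra_simps)
    finally show "norm (\<bar>c n * ln (real n)\<bar> * real n powr (-\<sigma>)) \<le> (1/e) * (\<bar>c n\<bar> * real n powr (-(\<sigma> - e)))"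
      using n by (simp add: abs_mult)
  qed
qed

lemma dir_summable_ln_pow: "dir_summable c \<Longrightarrow> dir_summable (\<lambda>n. c n * ln (real n) ^ j)"
proof (induction j)
  case (Suc j)
  from dir_summable_ln[OF Suc.IH[OF Suc.prems]] show ?case by (simp add: mult_ac)
qed simp

text \<open>Termwise differentiation, with the Weierstrass majorant taken at the abscissa halfway
  between 1 and \<open>Re s\<close>. The derived series satisfies the same hypothesis, so the lemma
  iterates.\<close>

lemma dir_series_has_derivative:
  assumes "dir_summable c" "Re s > 1"
  shows "(dir_series c has_field_derivative - dir_series (\<lambda>n. c n * ln (real n)) s) (at s)"
proof -
  define S where "S = {s::complex. Re s > 1}"
  have S: "open S" unfolding S_def by (rule open_halfspace_Re_gt)
  have der: "((\<lambda>s::complex. of_real (c n) * of_nat n powr (-s)) has_field_derivative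
           - (of_real (c n * ln (real n)) * of_nat n powr (-x))) (at x)" for n x
  proof (cases "n = 0")
    case False
    then have "((\<lambda>s. of_real (c n) * exp (- s * of_real (ln (real n)))) has_field_derivative
           - (of_real (c n * ln (real n)) * exp (- x * of_real (ln (real n))))) (at x)"
      by (auto intro!: derivative_eq_intros)
    with False show ?thesis by (simp add: nat_powr_exp)
  qed auto
  have "\<exists>g g'. \<forall>x \<in> S. ((\<lambda>n. of_real (c n) * of_nat n powr (-x)) sums g x) \<and>
       ((\<lambda>n. - (of_real (c n * ln (real n)) * of_nat n powr (-x))) sums g' x) \<and> (g has_field_derivative g' x) (at x)"
  proof (rule series_and_derivative_comparison_complex[OF S der])
    fix x assume x: "x \<in> S"
    define d where "d = (Re x - 1) / 2"
    have d: "d > 0" "Re x - d > 1" using x by (auto simp: d_def S_def field_simps)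
    have bd: "cmod (of_real (c n) * of_nat n powr (-y)) \<le> cmod (complex_of_real (\<bar>c n\<bar> * real n powr (-(Re x - d))))"
      if y: "y \<in> ball x d" for n y
    proof (cases "n = 0")
      case False
      have "\<bar>Re (x - y)\<bar> < d" using y abs_Re_le_cmod[of "x - y"] by (simp add: dist_norm)
      then have "Re y \<ge> Re x - d" by simp
      then have "real n powr - Re y \<le> real n powr (-(Re x - d))" using False by (intro powr_mono) auto
      then have "\<bar>c n\<bar> * real n powr - Re y \<le> \<bar>c n\<bar> * real n powr (-(Re x - d))" by (intro mult_left_mono) auto
      also have "\<dots> = \<bar>\<bar>c n\<bar> * real n powr (-(Re x - d))\<bar>" by simp
      finally show ?thesis by (simp only: norm_mult norm_of_real norm_nat_powr uminus_complex.sel)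
    qed auto
    have "summable (\<lambda>n. complex_of_real (\<bar>c n\<bar> * real n powr (-(Re x - d))))"
      using assms(1) d by (intro summable_of_real) (auto simp: dir_summable_def)
    with bd d show "\<exists>d h. 0 < d \<and> summable h \<and> range h \<subseteq> \<real>\<^sub>\<ge>\<^sub>0 \<and>
        (\<forall>\<^sub>F n in sequentially. \<forall>y\<in>ball x d \<inter> S. cmod (of_real (c n) * of_nat n powr (-y)) \<le> cmod (h n))"
      by (intro exI[of _ d] exI[of _ "\<lambda>n. complex_of_real (\<bar>c n\<bar> * real n powr (-(Re x - d)))"])
         (auto simp del: of_real_mult)
  qed
  then obtain g g' where g: "\<And>x. x \<in> S \<Longrightarrow> ((\<lambda>n. of_real (c n) * of_nat n powr (-x)) sums g x)"
      "\<And>x. x \<in> S \<Longrightarrow> ((\<lambda>n. - (of_real (c n * ln (real n)) * of_nat n powr (-x))) sums g' x)"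
      "\<And>x. x \<in> S \<Longrightarrow> (g has_field_derivative g' x) (at x)" by blast
  have sS: "s \<in> S" using assms by (simp add: S_def)
  have "g' s = - dir_series (\<lambda>n. c n * ln (real n)) s"
    using g(2)[OF sS] sums_minus[OF dir_series_sums[OF dir_summable_ln[OF assms(1)] assms(2)]] by (intro sums_unique2) 
  moreover have "g x = dir_series c x" if "x \<in> S" for x
    using g(1)[OF that] dir_series_sums[OF assms(1), of x] that by (intro sums_unique2) (auto simp: S_def)
  ultimately show ?thesis
    using has_field_derivative_transform_within_open[OF g(3)[OF sS] S sS] by auto
qed

lemma dir_series_holomorphic: "dir_summable c \<Longrightarrow> dir_series c holomorphic_on {s. Re s > 1}"
  by (auto simp: holomorphic_on_open open_halfspace_Re_gt intro: dir_series_has_derivative)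

lemma dir_series_higher_deriv:
  assumes "dir_summable c" "Re s > 1"
  shows "(deriv ^^ j) (dir_series c) s = (-1) ^ j * dir_series (\<lambda>n. c n * ln (real n) ^ j) s"
  using assms(2)
proof (induction j arbitrary: s)
  case (Suc j)
  have "deriv ((deriv ^^ j) (dir_series c)) s = deriv (\<lambda>s. (-1) ^ j * dir_series (\<lambda>n. c n * ln (real n) ^ j) s) s"
  proof (rule deriv_cong_ev)
    have "\<forall>\<^sub>F s in nhds s. s \<in> {s. Re s > 1}"
      using Suc.prems by (intro eventually_nhds_in_open) (auto simp: open_halfspace_Re_gt)
    then show "\<forall>\<^sub>F s in nhds s. (deriv ^^ j) (dir_series c) s = (-1) ^ j * dir_series (\<lambda>n. c n * ln (real n) ^ j) s"
      by eventually_elim (use Suc.IH in auto)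
  qed simp
  also have "\<dots> = (-1) ^ j * (- dir_series (\<lambda>n. (c n * ln (real n) ^ j) * ln (real n)) s)"
    by (intro DERIV_imp_deriv DERIV_cmult dir_series_has_derivative dir_summable_ln_pow assms Suc.prems)
  finally show ?case by (simp add: mult_ac)
qed simp

text \<open>Unordered sums are used because grouping the double family \<open>a k * b m\<close> by
  the product \<open>k * m\<close> is a rearrangement; the bijection sends \<open>(n, k)\<close> to
  \<open>(k, n div k)\<close>. Index 0 is removed since it has infinitely many divisors.\<close>

lemma dir_conv_has_sum:
  fixes a b :: "nat \<Rightarrow> complex"
  assumes "summable (\<lambda>n. norm (a n))" "summable (\<lambda>n. norm (b n))" "a 0 = 0" "b 0 = 0"
  shows "((\<lambda>n. \<Sum>k | k dvd n. a k * b (n div k)) has_sum (suminf a * suminf b)) {0<..}"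
    and "(\<lambda>n. norm (\<Sum>k | k dvd n. a k * b (n div k))) summable_on {0<..}"
proof -
  define N where "N = {0::nat<..}"
  have hs: "(f has_sum suminf f) N" "(\<lambda>x. norm (f x)) summable_on N" if "summable (\<lambda>n. norm (f n))" "f 0 = 0" for f :: "nat \<Rightarrow> complex"
  proof -
    have "(f has_sum suminf f) UNIV"
      using norm_summable_imp_has_sum[OF that(1)] summable_norm_cancel[OF that(1)] by (auto simp: summable_sums)
    then show "(f has_sum suminf f) N"
      by (subst has_sum_cong_neutral[where T = N and S = UNIV and g = f, symmetric]) (use that in \<open>auto simp: N_def\<close>)
    have "(\<lambda>x. norm (f x)) summable_on UNIV" using that(1) by (intro norm_summable_imp_summable_on) auto
    then show "(\<lambda>x. norm (f x)) summable_on N" by (rule summable_on_subset_banach) auto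
  qed
  have ab: "(\<lambda>x. norm ((\<lambda>(k,m). a k * b m) x)) summable_on N \<times> N"
  proof -
    have "(\<lambda>(k,m). norm (a k) * norm (b m)) summable_on (SIGMA k:N. N)"
    proof (rule summable_on_SigmaI)
      show "((\<lambda>m. case (k, m) of (k, m) \<Rightarrow> norm (a k) * norm (b m)) has_sum norm (a k) * infsum (\<lambda>m. norm (b m)) N) N" for k
        using has_sum_cmult_right[OF has_sum_infsum[OF hs(2)[OF assms(2,4)]]] by simp
      show "(\<lambda>k. norm (a k) * infsum (\<lambda>m. norm (b m)) N) summable_on N"
        using hs(2)[OF assms(1,3)] by (rule summable_on_cmult_left)
    qed auto
    then show ?thesis by (simp add: case_prod_unfold norm_mult)
  qed
  have ab': "(\<lambda>(k,m). a k * b m) summable_on N \<times> N" using ab by (rule abs_summable_summable)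
  have "infsum (\<lambda>(k,m). a k * b m) (N \<times> N) = (\<Sum>\<^sub>\<infinity>k\<in>N. \<Sum>\<^sub>\<infinity>m\<in>N. a k * b m)"
    using infsum_Sigma'_banach[OF ab'] by simp
  also have "\<dots> = (\<Sum>\<^sub>\<infinity>k\<in>N. a k * suminf b)"
    using hs(1)[OF assms(2,4)] by (intro infsum_cong) (metis has_sum_cmult_right infsumI)
  also have "\<dots> = suminf a * suminf b"
    using hs(1)[OF assms(1,3)] by (metis has_sum_cmult_left infsumI)
  finally have tot: "((\<lambda>(k,m). a k * b m) has_sum (suminf a * suminf b)) (N \<times> N)"
    using ab' by (metis has_sum_infsum)
  define T where "T = (SIGMA n:N. {k. k dvd n})"
  have bij: "bij_betw (\<lambda>(n,k). (k, n div k)) T (N \<times> N)"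
    by (rule bij_betwI[where g = "\<lambda>(k,m). (k * m, k)"]) (auto simp: T_def N_def elim!: dvdE)
  have 1: "((\<lambda>(n,k). a k * b (n div k)) has_sum (suminf a * suminf b)) T"
    using has_sum_reindex_bij_betw[OF bij, of "\<lambda>(k,m). a k * b m"] tot by (simp add: case_prod_unfold)
  then show "((\<lambda>n. \<Sum>k | k dvd n. a k * b (n div k)) has_sum (suminf a * suminf b)) {0<..}"
    unfolding T_def N_def[symmetric]
    by (rule has_sum_SigmaD) (auto simp: N_def intro!: has_sum_finiteI finite_divisors_nat)
  have "(\<lambda>x. norm ((\<lambda>(n,k). a k * b (n div k)) x)) summable_on T"
    using summable_on_reindex_bij_betw[OF bij, of "\<lambda>x. norm (case x of (k,m) \<Rightarrow> a k * b m)"] ab by (simp add: case_prod_unfold)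
  then have "(\<lambda>n. \<Sum>\<^sub>\<infinity>k\<in>{k. k dvd n}. norm (a k * b (n div k))) summable_on N"
    unfolding T_def using summable_on_Sigma_banach[of "\<lambda>n k. norm (a k * b (n div k))" N "\<lambda>n. {k. k dvd n}"]
    by (auto simp: case_prod_unfold)
  then have *: "(\<lambda>n. \<Sum>k | k dvd n. norm (a k * b (n div k))) summable_on N"
    by (rule summable_on_cong[THEN iffD1, rotated]) (auto simp: N_def intro!: infsum_finite finite_divisors_nat)
  show "(\<lambda>n. norm (\<Sum>k | k dvd n. a k * b (n div k))) summable_on {0<..}"
    by (rule summable_on_comparison_test[OF *[unfolded N_def]]) (auto intro: norm_sum)
qed

lemma nat_powr_mult_div:
  assumes "k dvd n" "n > 0"
  shows "(of_nat k powr (-s)) * (of_nat (n div k) powr (-s)) = (of_nat n powr (-s) :: complex)"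
proof -
  from assms obtain m where m: "n = k * m" by auto
  with assms have km: "k > 0" "m > 0" by auto
  then have "n div k = m" by (simp add: m)
  with km assms show ?thesis by (simp add: nat_powr_exp m ln_mult algebra_simps flip: exp_add del: of_nat_mult) (simp add: ln_mult algebra_simps)
qed

lemma dir_series_conv:
  assumes "dir_summable c" "dir_summable d"
  shows "Re s > 1 \<Longrightarrow> dir_series (dir_conv c d) s = dir_series c s * dir_series d s" and "dir_summable (dir_conv c d)"
proof -
  have *: "((\<lambda>n. of_real (dir_conv c d n) * of_nat n powr (-s)) has_sum (dir_series c s * dir_series d s)) {0<..} \<and>
      (\<lambda>n. norm (of_real (dir_conv c d n) * of_nat n powr (-s))) summable_on {0<..}" if "Re s > 1" for s
  proof -
    define a b where "a = (\<lambda>n. complex_of_real (c n) * of_nat n powr (-s))" and "b = (\<lambda>n. complex_of_real (d n) * of_nat n powr (-s))"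
    have eq: "(\<Sum>k | k dvd n. a k * b (n div k)) = of_real (dir_conv c d n) * of_nat n powr (-s)" if "n \<in> {0<..}" for n
      unfolding dir_conv_def of_real_sum sum_distrib_right
    proof (rule sum.cong)
      fix k assume "k \<in> {k. k dvd n}"
      with nat_powr_mult_div[of k n s] that 
      show "a k * b (n div k) = of_real (c k * d (n div k)) * of_nat n powr (-s)"
        by (simp add: a_def b_def mult_ac)
    qed auto
    have "summable (\<lambda>n. norm (a n))" "summable (\<lambda>n. norm (b n))" "a 0 = 0" "b 0 = 0"
      using dir_series_summable_norm[OF assms(1) that] dir_series_summable_norm[OF assms(2) that] by (auto simp: a_def b_def)
    note h = dir_conv_has_sum[OF this]
    have 1: "((\<lambda>n. of_real (dir_conv c d n) * of_nat n powr (-s)) has_sum suminf a * suminf b) {0<..}"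
      using h(1) by (rule has_sum_cong[THEN iffD1, rotated]) (rule eq)
    have 2: "(\<lambda>n. norm (of_real (dir_conv c d n) * of_nat n powr (-s))) summable_on {0<..}"
      using h(2) by (rule summable_on_cong[THEN iffD1, rotated]) (simp only: eq)
    from 1 2 show ?thesis
      unfolding dir_series_def a_def[symmetric] b_def[symmetric] by blast
  qed
  show "dir_series (dir_conv c d) s = dir_series c s * dir_series d s" if "Re s > 1"
  proof -
    have "((\<lambda>n. of_real (dir_conv c d n) * of_nat n powr (-s)) has_sum (dir_series c s * dir_series d s)) UNIV"
      by (subst has_sum_cong_neutral[where T = "{0<..}" and S = UNIV and g = "(\<lambda>n. of_real (dir_conv c d n) * of_nat n powr (-s))"]) (use *[OF that] in \<open>auto\<close>)
    then show ?thesis unfolding dir_series_def by (intro sums_unique[symmetric] has_sum_imp_sums)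
  qed
  show "dir_summable (dir_conv c d)" unfolding dir_summable_def
  proof (intro allI impI)
    fix \<sigma> :: real assume "\<sigma> > 1"
    then have "(\<lambda>n. norm (of_real (dir_conv c d n) * of_nat n powr (-complex_of_real \<sigma>))) summable_on {0<..}"
      using *[of "complex_of_real \<sigma>"] by auto
    then have "(\<lambda>n. norm (of_real (dir_conv c d n) * of_nat n powr (-complex_of_real \<sigma>))) summable_on UNIV"
      by (subst summable_on_cong_neutral[where T = "{0<..}" and S = UNIV and g = "\<lambda>n. norm (of_real (dir_conv c d n) * of_nat n powr (-complex_of_real \<sigma>))"]) auto
    then have "summable (\<lambda>n. norm (of_real (dir_conv c d n) * of_nat n powr (-complex_of_real \<sigma>)))"
      by (rule summable_on_imp_summable)
    then show "summable (\<lambda>n. \<bar>dir_conv c d n\<bar> * real n powr (-\<sigma>))" by (simp add: norm_mult norm_nat_powr)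
  qed
qed

section \<open>Continuation of zeta and L to the half plane Re s > 0\<close>

lemma field_diff_seg_bound:
  fixes f f' :: "complex \<Rightarrow> complex"
  assumes "\<And>x. a \<le> x \<Longrightarrow> x \<le> b \<Longrightarrow> (f has_field_derivative f' (of_real x)) (at (of_real x))"
    and "\<And>x. a \<le> x \<Longrightarrow> x \<le> b \<Longrightarrow> cmod (f' (of_real x)) \<le> B" and "a \<le> b"
  shows "cmod (f (of_real b) - f (of_real a)) \<le> B * (b - a)"
proof -
  let ?S = "complex_of_real ` {a..b}"
  have conv: "convex ?S" by (intro convex_linear_image) (auto simp: linear_iff scaleR_conv_of_real)
  have "cmod (f (of_real b) - f (of_real a)) \<le> B * cmod (of_real b - of_real a)"
    using assms by (intro field_differentiable_bound[OF conv, of f f' B]) (auto intro: has_field_derivative_at_within)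
  also have "\<dots> = B * (b - a)" using assms(3) by (simp flip: of_real_diff)
  finally show ?thesis .
qed

lemma real_powr_deriv:
  assumes "x > 0"
  shows "((\<lambda>z::complex. z powr p) has_field_derivative p * of_real x powr (p - 1)) (at (of_real x))"
  using assms by (intro has_field_derivative_powr) auto

lemma norm_real_powr: "a \<ge> 0 \<Longrightarrow> cmod (of_real a powr s) = a powr Re s"
  by (simp add: norm_powr_real_powr)

lemma powr_diff_bound1:
  assumes "1 \<le> a" "a \<le> x" "x \<le> a + 1" "Re s \<ge> 0"
  shows "cmod (of_real a powr (-s) - of_real x powr (-s)) \<le> cmod s * a powr (-Re s - 1)"
proof -
  have "cmod (of_real x powr (-s) - of_real a powr (-s)) \<le> (cmod s * a powr (-Re s - 1)) * (x - a)"
  proof (rule field_diff_seg_bound)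
    fix y assume y: "a \<le> y" "y \<le> x"
    then show "((\<lambda>z. z powr (-s)) has_field_derivative (\<lambda>z. - s * z powr (-s - 1)) (of_real y)) (at (of_real y))"
      using assms real_powr_deriv[of y "-s"] by simp
    have "y powr (-Re s - 1) \<le> a powr (-Re s - 1)" using assms y by (intro powr_mono2') auto
    then show "cmod ((\<lambda>z. - s * z powr (-s - 1)) (of_real y)) \<le> cmod s * a powr (-Re s - 1)"
      using assms y by (simp add: norm_mult norm_real_powr mult_left_mono)
  qed (use assms in auto)
  also have "\<dots> \<le> (cmod s * a powr (-Re s - 1)) * 1" using assms by (intro mult_left_mono) auto
  finally show ?thesis by (simp add: norm_minus_commute)
qed

text \<open>Interpolating between the trivial bound and the mean value bound keeps the dependence on
  \<open>s\<close> down to an arbitrarily small power.\<close>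

lemma powr_diff_bound:
  assumes "1 \<le> a" "a \<le> x" "x \<le> a + 1" "Re s \<ge> 0" "0 \<le> \<theta>" "\<theta> \<le> 1"
  shows "cmod (of_real a powr (-s) - of_real x powr (-s)) \<le> 2 * cmod s powr \<theta> * a powr (-Re s - \<theta>)"
proof -
  define A where "A = cmod (of_real a powr (-s) - of_real x powr (-s))"
  have b1: "A \<le> cmod s * a powr (-Re s - 1)" unfolding A_def using powr_diff_bound1 assms by blast
  have "A \<le> a powr (-Re s) + x powr (-Re s)"
    unfolding A_def by (rule order.trans[OF norm_triangle_ineq4]) (use assms in \<open>simp add: norm_real_powr\<close>)
  also have "x powr (-Re s) \<le> a powr (-Re s)" using assms by (intro powr_mono2') auto
  finally have b2: "A \<le> 2 * a powr (-Re s)" by simp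
  have "A \<le> 2 * cmod s powr \<theta> * a powr (-Re s - \<theta>)"
  proof (cases "A = 0")
    case False
    then have A0: "A > 0" by (simp add: A_def)
    have "A = A powr \<theta> * A powr (1 - \<theta>)" using A0 by (simp add: powr_add[symmetric])
    also have "\<dots> \<le> (cmod s * a powr (-Re s - 1)) powr \<theta> * (2 * a powr (-Re s)) powr (1 - \<theta>)"
      using A0 b1 b2 assms by (intro mult_mono powr_mono2) auto
    also have "\<dots> = 2 powr (1-\<theta>) * cmod s powr \<theta> * (a powr ((-Re s - 1) * \<theta>) * a powr (-Re s * (1 - \<theta>)))"
      using assms by (simp add: powr_mult powr_powr mult_ac)
    also have "a powr ((-Re s - 1) * \<theta>) * a powr (-Re s * (1 - \<theta>)) = a powr (-Re s - \<theta>)"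
      by (simp add: powr_add[symmetric] algebra_simps)
    also have "2 powr (1-\<theta>) * cmod s powr \<theta> * a powr (-Re s - \<theta>) \<le> 2 powr 1 * cmod s powr \<theta> * a powr (-Re s - \<theta>)"
      using assms by (intro mult_right_mono powr_mono) auto
    finally show ?thesis by simp
  qed auto
  then show ?thesis by (simp add: A_def)
qed

lemma summable_Suc_powr: "p > 1 \<Longrightarrow> summable (\<lambda>n. real (Suc n) powr (-p))"
  using summable_real_powr_iff[of "-p"] summable_Suc_iff[of "\<lambda>n. real n powr (-p)"] by simp

lemma holomorphic_series:
  fixes f :: "nat \<Rightarrow> complex \<Rightarrow> complex"
  assumes "open S" "\<And>n. f n holomorphic_on S"
    and "\<And>x. x \<in> S \<Longrightarrow> \<exists>d C p. d > 0 \<and> p > 1 \<and> (\<forall>n. \<forall>y\<in>ball x d \<inter> S. cmod (f n y) \<le> C * real (Suc n) powr (-p))"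
  shows "(\<lambda>s. \<Sum>n. f n s) holomorphic_on S"
proof -
  obtain g where g: "\<forall>x \<in> S. ((\<lambda>n. f n x) sums g x) \<and> g field_differentiable (at x)"
  proof (rule series_differentiable_comparison_complex[OF assms(1)])
    show "f n field_differentiable at x" if "x \<in> S" for n x
      using assms(1,2) that holomorphic_on_imp_differentiable_at by blast
    fix x assume x: "x \<in> S"
    from assms(3)[OF x] obtain d C p where d: "d > 0" "p > 1"
      and b: "\<And>n y. y\<in>ball x d \<inter> S \<Longrightarrow> cmod (f n y) \<le> C * real (Suc n) powr (-p)" by blast
    have "cmod (f 0 x) \<le> C" using b[of x 0] x d by simp
    then have C: "C \<ge> 0" by (rule order.trans[OF norm_ge_zero])
    show "\<exists>d h. 0 < d \<and> summable h \<and> range h \<subseteq> \<real>\<^sub>\<ge>\<^sub>0 \<and>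
        (\<forall>\<^sub>F n in sequentially. \<forall>y\<in>ball x d \<inter> S. cmod (f n y) \<le> cmod (h n))"
    proof (intro exI conjI)
      show "summable (\<lambda>n. complex_of_real (C * real (Suc n) powr (-p)))"
        by (intro summable_of_real summable_mult summable_Suc_powr d)
      show "\<forall>\<^sub>F n in sequentially. \<forall>y\<in>ball x d \<inter> S. cmod (f n y) \<le> cmod (complex_of_real (C * real (Suc n) powr (-p)))"
        using b C by (auto simp: norm_mult simp del: of_real_mult of_nat_Suc)
    qed (use d C in auto)
  qed auto
  have "(\<Sum>n. f n x) = g x" if "x \<in> S" for x using g that by (auto simp: sums_iff)
  moreover have "g holomorphic_on S" using g assms(1) by (auto simp: holomorphic_on_def field_differentiable_at_within)
  ultimately show ?thesis by (simp cong: holomorphic_cong)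
qed

text \<open>\<open>zeta1\<close> continues \<open>(s - 1) \<zeta>(s)\<close>: the telescoping difference makes the terms \<open>O(n\<^bsup>-1-Re s\<^esup>)\<close>.\<close>

definition zeta_term :: "nat \<Rightarrow> complex \<Rightarrow> complex" where
  "zeta_term n s = (s - 1) * of_nat (Suc n) powr (-s) - of_nat (Suc n) powr (1 - s) + of_nat (Suc (Suc n)) powr (1 - s)"

definition zeta1 :: "complex \<Rightarrow> complex" where
  "zeta1 s = 1 + (\<Sum>n. zeta_term n s)"

text \<open>The term is the increment over \<open>[a, a + 1]\<close>, with \<open>a = n + 1\<close>,
  of a function whose derivative is \<open>s - 1\<close> times a difference of the powers
  \<open>a powr -s\<close> and \<open>x powr -s\<close>; the interpolated bound applies to that
  difference.\<close>

lemma zeta_term_bound: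
  assumes "Re s \<ge> 0" "0 \<le> \<theta>" "\<theta> \<le> 1"
  shows "cmod (zeta_term n s) \<le> cmod (s - 1) * (2 * cmod s powr \<theta>) * real (Suc n) powr (-(Re s + \<theta>))"
proof -
  define a where "a = real (Suc n)"
  define g where "g = (\<lambda>z. (s - 1) * of_real a powr (-s) * z + z powr (1 - s))"
  define g' where "g' = (\<lambda>z. (s - 1) * (of_real a powr (-s) - z powr (-s)))"
  have a: "a \<ge> 1" by (simp add: a_def)
  have "cmod (g (of_real (a+1)) - g (of_real a)) \<le> (cmod (s - 1) * (2 * cmod s powr \<theta> * a powr (-Re s - \<theta>))) * (a + 1 - a)"
  proof (rule field_diff_seg_bound)
    fix x assume x: "a \<le> x" "x \<le> a + 1"
    have "((\<lambda>z. (s - 1) * of_real a powr (-s) * z + z powr (1 - s)) has_field_derivative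
        ((s - 1) * of_real a powr (-s) * 1 + (1 - s) * of_real x powr (1 - s - 1))) (at (of_real x))"
      using x a by (intro DERIV_add DERIV_cmult DERIV_ident real_powr_deriv) auto
    then show "(g has_field_derivative g' (of_real x)) (at (of_real x))"
      by (simp add: g_def g'_def algebra_simps)
    show "cmod (g' (of_real x)) \<le> cmod (s - 1) * (2 * cmod s powr \<theta> * a powr (-Re s - \<theta>))"
      unfolding g'_def norm_mult using powr_diff_bound[of a x s \<theta>] x a assms by (intro mult_left_mono) auto
  qed auto
  moreover have "g (of_real (a+1)) - g (of_real a) = zeta_term n s"
    by (simp add: g_def zeta_term_def a_def algebra_simps)
  ultimately show ?thesis by (simp add: a_def mult_ac)
qed

lemma holomorphic_powr_minus: "(\<lambda>s. of_nat (Suc n) powr (f s)) holomorphic_on S" if "f holomorphic_on S"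
proof -
  have "(\<lambda>s. exp (f s * of_real (ln (real (Suc n))))) holomorphic_on S" by (intro holomorphic_intros that)
  then show ?thesis by (simp add: nat_powr_exp del: of_nat_Suc)
qed

lemma zeta1_holomorphic: "zeta1 holomorphic_on {s. Re s > 0}"
  unfolding zeta1_def
proof (intro holomorphic_intros holomorphic_series)
  show "open {s. Re s > 0}" by (rule open_halfspace_Re_gt)
  show "zeta_term n holomorphic_on {s. Re s > 0}" for n
    unfolding zeta_term_def[abs_def] by (intro holomorphic_intros holomorphic_powr_minus)
  fix x assume x: "x \<in> {s. Re s > 0}"
  define d where "d = Re x / 2"
  have d: "d > 0" using x by (simp add: d_def)
  have "cmod (zeta_term n y) \<le> ((cmod x + d + 1) * (2 * (cmod x + d))) * real (Suc n) powr (-(d + 1))" if y: "y \<in> ball x d" for n y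
  proof -
    have "\<bar>Re (x - y)\<bar> \<le> d" "cmod (y - x) \<le> d" using y abs_Re_le_cmod[of "x - y"] by (auto simp: dist_norm norm_minus_commute)
    then have Re: "Re y \<ge> d" unfolding d_def minus_complex.sel by linarith
    have ny: "cmod y \<le> cmod x + d" using \<open>cmod (y - x) \<le> d\<close> norm_triangle_ineq2[of y x] by simp
    have "cmod (zeta_term n y) \<le> cmod (y - 1) * (2 * cmod y powr 1) * real (Suc n) powr (-(Re y + 1))"
      using Re d by (intro zeta_term_bound) auto
    also have "\<dots> \<le> ((cmod x + d + 1) * (2 * (cmod x + d))) * real (Suc n) powr (-(d + 1))"
      using ny Re d norm_triangle_ineq4[of y 1] by (intro mult_mono powr_mono mult_nonneg_nonneg) auto
    finally show ?thesis .
  qed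
  with d show "\<exists>d C p. d > 0 \<and> p > 1 \<and> (\<forall>n. \<forall>y\<in>ball x d \<inter> {s. Re s > 0}. cmod (zeta_term n y) \<le> C * real (Suc n) powr (-p))"
    by (intro exI[of _ d] exI[of _ "(cmod x + d + 1) * (2 * (cmod x + d))"] exI[of _ "d + 1"]) auto
qed

lemma nat_powr_tendsto_0:
  assumes "Re s > 0"
  shows "(\<lambda>n. of_nat (Suc n) powr (-s)) \<longlonglongrightarrow> 0"
proof (rule tendsto_norm_zero_cancel)
  have "(\<lambda>n. real (Suc n) powr (-Re s)) \<longlonglongrightarrow> 0"
    using assms by (intro tendsto_neg_powr filterlim_compose[OF filterlim_real_sequentially] filterlim_Suc) auto
  then show "(\<lambda>n. cmod (of_nat (Suc n) powr (-s))) \<longlonglongrightarrow> 0"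
    by (simp add: norm_nat_powr del: of_nat_Suc)
qed

lemma dir_series_Suc_sums:
  assumes "dir_summable c" "Re s > 1"
  shows "(\<lambda>n. of_real (c (Suc n)) * of_nat (Suc n) powr (-s)) sums dir_series c s"
  using dir_series_sums[OF assms] sums_Suc_iff[of "\<lambda>n. of_real (c n) * of_nat n powr (-s)" "dir_series c s"] by simp

lemma zeta1_eq:
  assumes "Re s > 1"
  shows "zeta1 s = (s - 1) * dir_series (\<lambda>_. 1) s"
proof -
  \<comment> \<open>The powers with exponent \<open>1 - s\<close> telescope; the boundary term left
    at \<open>N\<close> tends to 0 only right of 1, which confines the identity to that half
    plane.\<close>
  have fin: "(\<Sum>n<N. zeta_term n s) = (s - 1) * (\<Sum>n<N. of_real 1 * of_nat (Suc n) powr (-s)) - 1 + of_nat (Suc N) powr (-(s-1))" for N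
    by (induction N) (simp_all add: zeta_term_def algebra_simps)
  have "(\<lambda>N. (s - 1) * (\<Sum>n<N. of_real 1 * of_nat (Suc n) powr (-s)) - 1 + of_nat (Suc N) powr (-(s-1)))
      \<longlonglongrightarrow> (s - 1) * dir_series (\<lambda>_. 1) s - 1 + 0"
    using dir_series_Suc_sums[OF dir_summable_bounded[of "\<lambda>_. 1" 1], of s] assms
    by (intro tendsto_intros nat_powr_tendsto_0) (auto simp: sums_def)
  then have "(\<lambda>n. zeta_term n s) sums ((s - 1) * dir_series (\<lambda>_. 1) s - 1)"
    unfolding sums_def fin by simp
  then show ?thesis by (simp add: zeta1_def sums_iff)
qed

text \<open>With \<open>\<theta> = \<epsilon>\<close> the exponent of decay is still at least
  \<open>1 + \<epsilon>/2\<close> at distance \<open>\<epsilon>/2\<close> to the left of the line.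
  This margin is what the Cauchy estimates for derivatives on \<open>Re s = 1\<close> live
  on.\<close>

lemma zeta1_bound:
  assumes "0 < \<epsilon>" "\<epsilon> \<le> 1"
  obtains C where "C > 0" "\<And>s. Re s \<ge> 1 - \<epsilon>/2 \<Longrightarrow> cmod (zeta1 s) \<le> 1 + C * cmod (s - 1) * cmod s powr \<epsilon>"
proof
  define B where "B = (\<Sum>n. real (Suc n) powr (-(1 + \<epsilon>/2)))"
  have su: "summable (\<lambda>n. real (Suc n) powr (-(1 + \<epsilon>/2)))" using assms by (intro summable_Suc_powr) auto
  then have "B > 0" unfolding B_def by (intro suminf_pos) auto
  then show "2 * B > 0" by simp
  fix s assume s: "Re s \<ge> 1 - \<epsilon>/2"
  have b: "cmod (zeta_term n s) \<le> (cmod (s - 1) * (2 * cmod s powr \<epsilon>)) * real (Suc n) powr (-(1 + \<epsilon>/2))" for n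
  proof -
    have "cmod (zeta_term n s) \<le> cmod (s - 1) * (2 * cmod s powr \<epsilon>) * real (Suc n) powr (-(Re s + \<epsilon>))"
      using s assms by (intro zeta_term_bound) auto
    also have "\<dots> \<le> (cmod (s - 1) * (2 * cmod s powr \<epsilon>)) * real (Suc n) powr (-(1 + \<epsilon>/2))"
      using s by (intro mult_left_mono powr_mono) auto
    finally show ?thesis .
  qed
  have "cmod (\<Sum>n. zeta_term n s) \<le> (\<Sum>n. (cmod (s - 1) * (2 * cmod s powr \<epsilon>)) * real (Suc n) powr (-(1 + \<epsilon>/2)))"
    by (rule norm_suminf_le[OF b summable_mult[OF su]])
  also have "\<dots> = (cmod (s - 1) * (2 * cmod s powr \<epsilon>)) * B" unfolding B_def by (rule suminf_mult[OF su])
  finally show "cmod (zeta1 s) \<le> 1 + 2 * B * cmod (s - 1) * cmod s powr \<epsilon>"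
    unfolding zeta1_def using norm_triangle_ineq[of 1 "\<Sum>n. zeta_term n s"] by (simp add: mult_ac)
qed

section \<open>Nonprincipal real characters and the continuation of their L-functions\<close>

locale real_char =
  fixes ch :: "nat \<Rightarrow> real" and M :: nat
  assumes M_pos: "M > 0" and periodic: "ch (n + M) = ch n" and mult: "ch (m * n) = ch m * ch n"
    and one: "ch 1 = 1" and vals: "ch n \<in> {-1, 0, 1}" and sum_period: "(\<Sum>n<M. ch n) = 0"
begin

lemma abs_le_1: "\<bar>ch n\<bar> \<le> 1" using vals[of n] by auto

lemma dir_summable_ch: "dir_summable ch" using abs_le_1 by (rule dir_summable_bounded)

lemma sum_lessThan_periodic: "(\<Sum>n<k * M + r. ch n) = (\<Sum>n<r. ch n)"
proof -
  have per: "ch (n + k * M) = ch n" for n k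
  proof (induction k)
    case (Suc k)
    have eq: "n + Suc k * M = (n + k * M) + M" by simp
    show ?case unfolding eq using Suc periodic[of "n + k * M"] by (simp only:)
  qed simp
  have shift: "(\<Sum>n<k * M + r. ch n) = (\<Sum>n<k*M. ch n) + (\<Sum>n<r. ch n)" for r k
  proof -
    have "(\<Sum>n<k * M + r. ch n) = (\<Sum>n<k*M. ch n) + (\<Sum>n<r. ch (k * M + n))"
      by (induction r) (simp_all add: add.assoc)
    moreover have "ch (k * M + n) = ch n" for n using per[of n k] by (simp add: add.commute)
    ultimately show ?thesis by simp
  qed
  have "(\<Sum>n<k*M. ch n) = 0"
  proof (induction k)
    case (Suc k)
    then show ?case using shift[of k M] sum_period by (simp add: add.commute)
  qed auto
  with shift show ?thesis by simp
qed

definition csum :: "nat \<Rightarrow> real" where "csum n = (\<Sum>k<n. ch (Suc k))"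

text \<open>Full periods cancel, which is where nonprincipality (\<open>sum_period\<close>) enters,
  and fewer than \<open>M\<close> terms remain; the extra 1 accounts for
  \<open>ch 0\<close>.\<close>

lemma csum_bound: "\<bar>csum n\<bar> \<le> real M + 1"
proof -
  have eq: "csum n = (\<Sum>k<Suc n. ch k) - ch 0"
    unfolding csum_def by (subst sum.lessThan_Suc_shift) simp
  have "(\<Sum>k<Suc n. ch k) = (\<Sum>k<(Suc n div M) * M + Suc n mod M. ch k)"
    by (simp only: div_mult_mod_eq)
  also have "\<dots> = (\<Sum>k<Suc n mod M. ch k)" by (rule sum_lessThan_periodic)
  also have "\<bar>\<dots>\<bar> \<le> (\<Sum>k<Suc n mod M. 1)"
    by (rule order.trans[OF sum_abs]) (intro sum_mono abs_le_1)
  also have "\<dots> \<le> real M" using M_pos by (simp add: less_imp_le)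
  finally show ?thesis using abs_le_1[of 0] unfolding eq by linarith
qed

text \<open>Summation by parts against the bounded character sums continues \<open>L(s, ch)\<close> to \<open>Re s > 0\<close>.\<close>

definition Lterm :: "nat \<Rightarrow> complex \<Rightarrow> complex" where
  "Lterm n s = of_real (csum (Suc n)) * (of_nat (Suc n) powr (-s) - of_nat (Suc (Suc n)) powr (-s))"

definition Lf :: "complex \<Rightarrow> complex" where "Lf s = (\<Sum>n. Lterm n s)"

lemma Lterm_bound:
  assumes "Re s \<ge> 0" "0 \<le> \<theta>" "\<theta> \<le> 1"
  shows "cmod (Lterm n s) \<le> (real M + 1) * (2 * cmod s powr \<theta>) * real (Suc n) powr (-(Re s + \<theta>))"
proof -
  have "cmod (of_real (real (Suc n)) powr (-s) - of_real (real (Suc n) + 1) powr (-s)) \<le> 2 * cmod s powr \<theta> * real (Suc n) powr (-Re s - \<theta>)"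
    using assms by (intro powr_diff_bound) auto
  then have "\<bar>csum (Suc n)\<bar> * cmod (of_nat (Suc n) powr (-s) - of_nat (Suc (Suc n)) powr (-s)) \<le> (real M + 1) * (2 * cmod s powr \<theta> * real (Suc n) powr (-Re s - \<theta>))"
    using csum_bound by (intro mult_mono) (auto simp: algebra_simps)
  then show ?thesis by (simp add: Lterm_def norm_mult mult_ac)
qed

lemma Lf_holomorphic: "Lf holomorphic_on {s. Re s > 0}"
  unfolding Lf_def
proof (intro holomorphic_series)
  show "open {s. Re s > 0}" by (rule open_halfspace_Re_gt)
  show "Lterm n holomorphic_on {s. Re s > 0}" for n
    unfolding Lterm_def[abs_def] by (intro holomorphic_intros holomorphic_powr_minus)
  fix x assume x: "x \<in> {s. Re s > 0}"
  define d where "d = Re x / 2"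
  have d: "d > 0" using x by (simp add: d_def)
  have "cmod (Lterm n y) \<le> ((real M + 1) * (2 * (cmod x + d))) * real (Suc n) powr (-(d + 1))" if y: "y \<in> ball x d" for n y
  proof -
    have "\<bar>Re (x - y)\<bar> \<le> d" "cmod (y - x) \<le> d" using y abs_Re_le_cmod[of "x - y"] by (auto simp: dist_norm norm_minus_commute)
    then have Re: "Re y \<ge> d" unfolding d_def minus_complex.sel by linarith
    have ny: "cmod y \<le> cmod x + d" using \<open>cmod (y - x) \<le> d\<close> norm_triangle_ineq2[of y x] by simp
    have "cmod (Lterm n y) \<le> (real M + 1) * (2 * cmod y powr 1) * real (Suc n) powr (-(Re y + 1))"
      using Re d by (intro Lterm_bound) auto
    also have "\<dots> \<le> ((real M + 1) * (2 * (cmod x + d))) * real (Suc n) powr (-(d + 1))"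
      using ny Re d by (intro mult_mono powr_mono mult_nonneg_nonneg) auto
    finally show ?thesis .
  qed
  with d show "\<exists>d C p. d > 0 \<and> p > 1 \<and> (\<forall>n. \<forall>y\<in>ball x d \<inter> {s. Re s > 0}. cmod (Lterm n y) \<le> C * real (Suc n) powr (-p))"
    by (intro exI[of _ d] exI[of _ "(real M + 1) * (2 * (cmod x + d))"] exI[of _ "d + 1"]) auto
qed

lemma Lf_eq:
  assumes "Re s > 1"
  shows "Lf s = dir_series ch s"
proof -
  have fin: "(\<Sum>n<N. Lterm n s) = (\<Sum>n<N. of_real (ch (Suc n)) * of_nat (Suc n) powr (-s)) - of_real (csum N) * of_nat (Suc N) powr (-s)" for N
    by (induction N) (simp_all add: Lterm_def csum_def algebra_simps)
  have "(\<lambda>N. of_real (csum N) * of_nat (Suc N) powr (-s)) \<longlonglongrightarrow> 0"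
  proof (rule tendsto_norm_zero_cancel, rule Lim_null_comparison)
    have "(\<lambda>n. (real M + 1) * cmod (of_nat (Suc n) powr (-s))) \<longlonglongrightarrow> (real M + 1) * cmod 0"
      using assms by (intro tendsto_intros nat_powr_tendsto_0) auto
    then show "(\<lambda>n. (real M + 1) * cmod (of_nat (Suc n) powr (-s))) \<longlonglongrightarrow> 0" by simp
    show "\<forall>\<^sub>F n in sequentially. norm (cmod (of_real (csum n) * of_nat (Suc n) powr (-s))) \<le> (real M + 1) * cmod (of_nat (Suc n) powr (-s))"
      using csum_bound by (intro always_eventually allI) (simp add: norm_mult mult_right_mono)
  qed
  then have "(\<lambda>N. (\<Sum>n<N. of_real (ch (Suc n)) * of_nat (Suc n) powr (-s)) - of_real (csum N) * of_nat (Suc N) powr (-s)) \<longlonglongrightarrow> dir_series ch s - 0"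
    using dir_series_Suc_sums[OF dir_summable_ch assms] by (intro tendsto_intros) (auto simp: sums_def)
  then have "(\<lambda>n. Lterm n s) sums dir_series ch s" unfolding sums_def fin by simp
  then show ?thesis by (simp add: Lf_def sums_iff)
qed

lemma Lf_bound:
  assumes "0 < \<epsilon>" "\<epsilon> \<le> 1"
  obtains C where "C > 0" "\<And>s. Re s \<ge> 1 - \<epsilon>/2 \<Longrightarrow> cmod (Lf s) \<le> C * cmod s powr \<epsilon>"
proof
  define B where "B = (\<Sum>n. real (Suc n) powr (-(1 + \<epsilon>/2)))"
  have su: "summable (\<lambda>n. real (Suc n) powr (-(1 + \<epsilon>/2)))" using assms by (intro summable_Suc_powr) auto
  then have "B > 0" unfolding B_def by (intro suminf_pos) auto
  then show "2 * (real M + 1) * B > 0" by simp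
  fix s assume s: "Re s \<ge> 1 - \<epsilon>/2"
  have b: "cmod (Lterm n s) \<le> ((real M + 1) * (2 * cmod s powr \<epsilon>)) * real (Suc n) powr (-(1 + \<epsilon>/2))" for n
  proof -
    have "cmod (Lterm n s) \<le> (real M + 1) * (2 * cmod s powr \<epsilon>) * real (Suc n) powr (-(Re s + \<epsilon>))"
      using s assms by (intro Lterm_bound) auto
    also have "\<dots> \<le> ((real M + 1) * (2 * cmod s powr \<epsilon>)) * real (Suc n) powr (-(1 + \<epsilon>/2))"
      using s by (intro mult_left_mono powr_mono) auto
    finally show ?thesis .
  qed
  have "cmod (\<Sum>n. Lterm n s) \<le> (\<Sum>n. ((real M + 1) * (2 * cmod s powr \<epsilon>)) * real (Suc n) powr (-(1 + \<epsilon>/2)))"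
    by (rule norm_suminf_le[OF b summable_mult[OF su]])
  also have "\<dots> = ((real M + 1) * (2 * cmod s powr \<epsilon>)) * B" unfolding B_def by (rule suminf_mult[OF su])
  finally show "cmod (Lf s) \<le> 2 * (real M + 1) * B * cmod s powr \<epsilon>"
    unfolding Lf_def by (simp add: algebra_simps)
qed

end

section \<open>The product of zeta and L\<close>

lemma ln_nat_nonneg: "ln (real n) \<ge> 0"
  by (cases "n = 0") auto

lemma power_powr_eq: "x > 0 \<Longrightarrow> (x ^ n) powr a = x powr (real n * a)"
  by (simp only: powr_realpow[symmetric] powr_powr)

lemma powr_power_eq: "x > 0 \<Longrightarrow> (x powr a) ^ n = x powr (a * real n)"
  by (simp only: powr_realpow[symmetric] powr_powr powr_gt_zero)

lemma nat_powr_real: "(of_nat n :: complex) powr (of_real y) = of_real (real n powr y)"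
  using powr_of_real[of "real n" y] by simp

lemma Re_nat_powr_minus_2: "Re (of_real c * (of_nat k :: complex) powr (-2)) = c * real k powr (-2)"
proof -
  have "(of_nat k :: complex) powr (-2) = of_real (real k powr (-2))" using nat_powr_real[of k "-2"] by simp
  then show ?thesis by simp
qed

context real_char
begin

definition zcoef :: "nat \<Rightarrow> real" where "zcoef = dir_conv (\<lambda>_. 1) ch"

lemma zcoef_altdef: "zcoef n = (\<Sum>d | d dvd n. ch d)"
proof (cases "n = 0")
  case False
  have "(\<Sum>k | k dvd n. ch (n div k)) = (\<Sum>d | d dvd n. ch d)"
    using False by (intro sum.reindex_bij_witness[of _ "\<lambda>d. n div d" "\<lambda>d. n div d"]) (auto elim!: dvdE)
  then show ?thesis by (simp add: zcoef_def dir_conv_def)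
qed (simp add: zcoef_def dir_conv_def)

lemma ch_power: "ch (p ^ j) = ch p ^ j"
  using one by (induction j) (simp_all add: mult)

lemma divisors_bij:
  assumes "prime p" "\<not> p dvd m" "m > (0::nat)"
  shows "bij_betw (\<lambda>(j,d). p ^ j * d) ({..a} \<times> {d. d dvd m}) {d. d dvd p ^ a * m}"
  unfolding bij_betw_def
proof
  show "inj_on (\<lambda>(j,d). p ^ j * d) ({..a} \<times> {d. d dvd m})"
  proof (rule inj_onI)
    fix u v assume u: "u \<in> {..a} \<times> {d. d dvd m}" "v \<in> {..a} \<times> {d. d dvd m}"
      and eq: "(\<lambda>(j,d). p ^ j * d) u = (\<lambda>(j,d). p ^ j * d) v"
    obtain j d j' d' where [simp]: "u = (j,d)" "v = (j',d')" by fastforce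
    have nd: "\<not> p dvd d" "\<not> p dvd d'" using u assms(2) dvd_trans by auto
    have mu: "multiplicity p (p ^ j * d) = j" "multiplicity p (p ^ j' * d') = j'"
      using nd assms(1) by (auto intro!: multiplicity_eqI simp: prime_dvd_mult_iff)
    have "j = j'" using mu eq by simp
    with eq assms(1) show "u = v" by (simp add: prime_gt_0_nat)
  qed
  show "(\<lambda>(j,d). p ^ j * d) ` ({..a} \<times> {d. d dvd m}) = {d. d dvd p ^ a * m}"
  proof (intro equalityI subsetI)
    fix x assume "x \<in> {d. d dvd p ^ a * m}"
    then obtain b c where bc: "x = b * c" "b dvd p ^ a" "c dvd m" using division_decomp by blast
    then obtain j where "j \<le> a" "b = p ^ j" using divides_primepow_nat[OF assms(1)] by auto
    with bc show "x \<in> (\<lambda>(j,d). p ^ j * d) ` ({..a} \<times> {d. d dvd m})" by (intro image_eqI[of _ _ "(j,c)"]) auto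
  qed (auto intro!: mult_dvd_mono le_imp_power_dvd)
qed

lemma zcoef_prime_power_mult:
  assumes "prime p" "\<not> p dvd m" "m > (0::nat)"
  shows "zcoef (p ^ a * m) = (\<Sum>j\<le>a. ch p ^ j) * zcoef m"
proof -
  have "zcoef (p ^ a * m) = (\<Sum>(j,d)\<in>{..a} \<times> {d. d dvd m}. ch (p ^ j * d))"
    unfolding zcoef_altdef sum.reindex_bij_betw[OF divisors_bij[OF assms], symmetric] by (simp add: case_prod_unfold)
  also have "\<dots> = (\<Sum>(j,d)\<in>{..a} \<times> {d. d dvd m}. ch p ^ j * ch d)"
    by (simp add: mult ch_power)
  also have "\<dots> = (\<Sum>j\<le>a. ch p ^ j) * zcoef m"
    unfolding zcoef_altdef sum_product sum.cartesian_product ..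
  finally show ?thesis .
qed

lemma geometric_ch: "(\<Sum>j\<le>a. ch p ^ j) \<ge> 0" "even a \<Longrightarrow> (\<Sum>j\<le>a. ch p ^ j) \<ge> 1"
proof -
  consider "ch p = 0" | "ch p = 1" | "ch p = -1" using vals[of p] by auto
  then have "(\<Sum>j\<le>a. ch p ^ j) \<ge> 0 \<and> (even a \<longrightarrow> (\<Sum>j\<le>a. ch p ^ j) \<ge> 1)"
  proof cases
    case 1 then show ?thesis by (simp add: power_0_left)
  next
    case 2 then show ?thesis by simp
  next
    case 3
    have "(\<Sum>j\<le>a. (-1::real) ^ j) = (if even a then 1 else 0)" by (induction a) auto
    with 3 show ?thesis by simp
  qed
  then show "(\<Sum>j\<le>a. ch p ^ j) \<ge> 0" "even a \<Longrightarrow> (\<Sum>j\<le>a. ch p ^ j) \<ge> 1" by auto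
qed

text \<open>One prime power is split off at a time. Its factor is a geometric sum in
  \<open>ch p\<close>, which is never negative and is at least 1 for an even exponent, even if
  \<open>ch p = -1\<close>; in a square all exponents are even.\<close>

lemma zcoef_nonneg_square:
  "zcoef n \<ge> 0 \<and> (n > 0 \<longrightarrow> (\<exists>k. n = k\<^sup>2) \<longrightarrow> zcoef n \<ge> 1)"
proof (induction n rule: less_induct)
  case (less n)
  consider "n = 0" | "n = 1" | "n > 1" by linarith
  then show ?case
  proof cases
    case 1 then show ?thesis by (simp add: zcoef_def dir_conv_def)
  next
    case 2 then show ?thesis using one by (simp add: zcoef_altdef)
  next
    case 3
    then obtain p where p: "prime p" "p dvd n" using prime_factor_nat[of n] by auto
    obtain m where m: "n = p ^ multiplicity p n * m" "\<not> p dvd m"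
      by (rule multiplicity_decompose'[of n p]) (use 3 p prime_gt_1_nat[OF p(1)] in auto)
    define a where "a = multiplicity p n"
    have m0: "m > 0" using m 3 by (cases m) auto
    have "a > 0" unfolding a_def using p 3 by (simp add: prime_multiplicity_gt_zero_iff)
    then have "p ^ a > 1" by (rule one_less_power[OF prime_gt_1_nat[OF p(1)]])
    then have mn: "m < n" using m m0 unfolding a_def[symmetric] by (metis mult_less_mono1 nat_mult_1)
    have eq: "zcoef n = (\<Sum>j\<le>a. ch p ^ j) * zcoef m"
      using zcoef_prime_power_mult[OF p(1) m(2) m0, of a] m(1) a_def by simp
    have "zcoef n \<ge> 0" unfolding eq using geometric_ch less[OF mn] by (intro mult_nonneg_nonneg) auto
    moreover have "zcoef n \<ge> 1" if "n = k\<^sup>2" for k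
    proof -
      have k0: "k \<noteq> 0" using that 3 by (intro notI) auto
      then have a2: "a = 2 * multiplicity p k" unfolding a_def that using p(1) by (subst prime_elem_multiplicity_power_distrib) auto
      then have ev: "even a" by simp
      have "\<exists>l. m = l\<^sup>2"
      proof -
        obtain l where l: "k = p ^ multiplicity p k * l" by (rule multiplicity_decompose'[of k p]) (use k0 prime_gt_1_nat[OF p(1)] in auto)
        have "p ^ a * m = (p ^ multiplicity p k * l)\<^sup>2" using m(1) that l a_def by simp
        also have "\<dots> = p ^ a * l\<^sup>2" unfolding a2 power_mult_distrib power_mult[symmetric] by (simp add: mult.commute)
        finally have "m = l\<^sup>2" using p(1) by (simp add: prime_gt_0_nat)
        then show ?thesis ..
      qed
      then have "zcoef m \<ge> 1" using less[OF mn] m0 by auto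
      then show "zcoef n \<ge> 1" unfolding eq using geometric_ch(2)[OF ev, of p] mult_mono[of 1 "\<Sum>j\<le>a. ch p ^ j" 1 "zcoef m"] by simp
    qed
    ultimately show ?thesis by blast
  qed
qed

lemma zcoef_nonneg: "zcoef n \<ge> 0" and zcoef_square: "k > 0 \<Longrightarrow> zcoef (k\<^sup>2) \<ge> 1"
  using zcoef_nonneg_square[of n] zcoef_nonneg_square[of "k\<^sup>2"] by auto

text \<open>Since \<open>zeta1 1 = 1\<close>, the value \<open>Wf 1\<close> is \<open>L(1)\<close>,
  and a zero there would cancel the pole of \<open>Zf\<close>.\<close>

definition Wf :: "complex \<Rightarrow> complex" where "Wf s = zeta1 s * Lf s"

definition Zf :: "complex \<Rightarrow> complex" where "Zf s = Wf s / (s - 1)"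

lemma dir_summable_one: "dir_summable (\<lambda>_. 1)" by (rule dir_summable_bounded[of _ 1]) simp

lemma dir_summable_zcoef: "dir_summable zcoef"
  unfolding zcoef_def by (intro dir_series_conv dir_summable_one dir_summable_ch)

lemma Zf_eq_prod: "Re s > 1 \<Longrightarrow> Zf s = dir_series (\<lambda>_. 1) s * dir_series ch s"
  unfolding Zf_def Wf_def by (subst zeta1_eq, simp, subst Lf_eq) auto

lemma Zf_eq: "Re s > 1 \<Longrightarrow> Zf s = dir_series zcoef s"
  unfolding zcoef_def by (simp add: Zf_eq_prod dir_series_conv(1)[OF dir_summable_one dir_summable_ch])

lemma Wf_holomorphic: "Wf holomorphic_on {s. Re s > 0}"
  unfolding Wf_def[abs_def] by (intro holomorphic_intros zeta1_holomorphic Lf_holomorphic)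

lemma Zf_holomorphic: "Zf holomorphic_on {s. Re s > 0} - {1}"
  unfolding Zf_def[abs_def] by (intro holomorphic_intros holomorphic_on_subset[OF Wf_holomorphic]) auto

text \<open>Landau's argument: were \<open>L(1) = 0\<close>, the Taylor series of \<open>\<zeta> L\<close> at 2, all of whose terms are
  nonnegative at \<open>1/2\<close>, would converge there and bound \<open>\<Sum> f(n) n\<^bsup>-1/2\<^esup> \<ge> \<Sum> 1/k\<close>.\<close>

lemma Wf_1_nonzero: "Wf 1 \<noteq> 0"
proof
  assume W1: "Wf 1 = 0"
  \<comment> \<open>If \<open>Wf 1 = 0\<close>, the singularity of \<open>Zf\<close> at 1 is
    removable. Then the disc of radius 2 around 2 lies in the domain of holomorphy and contains
    \<open>1/2\<close>.\<close>
  define G where "G = (\<lambda>z. if z = 1 then deriv Wf 1 else (Wf z - Wf 1) / (z - 1))"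
  have "1 \<in> interior {s::complex. Re s > 0}" by (subst interior_open) (auto simp: open_halfspace_Re_gt)
  then have hol: "G holomorphic_on {s. Re s > 0}" unfolding G_def by (rule pole_lemma[OF Wf_holomorphic])
  have GZ: "G z = dir_series zcoef z" if "Re z > 1" for z
    using that Zf_eq[of z] by (auto simp: G_def W1 Zf_def)
  have der: "(deriv ^^ n) G 2 = (-1) ^ n * dir_series (\<lambda>k. zcoef k * ln (real k) ^ n) 2" for n
  proof -
    have "(deriv ^^ n) G 2 = (deriv ^^ n) (dir_series zcoef) 2"
      by (rule higher_deriv_transform_within_open[where S = "{s. Re s > 1}"])
         (auto simp: GZ open_halfspace_Re_gt intro: holomorphic_on_subset[OF hol] dir_series_holomorphic dir_summable_zcoef)
    then show ?thesis using dir_series_higher_deriv[OF dir_summable_zcoef, of 2 n] by simp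
  qed
  have "ball 2 2 \<subseteq> {s::complex. Re s > 0}"
  proof
    fix z :: complex assume "z \<in> ball 2 2"
    then have "cmod (2 - z) < 2" by (simp add: dist_norm)
    with abs_Re_le_cmod[of "2 - z"] show "z \<in> {s. Re s > 0}" by simp
  qed
  then have "(\<lambda>n. (deriv ^^ n) G 2 / fact n * (1/2 - 2) ^ n) sums G (1/2)"
    by (intro holomorphic_power_series[OF holomorphic_on_subset[OF hol]]) (auto simp: dist_norm)
  then have T: "(\<lambda>n. of_real ((3/2) ^ n / fact n) * dir_series (\<lambda>k. zcoef k * ln (real k) ^ n) 2) sums G (1/2)"
    (is "?f sums _")
  proof (rule sums_cong[THEN iffD1, rotated])
    fix n
    have "(1/2 - 2 :: complex) ^ n = (-1) ^ n * (3/2) ^ n" by (simp flip: power_mult_distrib)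
    moreover have "(-1 :: complex) ^ n * (-1) ^ n = 1" by (simp flip: power_mult_distrib)
    ultimately show "(deriv ^^ n) G 2 / fact n * (1/2 - 2) ^ n = ?f n"
      unfolding der by (simp add: mult_ac)
  qed
  have T': "(\<lambda>n. (3/2) ^ n / fact n * Re (dir_series (\<lambda>k. zcoef k * ln (real k) ^ n) 2)) sums Re (G (1/2))"
  proof -
    have "Re (of_real x * z) = x * Re z" for x z by simp
    then show ?thesis using sums_Re[OF T] by (simp only:)
  qed
  \<comment> \<open>Only finitely many \<open>k\<close> are kept, so the exponential series of
    \<open>k powr (3/2) = exp (3/2 * ln k)\<close> can be compared term by term with the Taylor
    series, without exchanging two infinite sums.\<close>
  have bound: "(\<Sum>k\<in>{1..N}. zcoef k * real k powr (-1/2)) \<le> Re (G (1/2))" for N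
  proof -
    have Re_ds: "(\<lambda>k. zcoef k * ln (real k) ^ n * real k powr (-2)) sums Re (dir_series (\<lambda>k. zcoef k * ln (real k) ^ n) 2)" for n
      using sums_Re[OF dir_series_sums[OF dir_summable_ln_pow[OF dir_summable_zcoef], of 2 n]]
      by (simp only: Re_nat_powr_minus_2) simp
    have S2: "(\<lambda>n. \<Sum>k\<in>{1..N}. zcoef k * real k powr (-2) * ((3/2 * ln (real k)) ^ n / fact n)) sums
        (\<Sum>k\<in>{1..N}. zcoef k * real k powr (-2) * exp (3/2 * ln (real k)))"
    proof -
      have ex: "(\<lambda>n. x ^ n / fact n) sums exp x" for x :: real
        using exp_converges[of x] by (simp add: divide_inverse mult.commute)
      show ?thesis by (intro sums_sum sums_mult ex)
    qed
    have le: "(\<Sum>k\<in>{1..N}. zcoef k * real k powr (-2) * ((3/2 * ln (real k)) ^ n / fact n)) \<le>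
        (3/2) ^ n / fact n * Re (dir_series (\<lambda>k. zcoef k * ln (real k) ^ n) 2)" for n
    proof -
      have "(\<Sum>k\<in>{1..N}. zcoef k * ln (real k) ^ n * real k powr (-2)) \<le> Re (dir_series (\<lambda>k. zcoef k * ln (real k) ^ n) 2)"
        unfolding sums_unique[OF Re_ds[of n]]
        by (intro sum_le_suminf sums_summable[OF Re_ds[of n]] mult_nonneg_nonneg zcoef_nonneg)
           (auto simp: zcoef_nonneg ln_nat_nonneg intro!: zero_le_power)
      then have "(3/2) ^ n / fact n * (\<Sum>k\<in>{1..N}. zcoef k * ln (real k) ^ n * real k powr (-2)) \<le>
        (3/2) ^ n / fact n * Re (dir_series (\<lambda>k. zcoef k * ln (real k) ^ n) 2)" by (intro mult_left_mono) auto
      moreover have "zcoef k * real k powr (-2) * ((3/2 * ln (real k)) ^ n / fact n) =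
          (3/2) ^ n / fact n * (zcoef k * ln (real k) ^ n * real k powr (-2))" for k
        unfolding power_mult_distrib by (simp add: mult_ac)
      ultimately show ?thesis by (simp only: sum_distrib_left)
    qed
    have "(\<Sum>k\<in>{1..N}. zcoef k * real k powr (-2) * exp (3/2 * ln (real k))) \<le> Re (G (1/2))"
      by (rule sums_le[OF le S2 T'])
    moreover have "real k powr (-2) * exp (3/2 * ln (real k)) = real k powr (-1/2)" if "k \<in> {1..N}" for k
      using that by (simp add: powr_def flip: exp_add)
    ultimately show ?thesis by (simp add: mult.assoc)
  qed
  have "(\<Sum>j\<in>{1..N}. 1 / real j) \<le> Re (G (1/2))" for N
  proof -
    have "(\<Sum>j\<in>{1..N}. 1 / real j) \<le> (\<Sum>j\<in>{1..N}. zcoef (j\<^sup>2) * real (j\<^sup>2) powr (-1/2))"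
    proof (rule sum_mono)
      fix j assume j: "j \<in> {1..N}"
      then have "real (j\<^sup>2) powr (-1/2) = 1 / real j" 
        by (simp add: powr_minus powr_half_sqrt inverse_eq_divide)
      then show "1 / real j \<le> zcoef (j\<^sup>2) * real (j\<^sup>2) powr (-1/2)"
        using zcoef_square[of j] j by (simp add: divide_right_mono)
    qed
    also have "\<dots> = (\<Sum>k\<in>(\<lambda>j. j\<^sup>2) ` {1..N}. zcoef k * real k powr (-1/2))"
      by (subst sum.reindex) (auto simp: inj_on_def power2_eq_iff)
    also have "\<dots> \<le> (\<Sum>k\<in>{1..N\<^sup>2}. zcoef k * real k powr (-1/2))"
      by (intro sum_mono2) (auto simp: zcoef_nonneg power_mono)
    also have "\<dots> \<le> Re (G (1/2))" by (rule bound)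
    finally show ?thesis .
  qed
  then have "summable (\<lambda>j. 1 / real (Suc j))"
  proof (intro bounded_imp_summable[where B = "Re (G (1/2))"])
    fix n
    assume *: "\<And>N. (\<Sum>j\<in>{1..N}. 1 / real j) \<le> Re (G (1/2))"
    have "(\<Sum>k\<le>n. 1 / real (Suc k)) = (\<Sum>j\<in>{1..Suc n}. 1 / real j)"
      by (intro sum.reindex_bij_witness[of _ "\<lambda>j. j - 1" Suc]) auto
    then show "(\<Sum>k\<le>n. 1 / real (Suc k)) \<le> Re (G (1/2))" using *[of "Suc n"] by simp
  qed auto
  then have "summable (\<lambda>j. 1 / real j)" by (subst (asm) summable_Suc_iff)
  then show False using not_summable_harmonic[where 'a = real] by (simp add: inverse_eq_divide)
qed

section \<open>The logarithmic derivative and the 3-4-1 inequality\<close>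

definition acoef :: "nat \<Rightarrow> real" where "acoef n = mangoldt n * (1 + ch n)"

lemma mangoldt_le_ln: "(mangoldt n :: real) \<le> ln (real n)"
proof (cases "n = 0")
  case False
  have "(mangoldt n :: real) \<le> (\<Sum>d | d dvd n. mangoldt d)"
    using False by (intro member_le_sum) (auto simp: mangoldt_nonneg)
  also have "\<dots> = ln (real n)" using mangoldt_sum[of n, where 'a = real] False by simp
  finally show ?thesis .
qed simp

lemma acoef_nonneg: "acoef n \<ge> 0" and acoef_le: "acoef n \<le> 2 * ln (real n)"
proof -
  have c: "0 \<le> 1 + ch n" "1 + ch n \<le> 2" using vals[of n] by auto
  show "acoef n \<ge> 0" unfolding acoef_def using c mangoldt_nonneg by simp
  have "acoef n \<le> mangoldt n * 2" unfolding acoef_def using c mangoldt_nonneg by (intro mult_left_mono)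
  also have "\<dots> \<le> 2 * ln (real n)" using mangoldt_le_ln[of n] by simp
  finally show "acoef n \<le> 2 * ln (real n)" .
qed

lemma dir_summable_ln_le:
  assumes "\<And>n. \<bar>c n\<bar> \<le> B * \<bar>ln (real n)\<bar>"
  shows "dir_summable c"
proof (rule dir_summable_le)
  show "dir_summable (\<lambda>n. B * ln (real n))" using dir_summable_ln[OF dir_summable_bounded[of "\<lambda>_. B" "\<bar>B\<bar>"]] by simp
  show "\<bar>c n\<bar> \<le> \<bar>B * ln (real n)\<bar>" for n
    using assms[of n] by (simp add: abs_mult) (meson abs_ge_self abs_ge_zero mult_right_mono order_trans)
qed

lemma dir_summable_acoef: "dir_summable acoef"
  using acoef_nonneg acoef_le by (intro dir_summable_ln_le[of _ 2]) (smt (verit))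

text \<open>The identity \<open>ln = mangoldt * 1\<close> for Dirichlet convolution survives
  multiplication by \<open>c\<close>, because \<open>c k * c (n div k) = c n\<close> can be taken
  out of the divisor sum.\<close>

lemma completely_mult_deriv:
  assumes c: "\<And>m n. c (m * n) = c m * c n" "\<And>n. \<bar>c n\<bar> \<le> (1::real)" and s: "Re s > 1"
  shows "dir_series (\<lambda>n. c n * ln (real n)) s = dir_series (\<lambda>n. c n * mangoldt n) s * dir_series c s"
    and "dir_summable (\<lambda>n. c n * mangoldt n)"
proof -
  have 1: "dir_summable c" using c(2) by (rule dir_summable_bounded)
  show 2: "dir_summable (\<lambda>n. c n * mangoldt n)"
  proof (rule dir_summable_ln_le[of _ 1])
    fix n
    have "\<bar>c n * mangoldt n\<bar> \<le> 1 * mangoldt n" unfolding abs_mult using c(2) mangoldt_nonneg by (intro mult_mono) auto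
    also have "\<dots> \<le> ln (real n)" using mangoldt_le_ln by simp
    finally show "\<bar>c n * mangoldt n\<bar> \<le> 1 * \<bar>ln (real n)\<bar>" by simp
  qed
  have "dir_conv (\<lambda>n. c n * mangoldt n) c = (\<lambda>n. c n * ln (real n))"
  proof
    fix n
    show "dir_conv (\<lambda>n. c n * mangoldt n) c n = c n * ln (real n)"
    proof (cases "n = 0")
      case False
      have "dir_conv (\<lambda>n. c n * mangoldt n) c n = (\<Sum>k | k dvd n. c n * mangoldt k)"
        unfolding dir_conv_def
      proof (rule sum.cong)
        fix k assume "k \<in> {k. k dvd n}"
        then have "c n = c k * c (n div k)" using c(1)[of k "n div k"] by simp
        then show "c k * mangoldt k * c (n div k) = c n * mangoldt k" by simp
      qed simp
      also have "\<dots> = c n * ln (real n)" using mangoldt_sum[of n, where 'a = real] False by (simp flip: sum_distrib_left)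
      finally show ?thesis .
    qed (simp add: dir_conv_def)
  qed
  then show "dir_series (\<lambda>n. c n * ln (real n)) s = dir_series (\<lambda>n. c n * mangoldt n) s * dir_series c s"
    using dir_series_conv(1)[OF 2 1 s] by simp
qed

text \<open>This identifies \<open>acoef\<close> as the coefficients of \<open>- Zf' / Zf\<close>,
  the sum of the logarithmic derivatives of both factors.\<close>

lemma Zf_deriv:
  assumes "Re s > 1"
  shows "(Zf has_field_derivative - (Zf s * dir_series acoef s)) (at s)"
proof -
  have d1: "dir_series (\<lambda>n. 1 * ln (real n)) s = dir_series (\<lambda>n. 1 * mangoldt n) s * dir_series (\<lambda>_. 1) s"
    "dir_summable (\<lambda>n. 1 * mangoldt n)"
    using completely_mult_deriv[of "\<lambda>_. 1"] assms by auto
  have d2: "dir_series (\<lambda>n. ch n * ln (real n)) s = dir_series (\<lambda>n. ch n * mangoldt n) s * dir_series ch s"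
    "dir_summable (\<lambda>n. ch n * mangoldt n)"
    using completely_mult_deriv[of ch, OF mult abs_le_1 assms] by auto
  have "dir_series acoef s = dir_series (\<lambda>n. 1 * mangoldt n) s + dir_series (\<lambda>n. ch n * mangoldt n) s"
    using sums_add[OF dir_series_sums[OF d1(2) assms] dir_series_sums[OF d2(2) assms]]
    by (intro sums_unique2[OF dir_series_sums[OF dir_summable_acoef assms]]) (simp add: acoef_def algebra_simps)
  then have eq: "- dir_series (\<lambda>n. 1 * ln (real n)) s * dir_series ch s + - dir_series (\<lambda>n. ch n * ln (real n)) s * dir_series (\<lambda>_. 1) s
      = - (Zf s * dir_series acoef s)"
    unfolding d1 d2 Zf_eq_prod[OF assms] by (simp add: algebra_simps)
  have "((\<lambda>s. dir_series (\<lambda>_. 1) s * dir_series ch s) has_field_derivative - (Zf s * dir_series acoef s)) (at s)"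
    unfolding eq[symmetric] by (intro DERIV_mult dir_series_has_derivative dir_summable_one dir_summable_ch assms)
  then show ?thesis
    by (rule has_field_derivative_transform_within_open[where S = "{s. Re s > 1}"])
       (use assms in \<open>auto simp: open_halfspace_Re_gt Zf_eq_prod\<close>)
qed

text \<open>The coefficients of \<open>log (\<zeta> L)\<close> up to a constant.\<close>

definition pcoef :: "nat \<Rightarrow> real" where "pcoef n = acoef n / ln (real n)"

lemma pcoef_nonneg: "pcoef n \<ge> 0"
  unfolding pcoef_def using acoef_nonneg[of n] by (cases "n = 0") auto

lemma dir_summable_pcoef: "dir_summable pcoef"
proof (rule dir_summable_bounded)
  fix n
  show "\<bar>pcoef n\<bar> \<le> 2"
  proof (cases "n \<le> 1")
    case False
    then show ?thesis using acoef_le[of n] acoef_nonneg[of n] by (simp add: pcoef_def field_simps)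
  qed (auto simp: pcoef_def le_Suc_eq)
qed

lemma pcoef_ln: "pcoef n * ln (real n) = acoef n"
proof (cases "n \<le> 1")
  case False then show ?thesis by (simp add: pcoef_def)
qed (auto simp: pcoef_def acoef_def le_Suc_eq)

text \<open>A branch of the logarithm is avoided: \<open>Zf\<close> times the exponential of minus
  the candidate series has derivative 0 on a convex set. A constant \<open>k = 0\<close> is refuted
  at \<open>s = 2\<close>, where the first coefficient alone makes the series positive.\<close>

lemma Zf_exp:
  "\<exists>k. k \<noteq> 0 \<and> (\<forall>s. Re s > 1 \<longrightarrow> Zf s = k * exp (dir_series pcoef s))"
proof -
  let ?g = "\<lambda>s. Zf s * exp (- dir_series pcoef s)"
  have "(?g has_field_derivative 0) (at s within {s. Re s > 1})" if "s \<in> {s. Re s > 1}" for s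
  proof -
    have P: "(dir_series pcoef has_field_derivative - dir_series acoef s) (at s)"
      using dir_series_has_derivative[OF dir_summable_pcoef, of s] that by (simp add: pcoef_ln)
    have "(?g has_field_derivative (- (Zf s * dir_series acoef s)) * exp (- dir_series pcoef s) + (exp (- dir_series pcoef s) * (- (- dir_series acoef s))) * Zf s) (at s)"
      using that by (intro DERIV_mult DERIV_chain2[OF DERIV_exp] DERIV_minus P Zf_deriv) auto
    then show ?thesis by (simp add: algebra_simps has_field_derivative_at_within)
  qed
  then have "\<exists>k. \<forall>s\<in>{s. Re s > 1}. ?g s = k"
    by (rule has_field_derivative_zero_constant[OF convex_halfspace_Re_gt])
  then obtain k where k: "\<And>s. s \<in> {s. Re s > 1} \<Longrightarrow> ?g s = k" by blast
  have Z: "Zf s = k * exp (dir_series pcoef s)" if "Re s > 1" for s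
    using k[of s] that by (simp add: exp_minus field_simps)
  moreover have "k \<noteq> 0"
  proof
    assume "k = 0"
    then have "dir_series zcoef 2 = 0" using Z[of 2] Zf_eq[of 2] by simp
    then have s: "(\<lambda>k. zcoef k * real k powr (-2)) sums 0"
      using sums_Re[OF dir_series_sums[OF dir_summable_zcoef, of 2]] by (simp add: Re_nat_powr_minus_2 del: Re_complex_of_real times_complex.sel)
    have "(\<Sum>k\<in>{1}. zcoef k * real k powr (-2)) \<le> 0"
      unfolding sums_unique[OF s] by (intro sum_le_suminf sums_summable[OF s]) (auto simp: zcoef_nonneg)
    then show False using zcoef_square[of 1] by simp
  qed
  ultimately show ?thesis by blast
qed

lemma three_four_one: "3 + 4 * cos x + cos (2 * x) \<ge> (0::real)"
proof -
  have "3 + 4 * cos x + cos (2 * x) = 2 * (1 + cos x)\<^sup>2"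
    unfolding cos_double_cos by (simp add: power2_eq_square algebra_simps)
  then show ?thesis by simp
qed

text \<open>The logarithm of the right-hand side is a cosine series with nonnegative coefficients.
  The constant is the eighth power of the one in \<open>Zf_exp\<close>, since
  \<open>3 + 4 + 1 = 8\<close>.\<close>

lemma Zf_341:
  "\<exists>k>0. \<forall>\<sigma> t. \<sigma> > 1 \<longrightarrow>
    k \<le> cmod (Zf (of_real \<sigma>)) ^ 3 * cmod (Zf (Complex \<sigma> t)) ^ 4 * cmod (Zf (Complex \<sigma> (2 * t)))"
proof -
  obtain k where k: "k \<noteq> 0" "\<And>s. Re s > 1 \<Longrightarrow> Zf s = k * exp (dir_series pcoef s)" using Zf_exp by blast
  have "cmod k ^ 8 \<le> cmod (Zf (of_real \<sigma>)) ^ 3 * cmod (Zf (Complex \<sigma> t)) ^ 4 * cmod (Zf (Complex \<sigma> (2 * t)))" if s: "\<sigma> > 1" for \<sigma> t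
  proof -
    define P where "P = (\<lambda>t. Re (dir_series pcoef (Complex \<sigma> t)))"
    have P: "(\<lambda>n. pcoef n * real n powr (-\<sigma>) * cos (t * ln (real n))) sums P t" for t
    proof -
      have e: "Re ((of_nat n :: complex) powr (-Complex \<sigma> t)) = real n powr (-\<sigma>) * cos (t * ln (real n))" for n
        by (cases "n = 0") (auto simp: nat_powr_exp Re_exp powr_def)
      show ?thesis unfolding P_def using sums_Re[OF dir_series_sums[OF dir_summable_pcoef, of "Complex \<sigma> t"]] s by (simp add: e mult.assoc)
    qed
    have S: "(\<lambda>n. 3 * (pcoef n * real n powr (-\<sigma>) * cos (0 * ln (real n))) + 4 * (pcoef n * real n powr (-\<sigma>) * cos (t * ln (real n)))
       + pcoef n * real n powr (-\<sigma>) * cos ((2 * t) * ln (real n))) sums (3 * P 0 + 4 * P t + P (2 * t))"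
      by (intro sums_add sums_mult P)
    have N: "3 * (pcoef n * real n powr (-\<sigma>) * cos (0 * ln (real n))) + 4 * (pcoef n * real n powr (-\<sigma>) * cos (t * ln (real n)))
       + pcoef n * real n powr (-\<sigma>) * cos ((2 * t) * ln (real n)) \<ge> 0" for n
    proof -
      have "0 \<le> pcoef n * real n powr (-\<sigma>) * (3 + 4 * cos (t * ln (real n)) + cos (2 * (t * ln (real n))))"
        using pcoef_nonneg three_four_one by (intro mult_nonneg_nonneg) auto
      then show ?thesis by (simp add: algebra_simps)
    qed
    have nn: "0 \<le> 3 * P 0 + 4 * P t + P (2 * t)" by (rule sums_le[OF N sums_zero S])
    have Z: "cmod (Zf (Complex \<sigma> t)) = cmod k * exp (P t)" for t
      using k(2)[of "Complex \<sigma> t"] s by (simp add: norm_mult P_def)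
    have "cmod (Zf (of_real \<sigma>)) ^ 3 * cmod (Zf (Complex \<sigma> t)) ^ 4 * cmod (Zf (Complex \<sigma> (2 * t))) = cmod k ^ 8 * exp (3 * P 0 + 4 * P t + P (2 * t))"
    proof -
      have e: "exp (3 * P 0) = exp (P 0) ^ 3" "exp (4 * P t) = exp (P t) ^ 4"
        using exp_of_nat_mult[of 3 "P 0"] exp_of_nat_mult[of 4 "P t"] by simp_all
      have "(k * a) ^ 3 * (k * b) ^ 4 * (k * c) = k ^ 8 * (a ^ 3 * b ^ 4 * c)" for k a b c :: real
        by (simp add: eval_nat_numeral mult_ac)
      then show ?thesis unfolding complex_of_real_def Z exp_add e .
    qed
    also have "\<dots> \<ge> cmod k ^ 8 * 1" using nn by (intro mult_left_mono) auto
    finally show ?thesis by simp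
  qed
  with k(1) show ?thesis by (intro exI[of _ "cmod k ^ 8"]) auto
qed

end

section \<open>Bounds on the line Re s = 1\<close>

context real_char
begin

text \<open>A stand-in for \<open>cmod s\<close> in vertical strips: at least 2, so that its powers
  are monotone in the exponent, and at most doubled when \<open>Im s\<close> is doubled or moved a
  little.\<close>

abbreviation \<tau> :: "complex \<Rightarrow> real" where "\<tau> s \<equiv> 2 + \<bar>Im s\<bar>"

text \<open>Each factor is granted growth exponent \<open>1/60\<close>, which is available for
  \<open>Re s \<ge> 1 - 1/120\<close>; the product gets \<open>1/30\<close>. The value is chosen so
  small that the exponent reached in the end, \<open>4 * (1/30 + 4/30) = 20/30\<close>, stays below
  1.\<close>

lemma Zf_bound:
  assumes "t1 > 0"
  shows "\<exists>C>0. \<forall>s. 1 - 1/120 \<le> Re s \<longrightarrow> Re s \<le> 3 \<longrightarrow> cmod (s - 1) \<ge> t1 \<longrightarrow> cmod (Zf s) \<le> C * \<tau> s powr (1/30)"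
proof -
  have "\<exists>C>0. \<forall>s. 1 - (1/60)/2 \<le> Re s \<longrightarrow> cmod (zeta1 s) \<le> 1 + C * cmod (s - 1) * cmod s powr (1/60)"
    by (rule zeta1_bound[of "1/60"]) auto
  then obtain C1 where C1: "C1 > 0" "\<And>s. Re s \<ge> 1 - 1/120 \<Longrightarrow> cmod (zeta1 s) \<le> 1 + C1 * cmod (s - 1) * cmod s powr (1/60)" by auto
  have "\<exists>C>0. \<forall>s. 1 - (1/60)/2 \<le> Re s \<longrightarrow> cmod (Lf s) \<le> C * cmod s powr (1/60)"
    by (rule Lf_bound[of "1/60"]) auto
  then obtain C2 where C2: "C2 > 0" "\<And>s. Re s \<ge> 1 - 1/120 \<Longrightarrow> cmod (Lf s) \<le> C2 * cmod s powr (1/60)" by auto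
  define C where "C = (1/t1 + C1 * 2) * (C2 * 2)"
  have "C > 0" unfolding C_def using C1 C2 assms by (intro mult_pos_pos add_pos_pos) auto
  moreover have "cmod (Zf s) \<le> C * \<tau> s powr (1/30)" if s: "1 - 1/120 \<le> Re s" "Re s \<le> 3" "cmod (s - 1) \<ge> t1" for s
  proof -
    define T where "T = \<tau> s powr (1/60)"
    have T1: "T \<ge> 1" unfolding T_def by (rule ge_one_powr_ge_zero) auto
    have "cmod s \<le> \<bar>Re s\<bar> + \<bar>Im s\<bar>" by (rule cmod_le)
    also have "\<dots> \<le> 2 * \<tau> s" using s by simp
    finally have "cmod s powr (1/60) \<le> (2 * \<tau> s) powr (1/60)" by (intro powr_mono2) auto
    also have "\<dots> = 2 powr (1/60) * T" unfolding T_def by (subst powr_mult) auto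
    also have "\<dots> \<le> 2 powr 1 * T" using T1 by (intro mult_right_mono powr_mono) auto
    finally have sT: "cmod s powr (1/60) \<le> 2 * T" by simp
    have d0: "cmod (s - 1) > 0" using s assms by linarith
    have "cmod (zeta1 s) / cmod (s - 1) \<le> (1 + C1 * cmod (s - 1) * cmod s powr (1/60)) / cmod (s - 1)"
      using C1 s by (intro divide_right_mono) auto
    also have "\<dots> = 1 / cmod (s - 1) + C1 * cmod s powr (1/60)" using d0 by (simp add: add_divide_distrib)
    also have "\<dots> \<le> 1 / t1 * T + C1 * (2 * T)"
    proof (intro add_mono mult_left_mono sT)
      have "1 / cmod (s - 1) \<le> 1 / t1" using s assms by (intro divide_left_mono) (auto intro: mult_pos_pos d0)
      also have "\<dots> \<le> 1 / t1 * T" using T1 assms by (simp add: field_simps)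
      finally show "1 / cmod (s - 1) \<le> 1 / t1 * T" .
    qed (use C1 in auto)
    finally have z: "cmod (zeta1 s) / cmod (s - 1) \<le> (1/t1 + C1 * 2) * T" by (simp add: algebra_simps)
    have "cmod (Lf s) \<le> C2 * (2 * T)" using C2(2)[OF s(1)] mult_left_mono[OF sT, of C2] C2(1) by linarith
    then have "cmod (zeta1 s) / cmod (s - 1) * cmod (Lf s) \<le> ((1/t1 + C1 * 2) * T) * (C2 * (2 * T))"
      using z C1 assms T1 by (intro mult_mono) auto
    also have "\<dots> = C * (T * T)" by (simp add: C_def algebra_simps)
    also have "T * T = \<tau> s powr (1/30)" unfolding T_def by (simp add: powr_add[symmetric])
    finally show ?thesis by (simp add: Zf_def Wf_def norm_mult norm_divide)
  qed
  ultimately show ?thesis by blast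
qed

lemma \<tau>_powr_shift:
  assumes "\<tau> x \<le> 2 * \<tau> s"
  shows "\<tau> x powr (1/30) \<le> 2 * \<tau> s powr (1/30)"
proof -
  have "\<tau> x powr (1/30) \<le> (2 * \<tau> s) powr (1/30)" using assms by (intro powr_mono2) auto
  also have "\<dots> = 2 powr (1/30) * \<tau> s powr (1/30)" by (subst powr_mult) auto
  also have "\<dots> \<le> 2 powr 1 * \<tau> s powr (1/30)" by (intro mult_right_mono powr_mono) auto
  finally show ?thesis by simp
qed

text \<open>Cauchy's inequality on a disc of fixed radius, small enough to stay right of
  \<open>1 - 1/120\<close> and at distance \<open>t1/2\<close> from the pole.\<close>

lemma Zf_deriv_bound:
  assumes "t1 > 0"
  shows "\<exists>C>0. \<forall>s. 1 \<le> Re s \<longrightarrow> Re s \<le> 2 \<longrightarrow> \<bar>Im s\<bar> \<ge> t1 \<longrightarrow> cmod ((deriv ^^ j) Zf s) \<le> C * \<tau> s powr (1/30)"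
proof -
  obtain C where C: "C > 0" "\<And>s. 1 - 1/120 \<le> Re s \<Longrightarrow> Re s \<le> 3 \<Longrightarrow> cmod (s - 1) \<ge> t1/2 \<Longrightarrow> cmod (Zf s) \<le> C * \<tau> s powr (1/30)"
    using Zf_bound[of "t1/2"] assms by auto
  define r where "r = min (1/120) (t1/2)"
  have r: "r > 0" "r \<le> 1/120" "r \<le> t1/2" using assms by (auto simp: r_def)
  have "cmod ((deriv ^^ j) Zf s) \<le> (fact j * (2 * C) / r ^ j) * \<tau> s powr (1/30)"
    if s: "1 \<le> Re s" "Re s \<le> 2" "\<bar>Im s\<bar> \<ge> t1" for s
  proof -
    have near: "1 - 1/120 \<le> Re x \<and> Re x \<le> 3 \<and> cmod (x - 1) \<ge> t1/2 \<and> \<tau> x \<le> 2 * \<tau> s" if "cmod (s - x) \<le> r" for x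
    proof -
      have "\<bar>Re (s - x)\<bar> \<le> r" "\<bar>Im (s - x)\<bar> \<le> r"
        using that abs_Re_le_cmod[of "s - x"] abs_Im_le_cmod[of "s - x"] by linarith+
      moreover have "\<bar>Im (x - 1)\<bar> \<le> cmod (x - 1)" by (rule abs_Im_le_cmod)
      ultimately show ?thesis using s r by (simp add: abs_le_iff) linarith
    qed
    have sub: "cball s r \<subseteq> {s. Re s > 0} - {1}"
    proof
      fix x assume "x \<in> cball s r"
      then have "cmod (s - x) \<le> r" by (simp add: dist_norm)
      from near[OF this] assms show "x \<in> {s. Re s > 0} - {1}" by auto
    qed
    have hol: "Zf holomorphic_on cball s r" using Zf_holomorphic sub by (rule holomorphic_on_subset)
    have "cmod ((deriv ^^ j) Zf s) \<le> fact j * (C * (2 * \<tau> s powr (1/30))) / r ^ j"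
    proof (rule Cauchy_inequality)
      show "Zf holomorphic_on ball s r" using hol by (rule holomorphic_on_subset) auto
      show "continuous_on (cball s r) Zf" using hol by (rule holomorphic_on_imp_continuous_on)
      fix x assume "cmod (s - x) = r"
      then have n: "1 - 1/120 \<le> Re x \<and> Re x \<le> 3 \<and> cmod (x - 1) \<ge> t1/2 \<and> \<tau> x \<le> 2 * \<tau> s" by (intro near) simp
      then have "cmod (Zf x) \<le> C * \<tau> x powr (1/30)" by (intro C) auto
      also have "\<dots> \<le> C * (2 * \<tau> s powr (1/30))" using n C(1) by (intro mult_left_mono \<tau>_powr_shift) auto
      finally show "cmod (Zf x) \<le> C * (2 * \<tau> s powr (1/30))" .
    qed (rule r)
    then show ?thesis by (simp add: mult_ac)
  qed
  moreover have "fact j * (2 * C) / r ^ j > 0" using C(1) r by simp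
  ultimately show ?thesis by blast
qed

lemma Zf_near_pole: "\<exists>C>0. \<forall>\<sigma>. 1 < \<sigma> \<longrightarrow> \<sigma> \<le> 2 \<longrightarrow> cmod (Zf (of_real \<sigma>)) \<le> C / (\<sigma> - 1)"
proof -
  have "compact (complex_of_real ` {1..2})" by (intro compact_continuous_image continuous_intros) auto
  moreover have "continuous_on (complex_of_real ` {1..2}) Wf"
    using Wf_holomorphic by (intro holomorphic_on_imp_continuous_on) (rule holomorphic_on_subset, auto)
  ultimately have "bounded (Wf ` complex_of_real ` {1..2})" using compact_continuous_image compact_imp_bounded by blast
  then obtain C where C: "C > 0" "\<And>x. x \<in> Wf ` complex_of_real ` {1..2} \<Longrightarrow> cmod x \<le> C"
    by (auto simp: bounded_pos)
  have "cmod (Zf (of_real \<sigma>)) \<le> C / (\<sigma> - 1)" if "1 < \<sigma>" "\<sigma> \<le> 2" for \<sigma>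
  proof -
    have "cmod (Wf (of_real \<sigma>)) \<le> C" using that by (intro C) auto
    moreover have "cmod (of_real \<sigma> - 1) = \<sigma> - 1" using that norm_of_real[of "\<sigma> - 1", where 'a = complex] by simp
    ultimately show ?thesis using that by (simp add: Zf_def norm_divide divide_right_mono)
  qed
  with C(1) show ?thesis by blast
qed

text \<open>Two ranges of \<open>Re s\<close> are balanced at \<open>1 + \<eta>\<close>. To the
  right of it the 3-4-1 inequality gives at least a constant times
  \<open>\<eta> powr (3/4) * T powr (-1/120)\<close>. To the left the derivative bound limits the
  change of \<open>Zf\<close> to \<open>C1 * \<eta> * T powr (1/30)\<close>. With
  \<open>\<eta> = c2 * T powr (-5/30)\<close> both are multiples of \<open>T powr (-4/30)\<close>,
  and \<open>c2\<close> is so small that the change is at most half of the first bound.\<close>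

lemma Zf_lower_bound:
  assumes "t1 > 0"
  shows "\<exists>c>0. \<forall>s. 1 < Re s \<longrightarrow> Re s \<le> 2 \<longrightarrow> \<bar>Im s\<bar> \<ge> t1 \<longrightarrow> cmod (Zf s) \<ge> c * \<tau> s powr (-4/30)"
proof -
  obtain C1 where C1: "C1 > 0" "\<And>s. 1 \<le> Re s \<Longrightarrow> Re s \<le> 2 \<Longrightarrow> \<bar>Im s\<bar> \<ge> t1 \<Longrightarrow> cmod (deriv Zf s) \<le> C1 * \<tau> s powr (1/30)"
    using Zf_deriv_bound[OF assms, of 1] by auto
  obtain C2 where C2: "C2 > 0" "\<And>s. 1 - 1/120 \<le> Re s \<Longrightarrow> Re s \<le> 3 \<Longrightarrow> cmod (s - 1) \<ge> t1 \<Longrightarrow> cmod (Zf s) \<le> C2 * \<tau> s powr (1/30)"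
    using Zf_bound[OF assms] by auto
  obtain C3 where C3: "C3 > 0" "\<And>\<sigma>. 1 < \<sigma> \<Longrightarrow> \<sigma> \<le> 2 \<Longrightarrow> cmod (Zf (of_real \<sigma>)) \<le> C3 / (\<sigma> - 1)"
    using Zf_near_pole by auto
  obtain k where k: "k > 0" "\<And>\<sigma> t. \<sigma> > 1 \<Longrightarrow>
    k \<le> cmod (Zf (of_real \<sigma>)) ^ 3 * cmod (Zf (Complex \<sigma> t)) ^ 4 * cmod (Zf (Complex \<sigma> (2 * t)))" using Zf_341 by auto
  define c1 where "c1 = k / (C3 ^ 3 * (2 * C2))"
  have c1: "c1 > 0" unfolding c1_def using k C3 C2 by simp
  define c2 where "c2 = min 1 (c1 / (2 * C1) ^ 4)"
  have c2: "c2 > 0" "c2 \<le> 1" "c2 \<le> c1 / (2 * C1) ^ 4" unfolding c2_def using c1 C1 by auto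
  define c4 where "c4 = c1 powr (1/4) * c2 powr (3/4)"
  have c4: "c4 \<ge> 2 * (C1 * c2)" "c4 > 0"
  proof -
    have "c2 powr (1/4) \<le> (c1 / (2 * C1) ^ 4) powr (1/4)" using c2 by (intro powr_mono2) auto
    also have "\<dots> = c1 powr (1/4) / (2 * C1)"
    proof -
      have "((2 * C1) ^ 4) powr (1/4) = 2 * C1" using power_powr_eq[of "2 * C1" 4 "1/4"] C1(1) by simp
      then show ?thesis using c1 C1(1) by (simp add: powr_divide)
    qed
    finally have "2 * C1 * c2 powr (1/4) \<le> c1 powr (1/4)" using C1(1) by (simp add: field_simps)
    then have "2 * C1 * c2 powr (1/4) * c2 powr (3/4) \<le> c1 powr (1/4) * c2 powr (3/4)" by (intro mult_right_mono) auto
    moreover have "c2 powr (1/4) * c2 powr (3/4) = c2" using c2 by (simp add: powr_add[symmetric])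
    ultimately show "c4 \<ge> 2 * (C1 * c2)" by (simp add: c4_def mult.assoc)
    show "c4 > 0" using c1 c2 by (simp add: c4_def)
  qed
  have "cmod (Zf s) \<ge> c4 / 2 * \<tau> s powr (-4/30)" if s: "1 < Re s" "Re s \<le> 2" "\<bar>Im s\<bar> \<ge> t1" for s
  proof -
    define T where "T = \<tau> s"
    have T: "T \<ge> 2" by (simp add: T_def)
    define \<sigma> t where "\<sigma> = Re s" and "t = Im s"
    have low: "cmod (Zf (Complex \<sigma> t)) \<ge> c1 powr (1/4) * (\<sigma> - 1) powr (3/4) * T powr (-1/120)"
      if sg: "1 < \<sigma>" "\<sigma> \<le> 2" for \<sigma>
    proof -
      have t2: "cmod (Zf (Complex \<sigma> (2 * t))) \<le> C2 * (2 * T powr (1/30))"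
      proof -
        have "cmod (Zf (Complex \<sigma> (2 * t))) \<le> C2 * \<tau> (Complex \<sigma> (2 * t)) powr (1/30)"
        proof (rule C2)
          have "t1 \<le> \<bar>Im (Complex \<sigma> (2 * t) - 1)\<bar>" using s assms by (simp add: t_def)
          then show "t1 \<le> cmod (Complex \<sigma> (2 * t) - 1)" using abs_Im_le_cmod order.trans by blast
        qed (use sg in auto)
        also have "\<dots> \<le> C2 * (2 * \<tau> s powr (1/30))"
          using C2(1) by (intro mult_left_mono \<tau>_powr_shift) (auto simp: t_def)
        finally show ?thesis by (simp add: T_def)
      qed
      have "k \<le> cmod (Zf (of_real \<sigma>)) ^ 3 * cmod (Zf (Complex \<sigma> t)) ^ 4 * cmod (Zf (Complex \<sigma> (2 * t)))"
        using k sg by auto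
      also have "\<dots> \<le> (C3 / (\<sigma> - 1)) ^ 3 * cmod (Zf (Complex \<sigma> t)) ^ 4 * (C2 * (2 * T powr (1/30)))"
        using C3 sg t2 by (intro mult_mono power_mono) auto
      finally have "k * (\<sigma> - 1) ^ 3 \<le> (C3 ^ 3 * (2 * C2)) * T powr (1/30) * cmod (Zf (Complex \<sigma> t)) ^ 4"
        using sg by (simp add: field_simps power_divide)
      then have "c1 * (\<sigma> - 1) ^ 3 \<le> T powr (1/30) * cmod (Zf (Complex \<sigma> t)) ^ 4"
        using C3(1) C2(1) by (simp add: c1_def field_simps)
      then have "c1 * (\<sigma> - 1) ^ 3 * T powr (-1/30) \<le> T powr (1/30) * cmod (Zf (Complex \<sigma> t)) ^ 4 * T powr (-1/30)"
        by (intro mult_right_mono) auto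
      also have "\<dots> = cmod (Zf (Complex \<sigma> t)) ^ 4 * (T powr (1/30) * T powr (-1/30))" by simp
      also have "T powr (1/30) * T powr (-1/30) = 1" using T by (simp add: powr_add[symmetric])
      finally have "(c1 * (\<sigma> - 1) ^ 3 * T powr (-1/30)) powr (1/4) \<le> (cmod (Zf (Complex \<sigma> t)) ^ 4) powr (1/4)"
        using c1 sg by (intro powr_mono2) auto
      also have "\<dots> = cmod (Zf (Complex \<sigma> t))"
        by (cases "Zf (Complex \<sigma> t) = 0") (auto simp: power_powr_eq)
      also have "(c1 * (\<sigma> - 1) ^ 3 * T powr (-1/30)) powr (1/4) = c1 powr (1/4) * (\<sigma> - 1) powr (3/4) * T powr (-1/120)"
        using c1 sg T by (simp add: powr_mult powr_powr power_powr_eq)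
      finally show ?thesis .
    qed
    define \<eta> where "\<eta> = c2 * T powr (-5/30)"
    have eta0: "\<eta> > 0" unfolding \<eta>_def using c2 T by simp
    have "T powr (-5/30) \<le> T powr 0" using T by (intro powr_mono) auto
    then have eta1: "\<eta> \<le> 1" unfolding \<eta>_def using c2 T mult_mono[of c2 1 "T powr (-5/30)" 1] by simp
    have etaT: "c1 powr (1/4) * \<eta> powr (3/4) * T powr (-1/120) = c4 * T powr (-4/30)"
    proof -
      have "\<eta> powr (3/4) * T powr (-1/120) = c2 powr (3/4) * (T powr (-5/30 * (3/4)) * T powr (-1/120))"
        unfolding \<eta>_def using c2 T by (simp add: powr_mult powr_powr)
      also have "T powr (-5/30 * (3/4)) * T powr (-1/120) = T powr (-4/30)" by (simp add: powr_add[symmetric])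
      finally show ?thesis by (simp add: c4_def mult.assoc)
    qed
    have "cmod (Zf (Complex \<sigma> t)) \<ge> c4 / 2 * T powr (-4/30)"
    proof (cases "\<sigma> \<ge> 1 + \<eta>")
      case True
      have "c4 / 2 * T powr (-4/30) \<le> c4 * T powr (-4/30)" using c4 by (intro mult_right_mono) auto
      also have "\<dots> = c1 powr (1/4) * \<eta> powr (3/4) * T powr (-1/120)" by (rule etaT[symmetric])
      also have "\<dots> \<le> c1 powr (1/4) * (\<sigma> - 1) powr (3/4) * T powr (-1/120)"
        using True eta0 by (intro mult_right_mono mult_left_mono powr_mono2) auto
      also have "\<dots> \<le> cmod (Zf (Complex \<sigma> t))" using s by (intro low) (auto simp: \<sigma>_def)
      finally show ?thesis .
    next
      case False
      define S where "S = {z. 1 \<le> Re z \<and> Re z \<le> 2 \<and> Im z = t}"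
      have conv: "convex S" unfolding S_def
      proof -
        have "{z. 1 \<le> Re z \<and> Re z \<le> 2 \<and> Im z = t} = {z. Re z \<ge> 1} \<inter> {z. Re z \<le> 2} \<inter> ({z. Im z \<ge> t} \<inter> {z. Im z \<le> t})" by auto
        then show "convex {z. 1 \<le> Re z \<and> Re z \<le> 2 \<and> Im z = t}"
          by (auto intro!: convex_Int convex_halfspace_Re_ge convex_halfspace_Re_le convex_halfspace_Im_ge convex_halfspace_Im_le)
      qed
      have "cmod (Zf (Complex (1 + \<eta>) t) - Zf (Complex \<sigma> t)) \<le> (C1 * T powr (1/30)) * cmod (Complex (1 + \<eta>) t - Complex \<sigma> t)"
      proof (rule field_differentiable_bound[OF conv])
        fix z assume z: "z \<in> S"
        then have "z \<in> {s. Re s > 0} - {1}" using s assms by (auto simp: S_def t_def)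
        then have "(Zf has_field_derivative deriv Zf z) (at z)"
          by (intro holomorphic_derivI[OF Zf_holomorphic]) (auto intro!: open_Diff open_halfspace_Re_gt)
        then show "(Zf has_field_derivative deriv Zf z) (at z within S)" by (rule has_field_derivative_at_within)
        show "cmod (deriv Zf z) \<le> C1 * T powr (1/30)"
          using C1(2)[of z] z s by (auto simp: S_def T_def t_def)
      qed (use s eta0 eta1 in \<open>auto simp: S_def \<sigma>_def\<close>)
      also have "cmod (Complex (1 + \<eta>) t - Complex \<sigma> t) \<le> \<eta>"
      proof -
        have "Complex (1 + \<eta>) t - Complex \<sigma> t = of_real (1 + \<eta> - \<sigma>)" by (simp add: complex_eq_iff)
        then have "cmod (Complex (1 + \<eta>) t - Complex \<sigma> t) = \<bar>1 + \<eta> - \<sigma>\<bar>" by (simp only: norm_of_real)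
        then show ?thesis using False s by (simp add: \<sigma>_def)
      qed
      finally have "cmod (Zf (Complex (1 + \<eta>) t) - Zf (Complex \<sigma> t)) \<le> (C1 * T powr (1/30)) * \<eta>"
        using C1(1) by (simp add: mult_left_mono)
      also have "\<dots> = C1 * c2 * (T powr (1/30) * T powr (-5/30))" by (simp add: \<eta>_def)
      also have "T powr (1/30) * T powr (-5/30) = T powr (-4/30)" by (simp add: powr_add[symmetric])
      also have "C1 * c2 * T powr (-4/30) \<le> c4 / 2 * T powr (-4/30)" using c4 by (intro mult_right_mono) auto
      finally have d: "cmod (Zf (Complex (1 + \<eta>) t) - Zf (Complex \<sigma> t)) \<le> c4 / 2 * T powr (-4/30)" .
      have "cmod (Zf (Complex (1 + \<eta>) t)) \<ge> c4 * T powr (-4/30)"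
      proof -
        have "c1 powr (1/4) * (1 + \<eta> - 1) powr (3/4) * T powr (-1/120) \<le> cmod (Zf (Complex (1 + \<eta>) t))"
          using eta0 eta1 by (intro low) auto
        then show ?thesis by (simp only: add_diff_cancel_left' etaT)
      qed
      then show ?thesis using d norm_triangle_ineq2[of "Zf (Complex (1 + \<eta>) t)" "Zf (Complex \<sigma> t)"] by linarith
    qed
    then show ?thesis by (simp add: \<sigma>_def t_def T_def)
  qed
  with c4(2) show ?thesis by (intro exI[of _ "c4/2"]) auto
qed

section \<open>The third derivative of the logarithmic derivative\<close>

lemma Zf_nonzero: "Re s > 1 \<Longrightarrow> Zf s \<noteq> 0" using Zf_exp by auto

abbreviation Af :: "complex \<Rightarrow> complex" where "Af \<equiv> dir_series acoef"

lemma deriv_Zf: "Re s > 1 \<Longrightarrow> deriv Zf s = - (Zf s * Af s)"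
  by (intro DERIV_imp_deriv Zf_deriv)

lemma Af_deriv3: "Re s > 1 \<Longrightarrow> (deriv ^^ 3) Af s = - dir_series (\<lambda>n. acoef n * ln (real n) ^ 3) s"
  using dir_series_higher_deriv[OF dir_summable_acoef, of s 3] by simp

lemma Zf_higher_deriv:
  assumes "Re s > 1"
  shows "(deriv ^^ Suc n) Zf s = - (\<Sum>i = 0..n. of_nat (n choose i) * (deriv ^^ i) Zf s * (deriv ^^ (n-i)) Af s)"
proof -
  let ?S = "{s. Re s > 1}"
  have Z: "Zf holomorphic_on ?S" using Zf_holomorphic by (rule holomorphic_on_subset) auto
  have A: "Af holomorphic_on ?S" by (rule dir_series_holomorphic[OF dir_summable_acoef])
  have o: "open ?S" by (rule open_halfspace_Re_gt)
  have "(deriv ^^ Suc n) Zf s = (deriv ^^ n) (deriv Zf) s" by (simp add: funpow_swap1)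
  also have "\<dots> = (deriv ^^ n) (\<lambda>w. - (Zf w * Af w)) s"
    using assms by (intro higher_deriv_transform_within_open[OF _ _ o] holomorphic_deriv Z o holomorphic_intros A) (auto simp: deriv_Zf)
  also have "\<dots> = - (deriv ^^ n) (\<lambda>w. Zf w * Af w) s"
    using assms by (intro higher_deriv_uminus[OF _ o] holomorphic_intros Z A) auto
  also have "(deriv ^^ n) (\<lambda>w. Zf w * Af w) s = (\<Sum>i = 0..n. of_nat (n choose i) * (deriv ^^ i) Zf s * (deriv ^^ (n-i)) Af s)"
    using assms by (intro higher_deriv_mult[OF Z A o]) auto
  finally show ?thesis .
qed

text \<open>Leibniz' rule for \<open>Zf' = - Zf * Af\<close>, solved for the highest derivative of
  \<open>Af\<close>, gives a polynomial of degree at most 4 in the quotients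
  \<open>Zf^(j) / Zf\<close>. Each quotient is at most \<open>q\<close>, of order
  \<open>\<tau> s powr (5/30)\<close>, so the fourth power is still below \<open>\<tau> s\<close>.
  The count of terms is \<open>26 = 1 + 18 + 6 + 1\<close>.\<close>

lemma Af_deriv3_bound_far:
  assumes "t1 > 0"
  shows "\<exists>C>0. \<forall>s. 1 < Re s \<longrightarrow> Re s \<le> 2 \<longrightarrow> \<bar>Im s\<bar> \<ge> t1 \<longrightarrow> cmod ((deriv ^^ 3) Af s) \<le> C * \<tau> s"
proof -
  obtain c where c: "c > 0" "\<And>s. 1 < Re s \<Longrightarrow> Re s \<le> 2 \<Longrightarrow> \<bar>Im s\<bar> \<ge> t1 \<Longrightarrow> cmod (Zf s) \<ge> c * \<tau> s powr (-4/30)"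
    using Zf_lower_bound[OF assms] by auto
  have "\<forall>j. \<exists>C>0. \<forall>s. 1 \<le> Re s \<longrightarrow> Re s \<le> 2 \<longrightarrow> \<bar>Im s\<bar> \<ge> t1 \<longrightarrow> cmod ((deriv ^^ j) Zf s) \<le> C * \<tau> s powr (1/30)"
    using Zf_deriv_bound[OF assms] by blast
  then obtain C where C: "\<And>j. C j > 0" "\<And>j s. 1 \<le> Re s \<Longrightarrow> Re s \<le> 2 \<Longrightarrow> \<bar>Im s\<bar> \<ge> t1 \<Longrightarrow> cmod ((deriv ^^ j) Zf s) \<le> C j * \<tau> s powr (1/30)"
    by metis
  \<comment> \<open>The summand 1 makes \<open>q \<ge> 1\<close>, so that lower powers of
    \<open>q\<close> are absorbed by \<open>q ^ 4\<close>.\<close>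
  define D where "D = 1 + (C 1 + C 2 + C 3 + C 4) / c"
  have D1: "D \<ge> 1" unfolding D_def using C(1)[of 1] C(1)[of 2] C(1)[of 3] C(1)[of 4] c(1) by simp
  have "cmod ((deriv ^^ 3) Af s) \<le> (26 * D ^ 4) * \<tau> s" if s: "1 < Re s" "Re s \<le> 2" "\<bar>Im s\<bar> \<ge> t1" for s
  proof -
    define q where "q = D * \<tau> s powr (5/30)"
    have q1: "q \<ge> 1" unfolding q_def using D1 ge_one_powr_ge_zero[of "\<tau> s" "5/30"] mult_mono[of 1 D 1 "\<tau> s powr (5/30)"] by simp
    have Z0: "Zf s \<noteq> 0" by (rule Zf_nonzero[OF s(1)])
    have zq: "cmod ((deriv ^^ j) Zf s / Zf s) \<le> q" if j: "j \<in> {1,2,3,4}" for j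
    proof -
      have "cmod ((deriv ^^ j) Zf s) / cmod (Zf s) \<le> (C j * \<tau> s powr (1/30)) / (c * \<tau> s powr (-4/30))"
        using s c(1) C(1)[of j] by (intro frac_le C(2) c(2)) auto
      also have "\<dots> = C j / c * \<tau> s powr (5/30)"
      proof -
        have "\<tau> s powr (1/30) / \<tau> s powr (-4/30) = \<tau> s powr (5/30)" by (subst powr_diff[symmetric]) simp
        then show ?thesis by (simp only: times_divide_times_eq[symmetric])
      qed
      also have "\<dots> \<le> q" unfolding q_def
      proof (intro mult_right_mono)
        have "C j \<le> C 1 + C 2 + C 3 + C 4" using j C(1)[of 1] C(1)[of 2] C(1)[of 3] C(1)[of 4] by auto
        then have "C j / c \<le> (C 1 + C 2 + C 3 + C 4) / c" using c(1) by (simp add: divide_right_mono)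
        then show "C j / c \<le> D" by (simp add: D_def)
      qed auto
      finally show ?thesis by (simp add: norm_divide)
    qed
    define z1 z2 z3 z4 where "z1 = (deriv ^^ 1) Zf s / Zf s" and "z2 = (deriv ^^ 2) Zf s / Zf s"
      and "z3 = (deriv ^^ 3) Zf s / Zf s" and "z4 = (deriv ^^ 4) Zf s / Zf s"
    define a0 a1 a2 a3 where "a0 = Af s" and "a1 = deriv Af s" and "a2 = (deriv ^^ 2) Af s" and "a3 = (deriv ^^ 3) Af s"
    have e0: "a0 = - z1" using deriv_Zf[OF s(1)] Z0 by (simp add: a0_def z1_def)
    have h1: "(deriv ^^ 2) Zf s = - (Zf s * a1 + (deriv ^^ 1) Zf s * a0)"
      using Zf_higher_deriv[OF s(1), of 1] by (simp add: a0_def a1_def eval_nat_numeral)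
    have h2: "(deriv ^^ 3) Zf s = - (Zf s * a2 + 2 * ((deriv ^^ 1) Zf s * a1) + (deriv ^^ 2) Zf s * a0)"
      using Zf_higher_deriv[OF s(1), of 2] by (simp add: a0_def a1_def a2_def eval_nat_numeral)
    have h3: "(deriv ^^ 4) Zf s = - (Zf s * a3 + 3 * ((deriv ^^ 1) Zf s * a2) + 3 * ((deriv ^^ 2) Zf s * a1) + (deriv ^^ 3) Zf s * a0)"
      using Zf_higher_deriv[OF s(1), of 3] by (simp add: a0_def a1_def a2_def a3_def eval_nat_numeral)
    have solve: "a = - (D / x) - w / x" if "x \<noteq> 0" "D = - (x * a + w)" for x D a w :: complex
      unfolding that(2) using that(1) by (simp add: diff_divide_distrib)
    have e1: "a1 = - z2 - z1 * a0" using solve[OF Z0 h1] by (simp add: z1_def z2_def)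
    have e2: "a2 = - z3 - 2 * (z1 * a1) - z2 * a0" 
      using solve[OF Z0 h2[unfolded add.assoc]] by (simp add: z1_def z2_def z3_def add_divide_distrib)
    have e3: "a3 = - z4 - 3 * (z1 * a2) - 3 * (z2 * a1) - z3 * a0" 
      using solve[OF Z0 h3[unfolded add.assoc]] by (simp add: z1_def z2_def z3_def z4_def add_divide_distrib)
    have b: "cmod z1 \<le> q" "cmod z2 \<le> q" "cmod z3 \<le> q" "cmod z4 \<le> q"
      using zq[of 1] zq[of 2] zq[of 3] zq[of 4] by (auto simp: z1_def z2_def z3_def z4_def)
    have qq: "q \<le> q ^ 2" "q ^ 2 \<le> q ^ 3" "q ^ 3 \<le> q ^ 4" using q1 by (auto intro: power_increasing self_le_power)
    have b0: "cmod a0 \<le> q" using b e0 by simp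
    have "cmod a1 \<le> cmod z2 + cmod z1 * cmod a0"
      unfolding e1 using norm_triangle_ineq4[of "-z2" "z1 * a0"] by (simp add: norm_mult)
    also have "\<dots> \<le> q ^ 2 + q * q" using b b0 qq q1 by (intro add_mono mult_mono) auto
    finally have b1: "cmod a1 \<le> 2 * q ^ 2" by (simp add: power2_eq_square)
    have "cmod a2 \<le> cmod z3 + 2 * (cmod z1 * cmod a1) + cmod z2 * cmod a0"
    proof -
      have "cmod a2 \<le> cmod (- z3 - 2 * (z1 * a1)) + cmod (z2 * a0)" unfolding e2 by (rule norm_triangle_ineq4)
      also have "cmod (- z3 - 2 * (z1 * a1)) \<le> cmod (-z3) + cmod (2 * (z1 * a1))" by (rule norm_triangle_ineq4)
      finally show ?thesis by (simp add: norm_mult)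
    qed
    also have "\<dots> \<le> q ^ 3 + 2 * (q * (2 * q ^ 2)) + q * q"
      using b b0 b1 qq q1 by (intro add_mono mult_mono mult_left_mono) auto
    also have "\<dots> \<le> 6 * q ^ 3" using qq by (simp add: power2_eq_square power3_eq_cube)
    finally have b2: "cmod a2 \<le> 6 * q ^ 3" .
    have "cmod a3 \<le> cmod z4 + 3 * (cmod z1 * cmod a2) + 3 * (cmod z2 * cmod a1) + cmod z3 * cmod a0"
    proof -
      have "cmod a3 \<le> cmod (- z4 - 3 * (z1 * a2) - 3 * (z2 * a1)) + cmod (z3 * a0)" unfolding e3 by (rule norm_triangle_ineq4)
      also have "cmod (- z4 - 3 * (z1 * a2) - 3 * (z2 * a1)) \<le> cmod (- z4 - 3 * (z1 * a2)) + cmod (3 * (z2 * a1))" by (rule norm_triangle_ineq4)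
      also have "cmod (- z4 - 3 * (z1 * a2)) \<le> cmod (-z4) + cmod (3 * (z1 * a2))" by (rule norm_triangle_ineq4)
      finally show ?thesis by (simp add: norm_mult)
    qed
    also have "\<dots> \<le> q ^ 4 + 3 * (q * (6 * q ^ 3)) + 3 * (q * (2 * q ^ 2)) + q * q"
      using b b0 b1 b2 qq q1 by (intro add_mono mult_mono mult_left_mono) auto
    also have "\<dots> = q ^ 4 + 18 * q ^ 4 + 6 * q ^ 3 + q ^ 2" by (simp add: eval_nat_numeral)
    also have "\<dots> \<le> 26 * q ^ 4" using qq by linarith
    also have "q ^ 4 \<le> D ^ 4 * \<tau> s"
    proof -
      have "\<tau> s powr (20/30) \<le> \<tau> s powr 1" by (intro powr_mono) auto
      moreover have "q ^ 4 = D ^ 4 * \<tau> s powr (20/30)"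
        unfolding q_def by (simp add: power_mult_distrib powr_power_eq)
      ultimately show ?thesis using D1 by (simp add: mult_left_mono)
    qed
    finally show ?thesis by (simp add: a3_def mult_ac)
  qed
  moreover have "26 * D ^ 4 > 0" using D1 by simp
  ultimately show ?thesis by blast
qed

text \<open>Here \<open>Af\<close> is \<open>1 / (s - 1)\<close> plus \<open>H = - Wf' / Wf\<close>,
  and \<open>- 6 / (s - 1) ^ 4\<close> is the third derivative of the former. \<open>H\<close> is
  holomorphic on a closed rectangle: right of the line \<open>Zf\<close> has no zeros, and the left
  edge is kept inside a disc around 1 where \<open>Wf\<close> is nonzero by continuity. That disc
  determines \<open>t1\<close>.\<close>

lemma Af_deriv3_bound_near:
  "\<exists>t1>0. \<exists>C>0. \<forall>s. 1 < Re s \<longrightarrow> Re s \<le> 2 \<longrightarrow> \<bar>Im s\<bar> \<le> t1 \<longrightarrow> cmod ((deriv ^^ 3) Af s + 6 / (s - 1) ^ 4) \<le> C"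
proof -
  have o: "open {s::complex. Re s > 0}" by (rule open_halfspace_Re_gt)
  have contW: "continuous_on {s. Re s > 0} Wf" using Wf_holomorphic by (rule holomorphic_on_imp_continuous_on)
  define U where "U = {s. Re s > 0 \<and> Wf s \<noteq> 0}"
  have "open ({s. Re s > 0} \<inter> Wf -` (- {0}))" using contW o by (intro continuous_open_preimage) auto
  moreover have "{s. Re s > 0} \<inter> Wf -` (- {0}) = U" by (auto simp: U_def)
  ultimately have oU: "open U" by simp
  have "1 \<in> U" using Wf_1_nonzero by (simp add: U_def)
  then obtain r where r: "r > 0" "ball 1 r \<subseteq> U" using oU by (auto simp: open_contains_ball)
  define t1 where "t1 = r / 2"
  define Kc where "Kc = cbox (Complex 1 (-t1)) (Complex 2 t1)"
  have Kc: "z \<in> Kc \<longleftrightarrow> 1 \<le> Re z \<and> Re z \<le> 2 \<and> \<bar>Im z\<bar> \<le> t1" for z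
    by (auto simp: Kc_def in_cbox_complex_iff)
  have KU: "Kc \<subseteq> U"
  proof
    fix z assume z: "z \<in> Kc"
    show "z \<in> U"
    proof (cases "Re z > 1")
      case True
      then show ?thesis using Zf_nonzero[of z] by (auto simp: U_def Zf_def)
    next
      case False
      with z have "Re z = 1" "\<bar>Im z\<bar> < r" using r(1) by (auto simp: Kc t1_def)
      then have "cmod (1 - z) \<le> \<bar>Im z\<bar>" using cmod_le[of "1 - z"] by simp
      then have "z \<in> ball 1 r" using \<open>\<bar>Im z\<bar> < r\<close> by (simp add: dist_norm)
      then show ?thesis using r by auto
    qed
  qed
  define H where "H = (\<lambda>s. - deriv Wf s / Wf s)"
  have holH: "H holomorphic_on U" unfolding H_def
    by (intro holomorphic_intros holomorphic_on_subset[OF holomorphic_deriv[OF Wf_holomorphic o]] holomorphic_on_subset[OF Wf_holomorphic])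
       (auto simp: U_def)
  have "(deriv ^^ 3) H holomorphic_on U" using holH oU by (rule holomorphic_higher_deriv)
  then have "continuous_on Kc ((deriv ^^ 3) H)"
    using KU holomorphic_on_imp_continuous_on continuous_on_subset by blast
  moreover have "compact Kc" by (simp add: Kc_def)
  ultimately have "bounded ((deriv ^^ 3) H ` Kc)" using compact_continuous_image compact_imp_bounded by blast
  then obtain C where C: "C > 0" "\<And>x. x \<in> (deriv ^^ 3) H ` Kc \<Longrightarrow> cmod x \<le> C" by (auto simp: bounded_pos)
  have "cmod ((deriv ^^ 3) Af s + 6 / (s - 1) ^ 4) \<le> C" if s: "1 < Re s" "Re s \<le> 2" "\<bar>Im s\<bar> \<le> t1" for s
  proof -
    let ?S = "{s. Re s > 1}"
    have oS: "open ?S" by (rule open_halfspace_Re_gt)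
    have SU: "?S \<subseteq> U" using Zf_nonzero by (auto simp: U_def Zf_def)
    have holH': "H holomorphic_on ?S" using holH SU by (rule holomorphic_on_subset)
    have holp: "(\<lambda>s. inverse (s - 1)) holomorphic_on ?S" by (intro holomorphic_intros) auto
    have AH: "Af z = H z + inverse (z - 1)" if z: "z \<in> ?S" for z
    proof -
      have z1: "z - 1 \<noteq> 0" using z by auto
      have dW: "(Wf has_field_derivative deriv Wf z) (at z)"
        using z by (intro holomorphic_derivI[OF Wf_holomorphic o]) auto
      have "(Zf has_field_derivative (deriv Wf z * (z - 1) - Wf z * 1) / ((z - 1) * (z - 1))) (at z)"
        unfolding Zf_def[abs_def] using z1 by (intro DERIV_divide dW) (auto intro!: derivative_eq_intros)
      then have "(deriv Wf z * (z - 1) - Wf z * 1) / ((z - 1) * (z - 1)) = - (Zf z * Af z)"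
        using Zf_deriv[of z] z DERIV_unique by blast
      moreover have "Wf z \<noteq> 0" using z SU by (auto simp: U_def)
      ultimately have "Af z = - (deriv Wf z * (z - 1) - Wf z) / ((z - 1) * Wf z)"
        unfolding Zf_def using z1 by (simp add: divide_simps) ((simp add: algebra_simps)?)
      then show ?thesis using \<open>Wf z \<noteq> 0\<close> z1 by (simp add: H_def divide_simps) ((simp add: algebra_simps)?)
    qed
    have "(deriv ^^ 3) Af s = (deriv ^^ 3) (\<lambda>z. H z + inverse (z - 1)) s"
      using s by (intro higher_deriv_transform_within_open[OF _ _ oS] dir_series_holomorphic dir_summable_acoef holomorphic_intros holH' AH) auto
    also have "\<dots> = (deriv ^^ 3) H s + (deriv ^^ 3) (\<lambda>z. inverse (z - 1)) s"
      using s by (intro higher_deriv_add[OF holH' holp oS]) auto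
    also have "(deriv ^^ 3) (\<lambda>z. inverse (z - 1)) s = - 6 / (s - 1) ^ 4"
    proof -
      have step: "deriv f z = g' z" if "z \<in> ?S" "\<And>w. w \<in> ?S \<Longrightarrow> f w = g w" "(g has_field_derivative g' z) (at z)" for f g g' :: "complex \<Rightarrow> complex" and z
        using that oS by (intro DERIV_imp_deriv) (rule has_field_derivative_transform_within_open[of g _ _ ?S], auto)
      have d1: "deriv (\<lambda>z. inverse (z - 1)) z = - inverse ((z - 1) ^ 2)" if "z \<in> ?S" for z
        using that by (intro DERIV_imp_deriv) (auto intro!: derivative_eq_intros simp: power2_eq_square field_simps)
      have d2: "deriv (deriv (\<lambda>z. inverse (z - 1))) z = 2 / (z - 1) ^ 3" if "z \<in> ?S" for z
        using that by (intro step[OF that d1, of _ "\<lambda>z. 2 / (z - 1) ^ 3"])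
          (auto intro!: derivative_eq_intros simp: power2_eq_square power3_eq_cube divide_simps)
      have d3: "deriv (deriv (deriv (\<lambda>z. inverse (z - 1)))) z = - 6 / (z - 1) ^ 4" if "z \<in> ?S" for z
        using that by (intro step[OF that d2, of _ "\<lambda>z. - 6 / (z - 1) ^ 4"])
          (auto intro!: derivative_eq_intros simp: eval_nat_numeral divide_simps)
      then show ?thesis using s by (simp add: eval_nat_numeral)
    qed
    finally have "(deriv ^^ 3) Af s + 6 / (s - 1) ^ 4 = (deriv ^^ 3) H s" by simp
    moreover have "s \<in> Kc" using s by (simp add: Kc)
    ultimately show ?thesis using C(2) by auto
  qed
  moreover have "t1 > 0" using r by (simp add: t1_def)
  ultimately show ?thesis using C(1) by blast
qed

text \<open>Linear growth is exactly what the division by \<open>s\<close> in the Laplace transform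
  of a summatory function absorbs, so that a bounded transform is left.\<close>

theorem F3_bound:
  "\<exists>C>0. \<forall>s. 1 < Re s \<longrightarrow> Re s \<le> 2 \<longrightarrow>
     cmod (dir_series (\<lambda>n. acoef n * ln (real n) ^ 3) s - 6 / (s - 1) ^ 4) \<le> C * cmod s"
proof -
  obtain t1 C where t1: "t1 > 0" "C > 0" and near: "\<And>s. 1 < Re s \<Longrightarrow> Re s \<le> 2 \<Longrightarrow> \<bar>Im s\<bar> \<le> t1 \<Longrightarrow> cmod ((deriv ^^ 3) Af s + 6 / (s - 1) ^ 4) \<le> C"
    using Af_deriv3_bound_near by auto
  obtain C' where C': "C' > 0" and far: "\<And>s. 1 < Re s \<Longrightarrow> Re s \<le> 2 \<Longrightarrow> \<bar>Im s\<bar> \<ge> t1 \<Longrightarrow> cmod ((deriv ^^ 3) Af s) \<le> C' * \<tau> s"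
    using Af_deriv3_bound_far[OF t1(1)] by auto
  define B where "B = C + C' + 6 / t1 ^ 4"
  have B: "B > 0" unfolding B_def using t1 C' by (intro add_pos_pos) auto
  have bd: "cmod ((deriv ^^ 3) Af s + 6 / (s - 1) ^ 4) \<le> B * \<tau> s" if s: "1 < Re s" "Re s \<le> 2" for s
  proof (cases "\<bar>Im s\<bar> \<le> t1")
    case True
    have "cmod ((deriv ^^ 3) Af s + 6 / (s - 1) ^ 4) \<le> C * 1" using near[OF s True] by simp
    also have "\<dots> \<le> B * \<tau> s" using t1 C' by (intro mult_mono) (auto simp: B_def)
    finally show ?thesis .
  next
    case False
    have "t1 \<le> \<bar>Im (s - 1)\<bar>" using False by simp
    then have "t1 \<le> cmod (s - 1)" using abs_Im_le_cmod order.trans by blast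
    then have "cmod (6 / (s - 1) ^ 4) \<le> 6 / t1 ^ 4"
      using t1 by (auto simp: norm_divide norm_power intro!: divide_left_mono power_mono mult_pos_pos zero_less_power)
    also have "\<dots> \<le> 6 / t1 ^ 4 * \<tau> s" using t1 mult_left_mono[of 1 "\<tau> s" "6 / t1 ^ 4"] by simp
    finally have 1: "cmod (6 / (s - 1) ^ 4) \<le> 6 / t1 ^ 4 * \<tau> s" .
    have 2: "cmod ((deriv ^^ 3) Af s) \<le> C' * \<tau> s" using far s False by auto
    have "cmod ((deriv ^^ 3) Af s + 6 / (s - 1) ^ 4) \<le> C' * \<tau> s + 6 / t1 ^ 4 * \<tau> s"
      using norm_triangle_ineq[of "(deriv ^^ 3) Af s" "6 / (s - 1) ^ 4"] 1 2 by linarith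
    also have "\<dots> = (C' + 6 / t1 ^ 4) * \<tau> s" by (simp only: distrib_right)
    also have "\<dots> \<le> B * \<tau> s" using t1 by (intro mult_right_mono) (auto simp: B_def)
    finally show ?thesis .
  qed
  have "cmod (dir_series (\<lambda>n. acoef n * ln (real n) ^ 3) s - 6 / (s - 1) ^ 4) \<le> (3 * B) * cmod s" if s: "1 < Re s" "Re s \<le> 2" for s
  proof -
    have "\<tau> s \<le> 3 * cmod s" using s abs_Re_le_cmod[of s] abs_Im_le_cmod[of s] by linarith
    then have "B * \<tau> s \<le> B * (3 * cmod s)" using B by (intro mult_left_mono) auto
    moreover have "cmod (dir_series (\<lambda>n. acoef n * ln (real n) ^ 3) s - 6 / (s - 1) ^ 4) = cmod ((deriv ^^ 3) Af s + 6 / (s - 1) ^ 4)"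
      using s by (simp add: Af_deriv3 norm_minus_commute)
    ultimately show ?thesis using bd[OF s] by simp
  qed
  with B show ?thesis by (intro exI[of _ "3 * B"]) auto
qed

end

section \<open>Gaussian smoothing\<close>

abbreviation "gaussN \<equiv> std_normal_distribution"

lemma prob_space_gaussN: "prob_space gaussN"
  by (rule prob_space_normal_density) simp

text \<open>The Gaussian is its own characteristic function up to scaling. By Fubini the average of
  \<open>g\<close> over a Gaussian of width \<open>1/T\<close> is therefore an average of Fourier
  transforms of \<open>g\<close> at the frequencies \<open>T * y\<close>, up to phases; the factor
  \<open>T / sqrt (2 * pi)\<close> is the peak of the narrow density.\<close>

lemma gaussian_smoothing_bound:
  fixes g :: "real \<Rightarrow> real"
  assumes g: "integrable lborel g" and T: "T > 0"
    and C: "\<And>t. cmod (LINT u|lborel. of_real (g u) * iexp (t * u)) \<le> C"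
  shows "\<bar>LINT y|gaussN. g (w + y / T)\<bar> \<le> T / sqrt (2 * pi) * C"
proof -
  interpret N: prob_space gaussN by (rule prob_space_gaussN)
  interpret P: pair_sigma_finite lborel gaussN ..
  have gm [measurable]: "g \<in> borel_measurable borel" using g by auto
  define F where "F = (\<lambda>(u,y). of_real (g u) * iexp (T * (u - w) * y))"
  have "(LINT y|gaussN. g (w + y / T)) = (LINT y|lborel. std_normal_density y * g (w + y / T))"
    by (subst integral_density) auto
  also have "\<dots> = \<bar>T\<bar> *\<^sub>R (LINT u|lborel. std_normal_density (- T * w + T * u) * g (w + (- T * w + T * u) / T))"
    using T by (intro lborel_integral_real_affine) auto
  also have "\<dots> = T * (LINT u|lborel. 1 / sqrt (2 * pi) * (exp (- (T * (u - w))\<^sup>2 / 2) * g u))"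
  proof -
    have "std_normal_density (- T * w + T * u) * g (w + (- T * w + T * u) / T) = 1 / sqrt (2 * pi) * (exp (- (T * (u - w))\<^sup>2 / 2) * g u)" for u
      using T by (simp add: std_normal_density_def add_divide_distrib diff_divide_distrib algebra_simps)
    then show ?thesis using T by simp
  qed
  also have "\<dots> = T / sqrt (2 * pi) * (LINT u|lborel. exp (- (T * (u - w))\<^sup>2 / 2) * g u)"
    by (subst integral_mult_right_zero) simp
  finally have E: "(LINT y|gaussN. g (w + y / T)) = T / sqrt (2 * pi) * (LINT u|lborel. exp (- (T * (u - w))\<^sup>2 / 2) * g u)" .
  have ch: "(CLINT y|gaussN. iexp (z * y)) = of_real (exp (- z\<^sup>2 / 2))" for z
    using fun_cong[OF char_std_normal_distribution, of z] by (simp add: char_def)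
  have Fm: "F \<in> borel_measurable (lborel \<Otimes>\<^sub>M gaussN)"
    unfolding F_def by measurable
  have int: "integrable (lborel \<Otimes>\<^sub>M gaussN) F"
  proof (rule P.Fubini_integrable[OF Fm])
    have "(\<lambda>u. LINT y|gaussN. norm (F (u, y))) = (\<lambda>u. \<bar>g u\<bar>)"
      using N.prob_space by (auto simp: F_def norm_mult)
    then show "integrable lborel (\<lambda>u. LINT y|gaussN. norm (F (u, y)))" using g by simp
    show "AE u in lborel. integrable gaussN (\<lambda>y. F (u, y))"
      by (intro AE_I2 N.integrable_const_bound[where B = "\<bar>g u\<bar>" for u]) (auto simp: F_def norm_mult)
  qed
  have "complex_of_real (LINT u|lborel. exp (- (T * (u - w))\<^sup>2 / 2) * g u) = (LINT u|lborel. of_real (exp (- (T * (u - w))\<^sup>2 / 2) * g u))"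
    by (rule integral_complex_of_real[symmetric])
  also have "\<dots> = (LINT u|lborel. LINT y|gaussN. F (u, y))"
  proof -
    have "(LINT y|gaussN. F (u, y)) = of_real (exp (- (T * (u - w))\<^sup>2 / 2) * g u)" for u
      unfolding F_def split_conv integral_mult_right_zero ch by (simp only: of_real_mult mult.commute)
    then show ?thesis by (simp only:)
  qed
  also have "\<dots> = (LINT y|gaussN. LINT u|lborel. F (u, y))"
    using P.Fubini_integral[of "\<lambda>u y. F (u, y)"] int by simp
  finally have eq: "complex_of_real (LINT u|lborel. exp (- (T * (u - w))\<^sup>2 / 2) * g u) = (LINT y|gaussN. LINT u|lborel. F (u, y))" .
  have bd: "cmod (LINT u|lborel. F (u, y)) \<le> C" for y
  proof -
    have "F (u, y) = iexp (- (T * w * y)) * (of_real (g u) * iexp ((T * y) * u))" for u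
      unfolding F_def split_conv by (simp add: algebra_simps flip: exp_add)
    then have "(LINT u|lborel. F (u, y)) = iexp (- (T * w * y)) * (LINT u|lborel. of_real (g u) * iexp ((T * y) * u))"
      by (simp only: integral_mult_right_zero)
    then show ?thesis using C[of "T * y"] by (simp add: norm_mult)
  qed
  have "cmod (LINT y|gaussN. LINT u|lborel. F (u, y)) \<le> (LINT y|gaussN. cmod (LINT u|lborel. F (u, y)))"
    by (rule integral_norm_bound)
  also have "\<dots> \<le> C"
    using P.integrable_snd[of "\<lambda>u y. F (u, y)"] int bd
    by (intro N.integral_le_const integrable_norm) auto
  finally have "\<bar>LINT u|lborel. exp (- (T * (u - w))\<^sup>2 / 2) * g u\<bar> \<le> C"
    unfolding eq[symmetric] by simp
  then show ?thesis unfolding E using T by (simp add: abs_mult mult_left_mono divide_right_mono)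
qed

section \<open>Laplace transforms of exponentials and powers\<close>

lemma FTC_Ici:
  fixes F f :: "real \<Rightarrow> complex"
  assumes der: "\<And>x. (F has_vector_derivative f x) (at x)" and cont: "\<And>x. isCont f x"
    and int: "set_integrable lborel {a..} f" and lim: "(F \<longlongrightarrow> L) at_top"
  shows "(LINT u:{a..}|lborel. f u) = L - F a"
proof -
  have int': "set_integrable lborel (einterval (ereal a) \<infinity>) f"
    unfolding einterval_eq_Ici using int by (rule set_integrable_subset) auto
  have cF: "isCont F x" for x using der has_vector_derivative_continuous by blast
  have A: "((F \<circ> real_of_ereal) \<longlongrightarrow> F a) (at_right (ereal a))"
    using cF[of a] by (simp add: ereal_tendsto_simps isCont_def filterlim_at_split)
  have B: "((F \<circ> real_of_ereal) \<longlongrightarrow> L) (at_left \<infinity>)"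
    using lim by (simp add: ereal_tendsto_simps)
  have "(LBINT x=ereal a..\<infinity>. f x) = L - F a"
    by (rule interval_integral_FTC_integrable[OF _ der cont int' A B]) auto
  then have "(LINT x:{a<..}|lborel. f x) = L - F a" by (simp add: interval_integral_to_infinity_eq)
  moreover have "(LINT x:{a<..}|lborel. f x) = (LINT x:{a..}|lborel. f x)"
    unfolding set_lebesgue_integral_def
  proof (rule integral_cong_AE)
    have m: "(\<lambda>x. indicator {a..} x *\<^sub>R f x) \<in> borel_measurable lborel"
      using int unfolding set_integrable_def by auto
    then show "(\<lambda>x. indicator {a..} x *\<^sub>R f x) \<in> borel_measurable lborel" .
    show "(\<lambda>x. indicator {a<..} x *\<^sub>R f x) \<in> borel_measurable lborel"
      using int' unfolding set_integrable_def einterval_eq_Ici by auto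
    show "AE x in lborel. indicator {a<..} x *\<^sub>R f x = indicator {a..} x *\<^sub>R f x"
      using AE_lborel_singleton[of a] by eventually_elim (auto simp: indicator_def)
  qed
  ultimately show ?thesis by simp
qed

lemma exp_integral_real:
  fixes a c :: real
  assumes "c > 0"
  shows "has_bochner_integral lborel (\<lambda>u. indicator {a..} u * exp (- c * u)) (exp (- c * a) / c)"
proof (rule has_bochner_integral_nn_integral)
  have "(\<integral>\<^sup>+x. ennreal (exp (- c * x)) * indicator {a ..} x \<partial>lborel) = 0 - (- exp (- c * a) / c)"
  proof (rule nn_integral_FTC_atLeast)
    show "DERIV (\<lambda>x. - exp (- c * x) / c) x :> exp (- c * x)" for x
      using assms by (auto intro!: derivative_eq_intros)
    show "((\<lambda>x. - exp (- c * x) / c) \<longlongrightarrow> 0) at_top" using assms by real_asymp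
  qed auto
  moreover have "ennreal (exp (- c * x)) * indicator {a ..} x = ennreal (indicator {a..} x * exp (- c * x))" for x
    by (auto simp: indicator_def)
  ultimately show "(\<integral>\<^sup>+x. ennreal (indicator {a..} x * exp (- c * x)) \<partial>lborel) = ennreal (exp (- c * a) / c)"
    by simp
qed (use assms in auto)

text \<open>A single term of the exponential series lets half of the exponent absorb the power; this
  yields integrability and decay at infinity at once.\<close>

lemma power_exp_le:
  assumes "c > 0" "u \<ge> (0::real)"
  shows "u ^ k * exp (- c * u) \<le> (fact k * (2 / c) ^ k) * exp (- (c / 2) * u)"
proof -
  have "(c / 2 * u) ^ k / fact k \<le> exp (c / 2 * u)"
  proof -
    have s: "(\<lambda>n. x ^ n / fact n) sums exp x" for x :: real
      using exp_converges[of x] by (simp add: divide_inverse mult.commute)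
    have "(\<Sum>n\<in>{k}. (c / 2 * u) ^ n / fact n) \<le> (\<Sum>n. (c / 2 * u) ^ n / fact n)"
      using assms by (intro sum_le_suminf sums_summable[OF s]) auto
    then show ?thesis using sums_unique[OF s[of "c / 2 * u"]] by simp
  qed
  then have "u ^ k \<le> (fact k * (2 / c) ^ k) * exp (c / 2 * u)"
    using assms by (simp add: field_simps power_mult_distrib)
  then have "u ^ k * exp (- c * u) \<le> (fact k * (2 / c) ^ k) * exp (c / 2 * u) * exp (- c * u)"
    by (intro mult_right_mono) auto
  also have "\<dots> = (fact k * (2 / c) ^ k) * exp (- (c / 2) * u)"
    by (simp add: mult.assoc flip: exp_add)
  finally show ?thesis .
qed

lemma power_exp_integrable:
  assumes "Re z > 0"
  shows "set_integrable lborel {0..} (\<lambda>u. of_real u ^ k * exp (- z * of_real u))"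
  unfolding set_integrable_def
proof (rule Bochner_Integration.integrable_bound)
  show "integrable lborel (\<lambda>u. (fact k * (2 / Re z) ^ k) * (indicator {0..} u * exp (- (Re z / 2) * u)))"
    using exp_integral_real[of "Re z / 2" 0] assms by (intro integrable_mult_right) (auto simp: has_bochner_integral_iff)
  show "AE u in lborel. norm (indicator {0..} u *\<^sub>R (of_real u ^ k * exp (- z * of_real u))) \<le> norm ((fact k * (2 / Re z) ^ k) * (indicator {0..} u * exp (- (Re z / 2) * u)))"
  proof (rule AE_I2)
    fix u :: real
    show "norm (indicator {0..} u *\<^sub>R (of_real u ^ k * exp (- z * of_real u))) \<le> norm ((fact k * (2 / Re z) ^ k) * (indicator {0..} u * exp (- (Re z / 2) * u)))"
      using power_exp_le[OF assms, of u k] assms by (cases "u \<ge> 0") (auto simp: norm_mult norm_power)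
  qed
qed measurable

lemma power_exp_tendsto_0:
  assumes "Re z > 0"
  shows "((\<lambda>u. of_real u ^ k * exp (- z * of_real u)) \<longlongrightarrow> 0) at_top"
proof (rule tendsto_norm_zero_cancel, rule Lim_null_comparison)
  show "((\<lambda>u. (fact k * (2 / Re z) ^ k) * exp (- (Re z / 2) * u)) \<longlongrightarrow> 0) at_top"
  proof -
    have "((\<lambda>u. exp (- (Re z / 2) * u)) \<longlongrightarrow> 0) at_top" using assms by real_asymp
    then show ?thesis using tendsto_mult_right_zero by blast
  qed
  show "\<forall>\<^sub>F u in at_top. norm (norm (of_real u ^ k * exp (- z * of_real u))) \<le> (fact k * (2 / Re z) ^ k) * exp (- (Re z / 2) * u)"
    using eventually_ge_at_top[of 0] by eventually_elim (use power_exp_le[OF assms] in \<open>auto simp: norm_mult norm_power\<close>)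
qed

lemma exp_vector_derivative:
  fixes z :: complex
  shows "((\<lambda>u. exp (- z * of_real u)) has_vector_derivative (- z * exp (- z * of_real u))) (at u)"
  by (rule has_vector_derivative_real_field) (auto intro!: derivative_eq_intros)

lemma power_exp_integral:
  assumes "Re z > 0"
  shows "(LINT u:{0..}|lborel. of_real u ^ k * exp (- z * of_real u)) = fact k / z ^ Suc k"
proof (induction k)
  have z0: "z \<noteq> 0" using assms by auto
  case 0
  have "(LINT u:{0..}|lborel. exp (- z * of_real u)) = 0 - (- 1 / z * exp (- z * of_real 0))"
  proof (rule FTC_Ici)
    show "((\<lambda>u. - 1 / z * exp (- z * of_real u)) has_vector_derivative exp (- z * of_real x)) (at x)" for x
      using has_vector_derivative_mult_right[OF exp_vector_derivative[of z x], of "-1/z"] z0 by simp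
    show "set_integrable lborel {0..} (\<lambda>u. exp (- z * of_real u))" using power_exp_integrable[OF assms, of 0] by simp
    show "((\<lambda>u. - 1 / z * exp (- z * of_real u)) \<longlongrightarrow> 0) at_top"
      using tendsto_mult_right_zero[OF power_exp_tendsto_0[OF assms, of 0], of "-1/z"] by simp
  qed (auto intro!: continuous_intros)
  then show ?case by simp
next
  have z0: "z \<noteq> 0" using assms by auto
  case (Suc k)
  let ?f = "\<lambda>k u. of_real u ^ k * exp (- z * of_real u)"
  let ?g = "\<lambda>u. ?f (Suc k) u - of_nat (Suc k) / z * ?f k u"
  have int: "set_integrable lborel {0..} (?f (Suc k))" "set_integrable lborel {0..} (\<lambda>u. of_nat (Suc k) / z * ?f k u)"
    by (intro power_exp_integrable[OF assms] set_integrable_mult_right)+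
  have "(LINT u:{0..}|lborel. ?g u) = 0 - (- 1 / z * ?f (Suc k) 0)"
  proof (rule FTC_Ici)
    show "((\<lambda>u. - 1 / z * ?f (Suc k) u) has_vector_derivative ?g x) (at x)" for x
    proof -
      have "((\<lambda>w. - 1 / z * (w ^ Suc k * exp (- z * w))) has_field_derivative ?g x) (at (of_real x))"
      proof -
        have p: "((\<lambda>w. w ^ Suc k) has_field_derivative of_nat (Suc k) * of_real x ^ k) (at (of_real x :: complex))"
          using DERIV_power[OF DERIV_ident, of "Suc k" "of_real x :: complex" UNIV] by simp
        have e: "((\<lambda>w. exp (- z * w)) has_field_derivative exp (- z * of_real x) * (- z)) (at (of_real x))"
          by (auto intro!: derivative_eq_intros)
        show ?thesis by (rule DERIV_cong[OF DERIV_cmult[OF DERIV_mult[OF p e], of "-1/z"]]) (use z0 in \<open>simp add: field_simps\<close>)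
      qed
      then show ?thesis by (rule has_vector_derivative_real_field)
    qed
    show "((\<lambda>u. - 1 / z * ?f (Suc k) u) \<longlongrightarrow> 0) at_top"
      by (rule tendsto_mult_right_zero[OF power_exp_tendsto_0[OF assms]])
    show "set_integrable lborel {0..} ?g" using int by (rule set_integral_diff)
  qed (use z0 in \<open>auto intro!: continuous_intros\<close>)
  also have "(LINT u:{0..}|lborel. ?g u) = (LINT u:{0..}|lborel. ?f (Suc k) u) - of_nat (Suc k) / z * (LINT u:{0..}|lborel. ?f k u)"
    using set_integral_diff(2)[OF int] z0 by simp
  finally have "(LINT u:{0..}|lborel. ?f (Suc k) u) = of_nat (Suc k) / z * (fact k / z ^ Suc k)"
    unfolding Suc.IH by simp
  then show ?case by (simp add: mult_ac)
qed

lemma exp_integral_complex: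
  assumes "Re s > 0"
  shows "has_bochner_integral lborel (\<lambda>u. indicator {a..} u *\<^sub>R exp (- s * of_real u)) (exp (- s * of_real a) / s)"
proof -
  have z0: "s \<noteq> 0" using assms by auto
  have int: "set_integrable lborel {a..} (\<lambda>u. exp (- s * of_real u))"
    unfolding set_integrable_def
  proof (rule Bochner_Integration.integrable_bound)
    show "integrable lborel (\<lambda>u. indicator {a..} u * exp (- Re s * u))"
      using exp_integral_real[OF assms] by (auto simp: has_bochner_integral_iff)
  qed (auto simp: indicator_def)
  have "(LINT u:{a..}|lborel. exp (- s * of_real u)) = 0 - (- 1 / s * exp (- s * of_real a))"
  proof (rule FTC_Ici[OF _ _ int])
    show "((\<lambda>u. - 1 / s * exp (- s * of_real u)) has_vector_derivative exp (- s * of_real x)) (at x)" for x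
      using has_vector_derivative_mult_right[OF exp_vector_derivative[of s x], of "-1/s"] z0 by simp
    show "((\<lambda>u. - 1 / s * exp (- s * of_real u)) \<longlongrightarrow> 0) at_top"
      using tendsto_mult_right_zero[OF power_exp_tendsto_0[OF assms, of 0], of "-1/s"] by simp
  qed (auto intro!: continuous_intros)
  then show ?thesis using int by (simp add: has_bochner_integral_iff set_integrable_def set_lebesgue_integral_def)
qed

text \<open>The value is \<open>\<integral>\<^sub>0\<^sup>u v\<^sup>3 e\<^sup>v dv\<close>, whose Laplace transform is the polar part \<open>6 / ((s - 1)\<^sup>4 s)\<close>.\<close>

definition main_sum :: "real \<Rightarrow> real" where
  "main_sum u = (if u < 0 then 0 else exp u * (u ^ 3 - 3 * u ^ 2 + 6 * u - 6) + 6)"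

lemma main_sum_laplace:
  assumes "Re s > 1"
  shows "has_bochner_integral lborel (\<lambda>u. of_real (main_sum u) * exp (- s * of_real u)) (6 / ((s - 1) ^ 4 * s))"
proof -
  define z where "z = s - 1"
  have z: "Re z > 0" and s0: "Re s > 0" using assms by (auto simp: z_def)
  have nz: "z \<noteq> 0" "s \<noteq> 0" using z s0 by auto
  let ?f = "\<lambda>z k u. indicator {0..} u *\<^sub>R (of_real u ^ k * exp (- z * of_real u))"
  have hb: "has_bochner_integral lborel (?f z k) (fact k / z ^ Suc k)" if "Re z > 0" for k z
    using power_exp_integrable[OF that, of k] power_exp_integral[OF that, of k]
    by (simp add: has_bochner_integral_iff set_integrable_def set_lebesgue_integral_def)
  have "has_bochner_integral lborel (\<lambda>u. ?f z 3 u - 3 * ?f z 2 u + 6 * ?f z 1 u - 6 * ?f z 0 u + 6 * ?f s 0 u)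
      (fact 3 / z ^ Suc 3 - 3 * (fact 2 / z ^ Suc 2) + 6 * (fact 1 / z ^ Suc 1) - 6 * (fact 0 / z ^ Suc 0) + 6 * (fact 0 / s ^ Suc 0))"
    by (intro has_bochner_integral_add has_bochner_integral_diff has_bochner_integral_mult_right hb z s0)
  moreover have "?f z 3 u - 3 * ?f z 2 u + 6 * ?f z 1 u - 6 * ?f z 0 u + 6 * ?f s 0 u = of_real (main_sum u) * exp (- s * of_real u)" for u
  proof (cases "u < 0")
    case False
    have "exp (- z * of_real u) = exp (of_real u) * exp (- s * of_real u)" by (simp add: z_def algebra_simps flip: exp_add)
    with False show ?thesis by (simp add: main_sum_def algebra_simps flip: exp_of_real)
  qed (simp add: main_sum_def)
  moreover have "fact 3 / z ^ Suc 3 - 3 * (fact 2 / z ^ Suc 2) + 6 * (fact 1 / z ^ Suc 1) - 6 * (fact 0 / z ^ Suc 0) + 6 * (fact 0 / s ^ Suc 0) = 6 / (z ^ 4 * s)"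
  proof -
    have s: "s = z + 1" by (simp add: z_def)
    \<comment> \<open>With \<open>w = 1 / z\<close> one has \<open>w * s = 1 + w\<close>, so
      multiplying the alternating sum by \<open>s\<close> makes it telescope to
      \<open>6 * w ^ 4 - 6\<close>.\<close>
    define w where "w = 1 / z"
    have ws: "w * s = 1 + w" using nz(1) by (simp add: w_def s add_divide_distrib)
    have "(6 * w ^ 4 - 6 * w ^ 3 + 6 * w ^ 2 - 6 * w) * s
        = 6 * (w ^ 3 * (w * s)) - 6 * (w ^ 2 * (w * s)) + 6 * (w * (w * s)) - 6 * (w * s)"
      by (simp add: algebra_simps eval_nat_numeral)
    also have "\<dots> = 6 * w ^ 4 - 6" unfolding ws by (simp add: algebra_simps eval_nat_numeral)
    finally have "6 * w ^ 4 - 6 * w ^ 3 + 6 * w ^ 2 - 6 * w = (6 * w ^ 4 - 6) / s"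
      using nz(2) by (simp add: nonzero_eq_divide_eq)
    moreover have "fact 3 / z ^ Suc 3 - 3 * (fact 2 / z ^ Suc 2) + 6 * (fact 1 / z ^ Suc 1) - 6 * (fact 0 / z ^ Suc 0)
        = 6 * w ^ 4 - 6 * w ^ 3 + 6 * w ^ 2 - 6 * w"
      by (simp add: w_def fact_numeral power_one_over eval_nat_numeral)
    ultimately show ?thesis by (simp add: w_def power_one_over diff_divide_distrib)
  qed
  ultimately show ?thesis by (simp add: z_def)
qed

section \<open>The weighted sum over prime powers and its Laplace transform\<close>

context real_char
begin

definition bcoef :: "nat \<Rightarrow> real" where "bcoef n = acoef n * ln (real n) ^ 3"

lemma bcoef_nonneg: "bcoef n \<ge> 0" unfolding bcoef_def using acoef_nonneg ln_nat_nonneg by simp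

definition bsum :: "real \<Rightarrow> real" where "bsum u = (\<Sum>n | real n \<le> exp u. bcoef n)"

lemma finite_nat_le: "finite {n. real n \<le> x}"
  by (rule finite_subset[of _ "{..nat \<lfloor>x\<rfloor>}"]) (auto simp: le_nat_floor)

lemma bsum_mono: "u \<le> v \<Longrightarrow> bsum u \<le> bsum v"
  unfolding bsum_def by (intro sum_mono2 finite_nat_le) (auto simp: bcoef_nonneg intro: order_trans)

lemma bsum_nonneg: "bsum u \<ge> 0" unfolding bsum_def by (intro sum_nonneg bcoef_nonneg)

lemma bsum_measurable [measurable]: "bsum \<in> borel_measurable borel"
  by (rule borel_measurable_mono) (auto simp: mono_def bsum_mono)

lemma bcoef_0 [simp]: "bcoef 0 = 0" by (simp add: bcoef_def)


text \<open>A superposition of steps at \<open>ln n\<close>, the form in which the transform can be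
  taken termwise. The convention \<open>ln 0 = 0\<close> would put the step of index 0 at the
  origin, but \<open>bcoef 0 = 0\<close>.\<close>

lemma bsum_sums: "(\<lambda>n. bcoef n * indicator {ln (real n)..} u) sums bsum u"
proof -
  have "(\<lambda>n. bcoef n * indicator {ln (real n)..} u) sums (\<Sum>n | real n \<le> exp u. bcoef n * indicator {ln (real n)..} u)"
  proof (rule sums_finite[OF finite_nat_le])
    fix n assume "n \<notin> {n. real n \<le> exp u}"
    then have "exp u < real n" by simp
    moreover from this have "real n > 0" using exp_gt_zero[of u] by linarith
    ultimately have "ln (exp u) < ln (real n)" using ln_less_cancel_iff[of "exp u" "real n"] by simp
    then have "u < ln (real n)" by simp
    then show "bcoef n * indicator {ln (real n)..} u = 0" by simp
  qed
  also have "(\<Sum>n | real n \<le> exp u. bcoef n * indicator {ln (real n)..} u) = bsum u"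
    unfolding bsum_def
  proof (rule sum.cong)
    fix n assume "n \<in> {n. real n \<le> exp u}"
    then show "bcoef n * indicator {ln (real n)..} u = bcoef n"
      using ln_le_cancel_iff[of "real n" "exp u"] by (cases "n = 0") (auto simp: indicator_def)
  qed simp
  finally show ?thesis .
qed

lemma bsum_le: "bsum u \<le> 2 * u ^ 4 * exp u"
proof (cases "u \<ge> 0")
  case True
  have "bsum u = (\<Sum>n | 0 < n \<and> real n \<le> exp u. bcoef n)"
    unfolding bsum_def by (rule sum.mono_neutral_right[OF finite_nat_le]) (auto intro!: gr0I)
  also have "\<dots> \<le> (\<Sum>n | 0 < n \<and> real n \<le> exp u. 2 * u ^ 4)"
  proof (rule sum_mono)
    fix n assume "n \<in> {n. 0 < n \<and> real n \<le> exp u}"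
    then have n: "n > 0" "ln (real n) \<le> u" using ln_le_cancel_iff[of "real n" "exp u"] by auto
    have "bcoef n \<le> 2 * ln (real n) * ln (real n) ^ 3" unfolding bcoef_def using acoef_le ln_nat_nonneg by (intro mult_right_mono) auto
    also have "\<dots> = 2 * ln (real n) ^ 4" by (simp add: eval_nat_numeral)
    also have "\<dots> \<le> 2 * u ^ 4" using n ln_nat_nonneg by (intro mult_left_mono power_mono) auto
    finally show "bcoef n \<le> 2 * u ^ 4" .
  qed
  also have "\<dots> = real (card {n. 0 < n \<and> real n \<le> exp u}) * (2 * u ^ 4)" by simp
  also have "\<dots> \<le> exp u * (2 * u ^ 4)"
  proof (rule mult_right_mono)
    have "{n. 0 < n \<and> real n \<le> exp u} \<subseteq> {1..nat \<lfloor>exp u\<rfloor>}" by (auto simp: le_nat_floor)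
    then have "card {n. 0 < n \<and> real n \<le> exp u} \<le> nat \<lfloor>exp u\<rfloor>" using card_mono[of "{1..nat \<lfloor>exp u\<rfloor>}"] by fastforce
    then show "real (card {n. 0 < n \<and> real n \<le> exp u}) \<le> exp u" 
      using of_nat_floor[of "exp u"] by (simp add: order_trans[OF of_nat_mono])
  qed simp
  finally show ?thesis by (simp add: mult_ac)
next
  case False
  then have "exp u < 1" by simp
  then have "bsum u = 0" unfolding bsum_def by (intro sum.neutral) (auto dest: order_le_less_trans)
  then show ?thesis by simp
qed

text \<open>The step at \<open>ln n\<close> has transform \<open>n powr (-s) / s\<close>; sum and
  integral are exchanged by absolute convergence right of 1.\<close>

lemma bsum_laplace:
  assumes "Re s > 1"
  shows "has_bochner_integral lborel (\<lambda>u. of_real (bsum u) * exp (- s * of_real u)) (dir_series bcoef s / s)"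
proof -
  have s0: "Re s > 0" using assms by simp
  let ?f = "\<lambda>n u. of_real (bcoef n) * (indicator {ln (real n)..} u *\<^sub>R exp (- s * of_real u))"
  have hb: "has_bochner_integral lborel (?f n) (of_real (bcoef n) * (exp (- s * of_real (ln (real n))) / s))" for n
    by (intro has_bochner_integral_mult_right exp_integral_complex s0)
  have val: "of_real (bcoef n) * (exp (- s * of_real (ln (real n))) / s) = of_real (bcoef n) * of_nat n powr (-s) / s" for n
    by (cases "n = 0") (auto simp: nat_powr_exp)
  have dsum: "dir_summable bcoef" unfolding bcoef_def[abs_def] by (rule dir_summable_ln_pow[OF dir_summable_acoef])
  have int: "integrable lborel (?f n)" for n using hb[of n] by (simp add: has_bochner_integral_iff)
  have eqS: "of_real (bsum u) * exp (- s * of_real u) = (\<Sum>n. ?f n u)" for u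
  proof -
    have "(\<lambda>n. of_real (bcoef n * indicator {ln (real n)..} u) * exp (- s * of_real u)) sums (of_real (bsum u) * exp (- s * of_real u))"
      by (intro sums_mult2 sums_of_real bsum_sums)
    moreover have "of_real (bcoef n * indicator {ln (real n)..} u) * exp (- s * of_real u) = ?f n u" for n
      by (simp add: scaleR_conv_of_real)
    ultimately show ?thesis by (simp add: sums_iff)
  qed
  have ae: "AE u in lborel. summable (\<lambda>n. norm (?f n u))"
  proof (rule AE_I2)
    fix u
    have "summable (\<lambda>n. bcoef n * indicator {ln (real n)..} u * exp (- Re s * u))"
      using bsum_sums[of u] by (intro summable_mult2) (auto simp: sums_iff)
    then show "summable (\<lambda>n. norm (?f n u))"
      by (rule summable_cong[THEN iffD1, rotated]) (auto simp: norm_mult bcoef_nonneg indicator_def)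
  qed
  have su: "summable (\<lambda>n. LINT u|lborel. norm (?f n u))"
  proof -
    have "(LINT u|lborel. norm (?f n u)) = \<bar>bcoef n\<bar> * real n powr (- Re s) * (1 / Re s)" for n
    proof -
      have "norm (?f n u) = bcoef n * (indicator {ln (real n)..} u * exp (- Re s * u))" for u
        by (simp add: norm_mult bcoef_nonneg indicator_def)
      then have "(LINT u|lborel. norm (?f n u)) = bcoef n * (exp (- Re s * ln (real n)) / Re s)"
        using exp_integral_real[OF s0, of "ln (real n)"] by (simp only: integral_mult_right_zero has_bochner_integral_iff)
      then show ?thesis by (cases "n = 0") (auto simp: powr_def bcoef_nonneg)
    qed
    moreover have "summable (\<lambda>n. \<bar>bcoef n\<bar> * real n powr (- Re s) * (1 / Re s))"
      using dsum assms by (intro summable_mult2) (auto simp: dir_summable_def)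
    ultimately show ?thesis by simp
  qed
  have "integrable lborel (\<lambda>u. \<Sum>n. ?f n u)" "(LINT u|lborel. (\<Sum>n. ?f n u)) = (\<Sum>n. LINT u|lborel. ?f n u)"
    by (rule integrable_suminf[OF int ae su], rule integral_suminf[OF int ae su])
  moreover have "(\<Sum>n. LINT u|lborel. ?f n u) = dir_series bcoef s / s"
  proof -
    have "(LINT u|lborel. ?f n u) = of_real (bcoef n) * of_nat n powr (-s) / s" for n
      using hb[of n] by (simp only: has_bochner_integral_iff val)
    then show ?thesis using sums_divide[OF dir_series_sums[OF dsum assms], of s] by (simp add: sums_iff)
  qed
  ultimately show ?thesis by (simp only: eqS has_bochner_integral_iff)
qed

text \<open>The transform is taken on \<open>Re s = 1 + \<delta>\<close>. The constant does not
  depend on \<open>\<delta>\<close> because \<open>F3_bound\<close> is uniform up to the line, so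
  \<open>\<delta>\<close> may later shrink with the height \<open>w\<close>.\<close>

theorem bsum_smooth:
  "\<exists>C>0. \<forall>\<delta> T w. 0 < \<delta> \<longrightarrow> \<delta> \<le> 1 \<longrightarrow> T > 0 \<longrightarrow>
     \<bar>LINT y|gaussN. (\<lambda>u. (bsum u - main_sum u) * exp (- (1 + \<delta>) * u)) (w + y / T)\<bar> \<le> C * T"
proof -
  obtain C where C: "C > 0" "\<And>s. 1 < Re s \<Longrightarrow> Re s \<le> 2 \<Longrightarrow> cmod (dir_series bcoef s - 6 / (s - 1) ^ 4) \<le> C * cmod s"
    using F3_bound unfolding bcoef_def[abs_def] by auto
  have "\<bar>LINT y|gaussN. (\<lambda>u. (bsum u - main_sum u) * exp (- (1 + \<delta>) * u)) (w + y / T)\<bar> \<le> (1 / sqrt (2 * pi) * C) * T"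
    if d: "0 < \<delta>" "\<delta> \<le> 1" "T > 0" for \<delta> T w
  proof -
    let ?g = "\<lambda>u. (bsum u - main_sum u) * exp (- (1 + \<delta>) * u)"
    have hb: "has_bochner_integral lborel (\<lambda>u. of_real (?g u) * iexp (t * u)) ((dir_series bcoef s - 6 / (s - 1) ^ 4) / s)"
      if s: "s = Complex (1 + \<delta>) (- t)" for t s
    proof -
      have "Re s > 1" using s d by simp
      then have "has_bochner_integral lborel (\<lambda>u. of_real (bsum u) * exp (- s * of_real u) - of_real (main_sum u) * exp (- s * of_real u))
        (dir_series bcoef s / s - 6 / ((s - 1) ^ 4 * s))"
        by (intro has_bochner_integral_diff bsum_laplace main_sum_laplace)
      moreover have "of_real (bsum u) * exp (- s * of_real u) - of_real (main_sum u) * exp (- s * of_real u) = of_real (?g u) * iexp (t * u)" for u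
      proof -
        have "exp (- s * of_real u) = of_real (exp (- (1 + \<delta>) * u)) * iexp (t * u)"
          unfolding s by (simp add: Complex_eq algebra_simps flip: exp_of_real exp_add)
        then show ?thesis by (simp add: algebra_simps)
      qed
      ultimately show ?thesis by (simp add: diff_divide_distrib)
    qed
    have "integrable lborel (\<lambda>u. complex_of_real (?g u))"
      using hb[of "Complex (1 + \<delta>) (- 0)" 0] by (simp add: has_bochner_integral_iff)
    then have "integrable lborel (\<lambda>u. Re (complex_of_real (?g u)))" by (rule integrable_Re)
    then have gi: "integrable lborel ?g" by simp
    have "cmod (LINT u|lborel. of_real (?g u) * iexp (t * u)) \<le> C" for t
    proof -
      let ?s = "Complex (1 + \<delta>) (- t)"
      have s: "1 < Re ?s" "Re ?s \<le> 2" using d by auto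
      have s0: "cmod ?s > 0" using s abs_Re_le_cmod[of ?s] by linarith
      have "(LINT u|lborel. of_real (?g u) * iexp (t * u)) = (dir_series bcoef ?s - 6 / (?s - 1) ^ 4) / ?s"
        using hb[OF refl, of t] by (simp only: has_bochner_integral_iff)
      also have "cmod \<dots> \<le> C" using C(2)[OF s] s0 by (simp only: norm_divide) (simp add: divide_le_eq)
      finally show ?thesis .
    qed
    from gaussian_smoothing_bound[OF gi d(3) this, of w] show ?thesis by (simp add: mult_ac)
  qed
  moreover have "1 / sqrt (2 * pi) * C > 0" using C(1) by simp
  ultimately show ?thesis by blast
qed

end

section \<open>The Tauberian step\<close>

lemma gaussN_moments: "(LINT y|gaussN. y\<^sup>2) = 1" "(LINT y|gaussN. y ^ 4) = 3"
  "integrable gaussN (\<lambda>y. y\<^sup>2)" "integrable gaussN (\<lambda>y. y ^ 4)"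
  using std_normal_distribution_even_moments[of 1] std_normal_distribution_even_moments[of 2]
  by (simp_all add: fact_numeral)

lemma exp_minus_le_quadratic: "u \<ge> 0 \<Longrightarrow> exp (-u) \<le> 1 - u + u\<^sup>2 / 2" for u :: real
proof -
  assume u: "u \<ge> 0"
  have "1 + u + u\<^sup>2 / 2 \<le> exp u" using u by (rule exp_lower_Taylor_quadratic)
  moreover have "0 < 1 + u + u\<^sup>2 / 2" using u by (simp add: add_pos_nonneg)
  ultimately have "exp (-u) \<le> 1 / (1 + u + u\<^sup>2 / 2)" by (simp add: exp_minus inverse_eq_divide frac_le)
  also have "\<dots> \<le> 1 - u + u\<^sup>2 / 2"
  proof -
    have "(1 - u + u\<^sup>2 / 2) * (1 + u + u\<^sup>2 / 2) = 1 + (u\<^sup>2)\<^sup>2 / 4"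
      by (simp add: power2_eq_square algebra_simps)
    then have "1 \<le> (1 - u + u\<^sup>2 / 2) * (1 + u + u\<^sup>2 / 2)" by simp
    then show ?thesis using \<open>0 < 1 + u + u\<^sup>2 / 2\<close> by (simp add: pos_divide_le_eq)
  qed
  finally show ?thesis .
qed

lemma main_sum_bounds:
  assumes "u \<ge> 0"
  shows "main_sum u * exp (-u) \<le> u ^ 3" "main_sum u * exp (-u) \<ge> u ^ 3 - 3 * u\<^sup>2"
proof -
  have eq: "main_sum u * exp (-u) = u ^ 3 - 3 * u\<^sup>2 + 6 * u - 6 + 6 * exp (-u)"
  proof -
    have e: "exp u * exp (-u) = 1" by (simp flip: exp_add)
    have "main_sum u * exp (-u) = (exp u * exp (-u)) * (u ^ 3 - 3 * u\<^sup>2 + 6 * u - 6) + 6 * exp (-u)"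
      using assms by (simp add: main_sum_def algebra_simps)
    then show ?thesis by (simp only: e) simp
  qed
  show "main_sum u * exp (-u) \<le> u ^ 3" unfolding eq using exp_minus_le_quadratic[OF assms] by simp
  show "main_sum u * exp (-u) \<ge> u ^ 3 - 3 * u\<^sup>2" unfolding eq using exp_ge_add_one_self[of "-u"] by simp
qed

lemma abs_le_one_plus_pow4: "\<bar>y\<bar> \<le> 1 + y ^ 4" "y\<^sup>2 \<le> 1 + y ^ 4" "\<bar>y\<bar> ^ 3 \<le> 1 + y ^ 4" for y :: real
proof -
  have *: "\<bar>y\<bar> ^ k \<le> 1 + y ^ 4" if "k \<le> 4" for k
  proof (cases "\<bar>y\<bar> \<le> 1")
    case True
    then have "\<bar>y\<bar> ^ k \<le> 1" by (simp add: power_le_one)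
    then show ?thesis by (simp add: add_increasing2)
  next
    case False
    then have "\<bar>y\<bar> ^ k \<le> \<bar>y\<bar> ^ 4" using that by (intro power_increasing) auto
    then show ?thesis by (simp add: power_even_abs)
  qed
  show "\<bar>y\<bar> \<le> 1 + y ^ 4" "y\<^sup>2 \<le> 1 + y ^ 4" "\<bar>y\<bar> ^ 3 \<le> 1 + y ^ 4"
    using *[of 1] *[of 2] *[of 3] by auto
qed

lemma square_sum_lin: "- 6 * r - 6 * (1 + t) \<le> - 3 * a" if "a \<le> 2 * (r + b)" "b \<le> c" "c \<le> 1 + t" for a b c r t :: real
  using that by simp

lemma main_sum_measurable [measurable]: "main_sum \<in> borel_measurable borel"
  unfolding main_sum_def[abs_def] by measurable

context real_char
begin

context
  fixes w :: real
  assumes w: "w \<ge> 30"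
begin

text \<open>At height \<open>w\<close>, the smoothing has width \<open>1/T\<close>, which is negligible against the shift \<open>h\<close> of the
  monotonicity argument, and \<open>d\<close> keeps the Laplace transforms convergent while \<open>e\<^bsup>-d w\<^esup> = 1 + O(h)\<close>.\<close>

private definition "T = w\<^sup>2"
private definition "h = 1 / w"
private definition "d = 1 / w\<^sup>2"
private definition "gS = (\<lambda>u. bsum u * exp (- (1 + d) * u))"
private definition "gM = (\<lambda>u. main_sum u * exp (- (1 + d) * u))"

private lemma params: "T > 0" "T \<ge> 1" "h > 0" "h \<le> 1" "d > 0" "d \<le> 1" "h * T = w" "d * w = h"
proof -
  have w0: "w > 0" "w \<ge> 1" using w by auto
  then show "T > 0" "h > 0" "d > 0" "h * T = w" "d * w = h" by (auto simp: T_def h_def d_def power2_eq_square)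
  show "T \<ge> 1" unfolding T_def using w0 by (simp add: one_le_power)
  then show "h \<le> 1" "d \<le> 1" using w0 by (auto simp: h_def d_def T_def)
qed

private lemma gS_nonneg: "gS u \<ge> 0" unfolding gS_def using bsum_nonneg by simp

private lemma shift_abs: "\<bar>y / T\<bar> \<le> \<bar>y\<bar>"
proof -
  have "\<bar>y\<bar> / T \<le> \<bar>y\<bar> / 1" using params by (intro divide_left_mono) auto
  then show ?thesis using params by simp
qed

text \<open>A trivial estimate, but polynomial in \<open>u\<close>: it makes \<open>gS\<close>
  integrable against the Gaussian and lets a fourth moment control what lies outside the
  window.\<close>

private lemma gS_le: "gS u \<le> 2 * u ^ 4"
proof (cases "u \<ge> 0")
  case True
  have "gS u \<le> 2 * u ^ 4 * exp u * exp (- (1 + d) * u)" unfolding gS_def by (intro mult_right_mono bsum_le) auto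
  also have "\<dots> = 2 * u ^ 4 * exp (- (d * u))" by (simp add: algebra_simps flip: exp_add)
  also have "\<dots> \<le> 2 * u ^ 4 * 1" using True params by (intro mult_left_mono) auto
  finally show ?thesis by simp
next
  case False
  then have "exp u < 1" by simp
  then have "bsum u = 0" unfolding bsum_def by (intro sum.neutral) (auto dest: order_le_less_trans)
  then show ?thesis by (simp add: gS_def)
qed

private lemma pow4_sum: "(w + y / T) ^ 4 \<le> 8 * (w ^ 4 + y ^ 4)"
proof -
  have "(a + b) ^ 4 \<le> 8 * (a ^ 4 + b ^ 4)" for a b :: real
  proof -
    have 2: "(a + b)\<^sup>2 \<le> 2 * (a\<^sup>2 + b\<^sup>2)" for a b :: real
      using zero_le_power2[of "a - b"] by (simp add: power2_eq_square algebra_simps)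
    have "((a + b)\<^sup>2)\<^sup>2 \<le> (2 * (a\<^sup>2 + b\<^sup>2))\<^sup>2" by (intro power_mono 2) auto
    also have "\<dots> = 4 * (a\<^sup>2 + b\<^sup>2)\<^sup>2" by (simp only: power_mult_distrib) simp
    also have "\<dots> \<le> 4 * (2 * ((a\<^sup>2)\<^sup>2 + (b\<^sup>2)\<^sup>2))" using 2[of "a\<^sup>2" "b\<^sup>2"] by simp
    finally show ?thesis by (simp flip: power_mult)
  qed
  from this[of w "y / T"] have "(w + y / T) ^ 4 \<le> 8 * (w ^ 4 + (y / T) ^ 4)" .
  also have "(y / T) ^ 4 \<le> y ^ 4" using power_mono[OF shift_abs[of y], of 4] by (simp add: power_even_abs_numeral del: abs_divide)
  finally show ?thesis by simp
qed

private lemma gM_bounds: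
  assumes "u \<ge> 0"
  shows "gM u \<le> u ^ 3" "gM u \<ge> exp (- (d * u)) * (u ^ 3 - 3 * u\<^sup>2)"
proof -
  have eq: "gM u = exp (- (d * u)) * (main_sum u * exp (- u))" by (simp add: gM_def algebra_simps flip: exp_add)
  have "gM u \<le> exp (- (d * u)) * u ^ 3" unfolding eq by (intro mult_left_mono main_sum_bounds assms) auto
  also have "\<dots> \<le> 1 * u ^ 3" using assms params by (intro mult_right_mono) auto
  finally show "gM u \<le> u ^ 3" by simp
  show "gM u \<ge> exp (- (d * u)) * (u ^ 3 - 3 * u\<^sup>2)" unfolding eq by (intro mult_left_mono main_sum_bounds assms) auto
qed

private lemma gM_lower: "gM u \<ge> - 3 * u\<^sup>2"
proof (cases "u \<ge> 0")
  case True
  have "exp (- (d * u)) * (3 * u\<^sup>2) \<le> 1 * (3 * u\<^sup>2)" using True params by (intro mult_right_mono) auto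
  then have "- 3 * u\<^sup>2 \<le> exp (- (d * u)) * (- 3 * u\<^sup>2)" by (simp add: algebra_simps)
  also have "\<dots> \<le> exp (- (d * u)) * (u ^ 3 - 3 * u\<^sup>2)" using True by (intro mult_left_mono) auto
  also have "\<dots> \<le> gM u" by (rule gM_bounds[OF True])
  finally show ?thesis .
qed (simp add: gM_def main_sum_def)

text \<open>A shift by \<open>a = \<bar>y\<bar> / w^2\<close> changes \<open>w ^ 3\<close> by
  \<open>3 * \<bar>y\<bar>\<close> to leading order, so smoothing costs only a bounded amount on
  average. The constant is \<open>7 = 3 + 3 + 1\<close>, from the remaining terms of the
  cube.\<close>

private lemma gM_upper: "gM (w + y / T) \<le> w ^ 3 + 7 * (1 + y ^ 4)"
proof (cases "w + y / T \<ge> 0")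
  case True
  define a where "a = \<bar>y\<bar> / T"
  have a: "a \<ge> 0" "a \<le> \<bar>y\<bar>" "a * w\<^sup>2 = \<bar>y\<bar>" "w * a \<le> \<bar>y\<bar>"
  proof -
    show "a \<ge> 0" "a \<le> \<bar>y\<bar>" using params shift_abs[of y] by (auto simp: a_def)
    show "a * w\<^sup>2 = \<bar>y\<bar>" using params by (simp add: a_def T_def)
    have "w * a \<le> w\<^sup>2 * a" using w \<open>a \<ge> 0\<close> by (intro mult_right_mono) (auto simp: power2_eq_square)
    then show "w * a \<le> \<bar>y\<bar>" using \<open>a * w\<^sup>2 = \<bar>y\<bar>\<close> by (simp add: mult.commute)
  qed
  have "gM (w + y / T) \<le> (w + y / T) ^ 3" by (rule gM_bounds[OF True])
  also have "\<dots> \<le> (w + a) ^ 3" using True params by (intro power_mono) (auto simp: a_def divide_right_mono)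
  also have "\<dots> = w ^ 3 + 3 * (a * w\<^sup>2) + 3 * ((w * a) * a) + a ^ 3" by (simp add: power2_eq_square power3_eq_cube algebra_simps)
  also have "\<dots> \<le> w ^ 3 + 3 * \<bar>y\<bar> + 3 * (\<bar>y\<bar> * \<bar>y\<bar>) + \<bar>y\<bar> ^ 3"
    using a w by (intro add_mono mult_left_mono mult_mono power_mono) auto
  also have "\<dots> \<le> w ^ 3 + 7 * (1 + y ^ 4)"
    using abs_le_one_plus_pow4[of y] by (simp add: power2_eq_square)
  finally show ?thesis .
next
  case False
  then have "gM (w + y / T) = 0" by (simp add: gM_def main_sum_def)
  then show ?thesis using w by (simp add: add_nonneg_nonneg)
qed

private lemma integrable_poly: "integrable gaussN (\<lambda>y. c * (1 + y ^ 4))"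
proof -
  interpret prob_space gaussN by (rule prob_space_gaussN)
  show ?thesis using gaussN_moments by auto
qed

private lemma integrable_g: "integrable gaussN (\<lambda>y. gS (w + y / T))" "integrable gaussN (\<lambda>y. gM (w + y / T))"
proof -
  have m [measurable]: "gS \<in> borel_measurable borel" "gM \<in> borel_measurable borel"
    unfolding gS_def gM_def by measurable
  show "integrable gaussN (\<lambda>y. gS (w + y / T))"
  proof (rule Bochner_Integration.integrable_bound[OF integrable_poly[of "16 * (w ^ 4 + 1)"]])
    show "AE y in gaussN. norm (gS (w + y / T)) \<le> norm (16 * (w ^ 4 + 1) * (1 + y ^ 4))"
    proof (rule AE_I2)
      fix y
      have "gS (w + y / T) \<le> 2 * (w + y / T) ^ 4" by (rule gS_le)
      also have "\<dots> \<le> 2 * (8 * (w ^ 4 + y ^ 4))" using pow4_sum[of y] by linarith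
      also have "\<dots> \<le> 16 * (w ^ 4 + 1) * (1 + y ^ 4)" by (simp add: algebra_simps)
      finally have "gS (w + y / T) \<le> 16 * (w ^ 4 + 1) * (1 + y ^ 4)" .
      then show "norm (gS (w + y / T)) \<le> norm (16 * (w ^ 4 + 1) * (1 + y ^ 4))" using gS_nonneg[of "w + y / T"] by simp
    qed
  qed measurable
  show "integrable gaussN (\<lambda>y. gM (w + y / T))"
  proof (rule Bochner_Integration.integrable_bound[OF integrable_poly[of "w ^ 3 + 6 * w\<^sup>2 + 7"]])
    show "AE y in gaussN. norm (gM (w + y / T)) \<le> norm ((w ^ 3 + 6 * w\<^sup>2 + 7) * (1 + y ^ 4))"
    proof (rule AE_I2)
      fix y :: real
      have w0: "0 \<le> w ^ 3" "0 \<le> w\<^sup>2" using w by auto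
      have y4: "0 \<le> y ^ 4" by simp
      define P Q R Y where "P = w ^ 3 * y ^ 4" and "Q = w\<^sup>2 * y ^ 4" and "R = w\<^sup>2" and "Y = y ^ 4"
      have pr: "0 \<le> P" "0 \<le> Q" "0 \<le> R" "0 \<le> Y" unfolding P_def Q_def R_def Y_def using w0 y4 by (auto intro!: mult_nonneg_nonneg simp del: zero_le_mult_iff)
      have ex: "(w ^ 3 + 6 * w\<^sup>2 + 7) * (1 + y ^ 4) = w ^ 3 + 6 * R + 7 + P + 6 * Q + 7 * Y"
        by (simp add: P_def Q_def R_def Y_def algebra_simps)
      have 1: "gM (w + y / T) \<le> (w ^ 3 + 6 * w\<^sup>2 + 7) * (1 + y ^ 4)"
        
      proof -
        have "w ^ 3 + 7 * (1 + Y) \<le> w ^ 3 + 6 * R + 7 + P + 6 * Q + 7 * Y" using pr by simp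
        then show ?thesis unfolding ex using gM_upper[of y] unfolding Y_def[symmetric] by (rule order_trans[rotated])
      qed
      have "(a + b)\<^sup>2 \<le> 2 * (a\<^sup>2 + b\<^sup>2)" for a b :: real
        using zero_le_power2[of "a - b"] by (simp add: power2_eq_square algebra_simps)
      from this[of w "y / T"] have q1: "(w + y / T)\<^sup>2 \<le> 2 * (w\<^sup>2 + (y / T)\<^sup>2)" .
      have q2: "(y / T)\<^sup>2 \<le> y\<^sup>2" using power_mono[OF shift_abs[of y], of 2] by (simp del: abs_divide)
      have "- 3 * (w + y / T)\<^sup>2 \<ge> - 6 * R - 6 * (1 + Y)"
        unfolding R_def Y_def by (rule square_sum_lin[OF q1 q2 abs_le_one_plus_pow4(2)])
      then have 2: "- gM (w + y / T) \<le> (w ^ 3 + 6 * w\<^sup>2 + 7) * (1 + y ^ 4)"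
        unfolding ex using gM_lower[of "w + y / T"] w0(1) pr by argo
      have "0 \<le> (w ^ 3 + 6 * w\<^sup>2 + 7) * (1 + y ^ 4)" using w0 y4 by (intro mult_nonneg_nonneg) auto
      with 1 2 show "norm (gM (w + y / T)) \<le> norm ((w ^ 3 + 6 * w\<^sup>2 + 7) * (1 + y ^ 4))" by simp
    qed
  qed measurable
qed

private lemma E_gS_gM:
  assumes "\<And>\<delta> T w. 0 < \<delta> \<Longrightarrow> \<delta> \<le> 1 \<Longrightarrow> T > 0 \<Longrightarrow>
     \<bar>LINT y|gaussN. (\<lambda>u. (bsum u - main_sum u) * exp (- (1 + \<delta>) * u)) (w + y / T)\<bar> \<le> C * T"
  shows "\<bar>(LINT y|gaussN. gS (w + y / T)) - (LINT y|gaussN. gM (w + y / T))\<bar> \<le> C * w\<^sup>2"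
proof -
  have "(LINT y|gaussN. gS (w + y / T)) - (LINT y|gaussN. gM (w + y / T)) =
      (LINT y|gaussN. (\<lambda>u. (bsum u - main_sum u) * exp (- (1 + d) * u)) (w + y / T))"
    unfolding Bochner_Integration.integral_diff[OF integrable_g, symmetric]
    by (simp add: gS_def gM_def algebra_simps)
  then show ?thesis using assms[of d T w] params by (simp add: T_def)
qed

private lemma window:
  assumes "\<bar>y\<bar> \<le> w"
  shows "w - h \<le> w + y / T" "w + y / T \<le> w + h"
proof -
  have "\<bar>y\<bar> / T \<le> w / T" using assms params by (intro divide_right_mono) auto
  also have "w / T = h" using w by (simp add: T_def h_def power2_eq_square)
  finally have "\<bar>y / T\<bar> \<le> h" using params by simp
  then show "w - h \<le> w + y / T" "w + y / T \<le> w + h" by linarith+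
qed

text \<open>The parabola \<open>1 - y^2 / w^2\<close> lies below the indicator of the window
  \<open>\<bar>y\<bar> \<le> w\<close> and has an explicit mean; it replaces a tail
  estimate.\<close>

private lemma E_quadratic: "(LINT y|gaussN. A * (1 - y\<^sup>2 / w\<^sup>2) - B * y\<^sup>2) = A * (1 - 1 / w\<^sup>2) - B"
  "integrable gaussN (\<lambda>y. A * (1 - y\<^sup>2 / w\<^sup>2) - B * y\<^sup>2)"
proof -
  interpret prob_space gaussN by (rule prob_space_gaussN)
  have u: "prob UNIV = 1" using prob_space by simp
  show "integrable gaussN (\<lambda>y. A * (1 - y\<^sup>2 / w\<^sup>2) - B * y\<^sup>2)" using gaussN_moments by auto
  show "(LINT y|gaussN. A * (1 - y\<^sup>2 / w\<^sup>2) - B * y\<^sup>2) = A * (1 - 1 / w\<^sup>2) - B"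
    using gaussN_moments u by (subst Bochner_Integration.integral_diff) (auto simp: algebra_simps)
qed

text \<open>Inside the window the sample point stays within \<open>h\<close> of \<open>w\<close>, so
  monotonicity bounds \<open>bsum\<close> from below by its value at \<open>w - h\<close>; outside,
  the parabola is not positive. The constant is \<open>28 = 7 * (1 + 3)\<close>, with 3 the fourth
  moment.\<close>

lemma tauber_upper:
  assumes "\<And>\<delta> T w. 0 < \<delta> \<Longrightarrow> \<delta> \<le> 1 \<Longrightarrow> T > 0 \<Longrightarrow>
     \<bar>LINT y|gaussN. (\<lambda>u. (bsum u - main_sum u) * exp (- (1 + \<delta>) * u)) (w + y / T)\<bar> \<le> C * T"
  shows "bsum (w - 1/w) * exp (- (1 + 1 / w\<^sup>2) * (w + 1/w)) * (1 - 1 / w\<^sup>2) \<le> w ^ 3 + 28 + C * w\<^sup>2"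
proof -
  interpret N: prob_space gaussN by (rule prob_space_gaussN)
  define c0 where "c0 = bsum (w - h) * exp (- (1 + d) * (w + h))"
  have c0: "c0 \<ge> 0" unfolding c0_def using bsum_nonneg by simp
  have pt: "c0 * (1 - y\<^sup>2 / w\<^sup>2) - 0 * y\<^sup>2 \<le> gS (w + y / T)" for y
  proof (cases "\<bar>y\<bar> \<le> w")
    case True
    have "c0 * (1 - y\<^sup>2 / w\<^sup>2) \<le> c0 * 1" using c0 by (intro mult_left_mono) auto
    also have "\<dots> \<le> gS (w + y / T)" unfolding c0_def gS_def mult_1_right
      using window[OF True] params bsum_nonneg by (intro mult_mono bsum_mono) auto
    finally show ?thesis by simp
  next
    case False
    then have "w\<^sup>2 < y\<^sup>2" using w abs_le_square_iff[of y w] by simp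
    then have "1 - y\<^sup>2 / w\<^sup>2 \<le> 0" using w by simp
    then have "c0 * (1 - y\<^sup>2 / w\<^sup>2) \<le> 0" using c0 by (rule mult_nonneg_nonpos[rotated])
    then show ?thesis using gS_nonneg[of "w + y / T"] by simp
  qed
  have "c0 * (1 - 1 / w\<^sup>2) - 0 \<le> (LINT y|gaussN. gS (w + y / T))"
    unfolding E_quadratic(1)[symmetric] using pt by (intro integral_mono E_quadratic(2) integrable_g) auto
  also have "\<dots> \<le> (LINT y|gaussN. gM (w + y / T)) + C * w\<^sup>2" using E_gS_gM[OF assms] by linarith
  also have "(LINT y|gaussN. gM (w + y / T)) \<le> (LINT y|gaussN. w ^ 3 + 7 * (1 + y ^ 4))"
    using gaussN_moments by (intro integral_mono integrable_g gM_upper) auto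
  also have "(LINT y|gaussN. w ^ 3 + 7 * (1 + y ^ 4)) = w ^ 3 + 28"
  proof -
    have u: "N.prob UNIV = 1" using N.prob_space by simp
    show ?thesis using gaussN_moments u by (simp add: algebra_simps)
  qed
  finally show ?thesis by (simp add: c0_def h_def d_def)
qed

text \<open>The mirror image, with pointwise bounds on the tails: for
  \<open>\<bar>y\<bar> > w\<close> the sample point has modulus at most
  \<open>2 * \<bar>y\<bar>\<close>, so \<open>gS\<close> is at most \<open>32 * y ^ 4\<close> and
  \<open>gM\<close> at least \<open>- 12 * y^2\<close>. Their means 96 and 12 add up to 108.\<close>

lemma tauber_lower:
  assumes "\<And>\<delta> T w. 0 < \<delta> \<Longrightarrow> \<delta> \<le> 1 \<Longrightarrow> T > 0 \<Longrightarrow>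
     \<bar>LINT y|gaussN. (\<lambda>u. (bsum u - main_sum u) * exp (- (1 + \<delta>) * u)) (w + y / T)\<bar> \<le> C * T"
  shows "bsum (w + 1/w) * exp (- (1 + 1 / w\<^sup>2) * (w - 1/w)) \<ge> (w ^ 3 - 20 * w\<^sup>2) * (1 - 1 / w\<^sup>2) - 108 - C * w\<^sup>2"
proof -
  interpret N: prob_space gaussN by (rule prob_space_gaussN)
  define c1 where "c1 = bsum (w + h) * exp (- (1 + d) * (w - h))"
  have c1: "c1 \<ge> 0" unfolding c1_def using bsum_nonneg by simp
  define A where "A = w ^ 3 - 20 * w\<^sup>2"
  have A: "A \<ge> 0" unfolding A_def using w by (simp add: power2_eq_square power3_eq_cube)
  have up: "gS (w + y / T) \<le> c1 + 32 * y ^ 4" for y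
  proof (cases "\<bar>y\<bar> \<le> w")
    case True
    have "gS (w + y / T) \<le> c1" unfolding c1_def gS_def
      using window[OF True] params bsum_nonneg by (intro mult_mono bsum_mono) auto
    then show ?thesis by (simp add: add_increasing2)
  next
    case False
    have "\<bar>w + y / T\<bar> \<le> 2 * \<bar>y\<bar>" using False shift_abs[of y] w by linarith
    then have "\<bar>w + y / T\<bar> ^ 4 \<le> (2 * \<bar>y\<bar>) ^ 4" by (intro power_mono) auto
    then have "(w + y / T) ^ 4 \<le> 16 * y ^ 4" by (simp add: power_even_abs power_mult_distrib)
    then show ?thesis using gS_le[of "w + y / T"] c1 by linarith
  qed
  have low: "A * (1 - y\<^sup>2 / w\<^sup>2) - 12 * y\<^sup>2 \<le> gM (w + y / T)" for y
  proof (cases "\<bar>y\<bar> \<le> w")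
    case True
    define u where "u = w + y / T"
    have u: "w - h \<le> u" "u \<le> w + h" using window[OF True] by (auto simp: u_def)
    have h30: "h \<le> 1/30" using w by (simp add: h_def field_simps)
    have u29: "u \<ge> 29" using u h30 w by linarith
    \<comment> \<open>\<open>1 - (h + h / 30)\<close> is a lower bound for the damping factor
      \<open>exp (- (d * u))\<close>. The losses \<open>4 * w^2\<close> from the cubic,
      \<open>(31/30) * w^2\<close> from the damping and \<open>2 * w\<close> all fit into the
      \<open>20 * w^2\<close> in \<open>A\<close>.\<close>
    have "A \<le> (1 - (h + h / 30)) * (u ^ 3 - 3 * u\<^sup>2)"
    proof -
      have "(w - h) ^ 2 * (w - h - 3) \<le> u ^ 2 * (u - 3)"
        using u u29 w h30 by (intro mult_mono power_mono) auto
      also have "\<dots> = u ^ 3 - 3 * u\<^sup>2" by (simp add: power2_eq_square power3_eq_cube algebra_simps)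
      finally have 1: "(w - h) ^ 2 * (w - h - 3) \<le> u ^ 3 - 3 * u\<^sup>2" .
      have wh: "w * h = 1" using w by (simp add: h_def)
      have "(w - h) ^ 2 * (w - h - 3) \<ge> (w\<^sup>2 - 2) * (w - 4)"
      proof (intro mult_mono)
        have "(w - h)\<^sup>2 = w\<^sup>2 - 2 * (w * h) + h\<^sup>2" by (simp add: power2_eq_square algebra_simps)
        then show "w\<^sup>2 - 2 \<le> (w - h)\<^sup>2" by (simp add: wh)
      qed (use w h30 in auto)
      then have 2: "(w\<^sup>2 - 2) * (w - 4) \<le> u ^ 3 - 3 * u\<^sup>2" using 1 by linarith
      have "A \<le> (1 - (h + h / 30)) * ((w\<^sup>2 - 2) * (w - 4))"
      proof -
        have "(w\<^sup>2 - 2) * (w - 4) = w ^ 3 - 4 * w\<^sup>2 - 2 * w + 8" by (simp add: power2_eq_square power3_eq_cube algebra_simps)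
        moreover have "(h + h / 30) * ((w\<^sup>2 - 2) * (w - 4)) \<le> (h + h / 30) * w ^ 3"
        proof -
          have "8 - 2 * w \<le> 4 * w\<^sup>2" using w zero_le_power2[of w] by linarith
          then show ?thesis unfolding calculation using params by (intro mult_left_mono) linarith+
        qed
        moreover have "(h + h / 30) * w ^ 3 = (31 / 30) * w\<^sup>2"
        proof -
          have "h * w ^ 3 = w\<^sup>2" using w by (simp add: h_def power2_eq_square power3_eq_cube)
          then show ?thesis by (simp add: algebra_simps)
        qed
        moreover have "w \<le> w\<^sup>2" using w by (simp add: power2_eq_square)
        moreover have "(1 - (h + h / 30)) * ((w\<^sup>2 - 2) * (w - 4)) = (w\<^sup>2 - 2) * (w - 4) - (h + h / 30) * ((w\<^sup>2 - 2) * (w - 4))"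
          by (simp only: left_diff_distrib mult_1)
        ultimately show ?thesis unfolding A_def using zero_le_power2[of w] by linarith
      qed
      also have "\<dots> \<le> (1 - (h + h / 30)) * (u ^ 3 - 3 * u\<^sup>2)" using 2 h30 by (intro mult_left_mono) auto
      finally show ?thesis .
    qed
    also have "\<dots> \<le> exp (- (d * u)) * (u ^ 3 - 3 * u\<^sup>2)"
    proof (rule mult_right_mono)
      have "d * u \<le> d * (w + h)" using u params by (intro mult_left_mono) auto
      also have "\<dots> = h + d * h" using params by (simp add: algebra_simps)
      also have "d * h \<le> (1/30) * h"
      proof (rule mult_right_mono)
        have "d = h * h" by (simp add: d_def h_def power2_eq_square)
        also have "\<dots> \<le> (1/30) * 1" using h30 params by (intro mult_mono) auto
        finally show "d \<le> 1/30" by simp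
      qed (use params in auto)
      finally have "1 - (h + h / 30) \<le> 1 - d * u" by simp
      also have "\<dots> \<le> exp (- (d * u))" using exp_ge_add_one_self[of "- (d * u)"] by simp
      finally show "1 - (h + h / 30) \<le> exp (- (d * u))" .
      have "0 \<le> u ^ 2 * (u - 3)" using u29 by simp
      then show "0 \<le> u ^ 3 - 3 * u\<^sup>2" by (simp add: power2_eq_square power3_eq_cube algebra_simps)
    qed
    also have "\<dots> \<le> gM u" using u29 by (intro gM_bounds) auto
    finally have "A \<le> gM u" .
    moreover have "A * (1 - y\<^sup>2 / w\<^sup>2) \<le> A * 1" using A by (intro mult_left_mono) auto
    ultimately show ?thesis unfolding u_def using zero_le_power2[of y] by linarith
  next
    case False
    then have "w\<^sup>2 < y\<^sup>2" using w abs_le_square_iff[of y w] by simp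
    then have "1 - y\<^sup>2 / w\<^sup>2 \<le> 0" using w by simp
    then have 1: "A * (1 - y\<^sup>2 / w\<^sup>2) \<le> 0" using A by (rule mult_nonneg_nonpos[rotated])
    have "\<bar>w + y / T\<bar> \<le> 2 * \<bar>y\<bar>" using False shift_abs[of y] w by linarith
    then have "\<bar>w + y / T\<bar> ^ 2 \<le> (2 * \<bar>y\<bar>) ^ 2" by (intro power_mono) auto
    then have "(w + y / T)\<^sup>2 \<le> 4 * y\<^sup>2" by (simp add: power_mult_distrib)
    with 1 show ?thesis using gM_lower[of "w + y / T"] by linarith
  qed
  have "A * (1 - 1 / w\<^sup>2) - 12 \<le> (LINT y|gaussN. gM (w + y / T))"
    unfolding E_quadratic(1)[symmetric] using low by (intro integral_mono E_quadratic(2) integrable_g) auto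
  also have "\<dots> \<le> (LINT y|gaussN. gS (w + y / T)) + C * w\<^sup>2" using E_gS_gM[OF assms] by linarith
  also have "(LINT y|gaussN. gS (w + y / T)) \<le> (LINT y|gaussN. c1 + 32 * y ^ 4)"
    using gaussN_moments by (intro integral_mono integrable_g up) auto
  also have "(LINT y|gaussN. c1 + 32 * y ^ 4) = c1 + 96"
  proof -
    have u: "N.prob UNIV = 1" using N.prob_space by simp
    show ?thesis using gaussN_moments u by simp
  qed
  finally show ?thesis by (simp add: c1_def h_def d_def A_def)
qed

end

text \<open>The smoothed estimate at \<open>w\<close> concerns \<open>bsum\<close> at
  \<open>w - 1/w\<close> or \<open>w + 1/w\<close>. Choosing \<open>w = v + 2/v\<close> for the
  upper and \<open>w = v - 2/v\<close> for the lower bound puts that point on the required side of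
  \<open>v\<close>; a shift of this size changes \<open>v ^ 3 * exp v\<close> by a factor
  \<open>1 + O(1/v)\<close> only.\<close>

theorem bsum_asymp: "(\<lambda>v. bsum v - v ^ 3 * exp v) \<in> O(\<lambda>v. v\<^sup>2 * exp v)"
proof -
  obtain C where C: "C > 0" "\<And>\<delta> T w. 0 < \<delta> \<Longrightarrow> \<delta> \<le> 1 \<Longrightarrow> T > 0 \<Longrightarrow>
     \<bar>LINT y|gaussN. (\<lambda>u. (bsum u - main_sum u) * exp (- (1 + \<delta>) * u)) (w + y / T)\<bar> \<le> C * T"
    using bsum_smooth by blast
  define U where "U = (\<lambda>v. let w = v + 2 / v in exp ((1 + 1 / w\<^sup>2) * (w + 1/w)) * (w ^ 3 + 28 + C * w\<^sup>2) / (1 - 1 / w\<^sup>2))"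
  define D where "D = (\<lambda>v. let w = v - 2 / v in exp ((1 + 1 / w\<^sup>2) * (w - 1/w)) * ((w ^ 3 - 20 * w\<^sup>2) * (1 - 1 / w\<^sup>2) - 108 - C * w\<^sup>2))"
  have U: "(\<lambda>v. U v - v ^ 3 * exp v) \<in> O(\<lambda>v. v\<^sup>2 * exp v)"
    unfolding U_def Let_def using C(1) by real_asymp
  have D: "(\<lambda>v. D v - v ^ 3 * exp v) \<in> O(\<lambda>v. v\<^sup>2 * exp v)"
    unfolding D_def Let_def using C(1) by real_asymp
  have bu: "bsum v \<le> U v" if v: "v \<ge> 30" for v
  proof -
    define w where "w = v + 2 / v"
    have "w \<ge> v" using v by (simp add: w_def)
    then have w: "w \<ge> 30" using v by simp
    have "1 / w \<le> 1 / v" using \<open>w \<ge> v\<close> v by (intro divide_left_mono) auto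
    also have "\<dots> \<le> 2 / v" using v by (intro divide_right_mono) auto
    finally have vw: "v \<le> w - 1 / w" by (simp add: w_def)
    have w2: "1 - 1 / w\<^sup>2 > 0" using w one_less_power[of w 2] by simp
    have e: "exp (- (1 + 1 / w\<^sup>2) * (w + 1/w)) = 1 / exp ((1 + 1 / w\<^sup>2) * (w + 1/w))"
      by (simp only: minus_mult_left[symmetric] exp_minus inverse_eq_divide)
    have "bsum (w - 1/w) * exp (- (1 + 1 / w\<^sup>2) * (w + 1/w)) * (1 - 1 / w\<^sup>2) \<le> w ^ 3 + 28 + C * w\<^sup>2"
      by (rule tauber_upper[OF w C(2)])
    then have "bsum (w - 1/w) \<le> exp ((1 + 1 / w\<^sup>2) * (w + 1/w)) * (w ^ 3 + 28 + C * w\<^sup>2) / (1 - 1 / w\<^sup>2)"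
      unfolding e pos_le_divide_eq[OF w2] by (simp add: field_simps)
    moreover have "bsum v \<le> bsum (w - 1/w)" by (rule bsum_mono[OF vw])
    ultimately show ?thesis unfolding U_def Let_def w_def[symmetric] by linarith
  qed
  have bl: "bsum v \<ge> D v" if v: "v \<ge> 31" for v
  proof -
    define w where "w = v - 2 / v"
    have "2 / v \<le> 1" using v by simp
    then have w: "w \<ge> 30" "w \<ge> v / 2" using v unfolding w_def by linarith+
    have "1 / w \<le> 1 / (v / 2)" using w v by (intro divide_left_mono) auto
    then have vw: "w + 1 / w \<le> v" by (simp add: w_def)
    have e: "exp (- (1 + 1 / w\<^sup>2) * (w - 1/w)) = 1 / exp ((1 + 1 / w\<^sup>2) * (w - 1/w))"
      by (simp only: minus_mult_left[symmetric] exp_minus inverse_eq_divide)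
    have "bsum (w + 1/w) * exp (- (1 + 1 / w\<^sup>2) * (w - 1/w)) \<ge> (w ^ 3 - 20 * w\<^sup>2) * (1 - 1 / w\<^sup>2) - 108 - C * w\<^sup>2"
      by (rule tauber_lower[OF w(1) C(2)])
    then have "bsum (w + 1/w) \<ge> exp ((1 + 1 / w\<^sup>2) * (w - 1/w)) * ((w ^ 3 - 20 * w\<^sup>2) * (1 - 1 / w\<^sup>2) - 108 - C * w\<^sup>2)"
      unfolding e by (simp add: pos_le_divide_eq mult.commute)
    moreover have "bsum (w + 1/w) \<le> bsum v" by (rule bsum_mono[OF vw])
    ultimately show ?thesis unfolding D_def Let_def w_def[symmetric] by linarith
  qed
  have "(\<lambda>v. \<bar>U v - v ^ 3 * exp v\<bar> + \<bar>D v - v ^ 3 * exp v\<bar>) \<in> O(\<lambda>v. v\<^sup>2 * exp v)"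
    using U D by (intro sum_in_bigo) auto
  moreover have "(\<lambda>v. bsum v - v ^ 3 * exp v) \<in> O(\<lambda>v. \<bar>U v - v ^ 3 * exp v\<bar> + \<bar>D v - v ^ 3 * exp v\<bar>)"
  proof (rule bigoI[where c = 1])
    show "\<forall>\<^sub>F v in at_top. norm (bsum v - v ^ 3 * exp v) \<le> 1 * norm (\<bar>U v - v ^ 3 * exp v\<bar> + \<bar>D v - v ^ 3 * exp v\<bar>)"
      using eventually_ge_at_top[of 31]
    proof eventually_elim
      case (elim v)
      then show ?case using bu[of v] bl[of v] by (simp add: abs_le_iff) linarith
    qed
  qed
  ultimately show ?thesis by (rule landau_o.big_trans[rotated])
qed

end

section \<open>Counting split primes\<close>

context real_char
begin

lemma ch_add_mult: "ch (n + k * M) = ch n"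
proof (induction k)
  case (Suc k)
  have eq: "n + Suc k * M = (n + k * M) + M" by simp
  show ?case unfolding eq using Suc periodic[of "n + k * M"] by (simp only:)
qed simp

lemma ch_mod: "ch (n mod M) = ch n"
  using ch_add_mult[of "n mod M" "n div M"] by (simp add: mod_div_mult_eq)

text \<open>If \<open>p\<close> were coprime to \<open>M\<close>, a power of it would be congruent
  to 1, where \<open>ch\<close> is 1. So only finitely many primes are neither split nor
  inert.\<close>

lemma ch_zero_imp_dvd:
  assumes "prime p" "ch p = 0"
  shows "p dvd M"
proof (rule ccontr)
  assume "\<not> p dvd M"
  then have "coprime p M" using assms(1) by (simp add: prime_imp_coprime)
  then have "[p ^ totient M = 1] (mod M)" by (rule euler_theorem)
  then have "p ^ totient M mod M = 1 mod M" by (simp add: cong_def)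
  then have "ch (p ^ totient M) = ch 1" using ch_mod[of "p ^ totient M"] ch_mod[of 1] by simp
  moreover have "totient M > 0" using M_pos by simp
  ultimately show False using assms(2) one by (simp add: ch_power power_0_left)
qed

definition split_primes :: "real \<Rightarrow> nat set" where "split_primes x = {p. prime p \<and> ch p = 1 \<and> real p \<le> x}"

lemma finite_split_primes [simp]: "finite (split_primes x)"
  unfolding split_primes_def by (rule finite_subset[OF _ finite_nat_le[of x]]) auto

definition Qsum :: "real \<Rightarrow> real" where "Qsum x = (\<Sum>p\<in>split_primes x. ln (real p) ^ 4)"

lemma bcoef_prime: "prime p \<Longrightarrow> bcoef p = (1 + ch p) * ln (real p) ^ 4"
  by (simp add: bcoef_def acoef_def eval_nat_numeral)

lemma card_prime_powers:
  assumes "x \<ge> 1"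
  shows "real (card {n. primepow n \<and> \<not> prime n \<and> real n \<le> x}) \<le> (sqrt x + 1) * (log 2 x + 1)"
proof -
  let ?S = "{n. primepow n \<and> \<not> prime n \<and> real n \<le> x}"
  let ?T = "{..nat \<lfloor>sqrt x\<rfloor>} \<times> {..nat \<lfloor>log 2 x\<rfloor>}"
  have "?S \<subseteq> (\<lambda>(p,k). p ^ k) ` ?T"
  proof
    fix n assume "n \<in> ?S"
    then have n: "primepow n" "\<not> prime n" "real n \<le> x" by auto
    then obtain p k where pk: "prime p" "k > 0" "n = p ^ k" by (auto simp: primepow_def)
    have k2: "k \<ge> 2" using pk n(2) by (cases "k = 1") auto
    have p2: "p \<ge> 2" using pk(1) by (rule prime_ge_2_nat)
    have "p ^ 2 \<le> p ^ k" using k2 p2 by (intro power_increasing) auto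
    then have "real (p ^ 2) \<le> real (p ^ k)" by (simp only: of_nat_le_iff)
    then have "(real p)\<^sup>2 \<le> x" using n(3) pk(3) by simp
    then have "real p \<le> sqrt x" by (simp add: real_le_rsqrt)
    then have 1: "p \<le> nat \<lfloor>sqrt x\<rfloor>" by (rule le_nat_floor)
    have "2 ^ k \<le> p ^ k" using p2 by (intro power_mono) auto
    then have "real (2 ^ k) \<le> real (p ^ k)" by (simp only: of_nat_le_iff)
    then have "2 ^ k \<le> x" using n(3) pk(3) by simp
    then have "2 powr real k \<le> x" by (simp add: powr_realpow)
    then have "real k \<le> log 2 x" using assms by (subst le_log_iff) auto
    then have 2: "k \<le> nat \<lfloor>log 2 x\<rfloor>" by (rule le_nat_floor)
    show "n \<in> (\<lambda>(p,k). p ^ k) ` ?T" using 1 2 pk(3) by (intro image_eqI[of _ _ "(p,k)"]) auto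
  qed
  then have "card ?S \<le> card ?T" by (meson card_image_le card_mono finite_SigmaI finite_atMost finite_imageI le_trans)
  also have "\<dots> = (nat \<lfloor>sqrt x\<rfloor> + 1) * (nat \<lfloor>log 2 x\<rfloor> + 1)" by (simp add: card_cartesian_product)
  finally have "real (card ?S) \<le> (real (nat \<lfloor>sqrt x\<rfloor>) + 1) * (real (nat \<lfloor>log 2 x\<rfloor>) + 1)"
    by (simp flip: of_nat_le_iff[where 'a = real] add: algebra_simps)
  also have "\<dots> \<le> (sqrt x + 1) * (log 2 x + 1)"
    using assms of_nat_floor[of "sqrt x"] of_nat_floor[of "log 2 x"] by (intro mult_mono add_right_mono) auto
  finally show ?thesis .
qed

text \<open>The weight \<open>1 + ch p\<close> is 2 at split and 0 at inert primes. What remains are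
  at most \<open>M + 1\<close> primes with \<open>ch p = 0\<close> and the proper prime powers,
  about \<open>sqrt x * log x\<close> in number.\<close>

lemma bsum_Qsum:
  assumes "x \<ge> 1"
  shows "\<bar>bsum (ln x) - 2 * Qsum x\<bar> \<le> ln x ^ 4 * (real M + 1 + 2 * ((sqrt x + 1) * (log 2 x + 1)))"
proof -
  let ?N = "{n. real n \<le> x}"
  let ?S = "{n. primepow n \<and> \<not> prime n \<and> real n \<le> x}"
  let ?Z = "{p. prime p \<and> ch p = 0 \<and> real p \<le> x}"
  have fin: "finite ?N" by (rule finite_nat_le)
  have le: "ln (real n) ^ 4 \<le> ln x ^ 4" if "real n \<le> x" for n
  proof (cases "n = 0")
    case False
    then show ?thesis using that ln_nat_nonneg assms by (intro power_mono) auto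
  qed (use assms in simp)
  have "bsum (ln x) = (\<Sum>n\<in>?N. bcoef n)" using assms by (simp add: bsum_def)
  also have "\<dots> = (\<Sum>n\<in>split_primes x \<union> ?Z \<union> ?S. bcoef n)"
  proof (rule sum.mono_neutral_right[OF fin])
    show "split_primes x \<union> ?Z \<union> ?S \<subseteq> ?N" by (auto simp: split_primes_def)
    show "\<forall>n\<in>?N - (split_primes x \<union> ?Z \<union> ?S). bcoef n = 0"
    proof
      fix n assume n: "n \<in> ?N - (split_primes x \<union> ?Z \<union> ?S)"
      show "bcoef n = 0"
      proof (cases "prime n")
        case True
        then have "ch n \<noteq> 1" "ch n \<noteq> 0" using n by (auto simp: split_primes_def)
        then have "ch n = -1" using vals[of n] by auto
        then show ?thesis using True by (simp add: bcoef_prime)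
      next
        case False
        then have "\<not> primepow n" using n by auto
        then show ?thesis by (simp add: bcoef_def acoef_def mangoldt_def)
      qed
    qed
  qed
  also have "\<dots> = (\<Sum>n\<in>split_primes x. bcoef n) + (\<Sum>n\<in>?Z. bcoef n) + (\<Sum>n\<in>?S. bcoef n)"
  proof -
    have f: "finite (split_primes x)" "finite ?Z" "finite ?S"
      by (auto intro: finite_subset[OF _ fin])
    show ?thesis using f by (subst sum.union_disjoint sum.union_disjoint[of "split_primes x" ?Z]; auto simp: split_primes_def)+
  qed
  also have "(\<Sum>n\<in>split_primes x. bcoef n) = 2 * Qsum x"
    unfolding Qsum_def sum_distrib_left by (rule sum.cong) (auto simp: split_primes_def bcoef_prime)
  finally have eq: "bsum (ln x) - 2 * Qsum x = (\<Sum>n\<in>?Z. bcoef n) + (\<Sum>n\<in>?S. bcoef n)" by simp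
  have Z: "(\<Sum>n\<in>?Z. bcoef n) \<le> real (card ?Z) * ln x ^ 4"
    by (rule sum_bounded_above) (auto simp: bcoef_prime le)
  have "?Z \<subseteq> {..M}" using M_pos by (auto dest!: ch_zero_imp_dvd dvd_imp_le)
  then have "card ?Z \<le> M + 1" using card_mono[of "{..M}" ?Z] by simp
  then have "real (card ?Z) * ln x ^ 4 \<le> (real M + 1) * ln x ^ 4" by (intro mult_right_mono) auto
  with Z have Z': "(\<Sum>n\<in>?Z. bcoef n) \<le> (real M + 1) * ln x ^ 4" by linarith
  have "(\<Sum>n\<in>?S. bcoef n) \<le> real (card ?S) * (2 * ln x ^ 4)"
  proof (rule sum_bounded_above)
    fix n assume n: "n \<in> ?S"
    have "bcoef n \<le> 2 * ln (real n) * ln (real n) ^ 3" unfolding bcoef_def using acoef_le ln_nat_nonneg by (intro mult_right_mono) auto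
    also have "\<dots> = 2 * ln (real n) ^ 4" by (simp add: eval_nat_numeral)
    finally show "bcoef n \<le> 2 * ln x ^ 4" using le[of n] n by simp
  qed
  also have "\<dots> \<le> ((sqrt x + 1) * (log 2 x + 1)) * (2 * ln x ^ 4)"
    by (intro mult_right_mono card_prime_powers assms) auto
  finally have S': "(\<Sum>n\<in>?S. bcoef n) \<le> ((sqrt x + 1) * (log 2 x + 1)) * (2 * ln x ^ 4)" .
  have "0 \<le> bsum (ln x) - 2 * Qsum x" unfolding eq by (intro add_nonneg_nonneg sum_nonneg bcoef_nonneg)
  moreover have "bsum (ln x) - 2 * Qsum x \<le> (real M + 1) * ln x ^ 4 + ((sqrt x + 1) * (log 2 x + 1)) * (2 * ln x ^ 4)"
    unfolding eq using Z' S' by linarith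
  moreover have "(real M + 1) * ln x ^ 4 + ((sqrt x + 1) * (log 2 x + 1)) * (2 * ln x ^ 4) = ln x ^ 4 * (real M + 1 + 2 * ((sqrt x + 1) * (log 2 x + 1)))"
    by (simp only: distrib_left mult_ac)
  ultimately show ?thesis by simp
qed

lemma Qsum_asymp: "(\<lambda>x. Qsum x - x * ln x ^ 3 / 2) \<in> O(\<lambda>x. x * ln x ^ 2)"
proof -
  have ev: "\<forall>\<^sub>F x::real in at_top. exp (ln x) = x" using eventually_gt_at_top[of 0] by eventually_elim simp
  have "(\<lambda>x. bsum (ln x) - ln x ^ 3 * exp (ln x)) \<in> O(\<lambda>x. (ln x)\<^sup>2 * exp (ln x))"
    by (rule landau_o.big.compose[OF bsum_asymp ln_at_top])
  also have "O(\<lambda>x::real. (ln x)\<^sup>2 * exp (ln x)) = O(\<lambda>x. x * ln x ^ 2)"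
    by (rule landau_o.big.cong) (use ev in eventually_elim, simp)
  finally have 1: "(\<lambda>x. bsum (ln x) - x * ln x ^ 3) \<in> O(\<lambda>x. x * ln x ^ 2)"
    by (rule landau_o.big.in_cong[THEN iffD1, rotated]) (use ev in eventually_elim, simp)
  have "(\<lambda>x. bsum (ln x) - 2 * Qsum x) \<in> O(\<lambda>x. ln x ^ 4 * (real M + 1 + 2 * ((sqrt x + 1) * (log 2 x + 1))))"
  proof (rule bigoI[where c = 1])
    show "\<forall>\<^sub>F x in at_top. norm (bsum (ln x) - 2 * Qsum x) \<le> 1 * norm (ln x ^ 4 * (real M + 1 + 2 * ((sqrt x + 1) * (log 2 x + 1))))"
      using eventually_ge_at_top[of 1]
    proof eventually_elim
      case (elim x)
      show ?case using order_trans[OF bsum_Qsum[OF elim] abs_ge_self] by (simp only: real_norm_def mult_1)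
    qed
  qed
  also have "(\<lambda>x. ln x ^ 4 * (real M + 1 + 2 * ((sqrt x + 1) * (log 2 x + 1)))) \<in> O(\<lambda>x. x * ln x ^ 2)"
    by real_asymp
  finally have 2: "(\<lambda>x. bsum (ln x) - 2 * Qsum x) \<in> O(\<lambda>x. x * ln x ^ 2)" .
  have "(\<lambda>x. (bsum (ln x) - x * ln x ^ 3) - (bsum (ln x) - 2 * Qsum x)) \<in> O(\<lambda>x. x * ln x ^ 2)"
    by (rule sum_in_bigo(2)[OF 1 2])
  then have "(\<lambda>x. (1/2) * ((bsum (ln x) - x * ln x ^ 3) - (bsum (ln x) - 2 * Qsum x))) \<in> O(\<lambda>x. x * ln x ^ 2)"
    by (subst landau_o.big.cmult_in_iff) auto
  then show ?thesis by (simp add: algebra_simps)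
qed

text \<open>The weight \<open>ln p ^ 4\<close> is removed without partial summation: it is at most
  \<open>ln x ^ 4\<close>, and at least \<open>ln y ^ 4\<close> for primes beyond
  \<open>y = x / ln x ^ 2\<close>, the primes up to \<open>y\<close> being negligible. Since
  \<open>ln y\<close> differs from \<open>ln x\<close> by \<open>2 * ln (ln x)\<close>, this is the
  origin of the factor \<open>ln (ln x)\<close> in the error.\<close>

theorem split_primes_asymp:
  "(\<lambda>x. real (card (split_primes x)) - x / (2 * ln x)) \<in> O(\<lambda>x. x * ln (ln x) / ln x ^ 2)"
proof -
  obtain c where c: "c > 0" "\<forall>\<^sub>F x in at_top. norm (Qsum x - x * ln x ^ 3 / 2) \<le> c * norm (x * ln x ^ 2)"
    using Qsum_asymp by (auto simp: bigo_def)
  define L where "L = (\<lambda>x. (x * ln x ^ 3 / 2 - c * (x * ln x ^ 2)) / ln x ^ 4)"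
  define U where "U = (\<lambda>x. x / ln x ^ 2 + (x * ln x ^ 3 / 2 + c * (x * ln x ^ 2)) / ln (x / ln x ^ 2) ^ 4)"
  have L: "(\<lambda>x. L x - x / (2 * ln x)) \<in> O(\<lambda>x. x * ln (ln x) / ln x ^ 2)"
    unfolding L_def using c(1) by real_asymp
  have U: "(\<lambda>x. U x - x / (2 * ln x)) \<in> O(\<lambda>x. x * ln (ln x) / ln x ^ 2)"
    unfolding U_def using c(1) by real_asymp
  have "\<forall>\<^sub>F x::real in at_top. x / ln x ^ 2 > exp 1" "\<forall>\<^sub>F x::real in at_top. ln x > 1" by real_asymp+
  with c(2) eventually_gt_at_top[of 1]
  have ev: "\<forall>\<^sub>F x in at_top. L x \<le> real (card (split_primes x)) \<and> real (card (split_primes x)) \<le> U x"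
  proof eventually_elim
    case (elim x)
    have l0: "ln x > 0" using elim by simp
    define y where "y = x / ln x ^ 2"
    have y: "y > exp 1" "y \<le> x"
    proof -
      show "y > exp 1" using elim by (simp add: y_def)
      have "1 \<le> ln x ^ 2" using elim by (simp add: one_le_power)
      then show "y \<le> x" unfolding y_def using elim by (simp add: divide_le_eq mult_le_cancel_left1)
    qed
    have y0: "y > 0" using y(1) exp_gt_zero[of "1::real"] by linarith
    have "ln (exp 1) < ln y" using y(1) y0 by (subst ln_less_cancel_iff) auto
    then have ly: "ln y > 0" by simp
    have Q: "\<bar>Qsum x - x * ln x ^ 3 / 2\<bar> \<le> c * (x * ln x ^ 2)" using elim by (simp add: abs_mult)
    have "Qsum x \<le> real (card (split_primes x)) * ln x ^ 4"
      unfolding Qsum_def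
    proof (rule sum_bounded_above)
      fix p assume "p \<in> split_primes x"
      then have "0 < p" "real p \<le> x" by (auto simp: split_primes_def prime_gt_0_nat)
      then show "ln (real p) ^ 4 \<le> ln x ^ 4" using ln_nat_nonneg by (intro power_mono) auto
    qed
    then have "Qsum x / ln x ^ 4 \<le> real (card (split_primes x))" using l0 by (simp add: pos_divide_le_eq)
    moreover have "L x \<le> Qsum x / ln x ^ 4" unfolding L_def using Q l0 by (intro divide_right_mono) auto
    ultimately have 1: "L x \<le> real (card (split_primes x))" by linarith
    have "split_primes x = split_primes y \<union> {p \<in> split_primes x. y < real p}"
      using y(2) by (auto simp: split_primes_def)
    then have "card (split_primes x) \<le> card (split_primes y) + card {p \<in> split_primes x. y < real p}"
      by (metis card_Un_le)
    moreover have "real (card (split_primes y)) \<le> y"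
    proof -
      have "split_primes y \<subseteq> {1..nat \<lfloor>y\<rfloor>}" by (auto simp: split_primes_def le_nat_floor Suc_le_eq prime_gt_0_nat)
      then have "card (split_primes y) \<le> nat \<lfloor>y\<rfloor>" using card_mono[of "{1..nat \<lfloor>y\<rfloor>}"] by fastforce
      then have "real (card (split_primes y)) \<le> real (nat \<lfloor>y\<rfloor>)" by simp
      also have "\<dots> \<le> y" using y0 by (intro of_nat_floor) auto
      finally show ?thesis .
    qed
    moreover have "real (card {p \<in> split_primes x. y < real p}) \<le> Qsum x / ln y ^ 4"
    proof -
      have "real (card {p \<in> split_primes x. y < real p}) * ln y ^ 4 \<le> (\<Sum>p\<in>{p \<in> split_primes x. y < real p}. ln (real p) ^ 4)"
      proof (rule sum_bounded_below)
        fix p assume "p \<in> {p \<in> split_primes x. y < real p}"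
        then have "ln y \<le> ln (real p)" using y0 by simp
        then show "ln y ^ 4 \<le> ln (real p) ^ 4" using ly by (intro power_mono) auto
      qed
      also have "\<dots> \<le> Qsum x" unfolding Qsum_def by (intro sum_mono2) auto
      finally show ?thesis using ly by (simp add: pos_le_divide_eq)
    qed
    moreover have "Qsum x / ln y ^ 4 \<le> (x * ln x ^ 3 / 2 + c * (x * ln x ^ 2)) / ln y ^ 4"
      using Q ly by (intro divide_right_mono) auto
    ultimately have 2: "real (card (split_primes x)) \<le> U x" unfolding U_def y_def[symmetric] by linarith
    show ?case using 1 2 by simp
  qed
  have "(\<lambda>x. \<bar>U x - x / (2 * ln x)\<bar> + \<bar>L x - x / (2 * ln x)\<bar>) \<in> O(\<lambda>x. x * ln (ln x) / ln x ^ 2)"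
    using U L by (intro sum_in_bigo) auto
  moreover have "(\<lambda>x. real (card (split_primes x)) - x / (2 * ln x)) \<in> O(\<lambda>x. \<bar>U x - x / (2 * ln x)\<bar> + \<bar>L x - x / (2 * ln x)\<bar>)"
  proof (rule bigoI[where c = 1])
    show "\<forall>\<^sub>F x in at_top. norm (real (card (split_primes x)) - x / (2 * ln x)) \<le> 1 * norm (\<bar>U x - x / (2 * ln x)\<bar> + \<bar>L x - x / (2 * ln x)\<bar>)"
      using ev by eventually_elim (auto simp: abs_le_iff)
  qed
  ultimately show ?thesis by (rule landau_o.big_trans[rotated])
qed

end

section \<open>Ideals of a quadratic order as lattices\<close>

text \<open>Pairs are coordinates with respect to \<open>1, om\<close>. In a general Hermite basis
  the common factor \<open>k\<close> need not exist; closure under \<open>om\<close> forces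
  it.\<close>

definition hnf :: "int \<Rightarrow> int \<Rightarrow> int \<Rightarrow> (int \<times> int) set" where
  "hnf k m b = {(k * (m * i + b * j), k * j) | i j. True}"

definition coset_of :: "(int \<times> int) set \<Rightarrow> int \<times> int \<Rightarrow> (int \<times> int) set" where
  "coset_of J u = (\<lambda>h. (fst h + fst u, snd h + snd u)) ` J"

definition lattice2 :: "(int \<times> int) set \<Rightarrow> bool" where
  "lattice2 J \<longleftrightarrow> (0,0) \<in> J \<and> (\<forall>x y x' y'. (x,y) \<in> J \<longrightarrow> (x',y') \<in> J \<longrightarrow> (x - x', y - y') \<in> J)"

lemma lattice2_minus: "lattice2 J \<Longrightarrow> (x,y) \<in> J \<Longrightarrow> (-x,-y) \<in> J"
  unfolding lattice2_def by (metis diff_0)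

lemma lattice2_add: "lattice2 J \<Longrightarrow> (x,y) \<in> J \<Longrightarrow> (x',y') \<in> J \<Longrightarrow> (x + x', y + y') \<in> J"
  using lattice2_minus[of J x' y'] unfolding lattice2_def by fastforce

lemma lattice2_smult:
  assumes "lattice2 J" "(x,y) \<in> J"
  shows "(i * x, i * y) \<in> J"
proof -
  have nat: "(int n * x, int n * y) \<in> J" for n
    by (induction n) (use assms lattice2_add[OF assms(1)] in \<open>auto simp: lattice2_def algebra_simps\<close>)
  show ?thesis
  proof (cases "i \<ge> 0")
    case True then show ?thesis using nat[of "nat i"] by simp
  next
    case False then show ?thesis using lattice2_minus[OF assms(1) nat[of "nat (-i)"]] by simp
  qed
qed

lemma coset_of_eq_iff:
  assumes "lattice2 J"
  shows "coset_of J u = coset_of J v \<longleftrightarrow> (fst u - fst v, snd u - snd v) \<in> J"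
proof
  assume "coset_of J u = coset_of J v"
  moreover have "u \<in> coset_of J u" using assms by (force simp: coset_of_def lattice2_def)
  ultimately have "u \<in> coset_of J v" by simp
  then show "(fst u - fst v, snd u - snd v) \<in> J" by (auto simp: coset_of_def)
next
  assume *: "(fst u - fst v, snd u - snd v) \<in> J"
  show "coset_of J u = coset_of J v"
  proof (intro equalityI subsetI)
    fix z assume "z \<in> coset_of J u"
    then obtain a b where ab: "(a,b) \<in> J" "z = (a + fst u, b + snd u)" by (auto simp: coset_of_def)
    have "(a + (fst u - fst v), b + (snd u - snd v)) \<in> J" using lattice2_add[OF assms ab(1) *] .
    then show "z \<in> coset_of J v" unfolding coset_of_def using ab(2) by (intro image_eqI) auto
  next
    fix z assume "z \<in> coset_of J v"
    then obtain a b where ab: "(a,b) \<in> J" "z = (a + fst v, b + snd v)" by (auto simp: coset_of_def)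
    have "(a - (fst u - fst v), b - (snd u - snd v)) \<in> J" using assms ab(1) * by (auto simp: lattice2_def)
    then show "z \<in> coset_of J u" unfolding coset_of_def using ab(2) by (intro image_eqI) auto
  qed
qed

lemma lattice2_hnf: "lattice2 (hnf k m b)"
  unfolding lattice2_def hnf_def
proof (intro conjI allI impI)
  show "(0, 0) \<in> {(k * (m * i + b * j), k * j) |i j. True}" by (simp, rule exI[of _ 0], rule exI[of _ 0]) simp
  fix x y x' y' assume "(x, y) \<in> {(k * (m * i + b * j), k * j) |i j. True}" "(x', y') \<in> {(k * (m * i + b * j), k * j) |i j. True}"
  then obtain i j i' j' where "x = k * (m * i + b * j)" "y = k * j" "x' = k * (m * i' + b * j')" "y' = k * j'" by auto
  then show "(x - x', y - y') \<in> {(k * (m * i + b * j), k * j) |i j. True}"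
    by (simp, intro exI[of _ "i - i'"] exI[of _ "j - j'"]) (auto simp: algebra_simps)
qed

lemma hnf_mem_iff:
  assumes "k > 0"
  shows "(x, y) \<in> hnf k m b \<longleftrightarrow> k dvd y \<and> k * m dvd x - b * y"
proof
  assume "(x, y) \<in> hnf k m b"
  then obtain i j where "x = k * (m * i + b * j)" "y = k * j" by (auto simp: hnf_def)
  then show "k dvd y \<and> k * m dvd x - b * y" by (auto simp: algebra_simps)
next
  assume "k dvd y \<and> k * m dvd x - b * y"
  then obtain j i where "y = k * j" "x - b * y = k * m * i" by (auto elim!: dvdE)
  then have "x = k * (m * i + b * j) \<and> y = k * j" by (auto simp: algebra_simps)
  then show "(x, y) \<in> hnf k m b" by (auto simp: hnf_def)
qed

lemma card_cosets_hnf: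
  assumes "k > 0" "m > 0"
  shows "card (range (coset_of (hnf k m b))) = nat (k * k * m)"
proof -
  have km: "k * m > 0" using assms by simp
  have "bij_betw (coset_of (hnf k m b)) ({0..<k*m} \<times> {0..<k}) (range (coset_of (hnf k m b)))"
    unfolding bij_betw_def
  proof
    show "inj_on (coset_of (hnf k m b)) ({0..<k*m} \<times> {0..<k})"
    proof (rule inj_onI)
      fix u v assume u: "u \<in> {0..<k*m} \<times> {0..<k}" "v \<in> {0..<k*m} \<times> {0..<k}"
        and "coset_of (hnf k m b) u = coset_of (hnf k m b) v"
      then have "(fst u - fst v, snd u - snd v) \<in> hnf k m b" using coset_of_eq_iff[OF lattice2_hnf] by blast
      then have *: "k dvd snd u - snd v" "k * m dvd (fst u - fst v) - b * (snd u - snd v)" using hnf_mem_iff assms by auto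
      have "\<bar>snd u - snd v\<bar> < k" using u by auto
      with *(1) have sn: "snd u - snd v = 0" using zdvd_not_zless[of "\<bar>snd u - snd v\<bar>" k] by (cases "snd u - snd v = 0") auto
      with *(2) have "k * m dvd fst u - fst v" by simp
      moreover have "\<bar>fst u - fst v\<bar> < k * m" using u by auto
      ultimately have "fst u - fst v = 0" using zdvd_not_zless[of "\<bar>fst u - fst v\<bar>" "k * m"] by (cases "fst u - fst v = 0") auto
      with sn show "u = v" by (simp add: prod_eq_iff)
    qed
    show "coset_of (hnf k m b) ` ({0..<k * m} \<times> {0..<k}) = range (coset_of (hnf k m b))"
    proof (intro equalityI subsetI)
      fix z assume "z \<in> range (coset_of (hnf k m b))"
      then obtain x y where z: "z = coset_of (hnf k m b) (x,y)" by auto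
      define v where "v = ((x - b * (y - y mod k)) mod (k * m), y mod k)"
      have "k * m dvd (x - b * (y - y mod k)) - (x - b * (y - y mod k)) mod (k * m)" by (simp add: minus_mod_eq_mult_div)
      moreover have "(x - (x - b * (y - y mod k)) mod (k * m)) - b * (y - y mod k) = (x - b * (y - y mod k)) - (x - b * (y - y mod k)) mod (k * m)" by simp
      ultimately have "(x - fst v, y - snd v) \<in> hnf k m b"
        using assms by (auto simp: v_def hnf_mem_iff minus_mod_eq_mult_div)
      then have "z = coset_of (hnf k m b) v" unfolding z using coset_of_eq_iff[OF lattice2_hnf] by auto
      moreover have "v \<in> {0..<k * m} \<times> {0..<k}" using assms km by (auto simp: v_def)
      ultimately show "z \<in> coset_of (hnf k m b) ` ({0..<k * m} \<times> {0..<k})" by blast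
    qed auto
  qed
  then have "card (range (coset_of (hnf k m b))) = card ({0..<k*m} \<times> {0..<k})" by (simp add: bij_betw_same_card)
  also have "\<dots> = nat (k * k * m)" using assms by (simp add: card_cartesian_product nat_mult_distrib mult_ac)
  finally show ?thesis .
qed

lemma int_subgroup:
  fixes S :: "int set"
  assumes "\<And>x y. x \<in> S \<Longrightarrow> y \<in> S \<Longrightarrow> x - y \<in> S" "N \<in> S" "N > 0"
  obtains k where "k > 0" "k \<in> S" "\<And>x. x \<in> S \<Longrightarrow> k dvd x"
proof -
  define n where "n = (LEAST n. n > 0 \<and> int n \<in> S)"
  have ex: "nat N > 0 \<and> int (nat N) \<in> S" using assms by auto
  have n: "n > 0" "int n \<in> S" unfolding n_def using LeastI[of "\<lambda>n. n > 0 \<and> int n \<in> S", OF ex] by auto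
  have least: "m \<ge> n" if "m > 0" "int m \<in> S" for m unfolding n_def using that by (intro Least_le) auto
  have 0: "0 \<in> S" using assms(1)[OF n(2) n(2)] by simp
  have neg: "-x \<in> S" if "x \<in> S" for x using assms(1)[OF 0 that] by simp
  have add: "x + y \<in> S" if "x \<in> S" "y \<in> S" for x y using assms(1)[OF that(1) neg[OF that(2)]] by simp
  have mul: "int j * int n \<in> S" for j by (induction j) (auto simp: 0 algebra_simps intro: add n)
  have mul': "j * int n \<in> S" for j
    using mul[of "nat j"] neg[OF mul[of "nat (-j)"]] by (cases "j \<ge> 0") auto
  have "int n dvd x" if "x \<in> S" for x
  proof (rule ccontr)
    assume "\<not> int n dvd x"
    then have "x mod int n \<noteq> 0" by auto
    then have pos: "x mod int n > 0" "x mod int n < int n" using n pos_mod_sign[of "int n" x] pos_mod_bound[of "int n" x] by linarith+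
    have "x - (x div int n) * int n \<in> S" using assms(1)[OF that mul'] .
    then have "x mod int n \<in> S" by (simp add: minus_div_mult_eq_mod)
    with least[of "nat (x mod int n)"] pos show False by auto
  qed
  with n show ?thesis by (intro that[of "int n"]) auto
qed

text \<open>Closure under multiplication by a root of \<open>om^2 = t * om + e\<close>, in
  coordinates.\<close>

definition om_closed :: "int \<Rightarrow> int \<Rightarrow> (int \<times> int) set \<Rightarrow> bool" where
  "om_closed t e J \<longleftrightarrow> (\<forall>x y. (x,y) \<in> J \<longrightarrow> (e * y, x + t * y) \<in> J)"

text \<open>The generator \<open>k * (b + om)\<close> is the critical one: the condition says that
  \<open>m\<close> divides the norm \<open>b * b + t * b - e\<close> of \<open>b + om\<close>, in
  other words that \<open>- b\<close> is a root modulo \<open>m\<close> of the minimal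
  polynomial.\<close>

lemma om_closed_hnf_iff:
  assumes "k > 0"
  shows "om_closed t e (hnf k m b) \<longleftrightarrow> m dvd b * b + t * b - e"
proof
  assume "om_closed t e (hnf k m b)"
  moreover have "(k * b, k) \<in> hnf k m b" using assms by (simp add: hnf_mem_iff)
  ultimately have "(e * k, k * b + t * k) \<in> hnf k m b" unfolding om_closed_def by blast
  then have "k * m dvd e * k - b * (k * b + t * k)" using assms by (simp add: hnf_mem_iff)
  also have "e * k - b * (k * b + t * k) = k * (e - b * b - t * b)" by (simp add: algebra_simps)
  finally have "m dvd e - b * b - t * b" using assms by simp
  then have "m dvd - (e - b * b - t * b)" by (simp only: dvd_minus_iff)
  then show "m dvd b * b + t * b - e" by (simp add: algebra_simps)
next
  assume m: "m dvd b * b + t * b - e"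
  show "om_closed t e (hnf k m b)"
    unfolding om_closed_def
  proof (intro allI impI)
    fix x y assume "(x, y) \<in> hnf k m b"
    then have xy: "k dvd y" "k * m dvd x - b * y" using assms by (auto simp: hnf_mem_iff)
    then obtain j where j: "y = k * j" by auto
    have "k dvd x - b * y" using xy(2) dvd_mult_left by blast
    then have kx: "k dvd x" using xy(1) by (metis dvd_mult diff_add_cancel dvd_add)
    have "e * y - b * (x + t * y) = - (b * (x - b * y)) - k * j * (b * b + t * b - e)"
      by (simp add: j algebra_simps)
    moreover have "k * m dvd k * (b * b + t * b - e)" using m by simp
    then have "k * m dvd k * j * (b * b + t * b - e)" by (metis dvd_mult2 mult.assoc mult.commute)
    ultimately have "k * m dvd e * y - b * (x + t * y)"
      using xy(2) by (metis dvd_diff dvd_minus_iff dvd_mult)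
    then show "(e * y, x + t * y) \<in> hnf k m b" using assms kx xy(1) by (simp add: hnf_mem_iff)
  qed
qed

lemma hnf_inj:
  assumes "hnf k m b = hnf k' m' b'" "k > 0" "k' > 0" "m > 0" "m' > 0" "0 \<le> b" "b < m" "0 \<le> b'" "b' < m'"
  shows "k = k' \<and> m = m' \<and> b = b'"
proof -
  have sub: "k' dvd k \<and> k' * m' dvd k * m \<and> k' * m' dvd k * (b - b')"
    if "hnf k m b = hnf k' m' b'" "k > 0" "k' > 0" for k m b k' m' b' :: int
  proof -
    have "(k * b, k) \<in> hnf k m b" "(k * m, 0) \<in> hnf k m b"
      unfolding hnf_mem_iff[OF that(2)] by (auto simp: mult.commute)
    then have "(k * b, k) \<in> hnf k' m' b'" "(k * m, 0) \<in> hnf k' m' b'" using that by auto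
    then show ?thesis using that by (auto simp: hnf_mem_iff algebra_simps)
  qed
  have k: "k = k'" using sub[OF assms(1-3)] sub[OF assms(1)[symmetric] assms(3,2)] assms(2,3) by (simp add: zdvd_antisym_nonneg)
  have "k * m = k' * m'" using sub[OF assms(1-3)] sub[OF assms(1)[symmetric] assms(3,2)] assms by (intro zdvd_antisym_nonneg) auto
  then have m: "m = m'" using k assms by simp
  have "k * m dvd k * (b - b')" using sub[OF assms(1-3)] k m by simp
  then have "m dvd b - b'" using assms by simp
  moreover have "\<bar>b - b'\<bar> < m" using assms m by auto
  ultimately have "b = b'" using zdvd_not_zless[of "\<bar>b - b'\<bar>" m] by (cases "b = b'") auto
  with k m show ?thesis by simp
qed

text \<open>A positive \<open>card\<close> encodes finite index: two integers share a coset, so some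
  \<open>N > 0\<close> lies in the lattice, and \<open>N * om\<close> with it. \<open>k\<close>
  generates the second coordinates and \<open>k0\<close> the integers of the lattice; applying
  \<open>om\<close> shows that \<open>k\<close> divides both \<open>k0\<close> and the first
  coordinate of a vector with second coordinate \<open>k\<close>, and it can be taken out.\<close>

lemma finite_index_hnf:
  assumes "lattice2 J" "om_closed t e J" "card (range (coset_of J)) > 0"
  obtains k m b where "k > 0" "m > 0" "0 \<le> b" "b < m" "J = hnf k m b"
proof -
  have fin: "finite (range (coset_of J))" using assms(3) by (rule card_ge_0_finite)
  have "\<not> inj (\<lambda>i::int. coset_of J (i, 0))"
  proof
    assume "inj (\<lambda>i::int. coset_of J (i, 0))"
    moreover have "finite (range (\<lambda>i::int. coset_of J (i, 0)))" by (rule finite_subset[OF _ fin]) auto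
    ultimately have "finite (UNIV :: int set)" by (rule finite_imageD[rotated])
    then show False using infinite_UNIV_int by blast
  qed
  then obtain i j :: int where ij: "i \<noteq> j" "coset_of J (i,0) = coset_of J (j,0)" by (auto simp: inj_def)
  then have *: "(i - j, 0) \<in> J" using coset_of_eq_iff[OF assms(1)] by fastforce
  define N where "N = \<bar>i - j\<bar>"
  have N: "N > 0" "(N, 0) \<in> J" using ij * lattice2_minus[OF assms(1) *] by (auto simp: N_def abs_if)
  have om: "(e * y, x + t * y) \<in> J" if "(x,y) \<in> J" for x y using assms(2) that by (auto simp: om_closed_def)
  have diff: "(x - x', y - y') \<in> J" if "(x,y) \<in> J" "(x',y') \<in> J" for x y x' y' using assms(1) that by (auto simp: lattice2_def)
  have N2: "(0, N) \<in> J" using om[OF N(2)] by simp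
  obtain k where k: "k > 0" "k \<in> {y. \<exists>x. (x,y) \<in> J}" "\<And>y. y \<in> {y. \<exists>x. (x,y) \<in> J} \<Longrightarrow> k dvd y"
    by (rule int_subgroup[of "{y. \<exists>x. (x,y) \<in> J}" N]) (use N N2 diff in blast)+
  obtain k0 where k0: "k0 > 0" "k0 \<in> {x. (x,0) \<in> J}" "\<And>x. x \<in> {x. (x,0) \<in> J} \<Longrightarrow> k0 dvd x"
    by (rule int_subgroup[of "{x. (x,0) \<in> J}" N]) (use N in \<open>auto dest: diff\<close>)
  have "(0, k0) \<in> J" using om[of k0 0] k0(2) by simp
  then have "k dvd k0" using k(3) by blast
  then obtain m where m: "k0 = k * m" by auto
  have m0: "m > 0" using m k k0 by (simp add: zero_less_mult_iff)
  obtain c where c: "(c, k) \<in> J" using k(2) by auto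
  have "(e * k, c + t * k) \<in> J" using om[OF c] .
  then have "k dvd c + t * k" using k(3) by blast
  then have "k dvd c" by (metis dvd_add_times_triv_right_iff)
  then obtain b0 where b0: "c = k * b0" by auto
  define b where "b = b0 mod m"
  have "((b0 div m) * k0, (b0 div m) * 0) \<in> J" using lattice2_smult[OF assms(1)] k0(2) by blast
  from diff[OF c this] have "(k * b0 - (b0 div m) * (k * m), k) \<in> J" by (simp add: b0 m)
  also have "k * b0 - (b0 div m) * (k * m) = k * b"
    unfolding b_def minus_div_mult_eq_mod[symmetric] by (simp add: algebra_simps)
  finally have kb: "(k * b, k) \<in> J" .
  have "J = hnf k m b"
  proof (intro equalityI subsetI)
    fix z assume z: "z \<in> J"
    obtain x y where xy: "z = (x,y)" by fastforce
    then have "k dvd y" using z k(3) by blast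
    then obtain j where j: "y = k * j" by auto
    have "(x - j * (k * b), y - j * k) \<in> J" using diff[OF z[unfolded xy] lattice2_smult[OF assms(1) kb]] .
    then have "(x - b * y, 0) \<in> J" by (simp add: j mult_ac)
    then have "k * m dvd x - b * y" using k0(3) m by auto
    with \<open>k dvd y\<close> show "z \<in> hnf k m b" using hnf_mem_iff k(1) xy by auto
  next
    fix z assume "z \<in> hnf k m b"
    then obtain i j where z: "z = (k * (m * i + b * j), k * j)" by (auto simp: hnf_def)
    have "(i * k0, i * 0) \<in> J" using lattice2_smult[OF assms(1)] k0(2) by blast
    from lattice2_add[OF assms(1) this lattice2_smult[OF assms(1) kb, of j]]
    show "z \<in> J" by (simp add: z m algebra_simps)
  qed
  then show ?thesis using that[of k m b] k(1) m0 by (auto simp: b_def)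
qed

text \<open>The pair \<open>(k, b)\<close> encodes the lattice \<open>k (\<int> m + \<int> (b + \<omega>))\<close> of index \<open>k\<^sup>2 m = n\<close>.\<close>

definition hnf_pairs :: "int \<Rightarrow> int \<Rightarrow> nat \<Rightarrow> (nat \<times> int) set" where
  "hnf_pairs t e n = {(k, b). k\<^sup>2 dvd n \<and> 0 \<le> b \<and> b < int (n div k\<^sup>2) \<and> int (n div k\<^sup>2) dvd b * b + t * b - e}"

section \<open>Ideals and their norms in coordinates\<close>

locale quad_int =
  fixes K :: "'a :: field_char_0 set" and om :: 'a and t e :: int
  assumes ints: "{x \<in> K. algebraic_int x} = range (\<lambda>(a,b). of_int a + of_int b * om)"
    and irr: "om \<notin> \<rat>" and sq: "om * om = of_int t * om + of_int e"
begin

definition emb :: "int \<times> int \<Rightarrow> 'a" where "emb u = of_int (fst u) + of_int (snd u) * om"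

abbreviation R where "R \<equiv> ring_of_integers K"

lemma inj_emb: "inj emb"
proof (rule injI)
  fix u v assume *: "emb u = emb v"
  have "snd u = snd v"
  proof (rule ccontr)
    assume "snd u \<noteq> snd v"
    then have "of_int (snd u - snd v) \<noteq> (0 :: 'a)" by simp
    moreover have "of_int (snd u - snd v) * om = of_int (fst v - fst u)" using * by (simp add: emb_def algebra_simps)
    ultimately have "om = of_int (fst v - fst u) / of_int (snd u - snd v)" by (simp add: field_simps)
    then show False using irr by (metis Rats_divide Rats_of_int)
  qed
  with * show "u = v" by (simp add: emb_def prod_eq_iff)
qed

lemma carrier_R: "carrier R = range emb"
  using ints by (simp add: ring_of_integers_def emb_def[abs_def] case_prod_unfold)

lemma R_simps [simp]: "x \<oplus>\<^bsub>R\<^esub> y = x + y" "x \<otimes>\<^bsub>R\<^esub> y = x * y" "\<zero>\<^bsub>R\<^esub> = 0" "\<one>\<^bsub>R\<^esub> = 1"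
  by (simp_all add: ring_of_integers_def ring_of_type_algebra_def)

lemma emb_add: "emb u + emb v = emb (fst u + fst v, snd u + snd v)"
  and emb_minus: "- emb u = emb (- fst u, - snd u)"
  and emb_diff: "emb u - emb v = emb (fst u - fst v, snd u - snd v)"
  and emb_0: "0 = emb (0,0)" and emb_1: "1 = emb (1,0)"
  by (simp_all add: emb_def algebra_simps)

lemma emb_om: "om * emb u = emb (e * snd u, fst u + t * snd u)"
proof -
  have "om * emb u = of_int (fst u) * om + of_int (snd u) * (om * om)" by (simp add: emb_def algebra_simps)
  then show ?thesis unfolding sq by (simp add: emb_def algebra_simps)
qed

lemma emb_mult: "emb u * emb v = emb (fst u * fst v + e * snd u * snd v, fst u * snd v + snd u * fst v + t * snd u * snd v)"
proof -
  have "emb u * emb v = of_int (fst u) * emb v + of_int (snd u) * (om * emb v)" by (simp add: emb_def algebra_simps)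
  then show ?thesis unfolding emb_om by (simp add: emb_def algebra_simps)
qed

lemma ring_R: "ring R"
proof (rule ringI)
  show "abelian_group R"
  proof (rule abelian_groupI)
    fix x assume "x \<in> carrier R"
    then show "\<exists>y\<in>carrier R. y \<oplus>\<^bsub>R\<^esub> x = \<zero>\<^bsub>R\<^esub>"
      by (intro bexI[of _ "-x"]) (auto simp: carrier_R emb_minus)
  qed (use emb_0 in \<open>auto simp: carrier_R emb_add algebra_simps\<close>)
  show "monoid R"
  proof (rule monoidI)
    show "x \<otimes>\<^bsub>R\<^esub> y \<in> carrier R" if "x \<in> carrier R" "y \<in> carrier R" for x y
      using that by (auto simp: carrier_R emb_mult)
    show "\<one>\<^bsub>R\<^esub> \<in> carrier R" using emb_1 by (auto simp: carrier_R)
  qed (auto simp: mult.assoc)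
qed (auto simp: algebra_simps)

text \<open>Absorption needs to be tested on \<open>om\<close> alone, because \<open>1\<close> and
  \<open>om\<close> generate the ring additively.\<close>

lemma ideal_iff:
  "ideal (emb ` J) R \<longleftrightarrow> lattice2 J \<and> om_closed t e J"
proof
  assume id: "ideal (emb ` J) R"
  interpret ideal "emb ` J" R by fact
  have mem: "emb u \<in> emb ` J \<longleftrightarrow> u \<in> J" for u using inj_emb by (auto dest: injD)
  have min: "\<ominus>\<^bsub>R\<^esub> emb u = - emb u" for u
  proof -
    have "- emb u \<in> range emb" by (simp add: emb_minus)
    then show ?thesis by (intro minus_equality) (auto simp: carrier_R)
  qed
  show "lattice2 J \<and> om_closed t e J"
    unfolding lattice2_def om_closed_def
  proof (intro conjI allI impI)
    show "(0,0) \<in> J" using additive_subgroup.zero_closed[OF is_additive_subgroup] mem[of "(0,0)"] by (simp add: emb_0[symmetric])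
    fix x y x' y' assume "(x,y) \<in> J" "(x',y') \<in> J"
    then have "emb (x,y) \<oplus>\<^bsub>R\<^esub> (\<ominus>\<^bsub>R\<^esub> emb (x',y')) \<in> emb ` J" 
      by (intro additive_subgroup.a_closed[OF is_additive_subgroup] additive_subgroup.a_inv_closed[OF is_additive_subgroup]) auto
    then have "emb (x - x', y - y') \<in> emb ` J" unfolding min by (simp add: emb_diff)
    then show "(x - x', y - y') \<in> J" using mem by simp
  next
    fix x y assume "(x,y) \<in> J"
    then have "emb (0,1) \<otimes>\<^bsub>R\<^esub> emb (x,y) \<in> emb ` J" by (intro I_l_closed) (auto simp: carrier_R)
    then show "(e * y, x + t * y) \<in> J" using mem by (simp add: emb_mult)
  qed
next
  assume J: "lattice2 J \<and> om_closed t e J"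
  then have L: "lattice2 J" and omc: "\<And>x y. (x,y) \<in> J \<Longrightarrow> (e * y, x + t * y) \<in> J" by (auto simp: om_closed_def)
  interpret R: ring R by (rule ring_R)
  have min: "\<ominus>\<^bsub>R\<^esub> emb u = - emb u" for u
  proof -
    have "- emb u \<in> range emb" by (simp add: emb_minus)
    then show ?thesis by (intro R.minus_equality) (auto simp: carrier_R)
  qed
  have absorb: "emb u * emb v \<in> emb ` J" if "v \<in> J" for u v
  proof -
    obtain x y where v: "v = (x,y)" by fastforce
    have "(fst u * x + snd u * (e * y), fst u * y + snd u * (x + t * y)) \<in> J"
      using that v by (intro lattice2_add L lattice2_smult omc) auto
    then show ?thesis by (simp add: emb_mult v algebra_simps)
  qed
  show "ideal (emb ` J) R"
  proof (rule idealI[OF ring_R])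
    show "subgroup (emb ` J) (add_monoid R)"
    proof (rule R.add.subgroupI)
      show "emb ` J \<subseteq> carrier R" by (auto simp: carrier_R)
      show "emb ` J \<noteq> {}" using L by (auto simp: lattice2_def)
      show "\<ominus>\<^bsub>R\<^esub> a \<in> emb ` J" if "a \<in> emb ` J" for a
        using that lattice2_minus[OF L] min by (auto simp: emb_minus)
      show "a \<oplus>\<^bsub>R\<^esub> b \<in> emb ` J" if "a \<in> emb ` J" "b \<in> emb ` J" for a b
        using that lattice2_add[OF L] by (auto simp: emb_add)
    qed
  qed (use absorb in \<open>auto simp: carrier_R mult.commute\<close>)
qed

lemma ideal_norm_emb: "ideal_norm K (emb ` J) = card (range (coset_of J))"
proof -
  have "carrier (R Quot (emb ` J)) = (\<lambda>x. (\<lambda>h. h + x) ` (emb ` J)) ` range emb"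
    unfolding FactRing_def A_RCOSETS_def' a_r_coset_def' carrier_R by auto
  also have "\<dots> = (\<lambda>C. emb ` C) ` range (coset_of J)"
  proof -
    have "(\<lambda>h. h + emb u) ` (emb ` J) = emb ` coset_of J u" for u
      unfolding coset_of_def by (auto simp: image_image emb_add)
    then show ?thesis by (simp add: image_image)
  qed
  finally have "ideal_norm K (emb ` J) = card ((\<lambda>C. emb ` C) ` range (coset_of J))" by (simp add: ideal_norm_def)
  also have "\<dots> = card (range (coset_of J))"
    by (intro card_image inj_onI) (metis inj_emb inj_image_eq_iff)
  finally show ?thesis .
qed

theorem ideal_count_eq:
  assumes "n > 0"
  shows "ideal_count K n = card (hnf_pairs t e n)"
proof -
  let ?F = "\<lambda>(k,b). emb ` hnf (int k) (int (n div k\<^sup>2)) b"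
  have pos: "k > 0 \<and> n div k\<^sup>2 > 0" if "k\<^sup>2 dvd n" for k
  proof -
    have "k\<^sup>2 \<le> n" using that assms by (rule dvd_imp_le)
    moreover have "k \<noteq> 0" using that assms by (intro notI) simp
    ultimately show ?thesis by (simp add: div_greater_zero_iff)
  qed
  have "bij_betw ?F (hnf_pairs t e n) {I. ideal I R \<and> ideal_norm K I = n}"
    unfolding bij_betw_def
  proof
    show "inj_on ?F (hnf_pairs t e n)"
    proof (rule inj_onI)
      fix u v assume uv: "u \<in> hnf_pairs t e n" "v \<in> hnf_pairs t e n" "?F u = ?F v"
      obtain k b k' b' where [simp]: "u = (k,b)" "v = (k',b')" by fastforce
      have "hnf (int k) (int (n div k\<^sup>2)) b = hnf (int k') (int (n div k'\<^sup>2)) b'"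
        using uv(3) inj_emb by (simp add: inj_image_eq_iff)
      from hnf_inj[OF this] uv(1,2) pos[of k] pos[of k'] show "u = v" by (auto simp: hnf_pairs_def)
    qed
    show "?F ` hnf_pairs t e n = {I. ideal I R \<and> ideal_norm K I = n}"
    proof (intro equalityI subsetI)
      fix I assume "I \<in> ?F ` hnf_pairs t e n"
      then obtain k b where kb: "(k,b) \<in> hnf_pairs t e n" and I: "I = emb ` hnf (int k) (int (n div k\<^sup>2)) b" by auto
      have kp: "k\<^sup>2 dvd n" using kb by (auto simp: hnf_pairs_def)
      note p = pos[OF kp]
      have "ideal I R" unfolding I ideal_iff
        using kb p by (auto simp: lattice2_hnf om_closed_hnf_iff hnf_pairs_def)
      moreover have "ideal_norm K I = n"
      proof -
        have "ideal_norm K I = nat (int k * int k * int (n div k\<^sup>2))"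
          unfolding I ideal_norm_emb using p by (intro card_cosets_hnf) auto
        also have "\<dots> = k\<^sup>2 * (n div k\<^sup>2)" by (simp add: power2_eq_square nat_mult_distrib flip: of_nat_mult)
        also have "\<dots> = n" using kp by simp
        finally show ?thesis .
      qed
      ultimately show "I \<in> {I. ideal I R \<and> ideal_norm K I = n}" by simp
    next
      fix I assume "I \<in> {I. ideal I R \<and> ideal_norm K I = n}"
      then have I: "ideal I R" "ideal_norm K I = n" by auto
      interpret I: ideal I R by fact
      define J where "J = emb -` I"
      have IJ: "I = emb ` J" using I.a_subset by (auto simp: J_def carrier_R)
      have J: "lattice2 J" "om_closed t e J" using I(1) unfolding IJ ideal_iff by auto
      have card: "card (range (coset_of J)) = n" using I(2) unfolding IJ ideal_norm_emb .
      \<comment> \<open>An infinite quotient would have \<open>card\<close> 0, so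
        \<open>n > 0\<close> yields finite index.\<close>
      with assms have "card (range (coset_of J)) > 0" by simp
      from finite_index_hnf[OF J this] obtain k m b where h: "k > 0" "m > 0" "0 \<le> b" "b < m" "J = hnf k m b" .
      have n: "n = nat (k * k * m)" using card_cosets_hnf[OF h(1,2)] card h(5) by simp
      have dv: "m dvd b * b + t * b - e" using J(2) h om_closed_hnf_iff by simp
      have n': "n = (nat k)\<^sup>2 * nat m" using n h by (simp add: nat_mult_distrib power2_eq_square)
      then have div: "n div (nat k)\<^sup>2 = nat m" using h by simp
      have "(nat k, b) \<in> hnf_pairs t e n" using h dv by (auto simp: hnf_pairs_def div n')
      moreover have "I = ?F (nat k, b)" using h by (simp add: IJ div)
      ultimately show "I \<in> ?F ` hnf_pairs t e n" by (intro image_eqI)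
    qed
  qed
  then show ?thesis using assms by (simp add: ideal_count_def bij_betw_same_card)
qed

end

section \<open>The ideal counting function at prime powers\<close>

definition qroots :: "int \<Rightarrow> int \<Rightarrow> nat \<Rightarrow> int set" where
  "qroots t e m = {b. 0 \<le> b \<and> b < int m \<and> int m dvd b * b + t * b - e}"

lemma finite_qroots [simp]: "finite (qroots t e m)"
  by (rule finite_subset[of _ "{0..<int m}"]) (auto simp: qroots_def)

lemma card_hnf_pairs:
  assumes "n > 0"
  shows "card (hnf_pairs t e n) = (\<Sum>k | k\<^sup>2 dvd n. card (qroots t e (n div k\<^sup>2)))"
proof -
  have fin: "finite {k. k\<^sup>2 dvd n}"
    by (rule finite_subset[of _ "{..n}"]) (use assms in \<open>auto dest!: dvd_imp_le intro: order_trans[OF _ ] simp: power2_eq_square intro: le_trans[OF le_square]\<close>)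
  have "hnf_pairs t e n = Sigma {k. k\<^sup>2 dvd n} (\<lambda>k. qroots t e (n div k\<^sup>2))"
    by (auto simp: hnf_pairs_def qroots_def)
  then show ?thesis using fin by simp
qed

lemma qpoly_cong: "[b = c] (mod m) \<Longrightarrow> [b * b + t * b - e = c * c + t * c - e] (mod m)" for b c m t e :: int
  by (intro cong_diff cong_add cong_mult cong_refl)

lemma card_qroots_mult:
  assumes "coprime m1 m2" "m1 > 0" "m2 > 0"
  shows "card (qroots t e (m1 * m2)) = card (qroots t e m1) * card (qroots t e m2)"
proof -
  let ?F = "\<lambda>b. (b mod int m1, b mod int m2)"
  have cop: "coprime (int m1) (int m2)" using assms(1) by simp
  have red: "int m dvd (b mod int m) * (b mod int m) + t * (b mod int m) - e \<longleftrightarrow> int m dvd b * b + t * b - e" for m b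
    using qpoly_cong[of "b mod int m" b "int m" t e] by (intro cong_dvd_iff) (simp add: cong_def)
  have "bij_betw ?F (qroots t e (m1 * m2)) (qroots t e m1 \<times> qroots t e m2)"
    unfolding bij_betw_def
  proof
    show "inj_on ?F (qroots t e (m1 * m2))"
    proof (rule inj_onI)
      fix b c assume bc: "b \<in> qroots t e (m1 * m2)" "c \<in> qroots t e (m1 * m2)" "?F b = ?F c"
      then have "[b = c] (mod int m1)" "[b = c] (mod int m2)" by (auto simp: cong_def)
      then have "[b = c] (mod int m1 * int m2)" using cop by (simp add: coprime_cong_mult)
      then have "b mod int (m1 * m2) = c mod int (m1 * m2)" by (simp add: cong_def)
      then show "b = c" using bc(1,2) by (simp add: qroots_def)
    qed
    show "?F ` qroots t e (m1 * m2) = qroots t e m1 \<times> qroots t e m2"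
    proof (intro equalityI subsetI)
      fix z assume "z \<in> ?F ` qroots t e (m1 * m2)"
      then obtain b where b: "b \<in> qroots t e (m1 * m2)" "z = ?F b" by auto
      then have "int m1 * int m2 dvd b * b + t * b - e" by (simp add: qroots_def)
      then have "int m1 dvd b * b + t * b - e" "int m2 dvd b * b + t * b - e" by (auto dest: dvd_mult_left dvd_mult_right)
      then show "z \<in> qroots t e m1 \<times> qroots t e m2" using assms by (simp add: b(2) qroots_def red)
    next
      fix z assume z: "z \<in> qroots t e m1 \<times> qroots t e m2"
      obtain b1 b2 where [simp]: "z = (b1, b2)" by fastforce
      have b1: "0 \<le> b1" "b1 < int m1" "int m1 dvd b1 * b1 + t * b1 - e" and b2: "0 \<le> b2" "b2 < int m2" "int m2 dvd b2 * b2 + t * b2 - e"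
        using z by (auto simp: qroots_def)
      obtain x where x: "[x = b1] (mod int m1)" "[x = b2] (mod int m2)" using binary_chinese_remainder_int[OF cop] by blast
      define b where "b = x mod (int m1 * int m2)"
      have bm: "b mod int m1 = b1" "b mod int m2 = b2"
        using x b1 b2 by (auto simp: b_def cong_def mod_mod_cancel)
      have "int m1 dvd b * b + t * b - e" "int m2 dvd b * b + t * b - e" using red[of m1 b] red[of m2 b] b1 b2 bm by auto
      then have "int m1 * int m2 dvd b * b + t * b - e" using cop by (rule divides_mult)
      moreover have "0 \<le> b" "b < int m1 * int m2" using assms by (auto simp: b_def)
      ultimately have "b \<in> qroots t e (m1 * m2)" by (simp add: qroots_def)
      moreover have "z = ?F b" using bm by simp
      ultimately show "z \<in> ?F ` qroots t e (m1 * m2)" by (rule image_eqI[rotated])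
    qed
  qed
  from bij_betw_same_card[OF this] show ?thesis by (simp add: card_cartesian_product)
qed

text \<open>The two factors are recovered as gcds of the product with \<open>m1\<close> and
  \<open>m2\<close>. They exist because coprime numbers whose product is a square are themselves
  squares.\<close>

lemma square_divisors_bij:
  assumes "coprime m1 m2" "m1 > 0" "m2 > (0::nat)"
  shows "bij_betw (\<lambda>(k1,k2). k1 * k2) ({k. k\<^sup>2 dvd m1} \<times> {k. k\<^sup>2 dvd m2}) {k. k\<^sup>2 dvd m1 * m2}"
  unfolding bij_betw_def
proof
  have gcd1: "gcd (k1 * k2) m1 = k1" if "k1\<^sup>2 dvd m1" "k2\<^sup>2 dvd m2" "coprime m1 m2" for k1 k2 m1 m2 :: nat
  proof -
    have k1: "k1 dvd m1" and k2: "k2 dvd m2" using that(1,2) by (auto intro: dvd_trans[of _ "_\<^sup>2"] simp: power2_eq_square)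
    have "coprime k2 m1" using k2 that(3) by (meson coprime_commute coprime_divisors dvd_refl)
    then have "gcd (k1 * k2) m1 = gcd k1 m1" by (simp add: gcd_mult_right_right_cancel gcd_mult_left_right_cancel coprime_commute)
    then show ?thesis using k1 by (simp add: gcd_nat.absorb1)
  qed
  show "inj_on (\<lambda>(k1,k2). k1 * k2) ({k. k\<^sup>2 dvd m1} \<times> {k. k\<^sup>2 dvd m2})"
  proof (rule inj_onI)
    fix u v assume u: "u \<in> {k. k\<^sup>2 dvd m1} \<times> {k. k\<^sup>2 dvd m2}" "v \<in> {k. k\<^sup>2 dvd m1} \<times> {k. k\<^sup>2 dvd m2}"
      and eq: "(\<lambda>(k1,k2). k1 * k2) u = (\<lambda>(k1,k2). k1 * k2) v"
    obtain a b c d where [simp]: "u = (a,b)" "v = (c,d)" by fastforce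
    have cop: "coprime m2 m1" using assms(1) by (simp add: coprime_commute)
    have "a = gcd (a * b) m1" "c = gcd (c * d) m1" using gcd1[of a m1 b m2] gcd1[of c m1 d m2] u assms(1) by auto
    moreover have "b = gcd (b * a) m2" "d = gcd (d * c) m2" using gcd1[of b m2 a m1] gcd1[of d m2 c m1] u cop by auto
    moreover have "a * b = c * d" using eq by simp
    ultimately show "u = v" by (metis \<open>u = (a,b)\<close> \<open>v = (c,d)\<close> mult.commute)
  qed
  show "(\<lambda>(k1,k2). k1 * k2) ` ({k. k\<^sup>2 dvd m1} \<times> {k. k\<^sup>2 dvd m2}) = {k. k\<^sup>2 dvd m1 * m2}"
  proof (intro equalityI subsetI)
    fix k assume "k \<in> {k. k\<^sup>2 dvd m1 * m2}"
    then obtain x y where xy: "k\<^sup>2 = x * y" "x dvd m1" "y dvd m2" using division_decomp[of "k\<^sup>2" m1 m2] by auto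
    have cop: "coprime x y" using xy assms(1) coprime_divisors by blast
    have "is_nth_power 2 (x * y)" using xy(1) by (metis is_nth_powerI)
    moreover have "x > 0" "y > 0" using xy(2,3) assms(2,3) by (auto intro: dvd_pos_nat)
    ultimately have "is_nth_power 2 x" "is_nth_power 2 y" using is_nth_power_mult_coprime_natD[OF cop, of 2] by blast+
    then obtain k1 k2 where k: "x = k1\<^sup>2" "y = k2\<^sup>2" by (auto simp: is_nth_power_def)
    then have "k\<^sup>2 = (k1 * k2)\<^sup>2" using xy(1) by (simp add: power_mult_distrib)
    then have "k = k1 * k2" by simp
    then show "k \<in> (\<lambda>(k1,k2). k1 * k2) ` ({k. k\<^sup>2 dvd m1} \<times> {k. k\<^sup>2 dvd m2})"
      using xy k by (intro image_eqI[of _ _ "(k1,k2)"]) auto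
  qed (auto simp: power_mult_distrib intro: mult_dvd_mono)
qed

lemma card_hnf_pairs_mult:
  assumes "coprime m1 m2" "m1 > 0" "m2 > 0"
  shows "card (hnf_pairs t e (m1 * m2)) = card (hnf_pairs t e m1) * card (hnf_pairs t e m2)"
proof -
  have "card (hnf_pairs t e (m1 * m2)) = (\<Sum>k | k\<^sup>2 dvd m1 * m2. card (qroots t e (m1 * m2 div k\<^sup>2)))"
    using assms by (intro card_hnf_pairs) auto
  also have "\<dots> = (\<Sum>(k1,k2)\<in>{k. k\<^sup>2 dvd m1} \<times> {k. k\<^sup>2 dvd m2}. card (qroots t e (m1 * m2 div (k1 * k2)\<^sup>2)))"
    by (subst sum.reindex_bij_betw[OF square_divisors_bij[OF assms], symmetric]) (simp add: case_prod_unfold)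
  also have "\<dots> = (\<Sum>(k1,k2)\<in>{k. k\<^sup>2 dvd m1} \<times> {k. k\<^sup>2 dvd m2}. card (qroots t e (m1 div k1\<^sup>2)) * card (qroots t e (m2 div k2\<^sup>2)))"
  proof (intro sum.cong refl, clarify)
    fix k1 k2 assume k: "k1\<^sup>2 dvd m1" "k2\<^sup>2 dvd m2"
    then obtain a b where ab: "m1 = k1\<^sup>2 * a" "m2 = k2\<^sup>2 * b" by (auto elim!: dvdE)
    have pos: "k1 > 0" "k2 > 0" "a > 0" "b > 0" using ab assms by auto
    have "coprime a b" using assms(1) unfolding ab by (meson coprime_divisors dvd_triv_right)
    moreover have "m1 * m2 div (k1 * k2)\<^sup>2 = a * b" using pos by (simp add: ab power_mult_distrib mult_ac)
    moreover have "m1 div k1\<^sup>2 = a" "m2 div k2\<^sup>2 = b" using pos by (auto simp: ab)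
    ultimately show "card (qroots t e (m1 * m2 div (k1 * k2)\<^sup>2)) = card (qroots t e (m1 div k1\<^sup>2)) * card (qroots t e (m2 div k2\<^sup>2))"
      using card_qroots_mult pos by simp
  qed
  also have "\<dots> = card (hnf_pairs t e m1) * card (hnf_pairs t e m2)"
    using assms by (simp add: card_hnf_pairs sum_product sum.cartesian_product)
  finally show ?thesis .
qed

lemma card_qroots_1: "card (qroots t e 1) = 1"
proof -
  have "qroots t e 1 = {0}" by (auto simp: qroots_def)
  then show ?thesis by simp
qed

lemma card_hnf_pairs_prime_power:
  assumes "prime p"
  shows "card (hnf_pairs t e (p ^ a)) = (\<Sum>j\<le>a div 2. card (qroots t e (p ^ (a - 2 * j))))"
proof -
  have p1: "p > 1" using assms by (rule prime_gt_1_nat)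
  have "bij_betw (\<lambda>j. p ^ j) {..a div 2} {k. k\<^sup>2 dvd p ^ a}"
    unfolding bij_betw_def
  proof
    show "inj_on (\<lambda>j. p ^ j) {..a div 2}" using p1 by (auto intro!: inj_onI simp: power_inject_exp)
    show "(\<lambda>j. p ^ j) ` {..a div 2} = {k. k\<^sup>2 dvd p ^ a}"
    proof (intro equalityI subsetI)
      fix k assume k: "k \<in> {k. k\<^sup>2 dvd p ^ a}"
      then have "k dvd p ^ a" by (auto intro: dvd_trans[of _ "k\<^sup>2"] simp: power2_eq_square)
      then obtain j where j: "k = p ^ j" using divides_primepow_nat[OF assms] by auto
      then have "p ^ (j * 2) dvd p ^ a" using k by (simp add: power_mult)
      then have "j * 2 \<le> a" using p1 by (simp add: power_dvd_imp_le)
      then show "k \<in> (\<lambda>j. p ^ j) ` {..a div 2}" using j by auto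
    next
      fix k assume "k \<in> (\<lambda>j. p ^ j) ` {..a div 2}"
      then obtain j where "k = p ^ j" "j * 2 \<le> a" by auto
      then show "k \<in> {k. k\<^sup>2 dvd p ^ a}" by (simp add: le_imp_power_dvd flip: power_mult)
    qed
  qed
  from sum.reindex_bij_betw[OF this, of "\<lambda>k. card (qroots t e (p ^ a div k\<^sup>2))"]
  have "card (hnf_pairs t e (p ^ a)) = (\<Sum>j\<le>a div 2. card (qroots t e (p ^ a div (p ^ j)\<^sup>2)))"
    using p1 by (simp add: card_hnf_pairs)
  also have "\<dots> = (\<Sum>j\<le>a div 2. card (qroots t e (p ^ (a - 2 * j))))"
  proof (rule sum.cong)
    fix j assume "j \<in> {..a div 2}"
    then have "2 * j \<le> a" by auto
    then have "p ^ a div (p ^ j)\<^sup>2 = p ^ (a - 2 * j)" using p1 by (simp add: power_diff mult.commute flip: power_mult)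
    then show "card (qroots t e (p ^ a div (p ^ j)\<^sup>2)) = card (qroots t e (p ^ (a - 2 * j)))" by simp
  qed simp
  finally show ?thesis .
qed

section \<open>Roots of the minimal polynomial modulo prime powers\<close>

locale quad_arith =
  fixes t e d :: int
  assumes sqf: "squarefree d"
    and te: "(t = 0 \<and> e = d \<and> d mod 4 \<in> {2, 3}) \<or> (t = 1 \<and> 4 * e + 1 = d)"
begin

abbreviation g :: "int \<Rightarrow> int" where "g b \<equiv> b * b + t * b - e"

definition disc :: int where "disc = t * t + 4 * e"

text \<open>Phrased by roots instead of a Legendre symbol, so that \<open>p = 2\<close> is treated
  like the other primes; the condition on \<open>disc\<close> excludes ramified primes.\<close>

definition is_split :: "nat \<Rightarrow> bool" where
  "is_split p \<longleftrightarrow> prime p \<and> \<not> int p dvd disc \<and> (\<exists>b. int p dvd g b)"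

lemma disc_eq: "disc = (2 * b + t) * (2 * b + t) - 4 * g b"
  by (simp add: disc_def algebra_simps)

lemma g_diff: "g b - g c = (b - c) * (b + c + t)" by (simp add: algebra_simps)

text \<open>The derivative \<open>2 * b + t\<close> has square \<open>disc + 4 * g b\<close>, hence
  is invertible modulo \<open>p\<close> at a root. Newton's correction \<open>int p ^ a * z\<close>,
  with \<open>z\<close> from a linear congruence, gains one power of \<open>p\<close>.\<close>

lemma hensel:
  assumes "is_split p" "a \<ge> 1"
  shows "\<exists>b. int p ^ a dvd g b"
  using assms(2)
proof (induction a rule: dec_induct)
  case base then show ?case using assms(1) by (auto simp: is_split_def)
next
  case (step a)
  then obtain b where b: "int p ^ a dvd g b" by auto
  then obtain c where c: "g b = int p ^ a * c" by auto
  have pr: "prime (int p)" using assms(1) by (simp add: is_split_def)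
  have "int p dvd g b" using b step.hyps by (meson dvd_power dvd_trans less_le_trans zero_less_one)
  have "\<not> int p dvd 2 * b + t"
  proof
    assume "int p dvd 2 * b + t"
    then have "int p dvd (2 * b + t) * (2 * b + t) - 4 * g b" 
      by (intro dvd_diff dvd_mult \<open>int p dvd g b\<close>)
    then show False using assms(1) disc_eq[of b] by (simp add: is_split_def)
  qed
  then have "coprime (2 * b + t) (int p)" using pr by (meson coprime_commute prime_imp_coprime)
  then obtain z where z: "[(2 * b + t) * z = - c] (mod int p)"
  proof -
    obtain w where "[(2 * b + t) * w = 1] (mod int p)" using \<open>coprime (2 * b + t) (int p)\<close> cong_solve_coprime_int by blast
    from cong_scalar_right[OF this, of "- c"] show ?thesis using that[of "w * (- c)"] by (simp only: mult.assoc mult_1)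
  qed
  then have "int p dvd (2 * b + t) * z + c" by (simp add: cong_iff_dvd_diff)
  then obtain y where y: "(2 * b + t) * z + c = int p * y" by auto
  have aa: "int p ^ a * int p ^ a = int p * int p ^ a * int p ^ (a - 1)"
    using step.hyps by (cases a) auto
  have "g (b + int p ^ a * z) = g b + int p ^ a * ((2 * b + t) * z) + int p ^ a * int p ^ a * (z * z)"
    by (simp add: algebra_simps)
  also have "\<dots> = int p ^ a * ((2 * b + t) * z + c) + int p ^ a * int p ^ a * (z * z)"
    unfolding c by (simp add: algebra_simps)
  also have "\<dots> = int p * int p ^ a * (y + int p ^ (a - 1) * (z * z))"
    unfolding y aa by (simp add: algebra_simps)
  finally have "int p ^ Suc a dvd g (b + int p ^ a * z)" by simp
  then show ?case by blast
qed

text \<open>Besides \<open>b\<close> there is its conjugate \<open>- b - t\<close>; their difference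
  \<open>2 * b + t\<close> is prime to \<open>p\<close>. For another root \<open>c\<close>, only one
  of the factors \<open>c - b\<close> and \<open>c + b + t\<close> of \<open>g c - g b\<close> can
  be divisible by \<open>p\<close>, so the whole modulus divides that factor.\<close>

lemma card_qroots_split:
  assumes "is_split p" "a \<ge> 1"
  shows "card (qroots t e (p ^ a)) = 2"
proof -
  define q where "q = int (p ^ a)"
  have p: "prime p" using assms(1) by (simp add: is_split_def)
  have q0: "q > 0" using p by (simp add: q_def prime_gt_0_nat)
  have pq: "int p dvd q" using assms(2) by (simp add: q_def)
  obtain b where b: "q dvd g b" using hensel[OF assms] by (auto simp: q_def)
  have nd: "\<not> int p dvd 2 * b + t"
  proof
    assume "int p dvd 2 * b + t"
    then have "int p dvd (2 * b + t) * (2 * b + t) - 4 * g b" 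
      by (intro dvd_diff dvd_mult dvd_trans[OF pq b])
    then show False using assms(1) disc_eq[of b] by (simp add: is_split_def)
  qed
  have iff: "q dvd g c \<longleftrightarrow> [c = b] (mod q) \<or> [c = - b - t] (mod q)" for c
  proof
    assume "q dvd g c"
    then have "q dvd g c - g b" using b by (rule dvd_diff)
    then have dv: "q dvd (c - b) * (c + b + t)" by (simp only: g_diff)
    show "[c = b] (mod q) \<or> [c = - b - t] (mod q)"
    proof (cases "int p dvd c - b")
      case True
      have "\<not> int p dvd c + b + t"
      proof
        assume "int p dvd c + b + t"
        then have "int p dvd (c + b + t) - (c - b)" using True by (rule dvd_diff)
        then show False using nd by (simp add: algebra_simps)
      qed
      then have "coprime (int p) (c + b + t)" using p by (simp add: prime_imp_coprime)
      then have "coprime q (c + b + t)" unfolding q_def by (simp add: coprime_power_left_iff)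
      then have "q dvd c - b" using dv by (simp add: coprime_dvd_mult_left_iff)
      then show ?thesis by (simp add: cong_iff_dvd_diff)
    next
      case False
      then have "coprime (int p) (c - b)" using p by (simp add: prime_imp_coprime)
      then have "coprime q (c - b)" unfolding q_def by (simp add: coprime_power_left_iff)
      then have "q dvd c + b + t" using dv by (simp add: coprime_dvd_mult_right_iff)
      then show ?thesis by (simp add: cong_iff_dvd_diff algebra_simps)
    qed
  next
    assume "[c = b] (mod q) \<or> [c = - b - t] (mod q)"
    then have "q dvd c - b \<or> q dvd c + b + t" by (auto simp: cong_iff_dvd_diff algebra_simps)
    then have "q dvd g c - g b" unfolding g_diff by auto
    then have "q dvd (g c - g b) + g b" using b by (rule dvd_add)
    then show "q dvd g c" by (simp only: diff_add_cancel)
  qed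
  have "qroots t e (p ^ a) = {b mod q, (- b - t) mod q}"
  proof (intro equalityI subsetI)
    fix c assume "c \<in> qroots t e (p ^ a)"
    then have c: "0 \<le> c" "c < q" "q dvd g c" by (auto simp: qroots_def q_def)
    then have "c mod q = b mod q \<or> c mod q = (- b - t) mod q" using iff[of c] by (auto simp: cong_def)
    then show "c \<in> {b mod q, (- b - t) mod q}" using c by auto
  next
    fix c assume c: "c \<in> {b mod q, (- b - t) mod q}"
    then have "q dvd g c" unfolding iff by (auto simp: cong_def)
    moreover have "0 \<le> c" "c < q" using c q0 by auto
    ultimately show "c \<in> qroots t e (p ^ a)" by (simp add: qroots_def q_def)
  qed
  moreover have "b mod q \<noteq> (- b - t) mod q"
  proof
    assume "b mod q = (- b - t) mod q"
    then have "q dvd b - (- b - t)" by (simp add: mod_eq_dvd_iff)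
    then have "int p dvd b - (- b - t)" using pq dvd_trans by blast
    then show False using nd by (simp add: algebra_simps)
  qed
  ultimately show ?thesis by simp
qed

lemma odd_prime_sq_disc:
  assumes "prime p" "p \<noteq> 2"
  shows "\<not> (int p)\<^sup>2 dvd disc"
proof
  assume "(int p)\<^sup>2 dvd disc"
  moreover have "coprime ((int p)\<^sup>2) 4"
  proof -
    have "coprime p 2" using assms by (metis primes_coprime two_is_prime_nat)
    then have "coprime (int p) (int 2)" by (simp only: coprime_int_iff)
    then have "coprime ((int p)\<^sup>2) ((int 2)\<^sup>2)"
      by (intro coprime_power_left_iff[THEN iffD2] coprime_power_right_iff[THEN iffD2] disjI1)
    then show ?thesis by (simp only: of_nat_numeral power2_eq_square) simp
  qed
  ultimately have "(int p)\<^sup>2 dvd d" using te by (auto simp: disc_def coprime_dvd_mult_right_iff add.commute)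
  then have "int p dvd 1" using sqf squarefreeD by blast
  then show False using assms(1) by (simp add: prime_nat_iff)
qed

text \<open>If a root exists, \<open>p\<close> is ramified, and then the conjugate roots coincide
  modulo \<open>p\<close>. A root modulo \<open>p^2\<close> would make \<open>p^2\<close> divide the
  discriminant for odd \<open>p\<close>, against \<open>squarefree d\<close>; for
  \<open>p = 2\<close> it would make \<open>d\<close> a square modulo 4, although
  \<open>d mod 4\<close> is 2 or 3.\<close>

lemma card_qroots_nonsplit:
  assumes "prime p" "\<not> is_split p"
  shows "card (qroots t e p) \<le> 1" and "a \<ge> 2 \<Longrightarrow> qroots t e (p ^ a) = {}"
proof -
  have pr: "prime (int p)" using assms(1) by simp
  have ram: "int p dvd disc" if "int p dvd g b" for b using assms that by (auto simp: is_split_def)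
  have uniq: "b = c" if "b \<in> qroots t e p" "c \<in> qroots t e p" for b c
  proof -
    have b: "0 \<le> b" "b < int p" "int p dvd g b" and c: "0 \<le> c" "c < int p" "int p dvd g c" using that by (auto simp: qroots_def)
    note D = ram[OF b(3)]
    have "int p dvd b - c"
    proof (cases "p = 2")
      case True
      have "even t" using D True te by (auto simp: disc_def)
      have "int p dvd g b - g c" by (rule dvd_diff[OF b(3) c(3)])
      then have "int p dvd (b - c) * (b + c + t)" by (simp only: g_diff)
      then have "even ((b - c) * (b + c + t))" using True by (simp only: of_nat_numeral)
      then show ?thesis using True \<open>even t\<close> by auto
    next
      case False
      have div: "int p dvd 2 * b + t" if "int p dvd g b" for b
      proof -
        have "int p dvd disc + 4 * g b" by (intro dvd_add dvd_mult D that)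
        then have "int p dvd (2 * b + t) * (2 * b + t)" by (simp add: disc_eq[of b])
        then show ?thesis using pr prime_dvd_mult_iff by blast
      qed
      have "int p dvd (2 * b + t) - (2 * c + t)" using div b(3) c(3) by (intro dvd_diff) auto
      then have "int p dvd 2 * (b - c)" by (simp add: algebra_simps)
      moreover have "\<not> int p dvd 2"
      proof
        assume "int p dvd 2"
        then have "p dvd 2" by presburger
        then show False using assms(1) False primes_dvd_imp_eq two_is_prime_nat by blast
      qed
      ultimately show ?thesis using pr prime_dvd_mult_iff by blast
    qed
    moreover have "\<bar>b - c\<bar> < int p" using b c by auto
    ultimately show ?thesis using zdvd_not_zless[of "\<bar>b - c\<bar>" "int p"] by (cases "b = c") auto
  qed
  then show "card (qroots t e p) \<le> 1" using card_le_Suc0_iff_eq[OF finite_qroots, of t e p] by auto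
  show "qroots t e (p ^ a) = {}" if "a \<ge> 2"
  proof (rule ccontr)
    assume "qroots t e (p ^ a) \<noteq> {}"
    then obtain b where b: "int p ^ a dvd g b" by (auto simp: qroots_def)
    moreover have "(int p)\<^sup>2 dvd int p ^ a" using that by (rule le_imp_power_dvd)
    ultimately have b2: "(int p)\<^sup>2 dvd g b" using dvd_trans by blast
    then have "int p dvd g b" by (auto intro: dvd_trans[of _ "(int p)\<^sup>2"] simp: power2_eq_square)
    note D = ram[OF this]
    show False
    proof (cases "p = 2")
      case True
      have "even t" using D True te by (auto simp: disc_def)
      then have t0: "t = 0" "e = d" "d mod 4 \<in> {2,3}" using te by auto
      have "4 dvd b * b - d" using b2 True t0 by simp
      then have "(b * b) mod 4 = d mod 4" by (simp add: mod_eq_dvd_iff)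
      moreover have "(b * b) mod 4 \<in> {0, 1}"
      proof -
        have "b mod 4 \<in> {0,1,2,3}" by auto
        moreover have "(b * b) mod 4 = ((b mod 4) * (b mod 4)) mod 4" by (simp add: mod_mult_eq)
        ultimately show ?thesis by auto
      qed
      ultimately show False using t0(3) by auto
    next
      case False
      have "int p dvd disc + 4 * g b" by (intro dvd_add dvd_mult D \<open>int p dvd g b\<close>)
      then have "int p dvd (2 * b + t) * (2 * b + t)" by (simp add: disc_eq[of b])
      then have "int p dvd 2 * b + t" using pr prime_dvd_mult_iff by blast
      then have sq: "(int p)\<^sup>2 dvd (2 * b + t) * (2 * b + t)" by (simp add: power2_eq_square mult_dvd_mono)
      have "(int p)\<^sup>2 dvd (2 * b + t) * (2 * b + t) - 4 * g b" by (rule dvd_diff[OF sq dvd_mult[OF b2]])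
      then show False using odd_prime_sq_disc[OF assms(1) False] by (simp add: disc_eq[of b])
    qed
  qed
qed

lemma count_split:
  assumes "is_split p"
  shows "card (hnf_pairs t e (p ^ a)) = a + 1"
proof -
  have p: "prime p" using assms by (simp add: is_split_def)
  \<comment> \<open>The modulus 1 has a single root where the others have two; it occurs only for
    even \<open>a\<close>, and this makes the total \<open>a + 1\<close> for either parity.\<close>
  have "card (hnf_pairs t e (p ^ a)) = (\<Sum>j\<le>a div 2. if a = 2 * j then 1 else 2)"
    unfolding card_hnf_pairs_prime_power[OF p]
  proof (rule sum.cong)
    fix j assume j: "j \<in> {..a div 2}"
    show "card (qroots t e (p ^ (a - 2 * j))) = (if a = 2 * j then 1 else 2)"
    proof (cases "a = 2 * j")
      case True then show ?thesis using card_qroots_1 by simp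
    next
      case False
      then have "a - 2 * j \<ge> 1" using j by auto
      then show ?thesis using card_qroots_split[OF assms] False by simp
    qed
  qed simp
  also have "\<dots> = a + 1"
  proof (cases "even a")
    case True
    then obtain k where k: "a = 2 * k" by auto
    have "(\<Sum>j\<le>k. if a = 2 * j then 1 else 2) = (\<Sum>j<k. if a = 2 * j then 1 else 2) + (1::nat)"
      by (simp add: k flip: lessThan_Suc_atMost)
    also have "(\<Sum>j<k. if a = 2 * j then 1 else 2) = (\<Sum>j<k. 2::nat)" by (rule sum.cong) (auto simp: k)
    finally show ?thesis by (simp add: k)
  next
    case False
    then have "(\<Sum>j\<le>a div 2. if a = 2 * j then 1 else 2) = (\<Sum>j\<le>a div 2. 2::nat)" by (intro sum.cong) auto
    also have "\<dots> = a + 1" using False by (simp, presburger)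
    finally show ?thesis .
  qed
  finally show ?thesis .
qed

text \<open>Moduli \<open>p ^ b\<close> with \<open>b \<ge> 2\<close> have no roots, so only the
  term with \<open>a - 2 * j\<close> equal to 0 or 1 survives.\<close>

lemma count_nonsplit:
  assumes "prime p" "\<not> is_split p"
  shows "card (hnf_pairs t e (p ^ a)) \<le> 1"
proof -
  have "card (hnf_pairs t e (p ^ a)) \<le> (\<Sum>j\<le>a div 2. if j = a div 2 then 1 else 0)"
    unfolding card_hnf_pairs_prime_power[OF assms(1)]
  proof (rule sum_mono)
    fix j assume j: "j \<in> {..a div 2}"
    show "card (qroots t e (p ^ (a - 2 * j))) \<le> (if j = a div 2 then 1 else 0)"
    proof (cases "j = a div 2")
      case True
      then have "a - 2 * j = 0 \<or> a - 2 * j = 1" by presburger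
      then show ?thesis using card_qroots_1 card_qroots_nonsplit(1)[OF assms] True by auto
    next
      case False
      then have "a - 2 * j \<ge> 2" using j by auto
      then show ?thesis using card_qroots_nonsplit(2)[OF assms] False by simp
    qed
  qed
  then show ?thesis by simp
qed

lemma count_1: "card (hnf_pairs t e 1) = 1"
  using card_hnf_pairs[of 1 t e] card_qroots_1[of t e] by (simp add: power2_eq_square)

end

section \<open>Rings of integers of quadratic fields\<close>

text \<open>Inverting the inductive definition of \<open>dimension\<close> twice exposes two
  successive line extensions of the zero space.\<close>

lemma dimension_two_span:
  fixes K :: "'a :: field_char_0 set"
  assumes "ring.dimension ring_of_type_algebra 2 \<rat> K"
  obtains u v where "v \<noteq> 0" "\<forall>a\<in>\<rat>. u \<noteq> a * v"
    "K = {a * u + b * v | a b. a \<in> \<rat> \<and> b \<in> \<rat>}"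
proof -
  interpret ring "ring_of_type_algebra :: 'a ring" by (rule ring_from_type_algebra)
  have zero: "\<zero>\<^bsub>ring_of_type_algebra\<^esub> = (0::'a)" by (simp add: ring_of_type_algebra_def)
  have ops: "x \<otimes>\<^bsub>ring_of_type_algebra\<^esub> y = x * y" "x \<oplus>\<^bsub>ring_of_type_algebra\<^esub> y = x + y" for x y :: 'a
    by (simp_all add: ring_of_type_algebra_def)
  have d2: "dimension (Suc (Suc 0)) \<rat> K" using assms by (simp add: numeral_2_eq_2)
  have dim_Suc: "\<exists>v E'. dimension n \<rat> E' \<and> v \<notin> E' \<and> E = line_extension \<rat> v E'"
    if "dimension (Suc n) \<rat> E" for n and E :: "'a set"
    using that by (cases rule: dimension.cases) auto
  have zero_dim: "E = {0}" if "dimension 0 \<rat> E" for E :: "'a set"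
    using that by (cases rule: dimension.cases) (auto simp: zero)
  have ext: "line_extension \<rat> v E = {a * v + y | a y. a \<in> \<rat> \<and> y \<in> E}" for v and E :: "'a set"
    by (rule Set.set_eqI, unfold line_extension_mem_iff ops mem_Collect_eq, blast)
  obtain u E1 where u: "dimension (Suc 0) \<rat> E1" "u \<notin> E1" "K = line_extension \<rat> u E1"
    using dim_Suc[OF d2] by blast
  obtain v E0 where v: "dimension 0 \<rat> E0" "v \<notin> E0" "E1 = line_extension \<rat> v E0"
    using dim_Suc[OF u(1)] by blast
  have E1: "E1 = {b * v | b. b \<in> \<rat>}" using v(3) zero_dim[OF v(1)] by (auto simp: ext)
  show ?thesis
  proof (rule that[of v u])
    show "v \<noteq> 0" using v(2) zero_dim[OF v(1)] by auto
    show "\<forall>a\<in>\<rat>. u \<noteq> a * v" using u(2) by (auto simp: E1)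
    show "K = {a * u + b * v | a b. a \<in> \<rat> \<and> b \<in> \<rat>}"
      using u(3) by (auto simp: E1 ext)
  qed
qed

lemma rat_span_change_generator:
  fixes x y :: "'a :: field_char_0"
  assumes "p \<in> \<rat>" "q \<in> \<rat>" "q \<noteq> 0" "y = p + q * x"
  shows "{a + b * x | a b. a \<in> \<rat> \<and> b \<in> \<rat>} = {a + b * y | a b. a \<in> \<rat> \<and> b \<in> \<rat>}"
proof (intro equalityI subsetI)
  fix z assume "z \<in> {a + b * x | a b. a \<in> \<rat> \<and> b \<in> \<rat>}"
  then obtain a b where "a \<in> \<rat>" "b \<in> \<rat>" "z = a + b * x" by blast
  moreover from this assms have "z = (a - b / q * p) + (b / q) * y" by (simp add: field_simps)
  moreover have "a - b / q * p \<in> \<rat>" "b / q \<in> \<rat>" using \<open>a \<in> \<rat>\<close> \<open>b \<in> \<rat>\<close> assms by auto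
  ultimately show "z \<in> {a + b * y | a b. a \<in> \<rat> \<and> b \<in> \<rat>}" by blast
next
  fix z assume "z \<in> {a + b * y | a b. a \<in> \<rat> \<and> b \<in> \<rat>}"
  then obtain a b where "a \<in> \<rat>" "b \<in> \<rat>" "z = a + b * y" by blast
  moreover from this assms have "z = (a + b * p) + (b * q) * x" by (simp add: field_simps)
  moreover have "a + b * p \<in> \<rat>" "b * q \<in> \<rat>" using \<open>a \<in> \<rat>\<close> \<open>b \<in> \<rat>\<close> assms by auto
  ultimately show "z \<in> {a + b * x | a b. a \<in> \<rat> \<and> b \<in> \<rat>}" by blast
qed

lemma rat_affine_irrational:
  fixes x :: "'a :: field_char_0"
  assumes "p \<in> \<rat>" "q \<in> \<rat>" "q \<noteq> 0" "x \<notin> \<rat>"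
  shows "p + q * x \<notin> \<rat>"
proof
  assume "p + q * x \<in> \<rat>"
  then have "(p + q * x - p) / q \<in> \<rat>" using assms by (intro Rats_divide Rats_diff)
  then show False using assms by simp
qed

lemma quadratic_field_generator:
  fixes K :: "'a :: field_char_0 set"
  assumes "quadratic_field K"
  obtains x where "x \<notin> \<rat>" "x \<in> K" "x * x \<in> K" "K = {a + b * x | a b. a \<in> \<rat> \<and> b \<in> \<rat>}"
proof -
  have sub: "subring K (ring_of_type_algebra :: 'a ring)"
    using assms subfieldE(1) unfolding quadratic_field_def by blast
  have one: "1 \<in> K" using subringE(3)[OF sub] by (simp add: ring_of_type_algebra_def)
  have mult: "a * b \<in> K" if "a \<in> K" "b \<in> K" for a b
    using subringE(6)[OF sub that] by (simp add: ring_of_type_algebra_def)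
  have dim: "ring.dimension ring_of_type_algebra 2 \<rat> K"
    using assms unfolding quadratic_field_def by (rule conjunct2)
  obtain v u where uv: "v \<noteq> 0" "\<forall>a\<in>\<rat>. u \<noteq> a * v"
    and K: "K = {a * u + b * v | a b. a \<in> \<rat> \<and> b \<in> \<rat>}"
    by (rule dimension_two_span[OF dim])
  have uK: "u \<in> K" unfolding K by (rule CollectI, rule exI[of _ 1], rule exI[of _ 0]) auto
  have vK: "v \<in> K" unfolding K by (rule CollectI, rule exI[of _ 0], rule exI[of _ 1]) auto
  have "\<exists>x\<in>K. x \<notin> \<rat>"
  proof (rule ccontr)
    assume "\<not> ?thesis"
    then have "u / v \<in> \<rat>" using uK vK by auto
    from bspec[OF uv(2) this] uv(1) show False by simp
  qed
  then obtain x where x: "x \<in> K" "x \<notin> \<rat>" by blast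
  obtain a b where ab: "a \<in> \<rat>" "b \<in> \<rat>" "1 = a * u + b * v" using one unfolding K by blast
  obtain c d where cd: "c \<in> \<rat>" "d \<in> \<rat>" "x = c * u + d * v" using x(1) unfolding K by blast
  \<comment> \<open>The basis \<open>u, v\<close> need not contain 1. \<open>D\<close> is the
    determinant of the coordinates of \<open>1\<close> and \<open>x\<close>; Cramer's rule expresses
    \<open>D * u\<close> and \<open>D * v\<close> by \<open>1\<close> and \<open>x\<close>, and
    \<open>D = 0\<close> would make \<open>x\<close> rational.\<close>
  define D where "D = a * d - b * c"
  have D_rat: "D \<in> \<rat>" unfolding D_def using ab(1,2) cd(1,2) by auto
  have Du: "D * u = d - b * x" and Dv: "D * v = a * x - c"
  proof -
    have "d - b * x = d * 1 - b * x" by simp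
    also have "\<dots> = D * u" unfolding D_def by (subst ab(3), subst cd(3)) (simp add: algebra_simps)
    finally show "D * u = d - b * x" ..
    have "a * x - c = a * x - c * 1" by simp
    also have "\<dots> = D * v" unfolding D_def by (subst ab(3), subst cd(3)) (simp add: algebra_simps)
    finally show "D * v = a * x - c" ..
  qed
  have "D \<noteq> 0"
  proof
    assume D: "D = 0"
    have "a \<noteq> 0 \<or> b \<noteq> 0"
    proof (rule ccontr)
      assume "\<not> ?thesis"
      then have "a * u + b * v = 0" by simp
      with ab(3) have "(1 :: 'a) = 0" by (rule trans)
      then show False by simp
    qed
    then have "x = c / a \<or> x = d / b" using Du Dv D by (auto simp: field_simps)
    then show False using x(2) ab(1,2) cd(1,2) by auto
  qed
  have "K = {r + s * x | r s. r \<in> \<rat> \<and> s \<in> \<rat>}"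
  proof (intro equalityI subsetI)
    fix z assume "z \<in> K"
    then obtain k l where kl: "k \<in> \<rat>" "l \<in> \<rat>" "z = k * u + l * v" unfolding K by blast
    have "D * z = k * (D * u) + l * (D * v)" using kl by (simp add: algebra_simps)
    also have "\<dots> = (k * d - l * c) + (l * a - k * b) * x" unfolding Du Dv by (simp add: algebra_simps)
    finally have "z = ((k * d - l * c) + (l * a - k * b) * x) / D"
      using \<open>D \<noteq> 0\<close> by (simp add: nonzero_eq_divide_eq mult.commute[of D])
    then have "z = (k * d - l * c) / D + ((l * a - k * b) / D) * x" by (simp add: add_divide_distrib)
    moreover have "(k * d - l * c) / D \<in> \<rat>" "(l * a - k * b) / D \<in> \<rat>"
      using kl(1,2) ab(1,2) cd(1,2) D_rat by auto
    ultimately show "z \<in> {r + s * x | r s. r \<in> \<rat> \<and> s \<in> \<rat>}"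
      by (intro CollectI exI conjI)
  next
    fix z assume "z \<in> {r + s * x | r s. r \<in> \<rat> \<and> s \<in> \<rat>}"
    then obtain r s where rs: "r \<in> \<rat>" "s \<in> \<rat>" "z = r * 1 + s * x"
      unfolding mult_1_right by blast
    have "z = (r * a + s * c) * u + (r * b + s * d) * v"
      unfolding rs(3) by (subst ab(3), subst cd(3)) (simp add: algebra_simps)
    moreover have "r * a + s * c \<in> \<rat>" "r * b + s * d \<in> \<rat>" using rs(1,2) ab(1,2) cd(1,2) by auto
    ultimately show "z \<in> K" unfolding K by blast
  qed
  with x(2,1) mult[OF x(1) x(1)] show ?thesis by (rule that)
qed

lemma quadratic_field_sqrt_generator:
  fixes K :: "'a :: field_char_0 set"
  assumes "quadratic_field K"
  obtains w and d :: int where "w \<notin> \<rat>" "w * w = of_int d" "squarefree d"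
    "K = {a + b * w | a b. a \<in> \<rat> \<and> b \<in> \<rat>}"
proof -
  obtain x where x: "x \<notin> \<rat>" "x * x \<in> K" and K: "K = {a + b * x | a b. a \<in> \<rat> \<and> b \<in> \<rat>}"
    by (rule quadratic_field_generator[OF assms])
  obtain r s where rs: "r \<in> \<rat>" "s \<in> \<rat>" "x * x = r + s * x" using x(2) unfolding K by blast
  \<comment> \<open>Completing the square; the shape \<open>p + 1 * x\<close> matches the lemmas on
    a change of generator.\<close>
  define y where "y = - s / 2 + 1 * x"
  have "y * y = s * s / 4 + (x * x - s * x)" unfolding y_def by (simp add: field_simps)
  then have y2: "y * y = r + s * s / 4" unfolding rs(3) by simp
  have "r + s * s / 4 \<in> \<rat>" using rs by auto
  then obtain m n where mn: "n > 0" "r + s * s / 4 = of_int m / (of_int n :: 'a)"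
    by (rule Rats_cases') blast
  define N where "N = m * n"
  define k where "k = square_part N"
  define d where "d = squarefree_part N"
  have s2: "- s / 2 \<in> \<rat>" using rs by auto
  have y_irr: "y \<notin> \<rat>" unfolding y_def by (rule rat_affine_irrational[OF s2 _ _ x(1)]) auto
  have Ky: "K = {a + b * y | a b. a \<in> \<rat> \<and> b \<in> \<rat>}"
    unfolding K by (rule rat_span_change_generator[OF s2 _ _ y_def]) auto
  have "y \<noteq> 0" using y_irr by auto
  then have "y * y \<noteq> 0" by simp
  then have "m \<noteq> 0" unfolding y2 mn(2) by auto
  then have N0: "N \<noteq> 0" using mn(1) by (simp add: N_def)
  have N: "N = d * k\<^sup>2" unfolding d_def k_def by (rule squarefree_decompose)
  have k0: "k \<noteq> 0" using N N0 by auto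
  \<comment> \<open>The scaling is chosen for \<open>(n/k)^2 * (m/n) = m * n / k^2\<close>, which is
    the squarefree part of \<open>m * n\<close>.\<close>
  define w where "w = 0 + (of_int n / of_int k) * y"
  have q: "of_int n / of_int k \<in> (\<rat> :: 'a set)" "of_int n / of_int k \<noteq> (0 :: 'a)"
    using mn(1) k0 by auto
  have "w * w = (of_int n * of_int n / (of_int k * of_int k)) * (y * y)"
    unfolding w_def by (simp add: field_simps)
  also have "\<dots> = of_int N / (of_int k * of_int k)"
    unfolding y2 mn(2) N_def using mn(1) k0 by (simp add: field_simps)
  also have "\<dots> = of_int d" unfolding N using k0 by (simp add: power2_eq_square)
  finally have w2: "w * w = of_int d" .
  have sqf: "squarefree d" unfolding d_def by (simp add: N0)
  have irr: "w \<notin> \<rat>" unfolding w_def by (rule rat_affine_irrational) (use q y_irr in auto)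
  have "K = {a + b * w | a b. a \<in> \<rat> \<and> b \<in> \<rat>}"
    unfolding Ky by (rule rat_span_change_generator[OF _ q w_def]) auto
  with irr w2 sqf show ?thesis by (rule that)
qed

section \<open>Integrality in a quadratic field\<close>

lemma rat_lin_indep:
  fixes x :: "'a :: field_char_0"
  assumes "a \<in> \<rat>" "b \<in> \<rat>" "x \<notin> \<rat>" "a + b * x = 0"
  shows "a = 0 \<and> b = 0"
proof -
  have "b = 0"
  proof (rule ccontr)
    assume "b \<noteq> 0"
    then have "a + b * x \<notin> \<rat>" using rat_affine_irrational assms by blast
    then show False using assms(4) by simp
  qed
  then show ?thesis using assms by simp
qed

text \<open>Gauss' lemma: the primitive integer quadratic killing an irrational algebraic integer divides
  a monic integer polynomial, so its leading coefficient is a unit.\<close>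

lemma algebraic_int_quadratic:
  fixes x :: "'a :: field_char_0"
  assumes x: "algebraic_int x" "x \<notin> \<rat>" and pq: "p \<in> \<rat>" "q \<in> \<rat>" "x * x = p * x + q"
  shows "p \<in> \<int> \<and> q \<in> \<int>"
proof -
  obtain P where P: "poly (map_poly of_int P) x = 0" "lead_coeff P = 1"
    using x(1) algebraic_int_altdef_ipoly by blast
  obtain a m where am: "m > 0" "p = of_int a / of_int m" using pq(1) by (rule Rats_cases') blast
  obtain c n where cn: "n > 0" "q = of_int c / of_int n" using pq(2) by (rule Rats_cases') blast
  define Q0 where "Q0 = [:- c * m, - a * n, m * n:]"
  define Q where "Q = primitive_part Q0"
  have mn: "m * n \<noteq> 0" using am cn by simp
  have Q0_nz: "Q0 \<noteq> 0" and deg0: "degree Q0 = 2" using mn by (auto simp: Q0_def)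
  have cQ: "Polynomial.content Q = 1" using Q0_nz by (simp add: Q_def)
  have degQ: "degree Q = 2" using deg0 by (simp add: Q_def)
  have ev0: "poly (map_poly of_int Q0) x = 0"
  proof -
    have "poly (map_poly of_int Q0) x = of_int (m * n) * (x * x - p * x - q)"
      unfolding Q0_def using am cn by (simp add: field_simps map_poly_pCons)
    then show ?thesis using pq(3) by simp
  qed
  have hom_smult: "poly (map_poly of_int (smult k F)) x = of_int k * poly (map_poly of_int F) x" for k F
  proof -
    have "map_poly of_int (smult k F) = smult (of_int k :: 'a) (map_poly of_int F)"
      by (intro poly_eqI) (simp add: coeff_map_poly)
    then show ?thesis by simp
  qed
  have hom_mult: "poly (map_poly of_int (F * G)) x = poly (map_poly of_int F) x * poly (map_poly of_int G) x" for F G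
  proof -
    have "map_poly of_int (F * G) = map_poly (of_int :: int \<Rightarrow> 'a) F * map_poly of_int G"
      by (intro poly_eqI) (simp add: coeff_map_poly coeff_mult)
    then show ?thesis by simp
  qed
  have hom_add: "poly (map_poly of_int (F + G)) x = poly (map_poly of_int F) x + poly (map_poly of_int G) x" for F G
  proof -
    have "map_poly of_int (F + G) = map_poly (of_int :: int \<Rightarrow> 'a) F + map_poly of_int G"
      by (intro poly_eqI) (simp add: coeff_map_poly)
    then show ?thesis by simp
  qed
  have evQ: "poly (map_poly of_int Q) x = 0"
  proof -
    have "poly (map_poly of_int (smult (Polynomial.content Q0) Q)) x = 0" using ev0 by (simp add: Q_def)
    then show ?thesis using Q0_nz unfolding hom_smult by simp
  qed
  define R where "R = pseudo_mod P Q"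
  have Qnz: "Q \<noteq> 0" using degQ by auto
  obtain k S where kS: "k \<noteq> 0" "smult k P = Q * S + R"
    using pseudo_mod(1)[OF Qnz, of P] unfolding R_def by blast
  have Rdeg: "R = 0 \<or> degree R < 2" using pseudo_mod(2)[OF Qnz, of P] unfolding R_def degQ by blast
  have "poly (map_poly of_int R) x = 0"
  proof -
    have "poly (map_poly of_int (smult k P)) x = 0" unfolding hom_smult P(1) by simp
    then show ?thesis unfolding kS(2) hom_add hom_mult evQ by simp
  qed
  moreover have Rform: "R = [:coeff R 0, coeff R 1:]"
  proof (rule poly_eqI)
    fix i show "coeff R i = coeff [:coeff R 0, coeff R 1:] i"
    proof (cases "i < 2")
      case True then have "i = 0 \<or> i = 1" by auto
      then show ?thesis by auto
    next
      case False
      then obtain j where "i = Suc (Suc j)" by (metis add_2_eq_Suc le_add_diff_inverse not_less)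
      moreover from this have "coeff R i = 0" using Rdeg by (auto intro: coeff_eq_0)
      ultimately show ?thesis by simp
    qed
  qed
  moreover have "poly (map_poly of_int [:coeff R 0, coeff R 1:]) x = of_int (coeff R 0) + of_int (coeff R 1) * x"
    by (simp add: map_poly_pCons)
  ultimately have "of_int (coeff R 0) + of_int (coeff R 1) * x = 0" by metis
  then have "of_int (coeff R 0) = (0::'a) \<and> of_int (coeff R 1) = (0::'a)"
    by (intro rat_lin_indep[OF _ _ x(2)]) auto
  then have R0: "R = 0" using Rform by simp
  have "Polynomial.content P dvd 1" using content_dvd_coeff[of P "degree P"] P(2) by simp
  then have cP: "Polynomial.content P = 1" by (metis is_unit_content_iff)
  \<comment> \<open>Contents are compared in \<open>smult k P = Q * S\<close>: \<open>P\<close> and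
    \<open>Q\<close> being primitive, \<open>S\<close> has content \<open>k\<close> up to sign. So
    \<open>k\<close> cancels, and the leading coefficient of \<open>Q\<close> divides 1.\<close>
  have "normalize k = Polynomial.content S" using kS(2) R0 cP cQ by (metis add.right_neutral content_mult content_smult mult.right_neutral mult_1)
  then have "k dvd coeff S i" for i by (metis content_dvd_coeff normalize_dvd_iff)
  then have "k dvd coeff S (degree S)" .
  then obtain l where l: "lead_coeff S = k * l" by blast
  have "k * lead_coeff P = lead_coeff Q * lead_coeff S"
    using kS(2) R0 lead_coeff_mult[of Q S] lead_coeff_smult[of k P] by simp
  then have "lead_coeff Q * l = 1" using P(2) l kS(1) by simp
  then have lQ: "lead_coeff Q = 1 \<or> lead_coeff Q = -1" by (metis zmult_eq_1_iff)
  have "smult (Polynomial.content Q0) Q = Q0" by (simp add: Q_def)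
  then have co: "coeff Q0 i = Polynomial.content Q0 * coeff Q i" for i by (metis coeff_smult)
  have l2: "coeff Q 2 = 1 \<or> coeff Q 2 = -1" using lQ degQ by simp
  have e: "m * n = Polynomial.content Q0 * coeff Q 2" "- a * n = Polynomial.content Q0 * coeff Q 1" "- c * m = Polynomial.content Q0 * coeff Q 0"
    using co[of 2] co[of 1] co[of 0] by (simp_all add: Q0_def numeral_2_eq_2)
  define g where "g = coeff Q 2"
  have g: "g * g = 1" using l2 by (auto simp: g_def)
  have "Polynomial.content Q0 = m * n * g" using e(1) g by (simp add: g_def mult.assoc)
  then have "n * (- a) = n * (m * g * coeff Q 1)" "m * (- c) = m * (n * g * coeff Q 0)"
    using e(2,3) by (simp_all add: mult_ac)
  then have "- a = m * g * coeff Q 1" "- c = n * g * coeff Q 0"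
    using am(1) cn(1) by (metis mult_left_cancel less_irrefl)+
  then have ac: "a = m * (- g * coeff Q 1)" "c = n * (- g * coeff Q 0)"
    by (simp_all add: mult_ac minus_equation_iff[of a] minus_equation_iff[of c])
  have "p = of_int (- g * coeff Q 1)" "q = of_int (- g * coeff Q 0)"
    unfolding am(2) cn(2) by (subst ac, use am cn in simp)+
  then show ?thesis by (metis Ints_of_int)
qed


lemma square_mult_squarefree_int:
  fixes z :: "'a :: field_char_0" and d :: int
  assumes "z \<in> \<rat>" "squarefree d" "z * z * of_int d \<in> \<int>"
  shows "z \<in> \<int>"
proof -
  obtain u v where uv: "v > 0" "coprime u v" "z = of_int u / of_int v"
    using assms(1) by (rule Rats_cases')
  obtain M where "z * z * of_int d = of_int M" using assms(3) by (auto elim: Ints_cases)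
  then have "of_int (u * u * d) = (of_int (M * (v * v)) :: 'a)"
    using uv by (simp add: field_simps)
  then have "u * u * d = M * (v * v)" by (simp only: of_int_eq_iff)
  then have "v\<^sup>2 dvd u\<^sup>2 * d" by (simp add: power2_eq_square)
  moreover have "coprime (v\<^sup>2) (u\<^sup>2)" using uv(2) by (simp add: coprime_commute)
  ultimately have "v\<^sup>2 dvd d" by (simp add: coprime_dvd_mult_right_iff)
  then have "v dvd 1" using assms(2) unfolding squarefree_def by blast
  then have "v = 1" using uv(1) by simp
  then show ?thesis using uv(3) by simp
qed

lemma square_mod_4_int: "(n * n) mod 4 = (if even n then 0 else 1 :: int)"
proof -
  have "n mod 4 \<in> {0,1,2,3}" by auto
  moreover have "(n * n) mod 4 = ((n mod 4) * (n mod 4)) mod 4" by (simp add: mod_mult_eq)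
  moreover have "even n \<longleftrightarrow> even (n mod 4)" by presburger
  ultimately show ?thesis by auto
qed

lemma squarefree_mod_4_int:
  assumes "squarefree (d :: int)" shows "d mod 4 \<in> {1,2,3}"
proof -
  have "\<not> 2\<^sup>2 dvd d"
  proof
    assume "2\<^sup>2 dvd d"
    then have "is_unit (2 :: int)" using assms unfolding squarefree_def by blast
    then show False by simp
  qed
  then have "d mod 4 \<noteq> 0" by (simp add: dvd_eq_mod_eq_0)
  moreover have "d mod 4 \<in> {0,1,2,3}" by auto
  ultimately show ?thesis by auto
qed

lemma algebraic_int_of_quadratic:
  fixes om :: "'a :: field_char_0"
  assumes "om * om = of_int t * om + of_int e"
  shows "algebraic_int (of_int a + of_int b * om)"
proof -
  define x where "x = of_int a + of_int b * om"
  define P where "P = [:a * a + a * b * t - b * b * e, - (2 * a + b * t), 1:]"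
  have "x * x = of_int (a * a) + of_int (2 * a * b) * om + of_int (b * b) * (om * om)"
    unfolding x_def by (simp add: algebra_simps)
  also have "\<dots> = of_int (2 * a + b * t) * x - of_int (a * a + a * b * t - b * b * e)"
    unfolding assms x_def by (simp add: algebra_simps)
  finally have "poly (map_poly of_int P) x = 0" unfolding P_def by (simp add: map_poly_pCons algebra_simps)
  moreover have "lead_coeff P = 1" by (simp add: P_def)
  ultimately show ?thesis unfolding x_def algebraic_int_altdef_ipoly by blast
qed

theorem quadratic_field_integers:
  fixes K :: "'a :: field_char_0 set"
  assumes "quadratic_field K"
  obtains om t e d where "quad_int K om t e" "squarefree d" "d \<noteq> 1"
    "(t = 0 \<and> e = d \<and> d mod 4 \<in> {2,3}) \<or> (t = 1 \<and> 4 * e + 1 = d)"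
proof -
  obtain w d where w: "w \<notin> \<rat>" "w * w = of_int d" "squarefree d"
    and K: "K = {a + b * w | a b. a \<in> \<rat> \<and> b \<in> \<rat>}"
    by (rule quadratic_field_sqrt_generator[OF assms])
  have d1: "d \<noteq> 1"
  proof
    assume "d = 1"
    then have "(w - 1) * (w + 1) = 0" using w(2) by (simp add: algebra_simps)
    then have "w = 1 \<or> w = -1" by (simp add: eq_neg_iff_add_eq_0)
    then show False using w(1) by auto
  qed
  \<comment> \<open>\<open>m\<close> is the trace of \<open>p + q * w\<close> and
    \<open>(m * m - d * (n * n)) / 4\<close> its norm; \<open>n\<close> is an integer because
    \<open>d\<close> is squarefree.\<close>
  have key: "\<exists>m n. p = of_int m / 2 \<and> q = of_int n / 2 \<and> (m * m - d * (n * n)) mod 4 = 0"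
    if pq: "p \<in> \<rat>" "q \<in> \<rat>" and ai: "algebraic_int (p + q * w)" for p q
  proof (cases "q = 0")
    case True
    then have "p \<in> \<int>" using pq ai rational_algebraic_int_is_int by simp
    then obtain m where "p = of_int m" by (auto elim: Ints_cases)
    then show ?thesis using True by (intro exI[of _ "2 * m"] exI[of _ 0]) simp
  next
    case False
    define x where "x = p + q * w"
    have irr: "x \<notin> \<rat>" unfolding x_def by (rule rat_affine_irrational[OF pq False w(1)])
    have "x * x = p * p + 2 * p * q * w + q * q * (w * w)" unfolding x_def by (simp add: algebra_simps)
    also have "\<dots> = (2 * p) * x + (q * q * of_int d - p * p)"
      unfolding w(2) x_def by (simp add: algebra_simps)
    finally have eq: "x * x = (2 * p) * x + (q * q * of_int d - p * p)" .
    have "2 * p \<in> \<rat>" "q * q * of_int d - p * p \<in> \<rat>" using pq by auto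
    then have ints: "2 * p \<in> \<int>" "q * q * of_int d - p * p \<in> \<int>"
      using algebraic_int_quadratic[OF _ irr _ _ eq] ai unfolding x_def by auto
    obtain m where m: "2 * p = of_int m" using ints(1) by (auto elim: Ints_cases)
    obtain N where N: "q * q * of_int d - p * p = of_int N" using ints(2) by (auto elim: Ints_cases)
    have e: "(2 * q) * (2 * q) * of_int d = of_int (4 * N + m * m)"
    proof -
      have "(2 * q) * (2 * q) * of_int d = 4 * (q * q * of_int d - p * p) + (2 * p) * (2 * p)"
        by (simp add: algebra_simps)
      then show ?thesis unfolding m N by simp
    qed
    have "2 * q \<in> \<int>"
      by (rule square_mult_squarefree_int[OF _ w(3)]) (use pq e in \<open>auto simp only: Ints_of_int intro: Rats_mult Rats_number_of\<close>)
    then obtain n where n: "2 * q = of_int n" by (auto elim: Ints_cases)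
    have "of_int (n * n * d) = (of_int (4 * N + m * m) :: 'a)" using e unfolding n by simp
    then have "n * n * d = 4 * N + m * m" by (simp only: of_int_eq_iff)
    then have "m * m - d * (n * n) = 4 * (- N)" by (simp add: algebra_simps)
    then have "(m * m - d * (n * n)) mod 4 = 0" by simp
    moreover have "p = of_int m / 2" "q = of_int n / 2" using m n by (simp_all add: field_simps)
    ultimately show ?thesis by (intro exI conjI)
  qed
  show ?thesis
  proof (cases "d mod 4 = 1")
    case False
    then have d4: "d mod 4 \<in> {2,3}" using squarefree_mod_4_int[OF w(3)] by auto
    have "quad_int K w 0 d"
    proof
      show "w \<notin> \<rat>" by (rule w)
      show sq: "w * w = of_int 0 * w + of_int d" using w(2) by simp
      show "{x \<in> K. algebraic_int x} = range (\<lambda>(a, b). of_int a + of_int b * w)"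
      proof (intro equalityI subsetI)
        fix x assume "x \<in> {x \<in> K. algebraic_int x}"
        then obtain p q where pq: "p \<in> \<rat>" "q \<in> \<rat>" "x = p + q * w" "algebraic_int (p + q * w)"
          unfolding K by blast
        obtain m n where mn: "p = of_int m / 2" "q = of_int n / 2" "(m * m - d * (n * n)) mod 4 = 0"
          using key[OF pq(1,2,4)] by (elim exE conjE) (rule that)
        have "((m * m) mod 4 - (d mod 4) * ((n * n) mod 4) mod 4) mod 4 = 0"
          using mn(3) by (metis mod_diff_eq mod_mult_eq mod_mod_trivial)
        \<comment> \<open>Squares are 0 or 1 modulo 4, so \<open>m^2 = d * n^2\<close> modulo 4 with
          \<open>d\<close> equal to 2 or 3 modulo 4 leaves only even \<open>m\<close> and
          \<open>n\<close>.\<close>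
        then have "even m \<and> even n"
          unfolding square_mod_4_int using d4 by (auto split: if_splits)
        then obtain i j where "m = 2 * i" "n = 2 * j" by (auto elim!: evenE)
        then have "x = of_int i + of_int j * w" using pq(3) mn(1,2) by simp
        then show "x \<in> range (\<lambda>(a, b). of_int a + of_int b * w)" by auto
      next
        fix x assume "x \<in> range (\<lambda>(a, b). of_int a + of_int b * w)"
        then obtain a b where x: "x = of_int a + of_int b * w" by auto
        have "x \<in> K" unfolding K x by (intro CollectI exI conjI) auto
        then show "x \<in> {x \<in> K. algebraic_int x}"
          using algebraic_int_of_quadratic[OF sq, of a b] x by simp
      qed
    qed
    then show ?thesis using that[of w 0 d d] w(3) d1 d4 by blast
  next
    case True
    define e where "e = (d - 1) div 4"
    define om where "om = 1 / 2 + (1 / 2) * w"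
    have d_eq: "4 * e + 1 = d" unfolding e_def using True by presburger
    have om_irr: "om \<notin> \<rat>" unfolding om_def by (rule rat_affine_irrational[OF _ _ _ w(1)]) auto
    have sq: "om * om = of_int 1 * om + of_int e"
    proof -
      have "om * om = 1 / 4 + (1 / 2) * w + (w * w) / 4" unfolding om_def by (simp add: field_simps)
      also have "w * w = of_int (4 * e + 1)" using w(2) d_eq by simp
      also have "1 / 4 + (1 / 2) * w + of_int (4 * e + 1) / 4 = of_int 1 * om + of_int e"
        unfolding om_def by (simp add: field_simps)
      finally show ?thesis .
    qed
    have "quad_int K om 1 e"
    proof
      show "om \<notin> \<rat>" by (rule om_irr)
      show "om * om = of_int 1 * om + of_int e" by (rule sq)
      show "{x \<in> K. algebraic_int x} = range (\<lambda>(a, b). of_int a + of_int b * om)"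
      proof (intro equalityI subsetI)
        fix x assume "x \<in> {x \<in> K. algebraic_int x}"
        then obtain p q where pq: "p \<in> \<rat>" "q \<in> \<rat>" "x = p + q * w" "algebraic_int (p + q * w)"
          unfolding K by blast
        obtain m n where mn: "p = of_int m / 2" "q = of_int n / 2" "(m * m - d * (n * n)) mod 4 = 0"
          using key[OF pq(1,2,4)] by (elim exE conjE) (rule that)
        have "((m * m) mod 4 - (d mod 4) * ((n * n) mod 4) mod 4) mod 4 = 0"
          using mn(3) by (metis mod_diff_eq mod_mult_eq mod_mod_trivial)
        \<comment> \<open>For \<open>d\<close> equal to 1 modulo 4 the same congruence says no more
          than that the parities agree, and the halves survive in \<open>om\<close>.\<close>
        then have "even m \<longleftrightarrow> even n"
          unfolding square_mod_4_int True by (auto split: if_splits)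
        then have "even (m - n)" by simp
        then obtain i where "m - n = 2 * i" by (rule evenE)
        then have "m = n + 2 * i" by simp
        then have "x = of_int i + of_int n * om" using pq(3) mn(1,2) by (simp add: om_def field_simps)
        then show "x \<in> range (\<lambda>(a, b). of_int a + of_int b * om)" by auto
      next
        fix x assume "x \<in> range (\<lambda>(a, b). of_int a + of_int b * om)"
        then obtain a b where x: "x = of_int a + of_int b * om" by auto
        have "x = (of_int a + of_int b / 2) + (of_int b / 2) * w"
          unfolding x om_def by (simp add: field_simps)
        moreover have "of_int a + of_int b / 2 \<in> \<rat>" "of_int b / 2 \<in> \<rat>" by auto
        ultimately have "x \<in> K" unfolding K by (intro CollectI exI conjI)
        then show "x \<in> {x \<in> K. algebraic_int x}"
          using algebraic_int_of_quadratic[OF sq, of a b] x by simp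
      qed
    qed
    then show ?thesis using that[of om 1 e d] w(3) d1 d_eq by blast
  qed
qed

section \<open>Quadratic characters\<close>

lemma Legendre_vals: "Legendre a p \<in> {-1, 0, 1}" by (simp add: Legendre_def)

text \<open>Euler's criterion only yields congruences; for \<open>p > 2\<close> they determine
  numbers from \<open>{-1, 0, 1}\<close>, which turns it into identities between Legendre
  symbols.\<close>

lemma cong_small_imp_eq:
  fixes x y :: int
  assumes "[x = y] (mod int p)" "p > 2" "x \<in> {-1, 0, 1}" "y \<in> {-1, 0, 1}"
  shows "x = y"
proof (rule ccontr)
  assume "x \<noteq> y"
  moreover have "int p dvd x - y" using assms(1) by (simp add: cong_iff_dvd_diff)
  ultimately have "int p \<le> \<bar>x - y\<bar>" using dvd_imp_le_int[of "x - y" "int p"] by simp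
  then show False using assms by auto
qed

lemma Legendre_mult:
  assumes "prime p" "p > 2"
  shows "Legendre (a * b) (int p) = Legendre a (int p) * Legendre b (int p)"
proof (rule cong_small_imp_eq[OF _ assms(2)])
  have "[Legendre (a * b) p = (a * b) ^ ((p - 1) div 2)] (mod p)" by (rule euler_criterion[OF assms])
  also have "(a * b) ^ ((p - 1) div 2) = a ^ ((p - 1) div 2) * b ^ ((p - 1) div 2)"
    by (rule power_mult_distrib)
  also have "[\<dots> = Legendre a p * Legendre b p] (mod p)"
    by (intro cong_mult cong_sym[OF euler_criterion[OF assms]])
  finally show "[Legendre (a * b) p = Legendre a p * Legendre b p] (mod p)" .
  show "Legendre a p * Legendre b p \<in> {-1, 0, 1}"
    using Legendre_vals[of a p] Legendre_vals[of b p] by auto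
qed (rule Legendre_vals)

lemma Legendre_1: "p > 2 \<Longrightarrow> Legendre 1 (int p) = 1"
  unfolding Legendre_def QuadRes_def by (auto simp: cong_0_iff intro: exI[of _ 1])

lemma Legendre_power:
  assumes "prime p" "p > 2"
  shows "Legendre (a ^ n) (int p) = Legendre a (int p) ^ n"
  by (induction n) (simp_all add: Legendre_1 Legendre_mult assms)

lemma Legendre_cong:
  assumes "[a = b] (mod p)" shows "Legendre a p = Legendre b p"
proof -
  have "[c = a] (mod p) \<longleftrightarrow> [c = b] (mod p)" for c using assms by (auto simp: cong_def)
  moreover have "[a = 0] (mod p) \<longleftrightarrow> [b = 0] (mod p)" using assms by (auto simp: cong_def)
  ultimately show ?thesis unfolding Legendre_def QuadRes_def by simp
qed

lemma Legendre_minus_1: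
  assumes "prime p" "p > 2"
  shows "Legendre (-1) (int p) = (-1) ^ ((p - 1) div 2)"
proof (rule cong_small_imp_eq[OF euler_criterion[OF assms] assms(2) Legendre_vals])
  show "(-1 :: int) ^ ((p - 1) div 2) \<in> {-1, 0, 1}" by (cases "even ((p - 1) div 2)") auto
qed

text \<open>The sign makes \<open>prime_star q\<close> congruent to 1 modulo 4, so that reciprocity holds without a sign.\<close>

definition prime_star :: "nat \<Rightarrow> int" where "prime_star q = (-1) ^ ((q - 1) div 2) * int q"

lemma Legendre_prime_star:
  assumes "prime p" "p > 2" "prime q" "q > 2" "p \<noteq> q"
  shows "Legendre (prime_star q) (int p) = Legendre (int p) (int q)"
proof -
  let ?s = "(-1 :: int) ^ ((p - 1) div 2 * ((q - 1) div 2))"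
  have "Legendre (prime_star q) p = ?s * Legendre q p"
    unfolding prime_star_def using assms
    by (simp add: Legendre_mult Legendre_power Legendre_minus_1 power_mult)
  moreover have "\<not> p dvd q" using assms primes_dvd_imp_eq by blast
  then have "Legendre q p = 1 \<or> Legendre q p = -1" by (simp add: Legendre_def cong_0_iff)
  then have "Legendre q p * Legendre q p = 1" by auto
  moreover have "Legendre p q * Legendre q p = ?s" by (rule Quadratic_Reciprocity[OF assms])
  ultimately show ?thesis by (metis mult.assoc mult.right_neutral)
qed

text \<open>Gauss' lemma with multiplier 2: doubling \<open>1, ..., h\<close> with
  \<open>h = (p - 1) div 2\<close> stays below \<open>p\<close>, so no reduction occurs, and exactly
  \<open>h - h div 2\<close> of the doubles exceed \<open>h\<close>.\<close>

lemma Legendre_2: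
  assumes "prime p" "p > 2"
  shows "Legendre 2 (int p) = (if p mod 8 = 1 \<or> p mod 8 = 7 then 1 else -1)"
proof -
  have odd: "odd p" using assms prime_odd_nat by blast
  interpret GAUSS p 2
  proof
    show "[2 \<noteq> 0] (mod int p)" using assms(2) zdvd_imp_le[of "int p" 2] by (auto simp: cong_0_iff)
  qed (use assms in auto)
  define h where "h = (p - 1) div 2"
  have p: "int p = 2 * int h + 1" unfolding h_def using odd assms(2) by (auto elim!: oddE)
  have A: "A = {0<..int h}" unfolding A_def p by simp
  have C: "C = (\<lambda>x. 2 * x) ` A"
    unfolding C_def B_def image_image
    by (rule image_cong[OF refl]) (auto simp: A p mult.commute)
  have "E = (\<lambda>x. 2 * x) ` {int (h div 2)<..int h}"
  proof -
    have "(int p - 1) div 2 = int h" by (simp add: p)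
    then have "E = {y \<in> C. y > int h}" unfolding E_def by auto
    also have "\<dots> = (\<lambda>x. 2 * x) ` {x \<in> A. 2 * x > int h}" unfolding C by auto
    also have "{x \<in> A. 2 * x > int h} = {int (h div 2)<..int h}" unfolding A by auto
    finally show ?thesis .
  qed
  then have "card E = card {int (h div 2)<..int h}" by (simp add: card_image inj_on_def)
  then have cE: "card E = h - h div 2" by simp
  have "even (h - h div 2) \<longleftrightarrow> h mod 4 = 0 \<or> h mod 4 = 3" by presburger
  moreover have "p = 2 * h + 1" using p by linarith
  then have "(h mod 4 = 0 \<or> h mod 4 = 3) \<longleftrightarrow> (p mod 8 = 1 \<or> p mod 8 = 7)" by presburger
  ultimately show ?thesis using gauss_lemma cE by auto
qed

text \<open>Squaring modulo \<open>q\<close> identifies 1 and \<open>q - 1\<close>, so on a finite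
  set it is not surjective either.\<close>

lemma nonresidue_exists:
  assumes "prime q" "q > 2"
  obtains r where "Legendre (int r) (int q) = -1"
proof -
  let ?f = "\<lambda>y. y\<^sup>2 mod q"
  have "\<not> inj_on ?f {..<q}"
  proof
    assume inj: "inj_on ?f {..<q}"
    have "(q - 1)\<^sup>2 mod q = 1\<^sup>2 mod q"
    proof -
      obtain k where k: "q = k + 2" using assms(2) by (metis less_imp_add_positive add.commute)
      have "(q - 1)\<^sup>2 = k * q + 1\<^sup>2" by (simp add: k power2_eq_square algebra_simps)
      then show ?thesis by (simp only: mod_mult_self3)
    qed
    then have "q - 1 = 1" by (rule inj_onD[OF inj]) (use assms(2) in auto)
    then show False using assms(2) by simp
  qed
  then have "\<not> {..<q} \<subseteq> ?f ` {..<q}" 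
    using finite_surj_inj[of "{..<q}" ?f] by blast
  then obtain r where r: "r < q" "r \<notin> ?f ` {..<q}" by auto
  have "r \<noteq> 0"
  proof
    assume "r = 0"
    then have "r = ?f 0" by simp
    moreover have "0 \<in> {..<q}" using assms(2) by simp
    ultimately show False using r(2) by blast
  qed
  then have "\<not> [int r = 0] (mod int q)" using r(1) by (auto simp: cong_0_iff dest: dvd_imp_le)
  moreover have "\<not> QuadRes (int q) (int r)"
  proof
    assume "QuadRes (int q) (int r)"
    then obtain y where y: "[y\<^sup>2 = int r] (mod int q)" unfolding QuadRes_def by blast
    define z where "z = nat (y mod int q)"
    have z: "int z = y mod int q" using assms(2) by (simp add: z_def)
    have "int (z\<^sup>2 mod q) = y\<^sup>2 mod int q" by (simp add: z zmod_int power_mod)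
    also have "\<dots> = int r" using y r(1) by (simp add: cong_def)
    finally have "r = ?f z" by simp
    moreover have "int z < int q" unfolding z using assms(2) by simp
    then have "z \<in> {..<q}" by simp
    ultimately show False using r(2) by blast
  qed
  ultimately have "Legendre (int r) (int q) = -1" by (simp add: Legendre_def)
  then show ?thesis by (rule that)
qed

section \<open>Real characters attached to a squarefree number\<close>

definition int_char :: "(nat \<Rightarrow> int) \<Rightarrow> nat \<Rightarrow> bool" where
  "int_char ch M \<longleftrightarrow> M > 0 \<and> (\<forall>n. ch (n + M) = ch n) \<and> (\<forall>m n. ch (m * n) = ch m * ch n) \<and> ch 1 = 1 \<and>
     (\<forall>n. ch n \<in> {-1, 0, 1}) \<and> (\<forall>n. ch n \<noteq> 0 \<longrightarrow> coprime n M)"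

lemma int_char_add_mult: "int_char ch M \<Longrightarrow> ch (n + k * M) = ch n"
proof (induction k)
  case (Suc k)
  then have "ch (n + k * M + M) = ch (n + k * M)" unfolding int_char_def by blast
  with Suc show ?case by (simp add: add_ac)
qed simp

lemma int_char_cong:
  assumes "int_char ch M" "[m = n] (mod M)"
  shows "ch m = ch n"
proof -
  have "ch m = ch (m mod M)" for m
    using int_char_add_mult[OF assms(1), of "m mod M" "m div M"] by simp
  then show ?thesis using assms(2) unfolding cong_def by metis
qed

lemma int_char_prod:
  assumes "int_char ch M" "int_char ch' M'"
  shows "int_char (\<lambda>n. ch n * ch' n) (M * M')"
  unfolding int_char_def
proof (intro conjI allI impI)
  show "M * M' > 0" "ch 1 * ch' 1 = 1" using assms by (auto simp: int_char_def)
  fix m n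
  show "ch (n + M * M') * ch' (n + M * M') = ch n * ch' n"
    using int_char_add_mult[OF assms(1), of n M'] int_char_add_mult[OF assms(2), of n M]
    by (simp add: mult.commute)
  have "ch (m * n) = ch m * ch n" "ch' (m * n) = ch' m * ch' n" using assms by (auto simp: int_char_def)
  then show "ch (m * n) * ch' (m * n) = ch m * ch' m * (ch n * ch' n)" by simp
  have "ch n \<in> {-1, 0, 1}" "ch' n \<in> {-1, 0, 1}" using assms unfolding int_char_def by blast+
  then show "ch n * ch' n \<in> {-1, 0, 1}" by auto
  assume "ch n * ch' n \<noteq> 0"
  then show "coprime n (M * M')" using assms unfolding int_char_def by simp
qed

lemma int_char_Legendre:
  assumes "prime q" "q > 2"
  shows "int_char (\<lambda>n. Legendre (int n) (int q)) q"
  unfolding int_char_def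
proof (intro conjI allI impI)
  show "q > 0" using assms by simp
  show "Legendre (int 1) (int q) = 1" using Legendre_1 assms by simp
  fix m n
  show "Legendre (int (n + q)) (int q) = Legendre (int n) (int q)"
    by (rule Legendre_cong) (simp add: cong_def)
  show "Legendre (int (m * n)) (int q) = Legendre (int m) (int q) * Legendre (int n) (int q)"
    using Legendre_mult[OF assms] by simp
  show "Legendre (int n) (int q) \<in> {-1, 0, 1}" by (rule Legendre_vals)
  assume "Legendre (int n) (int q) \<noteq> 0"
  then have "\<not> q dvd n" by (auto simp: Legendre_def cong_0_iff split: if_splits)
  then show "coprime n q" using assms(1) prime_imp_coprime coprime_commute by blast
qed

text \<open>\<open>char4\<close> and \<open>char8\<close> are the characters by which
  \<open>-1\<close> and 2 are residues, the two supplementary laws of reciprocity.\<close>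

definition char4 :: "nat \<Rightarrow> int" where
  "char4 n = (if n mod 4 = 1 then 1 else if n mod 4 = 3 then -1 else 0)"

definition char8 :: "nat \<Rightarrow> int" where
  "char8 n = (if n mod 8 = 1 \<or> n mod 8 = 7 then 1 else if odd n then -1 else 0)"

lemma int_char_char4: "int_char char4 4"
  unfolding int_char_def
proof (intro conjI allI impI)
  fix m n :: nat
  show "char4 (m * n) = char4 m * char4 n"
  proof -
    have "m mod 4 \<in> {0,1,2,3}" "n mod 4 \<in> {0,1,2,3}" by auto
    moreover have "(m * n) mod 4 = ((m mod 4) * (n mod 4)) mod 4" by (simp add: mod_mult_eq)
    ultimately show ?thesis unfolding char4_def by auto
  qed
  assume "char4 n \<noteq> 0"
  then have "n mod 4 = 1 \<or> n mod 4 = 3" by (auto simp: char4_def split: if_splits)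
  then have "odd n" by presburger
  then have "coprime n (2 ^ 2)" by (simp only: coprime_power_right_iff coprime_right_2_iff_odd) simp
  then show "coprime n 4" by simp
qed (auto simp: char4_def)

lemma int_char_char8: "int_char char8 8"
  unfolding int_char_def
proof (intro conjI allI impI)
  fix m n :: nat
  have c8: "char8 n = (if n mod 8 \<in> {1,7} then 1 else if n mod 8 \<in> {3,5} then -1 else 0)" for n
  proof -
    have "n mod 8 \<in> {0,1,2,3,4,5,6,7}" by auto
    moreover have "odd n \<longleftrightarrow> odd (n mod 8)" by presburger
    ultimately show ?thesis unfolding char8_def by auto
  qed
  show "char8 (m * n) = char8 m * char8 n"
  proof -
    have "m mod 8 \<in> {0,1,2,3,4,5,6,7}" "n mod 8 \<in> {0,1,2,3,4,5,6,7}" by auto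
    moreover have "(m * n) mod 8 = ((m mod 8) * (n mod 8)) mod 8" by (simp add: mod_mult_eq)
    ultimately show ?thesis unfolding c8 by (elim insertE emptyE) simp_all
  qed
  show "char8 (n + 8) = char8 n" unfolding c8 by simp
  assume "char8 n \<noteq> 0"
  then have "n mod 8 = 1 \<or> n mod 8 = 7 \<or> odd n" by (auto simp: char8_def split: if_splits)
  then have "odd n" by presburger
  then have "coprime n (2 ^ 3)" by (simp only: coprime_power_right_iff coprime_right_2_iff_odd) simp
  then show "coprime n 8" by simp
qed (auto simp: char8_def)

text \<open>The clause on the prime divisors of \<open>M\<close> serves the induction: an odd prime
  not dividing \<open>d\<close> is then coprime to \<open>M\<close>, so that congruences modulo both
  can be prescribed. The value \<open>-1\<close> is how nonprincipality is carried along.\<close>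

definition quad_char :: "int \<Rightarrow> (nat \<Rightarrow> int) \<Rightarrow> nat \<Rightarrow> bool" where
  "quad_char d ch M \<longleftrightarrow> int_char ch M \<and>
     (\<forall>p. prime p \<and> p > 2 \<and> \<not> int p dvd d \<longrightarrow> ch p = Legendre d (int p)) \<and>
     (\<forall>q. prime q \<and> q dvd M \<longrightarrow> q = 2 \<or> int q dvd d) \<and>
     (d \<noteq> 1 \<longrightarrow> (\<exists>n. ch n = -1))"

lemma quad_char_1: "quad_char 1 (\<lambda>_. 1) 1"
  by (auto simp: quad_char_def int_char_def Legendre_1)

lemma char4_eq_Legendre:
  assumes "prime p" "p > 2" shows "char4 p = Legendre (-1) (int p)"
proof -
  have "odd p" using assms prime_odd_nat by blast
  then have "p mod 4 = 1 \<or> p mod 4 = 3" by presburger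
  moreover have "even ((p - 1) div 2) \<longleftrightarrow> p mod 4 = 1" using \<open>odd p\<close> by presburger
  ultimately show ?thesis unfolding Legendre_minus_1[OF assms] char4_def by auto
qed

lemma char8_eq_Legendre:
  assumes "prime p" "p > 2" shows "char8 p = Legendre 2 (int p)"
proof -
  have "odd p" using assms prime_odd_nat by blast
  then show ?thesis unfolding Legendre_2[OF assms] char8_def by simp
qed

lemma prime_dvd_2_power: "prime q \<Longrightarrow> q dvd 2 ^ k \<Longrightarrow> q = (2 :: nat)"
  using prime_dvd_power primes_dvd_imp_eq two_is_prime_nat by blast

lemma quad_char_minus_1: "quad_char (-1) char4 4"
  unfolding quad_char_def
proof (intro conjI allI impI)
  show "\<exists>n. char4 n = -1" by (rule exI[of _ 3]) (simp add: char4_def)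
  show "q = 2 \<or> int q dvd -1" if "prime q \<and> q dvd 4" for q
    using prime_dvd_2_power[of q 2] that by simp
qed (use int_char_char4 char4_eq_Legendre in auto)

lemma quad_char_2: "quad_char 2 char8 8"
  unfolding quad_char_def
proof (intro conjI allI impI)
  show "\<exists>n. char8 n = -1" by (rule exI[of _ 3]) (simp add: char8_def)
  show "q = 2 \<or> int q dvd 2" if "prime q \<and> q dvd 8" for q
    using prime_dvd_2_power[of q 3] that by simp
qed (use int_char_char8 char8_eq_Legendre in auto)

lemma quad_char_minus_2: "quad_char (-2) (\<lambda>n. char4 n * char8 n) (4 * 8)"
  unfolding quad_char_def
proof (intro conjI allI impI)
  show "\<exists>n. char4 n * char8 n = -1" by (rule exI[of _ 5]) (simp add: char4_def char8_def)
  show "q = 2 \<or> int q dvd -2" if "prime q \<and> q dvd 4 * 8" for q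
    using prime_dvd_2_power[of q 5] that by simp
  show "char4 p * char8 p = Legendre (-2) (int p)" if "prime p \<and> p > 2 \<and> \<not> int p dvd -2" for p
    using that Legendre_mult[of p "-1" 2] by (simp add: char4_eq_Legendre char8_eq_Legendre)
qed (rule int_char_prod[OF int_char_char4 int_char_char8])

text \<open>Reciprocity turns the symbol with numerator \<open>prime_star q\<close> into a character
  of its denominator, and the two characters multiply. The value \<open>-1\<close> is attained at an
  \<open>n\<close> that is a nonresidue modulo \<open>q\<close> and 1 modulo
  \<open>M\<close>.\<close>

lemma quad_char_mult_prime_star:
  assumes "quad_char d ch M" "prime q" "q > 2" "\<not> int q dvd d"
  shows "quad_char (prime_star q * d) (\<lambda>n. Legendre (int n) (int q) * ch n) (q * M)"
proof -
  have ic: "int_char ch M" and leg: "\<And>p. prime p \<Longrightarrow> p > 2 \<Longrightarrow> \<not> int p dvd d \<Longrightarrow> ch p = Legendre d (int p)"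
    and dv: "\<And>p. prime p \<Longrightarrow> p dvd M \<Longrightarrow> p = 2 \<or> int p dvd d"
    using assms(1) unfolding quad_char_def by blast+
  have cop: "coprime q M" using dv[of q] assms prime_imp_coprime by blast
  have qs: "int q dvd prime_star q" by (simp add: prime_star_def)
  show ?thesis unfolding quad_char_def
  proof (intro conjI allI impI)
    show "int_char (\<lambda>n. Legendre (int n) (int q) * ch n) (q * M)"
      by (rule int_char_prod[OF int_char_Legendre[OF assms(2,3)] ic])
    fix p assume p: "prime p \<and> p > 2 \<and> \<not> int p dvd prime_star q * d"
    then have "p \<noteq> q" "\<not> int p dvd d" using qs by (auto intro: dvd_mult2)
    then show "Legendre (int p) (int q) * ch p = Legendre (prime_star q * d) (int p)"
      using p assms by (simp add: Legendre_mult Legendre_prime_star leg)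
  next
    fix p assume p: "prime p \<and> p dvd q * M"
    then have "p dvd q \<or> p dvd M" using prime_dvd_mult_iff by blast
    then show "p = 2 \<or> int p dvd prime_star q * d"
    proof
      assume "p dvd q"
      then have "p = q" using p assms(2) primes_dvd_imp_eq by blast
      then show ?thesis using qs by simp
    next
      assume "p dvd M" then show ?thesis using dv[of p] p by auto
    qed
  next
    obtain r where r: "Legendre (int r) (int q) = -1" by (rule nonresidue_exists[OF assms(2,3)])
    obtain n where n: "[n = r] (mod q)" "[n = 1] (mod M)"
      using binary_chinese_remainder_nat[OF cop] by blast
    have "[int n = int r] (mod int q)" using n(1) by (simp add: cong_int_iff)
    then have "Legendre (int n) (int q) = -1" using r Legendre_cong by metis
    moreover have "ch n = 1" using int_char_cong[OF ic n(2)] ic by (simp add: int_char_def)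
    ultimately have "Legendre (int n) (int q) * ch n = -1" by simp
    then show "\<exists>n. Legendre (int n) (int q) * ch n = -1" ..
  qed
qed

lemma no_odd_prime_imp_abs_le_2:
  fixes d :: int
  assumes "squarefree d" "\<And>q. prime q \<Longrightarrow> q > 2 \<Longrightarrow> \<not> int q dvd d"
  shows "d \<in> {1, -1, 2, -2}"
proof -
  define N where "N = nat \<bar>d\<bar>"
  have d0: "d \<noteq> 0" using assms(1) by (metis not_squarefree_0)
  then have N: "int N = \<bar>d\<bar>" "N > 0" by (auto simp: N_def)
  have p2: "q = 2" if "prime q" "q dvd N" for q
  proof -
    have "int q dvd d" using that(2) N(1) by (metis dvd_abs_iff of_nat_dvd_iff)
    then have "\<not> q > 2" using assms(2) that(1) by blast
    then show ?thesis using prime_ge_2_nat[OF that(1)] by simp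
  qed
  have "N \<le> 2"
  proof (cases "even N")
    case False
    then have "N = 1" using p2 prime_factor_nat[of N] by auto
    then show ?thesis by simp
  next
    case True
    then obtain k where k: "N = 2 * k" by blast
    have "odd k"
    proof
      assume "even k"
      then have "4 dvd N" unfolding k by auto
      then have "int 4 dvd d" using N(1) by (metis dvd_abs_iff of_nat_dvd_iff)
      then have "2\<^sup>2 dvd d" by simp
      then have "is_unit (2 :: int)" using assms(1) unfolding squarefree_def by blast
      then show False by simp
    qed
    then have "k = 1" using p2 k prime_factor_nat[of k] by (metis dvd_mult)
    then show ?thesis using k by simp
  qed
  then show ?thesis using N by auto
qed

text \<open>The prime factors of \<open>d\<close> are split off one at a time with the sign that makes reciprocity
  sign-free, which leaves a squarefree number in \<open>{1, -1, 2, -2}\<close>.\<close>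

theorem quad_char_exists:
  fixes d :: int
  assumes "squarefree d"
  shows "\<exists>ch M. quad_char d ch M"
  using assms
proof (induction "nat \<bar>d\<bar>" arbitrary: d rule: less_induct)
  case less
  show ?case
  proof (cases "\<exists>q. prime q \<and> q > 2 \<and> int q dvd d")
    case True
    then obtain q where q: "prime q" "q > 2" "int q dvd d" by blast
    define s :: int where "s = (-1) ^ ((q - 1) div 2)"
    have s: "s * s = 1" "\<bar>s\<bar> = 1" unfolding s_def by (simp_all flip: power_mult_distrib)
    obtain c where c: "d = int q * c" using q(3) by blast
    define d' where "d' = s * c"
    have "prime_star q * d' = (s * s) * (int q * c)" by (simp add: prime_star_def d'_def s_def mult_ac)
    then have d: "d = prime_star q * d'" using c s(1) by simp
    have d0: "d \<noteq> 0" using less.prems by (metis not_squarefree_0)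
    have sq: "squarefree d'"
      by (rule squarefree_mono[OF _ less.prems]) (simp add: d)
    have nd: "\<not> int q dvd d'"
    proof
      assume "int q dvd d'"
      then have "(int q)\<^sup>2 dvd d" unfolding d power2_eq_square by (intro mult_dvd_mono) (simp_all add: prime_star_def)
      then have "is_unit (int q)" using less.prems unfolding squarefree_def by blast
      then show False using q(2) by simp
    qed
    have "\<bar>d\<bar> = int q * \<bar>d'\<bar>" unfolding c d'_def by (simp add: abs_mult s(2))
    moreover have "d' \<noteq> 0" using d0 d by auto
    ultimately have "\<bar>d'\<bar> < \<bar>d\<bar>" using q(2) by simp
    then have "nat \<bar>d'\<bar> < nat \<bar>d\<bar>" by simp
    from less.hyps[OF this sq] obtain ch M where "quad_char d' ch M" by blast
    from quad_char_mult_prime_star[OF this q(1,2) nd] show ?thesis unfolding d by blast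
  next
    case False
    then have "d \<in> {1, -1, 2, -2}" using no_odd_prime_imp_abs_le_2[OF less.prems] by blast
    then show ?thesis
      using quad_char_1 quad_char_minus_1 quad_char_2 quad_char_minus_2 by blast
  qed
qed

text \<open>Multiplication by \<open>a\<close> permutes the residues and reverses the sign of the
  sum.\<close>

lemma int_char_sum_period:
  assumes "int_char ch M" "ch a = -1"
  shows "(\<Sum>n<M. ch n) = 0"
proof -
  have cop: "coprime a M" and M: "M > 0" using assms unfolding int_char_def by auto
  have inj: "inj_on (\<lambda>n. a * n mod M) {..<M}"
  proof (rule inj_onI)
    fix m n assume mn: "m \<in> {..<M}" "n \<in> {..<M}" "a * m mod M = a * n mod M"
    then have "[a * m = a * n] (mod M)" by (simp add: cong_def)
    then have "[m = n] (mod M)" using cop by (simp add: cong_mult_lcancel_nat)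
    then show "m = n" using mn by (simp add: cong_def)
  qed
  then have bij: "bij_betw (\<lambda>n. a * n mod M) {..<M} {..<M}"
    unfolding bij_betw_def using M by (intro conjI endo_inj_surj) auto
  have "(\<Sum>n<M. ch n) = (\<Sum>n<M. ch (a * n mod M))" by (rule sum.reindex_bij_betw[OF bij, symmetric])
  also have "\<dots> = (\<Sum>n<M. - ch n)"
  proof (rule sum.cong[OF refl])
    fix n
    have "ch (a * n mod M) = ch (a * n)" by (rule int_char_cong[OF assms(1)]) (simp add: cong_def)
    also have "\<dots> = ch a * ch n" using assms(1) unfolding int_char_def by blast
    finally show "ch (a * n mod M) = - ch n" using assms(2) by simp
  qed
  finally show ?thesis by (simp add: sum_negf)
qed

section \<open>The iterated counting function\<close>

definition log_step :: "nat \<Rightarrow> real" where "log_step l = ln (1 + 1 / real (Suc l))"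

text \<open>Equal to \<open>c_const^2 / 8\<close>.\<close>

definition log_step_S :: real where "log_step_S = (\<Sum>l. (log_step l)\<^sup>2)"

lemma log_step_pos: "log_step l > 0" unfolding log_step_def by (simp add: ln_gt_zero)

lemma log_step_le: "log_step l \<le> 1 / real (Suc l)"
  unfolding log_step_def by (intro ln_add_one_self_le_self) auto

lemma log_step_le_1: "log_step l \<le> 1"
  using log_step_le[of l] by (rule order_trans) simp

lemma log_step_antimono: "l \<le> m \<Longrightarrow> log_step m \<le> log_step l"
  unfolding log_step_def by (auto intro!: divide_left_mono simp: add_pos_pos)

lemma sum_log_step: "(\<Sum>l<e. log_step l) = ln (1 + real e)"
proof (induction e)
  case (Suc e)
  have "1 + 1 / real (Suc e) = (2 + real e) / (1 + real e)" by (simp add: field_simps)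
  then have "log_step e = ln (2 + real e) - ln (1 + real e)" unfolding log_step_def by (simp add: ln_div)
  with Suc show ?case by simp
qed simp

lemma summable_log_step_sq: "summable (\<lambda>l. (log_step l)\<^sup>2)"
proof (rule summable_comparison_test')
  show "summable (\<lambda>l. 1 / real (Suc l) ^ 2)" using inverse_squares_sums by (simp add: sums_iff add.commute)
  show "norm ((log_step l)\<^sup>2) \<le> 1 / real (Suc l) ^ 2" for l
    using power_mono[OF log_step_le[of l], of 2] log_step_pos[of l] by (simp add: power_divide)
qed

lemma log_step_S_pos: "log_step_S > 0"
  unfolding log_step_S_def by (intro suminf_pos summable_log_step_sq) (auto simp: log_step_pos less_imp_neq[THEN not_sym] zero_less_power)

lemma sum_log_step_sq_le: "(\<Sum>l<N. (log_step l)\<^sup>2) \<le> log_step_S"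
  unfolding log_step_S_def by (intro sum_le_suminf summable_log_step_sq) auto

text \<open>The tail is dominated by the telescoping series of
  \<open>1 / l - 1 / (l + 1)\<close>.\<close>

lemma sum_log_step_sq_ge:
  assumes "N \<ge> 1"
  shows "(\<Sum>l<N. (log_step l)\<^sup>2) \<ge> log_step_S - 1 / real N"
proof -
  have "(\<lambda>l. 1 / real (l + N) - 1 / real (Suc l + N)) sums (1 / real (0 + N) - 0)"
  proof (rule telescope_sums')
    have "(\<lambda>l. 1 / real l) \<longlonglongrightarrow> 0" by (rule lim_1_over_n)
    then show "(\<lambda>l. 1 / real (l + N)) \<longlonglongrightarrow> 0" by (rule LIMSEQ_ignore_initial_segment)
  qed
  then have tel: "(\<lambda>l. 1 / real (l + N) - 1 / real (Suc l + N)) sums (1 / real N)" by simp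
  have "(\<Sum>l. (log_step (l + N))\<^sup>2) \<le> (\<Sum>l. 1 / real (l + N) - 1 / real (Suc l + N))"
  proof (rule suminf_le)
    fix l
    have "(log_step (l + N))\<^sup>2 \<le> (1 / real (Suc (l + N)))\<^sup>2"
      using log_step_le[of "l + N"] log_step_pos[of "l + N"] by (intro power_mono) auto
    also have "\<dots> \<le> 1 / real (l + N) - 1 / real (Suc l + N)"
    proof -
      define b where "b = real (l + N)"
      have b: "b > 0" using assms by (simp add: b_def)
      have "(1 / (b + 1))\<^sup>2 = 1 / ((b + 1) * (b + 1))" by (simp add: power2_eq_square)
      also have "\<dots> \<le> 1 / (b * (b + 1))" using b by (intro divide_left_mono mult_right_mono mult_pos_pos) auto
      also have "\<dots> = 1 / b - 1 / (b + 1)" using b by (simp add: field_simps)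
      finally show ?thesis by (simp add: b_def add_ac)
    qed
    finally show "(log_step (l + N))\<^sup>2 \<le> 1 / real (l + N) - 1 / real (Suc l + N)" .
  qed (use tel summable_log_step_sq in \<open>auto simp: sums_iff summable_iff_shift[of "\<lambda>l. (log_step l)\<^sup>2"]\<close>)
  also have "\<dots> = 1 / real N" using tel by (simp add: sums_iff)
  finally have "(\<Sum>l. (log_step (l + N))\<^sup>2) \<le> 1 / real N" .
  moreover have "log_step_S = (\<Sum>l. (log_step (l + N))\<^sup>2) + (\<Sum>l<N. (log_step l)\<^sup>2)"
    unfolding log_step_S_def by (rule suminf_split_initial_segment[OF summable_log_step_sq])
  ultimately show ?thesis by linarith
qed

text \<open>Bernoulli gives \<open>q ^ e \<ge> 1 + e * (q - 1)\<close>, and a product of numbers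
  \<open>1 + x\<close> with \<open>x \<ge> 0\<close> is at least 1 plus their sum. With
  \<open>k = a + 1\<close>, for an exponent \<open>a\<close> in \<open>n\<close>, the valuations
  gained from this exponent cost at most \<open>a\<close> prime factors. Equality holds for prime
  \<open>k\<close>, which the construction for the lower bound exploits.\<close>

lemma weighted_exponents_le:
  fixes k :: nat
  assumes "k > 0" "finite A" "\<And>q. q \<in> A \<Longrightarrow> prime q"
  shows "(\<Sum>q\<in>A. real (multiplicity q k) * (real q - 1)) \<le> real k - 1"
    and "(\<Sum>q\<in>A. real (multiplicity q k)) \<le> log 2 (real k)"
proof -
  have pp: "(\<Prod>q\<in>A. q ^ multiplicity q k) \<le> k"
  proof -
    have "(\<Prod>q\<in>A. q ^ multiplicity q k) = (\<Prod>q\<in>A \<inter> prime_factors k. q ^ multiplicity q k)"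
      using assms by (intro prod.mono_neutral_right) (auto simp: prime_factors_multiplicity)
    also have "\<dots> dvd (\<Prod>q\<in>prime_factors k. q ^ multiplicity q k)"
      by (intro prod_dvd_prod_subset) auto
    also have "\<dots> = k" using assms(1) by (simp add: prod_prime_factors)
    finally show ?thesis using assms(1) by (rule dvd_imp_le)
  qed
  have "1 + (\<Sum>q\<in>A. real (multiplicity q k) * (real q - 1)) \<le> (\<Prod>q\<in>A. 1 + real (multiplicity q k) * (real q - 1))"
    using assms(2,3)
  proof (induction A rule: finite_induct)
    case (insert q A)
    define x y where "x = real (multiplicity q k) * (real q - 1)" and "y = (\<Sum>q\<in>A. real (multiplicity q k) * (real q - 1))"
    have "x \<ge> 0" using insert.prems[of q] prime_ge_1_nat[of q] by (simp add: x_def)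
    moreover have "y \<ge> 0" unfolding y_def using insert.prems prime_ge_1_nat by (intro sum_nonneg mult_nonneg_nonneg) auto
    ultimately have "1 + (x + y) \<le> (1 + x) * (1 + y)" by (simp add: algebra_simps)
    also have "\<dots> \<le> (1 + x) * (\<Prod>q\<in>A. 1 + real (multiplicity q k) * (real q - 1))"
      using insert \<open>x \<ge> 0\<close> by (intro mult_left_mono) (auto simp: y_def)
    finally show ?case using insert.hyps by (simp add: x_def y_def)
  qed simp
  also have "\<dots> \<le> (\<Prod>q\<in>A. real q ^ multiplicity q k)"
  proof (rule prod_mono)
    fix q assume "q \<in> A"
    then have q: "q \<ge> 1" using assms(3) prime_ge_1_nat by blast
    then show "0 \<le> 1 + real (multiplicity q k) * (real q - 1) \<and> 1 + real (multiplicity q k) * (real q - 1) \<le> real q ^ multiplicity q k"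
      using Bernoulli_inequality[of "real q - 1" "multiplicity q k"] by (simp add: add_nonneg_nonneg)
  qed
  also have "\<dots> = real (\<Prod>q\<in>A. q ^ multiplicity q k)" by simp
  also have "\<dots> \<le> real k" using pp by (simp only: of_nat_le_iff)
  finally show "(\<Sum>q\<in>A. real (multiplicity q k) * (real q - 1)) \<le> real k - 1" by simp
  define s where "s = (\<Sum>q\<in>A. multiplicity q k)"
  have "2 ^ s = (\<Prod>q\<in>A. 2 ^ multiplicity q k :: nat)" unfolding s_def by (rule power_sum)
  also have "\<dots> \<le> (\<Prod>q\<in>A. q ^ multiplicity q k)"
    using assms(3) by (intro prod_mono) (auto intro!: power_mono prime_ge_2_nat)
  also have "\<dots> \<le> k" by (rule pp)
  finally have "real (2 ^ s) \<le> real k" by (simp only: of_nat_le_iff)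
  then have "2 powr real s \<le> real k" by (simp add: powr_realpow)
  then have "real s \<le> log 2 (real k)" using assms(1) by (subst le_log_iff) auto
  then show "(\<Sum>q\<in>A. real (multiplicity q k)) \<le> log 2 (real k)" by (simp add: s_def)
qed

text \<open>Weak duality: at price \<open>\<mu>\<close> per unit, the surplus of
  \<open>ln (1 + e)\<close> is a sum of \<open>log_step l - \<mu>\<close>, bounded by its positive
  parts. Beyond \<open>Y\<close> the gains are at most \<open>1 / Y\<close>, hence below the price,
  and the bound is uniform in \<open>e\<close>.\<close>

lemma ln_one_plus_le_dual:
  assumes "\<mu> \<ge> 1 / Y" "Y > 0"
  shows "ln (1 + real e) \<le> \<mu> * real e + (\<Sum>l<nat \<lfloor>Y\<rfloor>. max 0 (log_step l - \<mu>))"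
proof -
  let ?N = "nat \<lfloor>Y\<rfloor>"
  have z: "log_step l - \<mu> \<le> 0" if "l \<ge> ?N" for l
  proof -
    have "Y \<le> real (Suc l)" using that by linarith
    then have "1 / real (Suc l) \<le> 1 / Y" using assms by (intro divide_left_mono) auto
    then show ?thesis using log_step_le[of l] assms(1) by linarith
  qed
  have "ln (1 + real e) - \<mu> * real e = (\<Sum>l<e. log_step l - \<mu>)"
    by (simp add: sum_subtractf sum_log_step)
  also have "\<dots> \<le> (\<Sum>l<e. max 0 (log_step l - \<mu>))" by (intro sum_mono) auto
  also have "\<dots> \<le> (\<Sum>l<max e ?N. max 0 (log_step l - \<mu>))" by (intro sum_mono2) auto
  also have "\<dots> = (\<Sum>l<?N. max 0 (log_step l - \<mu>))"
    using z by (intro sum.mono_neutral_right) (auto simp: max_def dest: antisym)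
  finally show ?thesis by simp
qed

section \<open>The extremal problem for a multiplicative function\<close>

locale split_counting =
  fixes P :: "nat set" and f :: "nat \<Rightarrow> nat"
  assumes P_prime: "p \<in> P \<Longrightarrow> prime p"
    and f_0: "f 0 = 0" and f_1: "f 1 = 1"
    and f_mult: "coprime m n \<Longrightarrow> m > 0 \<Longrightarrow> n > 0 \<Longrightarrow> f (m * n) = f m * f n"
    and f_split: "p \<in> P \<Longrightarrow> f (p ^ a) = a + 1"
    and f_other: "prime p \<Longrightarrow> p \<notin> P \<Longrightarrow> f (p ^ a) \<le> 1"
begin

definition pP :: "real \<Rightarrow> real" where "pP t = real (card {p\<in>P. real p \<le> t})"

text \<open>This is \<open>\<integral>\<^sub>0\<^sup>z pP t dt\<close>.\<close>

definition WP :: "real \<Rightarrow> real" where "WP z = (\<Sum>p | p \<in> P \<and> real p \<le> z. z - real p)"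

lemma finite_P_le [simp]: "finite {p. p \<in> P \<and> real p \<le> t}"
  by (rule finite_subset[of _ "{..nat \<lfloor>t\<rfloor>}"]) (auto simp: le_nat_floor)

lemma pP_le: "t \<ge> 0 \<Longrightarrow> pP t \<le> t"
proof -
  assume t: "t \<ge> 0"
  have "{p\<in>P. real p \<le> t} \<subseteq> {1..nat \<lfloor>t\<rfloor>}" using P_prime prime_gt_0_nat by (auto simp: le_nat_floor Suc_le_eq)
  then have "card {p\<in>P. real p \<le> t} \<le> nat \<lfloor>t\<rfloor>" using card_mono[of "{1..nat \<lfloor>t\<rfloor>}"] by fastforce
  then have "pP t \<le> real (nat \<lfloor>t\<rfloor>)" by (simp add: pP_def)
  then show ?thesis using of_nat_floor[OF t] by linarith
qed

lemma pP_has_integral: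
  assumes "z \<ge> 0"
  shows "(pP has_integral WP z) {0..z}"
proof -
  let ?A = "{p\<in>P. real p \<le> z}"
  have 1: "((\<lambda>t. if t \<in> {real p..z} then 1 else 0 :: real) has_integral (z - real p)) {0..z}" if "p \<in> ?A" for p
    using has_integral_const_real[of "1::real" "real p" z] that
    by (subst has_integral_restrict) auto
  have "((\<lambda>t. \<Sum>p\<in>?A. if t \<in> {real p..z} then 1 else 0 :: real) has_integral (\<Sum>p\<in>?A. z - real p)) {0..z}"
    by (intro has_integral_sum finite_P_le 1)
  moreover have "(\<Sum>p\<in>?A. if t \<in> {real p..z} then 1 else 0 :: real) = pP t" if "t \<in> {0..z}" for t
  proof -
    have "(\<Sum>p\<in>?A. if t \<in> {real p..z} then 1 else 0 :: real) = real (card {p \<in> ?A. t \<in> {real p..z}})"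
      using sum.inter_filter[of ?A "\<lambda>_. 1::real" "\<lambda>p. t \<in> {real p..z}"] by simp
    also have "{p \<in> ?A. t \<in> {real p..z}} = {p\<in>P. real p \<le> t}" using that by auto
    finally show ?thesis by (simp add: pP_def)
  qed
  ultimately show ?thesis unfolding WP_def by (rule has_integral_eq[rotated])
qed

lemma linear_has_integral: "z \<ge> 0 \<Longrightarrow> ((\<lambda>t. k * t + h) has_integral (k * z\<^sup>2 / 2 + h * z)) {0..z}" for k h z :: real
  using has_integral_add[OF has_integral_mult_right[OF ident_has_integral[of 0 z], of k] has_integral_const_real[of h 0 z]]
  by (simp add: mult.commute)

lemma WP_upper:
  assumes "z \<ge> 0" "\<And>t. 0 \<le> t \<Longrightarrow> t \<le> z \<Longrightarrow> pP t \<le> k * t + h"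
  shows "WP z \<le> k * z\<^sup>2 / 2 + h * z"
  by (rule has_integral_le[OF pP_has_integral linear_has_integral]) (use assms in auto)

lemma WP_lower:
  assumes "z \<ge> 0" "\<And>t. 0 \<le> t \<Longrightarrow> t \<le> z \<Longrightarrow> k * t - h \<le> pP t"
  shows "WP z \<ge> k * z\<^sup>2 / 2 - h * z"
  using has_integral_le[OF linear_has_integral[of z k "-h"] pP_has_integral] assms by auto

lemma f_prod_primes:
  assumes "finite A" "\<And>p. p \<in> A \<Longrightarrow> prime p"
  shows "f (\<Prod>p\<in>A. p ^ g p) = (\<Prod>p\<in>A. f (p ^ g p))"
  using assms
proof (induction A rule: finite_induct)
  case (insert p A)
  have "coprime (p ^ g p) (\<Prod>q\<in>A. q ^ g q)"
    using insert by (intro prod_coprime_right) (auto intro!: coprime_power_left_iff[THEN iffD2] coprime_power_right_iff[THEN iffD2] primes_coprime)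
  moreover have "p ^ g p > 0" "(\<Prod>q\<in>A. q ^ g q) > 0" using insert.prems prime_gt_0_nat by (auto intro!: prod_pos)
  ultimately show ?case using insert f_mult by simp
qed (use f_1 in simp)

text \<open>The local factors outside \<open>P\<close> are 0 or 1, and a nonzero product forces them
  to be 1.\<close>

lemma f_eq_prod:
  assumes "n > 0" "f n \<noteq> 0"
  shows "f n = (\<Prod>p\<in>prime_factors n \<inter> P. multiplicity p n + 1)"
proof -
  have n: "n = (\<Prod>p\<in>prime_factors n. p ^ multiplicity p n)" using assms(1) by (simp add: prod_prime_factors)
  have h: "f n = (\<Prod>p\<in>prime_factors n. f (p ^ multiplicity p n))"
    by (subst n) (intro f_prod_primes, auto)
  moreover have "(\<Prod>p\<in>prime_factors n. f (p ^ multiplicity p n)) = (\<Prod>p\<in>prime_factors n \<inter> P. f (p ^ multiplicity p n))"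
  proof (rule prod.mono_neutral_right)
    show "\<forall>p\<in>prime_factors n - prime_factors n \<inter> P. f (p ^ multiplicity p n) = 1"
    proof
      fix p assume p: "p \<in> prime_factors n - prime_factors n \<inter> P"
      then have "f (p ^ multiplicity p n) \<le> 1" by (intro f_other) auto
      moreover have "f (p ^ multiplicity p n) \<noteq> 0"
        using assms(2) p unfolding h by (intro notI) (auto intro: prod_zero)
      ultimately show "f (p ^ multiplicity p n) = 1" by linarith
    qed
  qed auto
  ultimately show ?thesis using f_split by simp
qed

lemma ln_eq_sum_multiplicity: "n > 0 \<Longrightarrow> ln (real n) = (\<Sum>p\<in>prime_factors n. real (multiplicity p n) * ln (real p))" for n :: nat
proof -
  assume "n > 0"
  then have "real n = (\<Prod>p\<in>prime_factors n. real p ^ multiplicity p n)"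
    using arg_cong[OF prod_prime_factors[of n], of real] by simp
  moreover have "ln (\<Prod>p\<in>prime_factors n. real p ^ multiplicity p n) = (\<Sum>p\<in>prime_factors n. ln (real p ^ multiplicity p n))"
    by (rule ln_prod) (auto simp: prime_factors_gt_0_nat)
  moreover have "ln (real p ^ multiplicity p n) = real (multiplicity p n) * ln (real p)" if "p \<in> prime_factors n" for p
    by (rule ln_realpow)
  ultimately show ?thesis by simp
qed

text \<open>The first summand collects the prime factors of \<open>n\<close> up to
  \<open>P0\<close>, with a crude bound for each. Larger prime factors, counted with multiplicity,
  use at least \<open>ln P0\<close> of the budget \<open>Z\<close> each; at multiplier
  \<open>1 / Y\<close> they are worth at most the second summand. The third is the surplus left by
  the dual bound, summed over \<open>q\<close> by means of \<open>WP\<close>.\<close>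

lemma upper_bound:
  assumes n: "n \<ge> 1" "ln (real n) \<le> Z" and ff: "f (f n) > 0"
    and Z: "Z \<ge> 0" and Y: "Y \<ge> 1" and P0: "P0 > 1" and k: "k \<ge> 0" "h \<ge> 0"
    and pi: "\<And>t. 0 \<le> t \<Longrightarrow> t \<le> Y + 1 \<Longrightarrow> pP t \<le> k * t + h"
  shows "ln (real (f (f n))) \<le> P0 * log 2 (Z / ln 2 + 1) + Z / (Y * ln P0) +
    (k / 2 * (Y\<^sup>2 * log_step_S + 2 * Y * ln (1 + Y) + Y) + h * (Y * ln (1 + Y) + Y)) / Y"
proof -
  define m where "m = f n"
  have m0: "m > 0" using ff f_0 by (cases "f n") (auto simp: m_def)
  have n0: "n > 0" using n by simp
  define A where "A = prime_factors n \<inter> P"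
  define a where "a = (\<lambda>p. multiplicity p n)"
  have finA: "finite A" by (simp add: A_def)
  have Apr: "prime p" if "p \<in> A" for p using that by (auto simp: A_def)
  have m_eq: "m = (\<Prod>p\<in>A. a p + 1)" using f_eq_prod[OF n0] m0 by (simp add: m_def A_def a_def)
  define Q where "Q = prime_factors m \<inter> P"
  have finQ: "finite Q" by (simp add: Q_def)
  have Qpr: "prime q" if "q \<in> Q" for q using that by (auto simp: Q_def)
  have fm: "f m = (\<Prod>q\<in>Q. multiplicity q m + 1)" using f_eq_prod[OF m0] ff by (simp add: m_def Q_def)
  define v where "v = (\<lambda>q p. multiplicity q (a p + 1))"
  have mult_m: "multiplicity q m = (\<Sum>p\<in>A. v q p)" if "q \<in> Q" for q
    unfolding m_eq v_def using Qpr[OF that] finA by (intro prime_elem_multiplicity_prod_distrib) auto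
  define A1 A2 where "A1 = {p\<in>A. real p \<le> P0}" and "A2 = {p\<in>A. real p > P0}"
  have AA: "A = A1 \<union> A2" "A1 \<inter> A2 = {}" "finite A1" "finite A2" using finA by (auto simp: A1_def A2_def)
  define e1 e2 where "e1 = (\<lambda>q. \<Sum>p\<in>A1. v q p)" and "e2 = (\<lambda>q. \<Sum>p\<in>A2. v q p)"
  have e: "multiplicity q m = e1 q + e2 q" if "q \<in> Q" for q
    unfolding mult_m[OF that] e1_def e2_def AA(1) using AA by (intro sum.union_disjoint) auto
  have lnn: "(\<Sum>p\<in>prime_factors n. real (a p) * ln (real p)) \<le> Z"
    using n ln_eq_sum_multiplicity[OF n0] by (simp add: a_def)
  have lnp: "ln (real p) \<ge> ln 2" if "p \<in> prime_factors n" for p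
  proof -
    have "p \<ge> 2" using that by (intro prime_ge_2_nat) auto
    then show ?thesis by (subst ln_le_cancel_iff) auto
  qed
  have anon: "real (a p) * ln (real p) \<ge> 0" if "p \<in> prime_factors n" for p
  proof -
    have "ln (real p) \<ge> 0" using lnp[OF that] ln_gt_zero[of "2::real"] by linarith
    then show ?thesis by simp
  qed
  have ap: "real (a p) \<le> Z / ln 2" if "p \<in> A" for p
  proof -
    have pn: "p \<in> prime_factors n" using that by (simp add: A_def)
    have "real (a p) * ln 2 \<le> real (a p) * ln (real p)" using lnp[OF pn] by (intro mult_left_mono) auto
    also have "\<dots> \<le> (\<Sum>p\<in>prime_factors n. real (a p) * ln (real p))" using pn anon by (intro member_le_sum) auto
    also have "\<dots> \<le> Z" by (rule lnn)
    finally show ?thesis by (simp add: pos_le_divide_eq)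
  qed
  have "ln (real (f m)) = (\<Sum>q\<in>Q. ln (1 + real (multiplicity q m)))"
    unfolding fm of_nat_prod by (subst ln_prod) (auto simp: finQ add.commute)
  also have "\<dots> \<le> (\<Sum>q\<in>Q. real (e1 q) + ln (1 + real (e2 q)))"
  proof (rule sum_mono)
    fix q assume q: "q \<in> Q"
    \<comment> \<open>Separates the share \<open>e1\<close> of the small primes, for which
      \<open>ln (1 + e1) \<le> e1\<close> is good enough, from the share \<open>e2\<close> that is
      priced.\<close>
    have "1 + real (multiplicity q m) \<le> (1 + real (e1 q)) * (1 + real (e2 q))"
      using e[OF q] by (simp add: algebra_simps)
    then have "ln (1 + real (multiplicity q m)) \<le> ln ((1 + real (e1 q)) * (1 + real (e2 q)))" by (subst ln_le_cancel_iff) (auto intro!: mult_pos_pos)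
    also have "\<dots> = ln (1 + real (e1 q)) + ln (1 + real (e2 q))" by (simp add: ln_mult add_pos_nonneg)
    also have "ln (1 + real (e1 q)) \<le> real (e1 q)" by (rule ln_add_one_self_le_self) auto
    finally show "ln (1 + real (multiplicity q m)) \<le> real (e1 q) + ln (1 + real (e2 q))" by simp
  qed
  also have "\<dots> = (\<Sum>q\<in>Q. real (e1 q)) + (\<Sum>q\<in>Q. ln (1 + real (e2 q)))" by (rule sum.distrib)
  also have "(\<Sum>q\<in>Q. real (e1 q)) \<le> P0 * log 2 (Z / ln 2 + 1)"
  proof -
    have "(\<Sum>q\<in>Q. real (e1 q)) = (\<Sum>p\<in>A1. \<Sum>q\<in>Q. real (v q p))"
      unfolding e1_def of_nat_sum by (rule sum.swap)
    also have "\<dots> \<le> (\<Sum>p\<in>A1. log 2 (Z / ln 2 + 1))"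
    proof (rule sum_mono)
      fix p assume p: "p \<in> A1"
      have "(\<Sum>q\<in>Q. real (v q p)) \<le> log 2 (real (a p + 1))"
        unfolding v_def using finQ Qpr by (intro weighted_exponents_le(2)) auto
      also have "\<dots> \<le> log 2 (Z / ln 2 + 1)"
        using ap[of p] p by (subst log_le_cancel_iff) (auto simp: A1_def Z add_nonneg_pos)
      finally show "(\<Sum>q\<in>Q. real (v q p)) \<le> log 2 (Z / ln 2 + 1)" .
    qed
    also have "\<dots> = real (card A1) * log 2 (Z / ln 2 + 1)" by simp
    also have "\<dots> \<le> P0 * log 2 (Z / ln 2 + 1)"
    proof (rule mult_right_mono)
      have "A1 \<subseteq> {p\<in>P. real p \<le> P0}" by (auto simp: A1_def A_def)
      then have "real (card A1) \<le> pP P0" unfolding pP_def by (simp add: card_mono)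
      then show "real (card A1) \<le> P0" using pP_le[of P0] P0 by linarith
      have "0 \<le> Z / ln 2" using Z by simp
      then show "0 \<le> log 2 (Z / ln 2 + 1)" using zero_le_log_cancel_iff[of 2 "Z / ln 2 + 1"] by simp
    qed
    finally show ?thesis .
  qed
  \<comment> \<open>The price is the multiplier \<open>1 / Y\<close> times the cost
    \<open>q - 1\<close>; it is at least \<open>1 / Y\<close>, as the dual bound requires, because
    \<open>q \<ge> 2\<close>.\<close>
  also have "(\<Sum>q\<in>Q. ln (1 + real (e2 q))) \<le> (\<Sum>q\<in>Q. (real q - 1) / Y * real (e2 q) + (\<Sum>l<nat \<lfloor>Y\<rfloor>. max 0 (log_step l - (real q - 1) / Y)))"
  proof (intro sum_mono ln_one_plus_le_dual)
    fix q assume "q \<in> Q"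
    then have "real q - 1 \<ge> 1" using Qpr prime_ge_2_nat[of q] by auto
    then show "1 / Y \<le> (real q - 1) / Y" using Y by (intro divide_right_mono) auto
  qed (use Y in auto)
  also have "\<dots> = (\<Sum>q\<in>Q. (real q - 1) / Y * real (e2 q)) + (\<Sum>q\<in>Q. \<Sum>l<nat \<lfloor>Y\<rfloor>. max 0 (log_step l - (real q - 1) / Y))"
    by (rule sum.distrib)
  also have "(\<Sum>q\<in>Q. (real q - 1) / Y * real (e2 q)) \<le> Z / (Y * ln P0)"
  proof -
    have lP0: "ln P0 > 0" using P0 by simp
    have "(\<Sum>q\<in>Q. (real q - 1) / Y * real (e2 q)) = (\<Sum>p\<in>A2. \<Sum>q\<in>Q. real (v q p) * (real q - 1)) / Y"
      unfolding e2_def of_nat_sum by (subst sum.swap) (simp add: sum_distrib_left sum_divide_distrib mult_ac)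
    also have "\<dots> \<le> (\<Sum>p\<in>A2. real (a p)) / Y"
    proof (intro divide_right_mono sum_mono)
      fix p assume p: "p \<in> A2"
      have "(\<Sum>q\<in>Q. real (v q p) * (real q - 1)) \<le> real (a p + 1) - 1"
        unfolding v_def using finQ Qpr by (intro weighted_exponents_le(1)) auto
      then show "(\<Sum>q\<in>Q. real (v q p) * (real q - 1)) \<le> real (a p)" by simp
    qed (use Y in auto)
    also have "\<dots> \<le> (Z / ln P0) / Y"
    proof (rule divide_right_mono)
      have "(\<Sum>p\<in>A2. real (a p)) * ln P0 \<le> (\<Sum>p\<in>A2. real (a p) * ln (real p))"
        unfolding sum_distrib_right using P0 by (intro sum_mono mult_left_mono) (auto simp: A2_def)
      also have "\<dots> \<le> (\<Sum>p\<in>prime_factors n. real (a p) * ln (real p))"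
        using anon by (intro sum_mono2) (auto simp: A2_def A_def)
      also have "\<dots> \<le> Z" by (rule lnn)
      finally show "(\<Sum>p\<in>A2. real (a p)) \<le> Z / ln P0" using lP0 by (simp add: pos_le_divide_eq)
    qed (use Y in auto)
    finally show ?thesis by (simp add: mult.commute)
  qed
  also have "(\<Sum>q\<in>Q. \<Sum>l<nat \<lfloor>Y\<rfloor>. max 0 (log_step l - (real q - 1) / Y)) \<le>
     (k / 2 * (Y\<^sup>2 * log_step_S + 2 * Y * ln (1 + Y) + Y) + h * (Y * ln (1 + Y) + Y)) / Y"
  proof -
    let ?N = "nat \<lfloor>Y\<rfloor>"
    have N: "real ?N \<le> Y" using Y by simp
    have "(\<Sum>q\<in>Q. \<Sum>l<?N. max 0 (log_step l - (real q - 1) / Y)) = (\<Sum>l<?N. \<Sum>q\<in>Q. max 0 (log_step l - (real q - 1) / Y))"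
      by (rule sum.swap)
    also have "\<dots> \<le> (\<Sum>l<?N. WP (log_step l * Y + 1) / Y)"
    proof (rule sum_mono)
      fix l
      \<comment> \<open>The positive part vanishes beyond \<open>z\<close>, where the
        \<open>+ 1\<close> reflects the cost \<open>q - 1\<close>; summed over all \<open>q\<close>
        in \<open>P\<close> it is \<open>WP z / Y\<close>.\<close>
      define z where "z = log_step l * Y + 1"
      have "max 0 (log_step l - (real q - 1) / Y) = (if real q \<le> z then (z - real q) / Y else 0)" for q
        using Y by (auto simp: z_def max_def field_simps)
      then have "(\<Sum>q\<in>Q. max 0 (log_step l - (real q - 1) / Y)) = (\<Sum>q\<in>{q\<in>Q. real q \<le> z}. (z - real q) / Y)"
        using sum.inter_filter[OF finQ, of "\<lambda>q. (z - real q) / Y" "\<lambda>q. real q \<le> z"] by (simp only:)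
      also have "\<dots> \<le> (\<Sum>q | q \<in> P \<and> real q \<le> z. (z - real q) / Y)"
        using Y by (intro sum_mono2) (auto simp: Q_def)
      finally show "(\<Sum>q\<in>Q. max 0 (log_step l - (real q - 1) / Y)) \<le> WP (log_step l * Y + 1) / Y"
        by (simp add: WP_def z_def[symmetric] sum_divide_distrib)
    qed
    also have "\<dots> \<le> (\<Sum>l<?N. (k * (log_step l * Y + 1)\<^sup>2 / 2 + h * (log_step l * Y + 1)) / Y)"
    proof (intro sum_mono divide_right_mono WP_upper)
      fix l t assume t: "0 \<le> t" "t \<le> log_step l * Y + 1"
      have "log_step l * Y \<le> 1 * Y" using Y log_step_le_1 by (intro mult_right_mono) auto
      then show "pP t \<le> k * t + h" using t by (intro pi) auto
    next
      fix l show "0 \<le> log_step l * Y + 1" using log_step_pos[of l] Y by (simp add: add_nonneg_nonneg)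
    qed (use Y in auto)
    also have "\<dots> = (k / 2 * (Y\<^sup>2 * (\<Sum>l<?N. (log_step l)\<^sup>2) + 2 * Y * (\<Sum>l<?N. log_step l) + real ?N)
        + h * (Y * (\<Sum>l<?N. log_step l) + real ?N)) / Y"
    proof -
      have "(k * (log_step l * Y + 1)\<^sup>2 / 2 + h * (log_step l * Y + 1)) / Y =
        (k / 2 * (Y\<^sup>2 * (log_step l)\<^sup>2 + 2 * Y * log_step l + 1) + h * (Y * log_step l + 1)) / Y" for l
        by (simp add: power2_eq_square algebra_simps)
      then show ?thesis
        by (simp only: sum_divide_distrib[symmetric] sum.distrib sum_distrib_left[symmetric]) simp
    qed
    also have "\<dots> \<le> (k / 2 * (Y\<^sup>2 * log_step_S + 2 * Y * ln (1 + Y) + Y) + h * (Y * ln (1 + Y) + Y)) / Y"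
    proof -
      have "ln (1 + real i) \<le> ln (1 + Y)" if "real i \<le> Y" for i using that Y by (subst ln_le_cancel_iff) auto
      then have l: "(\<Sum>l<?N. log_step l) \<le> ln (1 + Y)" unfolding sum_log_step using N by blast
      show ?thesis using k Y l N sum_log_step_sq_le[of ?N]
        by (intro divide_right_mono add_mono mult_left_mono) auto
    qed
    finally show ?thesis .
  qed
  finally show ?thesis by (simp add: m_def)
qed

lemma downset_eq:
  fixes A :: "nat set"
  assumes "finite A" "\<And>i j. j \<in> A \<Longrightarrow> i \<le> j \<Longrightarrow> i \<in> A"
  shows "A = {..<card A}"
proof (cases "A = {}")
  case False
  have "A = {..Max A}" using assms(1) assms(2)[OF Max_in[OF assms(1) False]] by auto
  then have "card A = Suc (Max A)" by (metis card_atMost)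
  with \<open>A = {..Max A}\<close> show ?thesis using lessThan_Suc_atMost by simp
qed simp

text \<open>Every profitable increment \<open>(q, l)\<close> receives a prime of \<open>P\<close> of
  its own, at most \<open>B\<close>, with exponent \<open>q - 1\<close>; it contributes exactly the
  factor \<open>q\<close> to \<open>f n\<close>. At most \<open>Y * ln (1 + Y)\<close> increments
  occur, which is why \<open>piB\<close> has this form. Increments with \<open>l \<ge> N\<close> are
  dropped, at a loss of \<open>2 / Y\<close> in the sum of squares.\<close>

lemma lower_bound:
  assumes Y: "Y \<ge> 1" and B: "B \<ge> 1" and kl: "kl \<ge> 0" "h \<ge> 0" "2 * ku \<ge> kl"
    and pi_u: "\<And>t. 0 \<le> t \<Longrightarrow> t \<le> Y \<Longrightarrow> pP t \<le> ku * t + h"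
    and pi_l: "\<And>t. 0 \<le> t \<Longrightarrow> t \<le> Y \<Longrightarrow> kl * t - h \<le> pP t"
    and piB: "pP B \<ge> Y * ln (1 + Y)"
  shows "\<exists>n\<ge>1. f (f n) > 0 \<and> ln (real n) \<le> ln B * ((ku - kl / 2) * log_step_S * Y\<^sup>2 + 2 * h * Y * ln (1 + Y)) \<and>
     ln (real (f (f n))) \<ge> kl * Y * (log_step_S - 2 / Y) - h * ln (1 + Y)"
proof -
  define N where "N = nat \<lfloor>Y\<rfloor>"
  have N: "real N \<le> Y" "N \<ge> 1" "real N \<ge> Y / 2"
  proof -
    show "real N \<le> Y" "N \<ge> 1" using Y by (auto simp: N_def le_nat_floor)
    then show "real N \<ge> Y / 2" using Y unfolding N_def by linarith
  qed
  have lN: "(\<Sum>l<N. log_step l) \<le> ln (1 + Y)" unfolding sum_log_step using N(1) Y by (subst ln_le_cancel_iff) auto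
  define zl where "zl = (\<lambda>l. log_step l * Y)"
  have zl: "0 \<le> zl l" "zl l \<le> Y" for l
  proof -
    show "0 \<le> zl l" unfolding zl_def using log_step_pos[of l] Y by simp
    have "log_step l * Y \<le> 1 * Y" using Y log_step_le_1 by (intro mult_right_mono) auto
    then show "zl l \<le> Y" by (simp add: zl_def)
  qed
  define Q where "Q = {q\<in>P. real q \<le> Y}"
  define Ls where "Ls = (\<lambda>q. {l. l < N \<and> real q \<le> zl l})"
  define I where "I = Sigma Q Ls"
  have fin: "finite Q" "finite I" "finite (Ls q)" for q unfolding I_def Q_def Ls_def by auto
  have swap: "(\<Sum>q\<in>Q. \<Sum>l\<in>Ls q. F q l) = (\<Sum>l<N. \<Sum>q | q \<in> P \<and> real q \<le> zl l. F q l)" for F :: "nat \<Rightarrow> nat \<Rightarrow> real"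
  proof -
    have "(\<Sum>q\<in>Q. \<Sum>l\<in>Ls q. F q l) = (\<Sum>(q,l)\<in>I. F q l)" unfolding I_def using fin by (intro sum.Sigma) auto
    also have "\<dots> = (\<Sum>(l,q)\<in>(SIGMA l:{..<N}. {q. q \<in> P \<and> real q \<le> zl l}). F q l)"
      by (rule sum.reindex_bij_witness[of _ "\<lambda>(l,q). (q,l)" "\<lambda>(q,l). (l,q)"])
         (use zl in \<open>auto simp: I_def Q_def Ls_def intro: order_trans\<close>)
    also have "\<dots> = (\<Sum>l<N. \<Sum>q | q \<in> P \<and> real q \<le> zl l. F q l)" by (intro sum.Sigma[symmetric]) auto
    finally show ?thesis .
  qed
  have "real (card I) = (\<Sum>q\<in>Q. \<Sum>l\<in>Ls q. 1)" unfolding I_def using fin by simp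
  also have "\<dots> = (\<Sum>l<N. pP (zl l))" unfolding swap by (simp add: pP_def)
  also have "\<dots> \<le> (\<Sum>l<N. zl l)" using zl by (intro sum_mono pP_le) auto
  also have "\<dots> = Y * (\<Sum>l<N. log_step l)" by (simp add: zl_def sum_distrib_left mult.commute)
  also have "\<dots> \<le> Y * ln (1 + Y)" using lN Y by (intro mult_left_mono) auto
  also have "\<dots> \<le> real (card {p\<in>P. real p \<le> B})" using piB by (simp add: pP_def)
  finally have "card I \<le> card {p\<in>P. real p \<le> B}" by simp
  then obtain \<phi> where phi: "\<phi> ` I \<subseteq> {p\<in>P. real p \<le> B}" "inj_on \<phi> I"
    using card_le_inj[of I "{p\<in>P. real p \<le> B}"] fin by auto
  have phiP: "\<phi> i \<in> P" "real (\<phi> i) \<le> B" "prime (\<phi> i)" if "i \<in> I" for i using phi that P_prime by auto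
  have Qpr: "prime q" if "q \<in> Q" for q using that P_prime by (auto simp: Q_def)
  define n where "n = (\<Prod>i\<in>I. \<phi> i ^ (fst i - 1))"
  have n0: "n > 0" unfolding n_def using phiP(3) prime_gt_0_nat by (intro prod_pos) auto
  define m where "m = (\<Prod>q\<in>Q. q ^ card (Ls q))"
  have "f n = m"
  proof -
    define g where "g = (\<lambda>p. fst (inv_into I \<phi> p) - 1)"
    have gi: "g (\<phi> i) = fst i - 1" if "i \<in> I" for i using that phi(2) by (simp add: g_def)
    have "n = (\<Prod>p\<in>\<phi> ` I. p ^ g p)" unfolding n_def using phi(2) gi by (simp add: prod.reindex)
    then have "f n = (\<Prod>p\<in>\<phi> ` I. f (p ^ g p))" using fin phiP by (auto intro: f_prod_primes)
    also have "\<dots> = (\<Prod>p\<in>\<phi> ` I. g p + 1)" using phiP f_split by (intro prod.cong) auto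
    also have "\<dots> = (\<Prod>i\<in>I. fst i - 1 + 1)" using phi(2) gi by (simp add: prod.reindex)
    also have "\<dots> = (\<Prod>i\<in>I. fst i)"
      using Qpr prime_gt_0_nat by (intro prod.cong) (auto simp: I_def)
    also have "\<dots> = (\<Prod>q\<in>Q. \<Prod>l\<in>Ls q. q)" unfolding I_def using fin by (subst prod.Sigma) (auto intro: prod.cong)
    also have "\<dots> = m" by (simp add: m_def)
    finally show ?thesis .
  qed
  have fm: "f m = (\<Prod>q\<in>Q. card (Ls q) + 1)"
    unfolding m_def using fin Qpr f_split by (subst f_prod_primes) (auto simp: Q_def)
  have fm0: "f m > 0" unfolding fm by (intro prod_pos) auto
  have "ln (real (f m)) = (\<Sum>q\<in>Q. ln (1 + real (card (Ls q))))"
    unfolding fm of_nat_prod by (subst ln_prod) (auto simp: fin add.commute)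
  also have "\<dots> = (\<Sum>q\<in>Q. \<Sum>l\<in>Ls q. log_step l)"
  proof (rule sum.cong)
    fix q assume "q \<in> Q"
    \<comment> \<open>Gains decrease with \<open>l\<close>, so the profitable levels for
      \<open>q\<close> form an initial segment and their gains telescope to a logarithm.\<close>
    have "Ls q = {..<card (Ls q)}"
    proof (rule downset_eq[OF fin(3)])
      fix i j assume "j \<in> Ls q" "i \<le> j"
      moreover from this have "zl j \<le> zl i" unfolding zl_def using Y by (intro mult_right_mono log_step_antimono) auto
      ultimately show "i \<in> Ls q" by (auto simp: Ls_def)
    qed
    then show "ln (1 + real (card (Ls q))) = (\<Sum>l\<in>Ls q. log_step l)" using sum_log_step by metis
  qed simp
  also have "\<dots> = (\<Sum>l<N. log_step l * pP (zl l))" unfolding swap by (simp add: pP_def mult.commute)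
  also have "\<dots> \<ge> (\<Sum>l<N. log_step l * (kl * zl l - h))"
    using zl log_step_pos by (intro sum_mono mult_left_mono pi_l) (auto simp: less_imp_le)
  also have "(\<Sum>l<N. log_step l * (kl * zl l - h)) = kl * Y * (\<Sum>l<N. (log_step l)\<^sup>2) - h * (\<Sum>l<N. log_step l)"
    by (simp add: zl_def power2_eq_square algebra_simps sum_subtractf sum_distrib_left)
  finally have "kl * Y * (\<Sum>l<N. (log_step l)\<^sup>2) - h * (\<Sum>l<N. log_step l) \<le> ln (real (f m))" .
  moreover have "kl * Y * (log_step_S - 2 / Y) \<le> kl * Y * (\<Sum>l<N. (log_step l)\<^sup>2)"
  proof (intro mult_left_mono)
    have "1 / real N \<le> 1 / (Y / 2)" using N Y by (intro divide_left_mono) auto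
    then show "log_step_S - 2 / Y \<le> (\<Sum>l<N. (log_step l)\<^sup>2)" using sum_log_step_sq_ge[OF N(2)] by simp
  qed (use kl Y in auto)
  moreover have "h * (\<Sum>l<N. log_step l) \<le> h * ln (1 + Y)" using lN kl by (intro mult_left_mono) auto
  ultimately have val: "kl * Y * (log_step_S - 2 / Y) - h * ln (1 + Y) \<le> ln (real (f m))" by linarith
  have "ln (real n) = (\<Sum>i\<in>I. real (fst i - 1) * ln (real (\<phi> i)))"
  proof -
    have "ln (real n) = (\<Sum>i\<in>I. ln (real (\<phi> i) ^ (fst i - 1)))"
      unfolding n_def of_nat_prod of_nat_power using phiP(3) prime_gt_0_nat fin by (intro ln_prod) auto
    also have "\<dots> = (\<Sum>i\<in>I. real (fst i - 1) * ln (real (\<phi> i)))"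
      using phiP(3) prime_gt_0_nat by (intro sum.cong ln_realpow) auto
    finally show ?thesis .
  qed
  also have "\<dots> \<le> (\<Sum>i\<in>I. real (fst i) * ln B)"
  proof (intro sum_mono mult_mono)
    fix i assume i: "i \<in> I"
    show "ln (real (\<phi> i)) \<le> ln B" using phiP[OF i] prime_gt_0_nat B by (subst ln_le_cancel_iff) auto
    show "0 \<le> ln (real (\<phi> i))" using phiP[OF i] prime_ge_1_nat by auto
  qed auto
  also have "\<dots> = ln B * (\<Sum>i\<in>I. real (fst i))" by (simp add: sum_distrib_left mult.commute)
  also have "(\<Sum>i\<in>I. real (fst i)) = (\<Sum>q\<in>Q. \<Sum>l\<in>Ls q. real q)"
    unfolding I_def using fin by (subst sum.Sigma) (auto intro: sum.cong)
  also have "\<dots> = (\<Sum>l<N. \<Sum>q | q \<in> P \<and> real q \<le> zl l. real q)" by (rule swap)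
  also have "ln B * \<dots> \<le> ln B * (\<Sum>l<N. (ku - kl / 2) * (zl l)\<^sup>2 + 2 * h * zl l)"
  proof (intro mult_left_mono sum_mono)
    fix l
    \<comment> \<open>Partial summation for the sum of the primes up to \<open>zl l\<close>: the
      upper bound on \<open>pP\<close> is used in the boundary term and the lower bound in
      \<open>WP\<close>, whence \<open>ku - kl / 2\<close>.\<close>
    have "WP (zl l) = zl l * pP (zl l) - (\<Sum>q | q \<in> P \<and> real q \<le> zl l. real q)"
      by (simp add: WP_def pP_def sum_subtractf mult.commute)
    moreover have "WP (zl l) \<ge> kl * (zl l)\<^sup>2 / 2 - h * zl l"
      by (intro WP_lower zl pi_l) (use zl[of l] in auto)
    moreover have "zl l * pP (zl l) \<le> zl l * (ku * zl l + h)" by (intro mult_left_mono pi_u zl)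
    ultimately show "(\<Sum>q | q \<in> P \<and> real q \<le> zl l. real q) \<le> (ku - kl / 2) * (zl l)\<^sup>2 + 2 * h * zl l"
      by (simp add: power2_eq_square algebra_simps)
  qed (use B in auto)
  also have "(\<Sum>l<N. (ku - kl / 2) * (zl l)\<^sup>2 + 2 * h * zl l) = (ku - kl / 2) * (\<Sum>l<N. (log_step l)\<^sup>2) * Y\<^sup>2 + 2 * h * Y * (\<Sum>l<N. log_step l)"
    by (simp add: zl_def sum.distrib sum_distrib_left sum_distrib_right power_mult_distrib mult_ac)
  also have "ln B * \<dots> \<le> ln B * ((ku - kl / 2) * log_step_S * Y\<^sup>2 + 2 * h * Y * ln (1 + Y))"
    using B kl Y lN sum_log_step_sq_le[of N] by (intro mult_left_mono add_mono mult_right_mono) auto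
  finally have "ln (real n) \<le> ln B * ((ku - kl / 2) * log_step_S * Y\<^sup>2 + 2 * h * Y * ln (1 + Y))" .
  with val fm0 n0 \<open>f n = m\<close> show ?thesis by (intro exI[of _ n]) auto
qed

end

section \<open>Asymptotics of the extremal problem\<close>

locale split_counting_asymp = split_counting +
  assumes count: "(\<lambda>x. pP x - x / (2 * ln x)) \<in> O(\<lambda>x. x * ln (ln x) / ln x ^ 2)"
begin

text \<open>Linear bounds whose coefficients depend on \<open>Y\<close> alone make \<open>WP\<close>
  quadratic. Up to \<open>h = Y / ln Y ^ 3\<close> the trivial bounds
  \<open>0 \<le> pP t \<le> t\<close> are absorbed by the additive term \<open>h\<close>. Beyond it
  \<open>ln t\<close> lies between \<open>ln Y - 3 * ln (ln Y)\<close> and \<open>ln Y + 1\<close>,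
  so replacing it by constants costs no more than the permitted error. The range up to
  \<open>2 * Y\<close> leaves room for the argument \<open>Y + 1\<close>.\<close>

lemma sandwich:
  "\<exists>c>0. \<forall>\<^sub>F Y in at_top. \<forall>t. 0 \<le> t \<longrightarrow> t \<le> 2 * Y \<longrightarrow>
     (1 / (2 * (ln Y + 1)) - c * ln (ln Y + 1) / (ln Y - 3 * ln (ln Y)) ^ 2) * t - Y / ln Y ^ 3 \<le> pP t \<and>
     pP t \<le> (1 / (2 * (ln Y - 3 * ln (ln Y))) + c * ln (ln Y + 1) / (ln Y - 3 * ln (ln Y)) ^ 2) * t + Y / ln Y ^ 3"
proof -
  obtain c where c: "c > 0" and ev: "\<forall>\<^sub>F t in at_top. norm (pP t - t / (2 * ln t)) \<le> c * norm (t * ln (ln t) / ln t ^ 2)"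
    using count by (auto simp: bigo_def)
  then obtain t0 where t0: "\<And>t. t \<ge> t0 \<Longrightarrow> \<bar>pP t - t / (2 * ln t)\<bar> \<le> c * \<bar>t * ln (ln t) / ln t ^ 2\<bar>"
    by (auto simp: eventually_at_top_linorder)
  define D where "D = (\<lambda>Y::real. ln Y - 3 * ln (ln Y))"
  define kl where "kl = (\<lambda>Y. 1 / (2 * (ln Y + 1)) - c * ln (ln Y + 1) / D Y ^ 2)"
  define ku where "ku = (\<lambda>Y. 1 / (2 * D Y) + c * ln (ln Y + 1) / D Y ^ 2)"
  have 1: "filterlim (\<lambda>Y::real. Y / ln Y ^ 3) at_top at_top" by real_asymp
  have e1: "\<forall>\<^sub>F Y in at_top. Y / ln Y ^ 3 \<ge> max t0 3" using 1 unfolding filterlim_at_top by blast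
  have "\<forall>\<^sub>F Y in at_top. D Y > 1" unfolding D_def by real_asymp
  moreover have "\<forall>\<^sub>F Y::real in at_top. ln (2 * Y) \<le> ln Y + 1"
    using eventually_gt_at_top[of 0]
  proof eventually_elim
    case (elim Y)
    then show ?case using ln_le_minus_one[of "2::real"] by (simp add: ln_mult)
  qed
  moreover have "\<forall>\<^sub>F Y::real in at_top. ln Y > 1" by real_asymp
  ultimately have "\<forall>\<^sub>F Y in at_top. \<forall>t. 0 \<le> t \<longrightarrow> t \<le> 2 * Y \<longrightarrow> kl Y * t - Y / ln Y ^ 3 \<le> pP t \<and> pP t \<le> ku Y * t + Y / ln Y ^ 3"
    using e1 eventually_gt_at_top[of 1]
  proof eventually_elim
    case (elim Y)
    define L where "L = ln (ln Y + 1)"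
    have L0: "L \<ge> 0" unfolding L_def using elim by simp
    define h where "h = Y / ln Y ^ 3"
    have h: "h \<ge> 3" "h \<ge> t0" using elim by (auto simp: h_def)
    have D: "D Y > 1" using elim by simp
    have ku0: "ku Y \<ge> 0" unfolding ku_def L_def[symmetric] using c D L0 by (intro add_nonneg_nonneg divide_nonneg_nonneg mult_nonneg_nonneg) auto
    have kl1: "kl Y \<le> 1"
    proof -
      have "c * L / D Y ^ 2 \<ge> 0" using c L0 by simp
      moreover have "1 / (2 * (ln Y + 1)) \<le> 1" using elim by simp
      ultimately show ?thesis unfolding kl_def L_def[symmetric] by linarith
    qed
    have lnh: "ln h = D Y"
      unfolding h_def D_def using elim by (simp add: ln_div ln_realpow)
    show ?case
    proof (intro allI impI)
      fix t assume t: "0 \<le> t" "t \<le> 2 * Y"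
      show "kl Y * t - Y / ln Y ^ 3 \<le> pP t \<and> pP t \<le> ku Y * t + Y / ln Y ^ 3"
        unfolding h_def[symmetric]
      proof (cases "t \<le> h")
        case True
        have "kl Y * t \<le> 1 * t" using kl1 t by (intro mult_right_mono) auto
        moreover have "pP t \<ge> 0" by (simp add: pP_def)
        moreover have "ku Y * t \<ge> 0" using ku0 t by simp
        ultimately show "kl Y * t - h \<le> pP t \<and> pP t \<le> ku Y * t + h" using True pP_le[OF t(1)] by linarith
      next
        case False
        have l1: "D Y \<le> ln t" unfolding lnh[symmetric] using False h by simp
        have "ln t \<le> ln (2 * Y)" using t False h by (subst ln_le_cancel_iff) auto
        then have l2: "ln t \<le> ln Y + 1" using elim by linarith
        have lt: "ln t > 1" using l1 D by linarith
        have "\<bar>t * ln (ln t) / ln t ^ 2\<bar> = t * (ln (ln t) / ln t ^ 2)" using lt t by (simp add: abs_mult)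
        also have "\<dots> \<le> t * (L / D Y ^ 2)"
          using lt l1 l2 D t L0 unfolding L_def by (intro mult_left_mono frac_le power_mono) auto
        finally have "c * \<bar>t * ln (ln t) / ln t ^ 2\<bar> \<le> c * (t * (L / D Y ^ 2))" using c by (intro mult_left_mono) auto
        moreover have "\<bar>pP t - t / (2 * ln t)\<bar> \<le> c * \<bar>t * ln (ln t) / ln t ^ 2\<bar>" using False h by (intro t0) auto
        ultimately have err: "\<bar>pP t - t / (2 * ln t)\<bar> \<le> c * (t * (L / D Y ^ 2))" by linarith
        have u: "t / (2 * ln t) \<le> t / (2 * D Y)" using l1 D t lt by (intro divide_left_mono) auto
        have l: "t / (2 * (ln Y + 1)) \<le> t / (2 * ln t)" using l2 lt t by (intro divide_left_mono) auto
        have "ku Y * t = t / (2 * D Y) + c * (t * (L / D Y ^ 2))" by (simp add: ku_def L_def algebra_simps)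
        moreover have "kl Y * t = t / (2 * (ln Y + 1)) - c * (t * (L / D Y ^ 2))" by (simp add: kl_def L_def algebra_simps)
        ultimately show "kl Y * t - h \<le> pP t \<and> pP t \<le> ku Y * t + h"
          using err u l h(1) by (simp only: abs_le_iff) linarith
      qed
    qed
  qed
  with c show ?thesis unfolding kl_def ku_def D_def by blast
qed

lemma upper_asymp:
  "\<exists>U. (\<lambda>Z. U Z - 2 * sqrt log_step_S * sqrt Z / ln Z) \<in> O(\<lambda>Z. sqrt Z * ln (ln Z) / ln Z ^ 2) \<and>
     (\<forall>\<^sub>F Z in at_top. \<forall>n\<ge>1. ln (real n) \<le> Z \<longrightarrow> f (f n) > 0 \<longrightarrow> ln (real (f (f n))) \<le> U Z)"
proof -
  obtain c where c: "c > 0" and sw0: "\<forall>\<^sub>F Y in at_top. \<forall>t. 0 \<le> t \<longrightarrow> t \<le> 2 * Y \<longrightarrow>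
     (1 / (2 * (ln Y + 1)) - c * ln (ln Y + 1) / (ln Y - 3 * ln (ln Y)) ^ 2) * t - Y / ln Y ^ 3 \<le> pP t \<and>
     pP t \<le> (1 / (2 * (ln Y - 3 * ln (ln Y))) + c * ln (ln Y + 1) / (ln Y - 3 * ln (ln Y)) ^ 2) * t + Y / ln Y ^ 3"
    using sandwich by blast
  have sw: "\<forall>\<^sub>F Y in at_top. \<forall>t. 0 \<le> t \<longrightarrow> t \<le> 2 * Y \<longrightarrow>
     pP t \<le> (1 / (2 * (ln Y - 3 * ln (ln Y))) + c * ln (ln Y + 1) / (ln Y - 3 * ln (ln Y)) ^ 2) * t + Y / ln Y ^ 3"
    using sw0 by (rule eventually_mono) blast
  define S where "S = log_step_S"
  have S: "S > 0" using log_step_S_pos by (simp add: S_def)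
  define ku where "ku = (\<lambda>Y::real. 1 / (2 * (ln Y - 3 * ln (ln Y))) + c * ln (ln Y + 1) / (ln Y - 3 * ln (ln Y)) ^ 2)"
  define h where "h = (\<lambda>Y::real. Y / ln Y ^ 3)"
  define V where "V = (\<lambda>Y. (ku Y / 2 * (Y\<^sup>2 * S + 2 * Y * ln (1 + Y) + Y) + h Y * (Y * ln (1 + Y) + Y)) / Y)"
  \<comment> \<open>Small enough that \<open>P0 * log Z\<close> is an error term, yet
    \<open>ln P0\<close> is \<open>ln Z / 2\<close> up to \<open>O(ln (ln Z))\<close>.\<close>
  define P0 where "P0 = (\<lambda>Z::real. sqrt Z / ln Z ^ 3)"
  \<comment> \<open>Balances the two main terms, about \<open>2 * Z / (Y * ln Z)\<close> and
    \<open>S * Y / (2 * ln Z)\<close>; each becomes \<open>sqrt (S * Z) / ln Z\<close>.\<close>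
  define Yf where "Yf = (\<lambda>Z. 2 * sqrt (Z / S))"
  define U where "U = (\<lambda>Z. P0 Z * log 2 (Z / ln 2 + 1) + Z / (Yf Z * ln (P0 Z)) + V (Yf Z))"
  have Ylim: "filterlim Yf at_top at_top" unfolding Yf_def using S by real_asymp
  have Vas: "(\<lambda>Y. V Y - S * Y / (4 * ln Y)) \<in> O(\<lambda>Y. Y * ln (ln Y) / ln Y ^ 2)"
    unfolding V_def ku_def h_def using S c by real_asymp
  have "(\<lambda>Z. V (Yf Z) - S * Yf Z / (4 * ln (Yf Z))) \<in> O(\<lambda>Z. Yf Z * ln (ln (Yf Z)) / ln (Yf Z) ^ 2)"
    by (rule landau_o.big.compose[OF Vas Ylim])
  also have "(\<lambda>Z. Yf Z * ln (ln (Yf Z)) / ln (Yf Z) ^ 2) \<in> O(\<lambda>Z. sqrt Z * ln (ln Z) / ln Z ^ 2)"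
    unfolding Yf_def using S by real_asymp
  finally have U1: "(\<lambda>Z. V (Yf Z) - S * Yf Z / (4 * ln (Yf Z))) \<in> O(\<lambda>Z. sqrt Z * ln (ln Z) / ln Z ^ 2)" .
  have U2: "(\<lambda>Z. S * Yf Z / (4 * ln (Yf Z)) - sqrt S * sqrt Z / ln Z) \<in> O(\<lambda>Z. sqrt Z * ln (ln Z) / ln Z ^ 2)"
  proof -
    have "S * (2 * sqrt (Z / S)) = 2 * sqrt S * sqrt Z" for Z
      using S by (simp add: real_sqrt_divide field_simps)
    then have "S * Yf Z / (4 * ln (Yf Z)) - sqrt S * sqrt Z / ln Z = sqrt S * (2 * sqrt Z / (4 * ln (Yf Z)) - sqrt Z / ln Z)" for Z
      unfolding Yf_def by (simp add: algebra_simps)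
    moreover have "(\<lambda>Z. 2 * sqrt Z / (4 * ln (Yf Z)) - sqrt Z / ln Z) \<in> O(\<lambda>Z. sqrt Z * ln (ln Z) / ln Z ^ 2)"
      unfolding Yf_def using S by real_asymp
    ultimately show ?thesis using S by simp
  qed
  have U3: "(\<lambda>Z. Z / (Yf Z * ln (P0 Z)) - sqrt S * sqrt Z / ln Z) \<in> O(\<lambda>Z. sqrt Z * ln (ln Z) / ln Z ^ 2)"
  proof -
    have ev: "\<forall>\<^sub>F Z in at_top. Z / (Yf Z * ln (P0 Z)) - sqrt S * sqrt Z / ln Z = sqrt S * (sqrt Z / (2 * ln (P0 Z)) - sqrt Z / ln Z)"
      using eventually_gt_at_top[of 0]
    proof eventually_elim
      case (elim Z)
      have "Z / (Yf Z * ln (P0 Z)) = (Z / Yf Z) / ln (P0 Z)" by simp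
      also have "Z / Yf Z = sqrt S * (sqrt Z / 2)" unfolding Yf_def using elim S
        by (simp add: real_sqrt_divide field_simps)
      finally show ?case by (simp add: algebra_simps)
    qed
    have "(\<lambda>Z. sqrt S * (sqrt Z / (2 * ln (P0 Z)) - sqrt Z / ln Z)) \<in> O(\<lambda>Z. sqrt Z * ln (ln Z) / ln Z ^ 2)"
    proof -
      have "(\<lambda>Z. sqrt Z / (2 * ln (P0 Z)) - sqrt Z / ln Z) \<in> O(\<lambda>Z. sqrt Z * ln (ln Z) / ln Z ^ 2)"
        unfolding P0_def by real_asymp
      then show ?thesis using S by simp
    qed
    then show ?thesis using landau_o.big.in_cong[OF ev] by blast
  qed
  have U4: "(\<lambda>Z. P0 Z * log 2 (Z / ln 2 + 1)) \<in> O(\<lambda>Z. sqrt Z * ln (ln Z) / ln Z ^ 2)"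
    unfolding P0_def by real_asymp
  have "(\<lambda>Z. P0 Z * log 2 (Z / ln 2 + 1) + (Z / (Yf Z * ln (P0 Z)) - sqrt S * sqrt Z / ln Z) +
      ((V (Yf Z) - S * Yf Z / (4 * ln (Yf Z))) + (S * Yf Z / (4 * ln (Yf Z)) - sqrt S * sqrt Z / ln Z))) \<in> O(\<lambda>Z. sqrt Z * ln (ln Z) / ln Z ^ 2)"
    by (intro sum_in_bigo U1 U2 U3 U4)
  then have Uas: "(\<lambda>Z. U Z - 2 * sqrt log_step_S * sqrt Z / ln Z) \<in> O(\<lambda>Z. sqrt Z * ln (ln Z) / ln Z ^ 2)"
    by (simp add: U_def S_def algebra_simps)
  have ku_ev: "\<forall>\<^sub>F Y in at_top. ku Y \<ge> 0" unfolding ku_def using c by real_asymp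
  have h_ev: "\<forall>\<^sub>F Y in at_top. h Y \<ge> 0" unfolding h_def by real_asymp
  have P0_ev: "\<forall>\<^sub>F Z in at_top. P0 Z > 1" unfolding P0_def by real_asymp
  have "\<forall>\<^sub>F Z in at_top. \<forall>n\<ge>1. ln (real n) \<le> Z \<longrightarrow> f (f n) > 0 \<longrightarrow> ln (real (f (f n))) \<le> U Z"
    using filterlim_iff[THEN iffD1, OF Ylim, rule_format, OF sw]
      filterlim_iff[THEN iffD1, OF Ylim, rule_format, OF ku_ev]
      filterlim_iff[THEN iffD1, OF Ylim, rule_format, OF h_ev]
      filterlim_iff[THEN iffD1, OF Ylim, rule_format, OF eventually_ge_at_top[of 1]]
      P0_ev eventually_ge_at_top[of 0]
  proof eventually_elim
    case (elim Z)
    show ?case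
    proof (intro allI impI)
      fix n :: nat assume n: "1 \<le> n" "ln (real n) \<le> Z" "f (f n) > 0"
      have "ln (real (f (f n))) \<le> P0 Z * log 2 (Z / ln 2 + 1) + Z / (Yf Z * ln (P0 Z)) +
        (ku (Yf Z) / 2 * ((Yf Z)\<^sup>2 * log_step_S + 2 * Yf Z * ln (1 + Yf Z) + Yf Z) + h (Yf Z) * (Yf Z * ln (1 + Yf Z) + Yf Z)) / Yf Z"
      proof (rule upper_bound[OF n])
        show "pP t \<le> ku (Yf Z) * t + h (Yf Z)" if "0 \<le> t" "t \<le> Yf Z + 1" for t
          using elim that unfolding ku_def h_def by auto
      qed (use elim in auto)
      then show "ln (real (f (f n))) \<le> U Z" unfolding U_def V_def S_def .
    qed
  qed
  with Uas show ?thesis by blast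
qed

lemma lower_asymp:
  "\<exists>V. (\<lambda>Z. V Z - 2 * sqrt log_step_S * sqrt Z / ln Z) \<in> O(\<lambda>Z. sqrt Z * ln (ln Z) / ln Z ^ 2) \<and>
     (\<forall>\<^sub>F Z in at_top. \<exists>n\<ge>1. ln (real n) \<le> Z \<and> f (f n) > 0 \<and> ln (real (f (f n))) \<ge> V Z)"
proof -
  define S where "S = log_step_S"
  have S: "S > 0" using log_step_S_pos by (simp add: S_def)
  obtain c where c: "c > 0" and sw: "\<forall>\<^sub>F Y in at_top. \<forall>t. 0 \<le> t \<longrightarrow> t \<le> 2 * Y \<longrightarrow>
     (1 / (2 * (ln Y + 1)) - c * ln (ln Y + 1) / (ln Y - 3 * ln (ln Y)) ^ 2) * t - Y / ln Y ^ 3 \<le> pP t \<and>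
     pP t \<le> (1 / (2 * (ln Y - 3 * ln (ln Y))) + c * ln (ln Y + 1) / (ln Y - 3 * ln (ln Y)) ^ 2) * t + Y / ln Y ^ 3"
    using sandwich by blast
  define kl where "kl = (\<lambda>Y::real. 1 / (2 * (ln Y + 1)) - c * ln (ln Y + 1) / (ln Y - 3 * ln (ln Y)) ^ 2)"
  define ku where "ku = (\<lambda>Y::real. 1 / (2 * (ln Y - 3 * ln (ln Y))) + c * ln (ln Y + 1) / (ln Y - 3 * ln (ln Y)) ^ 2)"
  define h where "h = (\<lambda>Y::real. Y / ln Y ^ 3)"
  \<comment> \<open>The cube provides about \<open>Y * ln Y ^ 2 / 2\<close> primes, more than the
    required \<open>Y * ln (1 + Y)\<close>, while \<open>ln B\<close> exceeds \<open>ln Y\<close>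
    only by \<open>3 * ln (ln Y)\<close>.\<close>
  define B where "B = (\<lambda>Y::real. Y * ln Y ^ 3)"
  define Xi where "Xi = (\<lambda>Y. ln (B Y) * ((ku Y - kl Y / 2) * S * Y\<^sup>2 + 2 * h Y * Y * ln (1 + Y)))"
  define V where "V = (\<lambda>Y. kl Y * Y * (S - 2 / Y) - h Y * ln (1 + Y))"
  have kl_ev: "\<forall>\<^sub>F Y in at_top. kl Y \<ge> 0" unfolding kl_def using c by real_asymp
  have ku_ev: "\<forall>\<^sub>F Y in at_top. 2 * ku Y \<ge> kl Y" unfolding kl_def ku_def using c by real_asymp
  have h_ev: "\<forall>\<^sub>F Y in at_top. h Y \<ge> 0" unfolding h_def by real_asymp
  have B_ev: "\<forall>\<^sub>F Y in at_top. B Y \<ge> 1" unfolding B_def by real_asymp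
  have Blim: "filterlim B at_top at_top" unfolding B_def by real_asymp
  have pi_ev: "\<forall>\<^sub>F t in at_top. pP t \<ge> t / (3 * ln t)"
  proof -
    obtain c' where c': "c' > 0" and ev: "\<forall>\<^sub>F t in at_top. norm (pP t - t / (2 * ln t)) \<le> c' * norm (t * ln (ln t) / ln t ^ 2)"
      using count by (auto simp: bigo_def)
    have "\<forall>\<^sub>F t in at_top. c' * norm (t * ln (ln t) / ln t ^ 2) \<le> t / (2 * ln t) - t / (3 * ln t)"
      using c' unfolding real_norm_def by real_asymp
    with ev show ?thesis by eventually_elim (simp add: abs_le_iff)
  qed
  have piB_ev: "\<forall>\<^sub>F Y in at_top. pP (B Y) \<ge> Y * ln (1 + Y)"
  proof -
    have "\<forall>\<^sub>F Y in at_top. B Y / (3 * ln (B Y)) \<ge> Y * ln (1 + Y)" unfolding B_def by real_asymp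
    with filterlim_iff[THEN iffD1, OF Blim, rule_format, OF pi_ev] show ?thesis by eventually_elim linarith
  qed
  have ex_ev: "\<forall>\<^sub>F Y in at_top. \<exists>n\<ge>1. f (f n) > 0 \<and> ln (real n) \<le> Xi Y \<and> ln (real (f (f n))) \<ge> V Y"
    using sw kl_ev ku_ev h_ev B_ev piB_ev eventually_ge_at_top[of 1]
  proof eventually_elim
    case (elim Y)
    show ?case unfolding Xi_def V_def S_def
    proof (rule lower_bound)
      show "pP t \<le> ku Y * t + h Y" "kl Y * t - h Y \<le> pP t" if "0 \<le> t" "t \<le> Y" for t
        using elim that unfolding ku_def kl_def h_def by auto
    qed (use elim in auto)
  qed
  have "(\<lambda>Y. Xi Y - S * Y\<^sup>2 / 4) \<in> O(\<lambda>Y. Y\<^sup>2 * ln (ln Y) / ln Y)"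
    unfolding Xi_def ku_def kl_def h_def B_def using S c by real_asymp
  then obtain k where k: "k > 0" and Xi_ev: "\<forall>\<^sub>F Y in at_top. norm (Xi Y - S * Y\<^sup>2 / 4) \<le> k * norm (Y\<^sup>2 * ln (ln Y) / ln Y)"
    by (auto simp: bigo_def)
  have Vas: "(\<lambda>Y. V Y - S * Y / (2 * ln Y)) \<in> O(\<lambda>Y. Y * ln (ln Y) / ln Y ^ 2)"
    unfolding V_def kl_def h_def using S c by real_asymp
  \<comment> \<open>The cost satisfies \<open>Xi Y \<le> S * Y^2 / 4 * (1 + K * r Z)\<close>: the 16
    combines the denominator 4 with the bound \<open>4 * r Z\<close> for
    \<open>ln (ln Y) / ln Y\<close>. Dividing by \<open>sqrt (1 + K * r Z)\<close> in
    \<open>Yf\<close> brings the cost down to \<open>Z\<close> without touching the main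
    term.\<close>
  define K where "K = 16 * k / S"
  have K: "K > 0" using k S by (simp add: K_def)
  define r where "r = (\<lambda>Z::real. ln (ln Z) / ln Z)"
  define Yf where "Yf = (\<lambda>Z. 2 * sqrt (Z / S) / sqrt (1 + K * r Z))"
  have Ylim: "filterlim Yf at_top at_top" unfolding Yf_def r_def using S K by real_asymp
  have rho_ev: "\<forall>\<^sub>F Z in at_top. ln (ln (Yf Z)) / ln (Yf Z) \<le> 4 * r Z"
    unfolding Yf_def r_def using S K by real_asymp
  have r_ev: "\<forall>\<^sub>F Z in at_top. r Z \<ge> 0" unfolding r_def by real_asymp
  have ll_ev: "\<forall>\<^sub>F Y::real in at_top. ln (ln Y) \<ge> 0 \<and> ln Y > 0"
    by (intro eventually_conj) real_asymp+
  have XiX: "\<forall>\<^sub>F Z in at_top. Xi (Yf Z) \<le> Z"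
    using filterlim_iff[THEN iffD1, OF Ylim, rule_format, OF Xi_ev] rho_ev r_ev
      filterlim_iff[THEN iffD1, OF Ylim, rule_format, OF ll_ev] eventually_gt_at_top[of 0]
  proof eventually_elim
    case (elim Z)
    define Y where "Y = Yf Z"
    have pos: "1 + K * r Z > 0" using K elim by (simp add: add_pos_nonneg)
    have Y2: "Y\<^sup>2 = 4 * Z / S / (1 + K * r Z)"
      unfolding Y_def Yf_def using elim S pos by (simp add: power_divide power_mult_distrib)
    have nn: "norm (Y\<^sup>2 * ln (ln Y) / ln Y) = Y\<^sup>2 * (ln (ln Y) / ln Y)"
      using elim unfolding Y_def[symmetric] by (simp add: abs_mult)
    have "Xi Y \<le> S * Y\<^sup>2 / 4 + k * (Y\<^sup>2 * (ln (ln Y) / ln Y))"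
      using elim(1) unfolding Y_def[symmetric] nn unfolding real_norm_def by linarith
    also have "k * (Y\<^sup>2 * (ln (ln Y) / ln Y)) \<le> k * (Y\<^sup>2 * (4 * r Z))"
      using elim(2) k unfolding Y_def[symmetric] by (intro mult_left_mono) auto
    also have "S * Y\<^sup>2 / 4 + k * (Y\<^sup>2 * (4 * r Z)) = S * Y\<^sup>2 / 4 * (1 + K * r Z)"
      using S by (simp add: K_def field_simps)
    also have "\<dots> = Z"
    proof -
      define q where "q = 1 + K * r Z"
      have "q > 0" using pos by (simp add: q_def)
      then show ?thesis unfolding Y2 q_def[symmetric] using S by (simp add: field_simps)
    qed
    finally show ?case by (simp add: Y_def)
  qed
  have "(\<lambda>Z. V (Yf Z) - S * Yf Z / (2 * ln (Yf Z))) \<in> O(\<lambda>Z. Yf Z * ln (ln (Yf Z)) / ln (Yf Z) ^ 2)"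
    by (rule landau_o.big.compose[OF Vas Ylim])
  also have "(\<lambda>Z. Yf Z * ln (ln (Yf Z)) / ln (Yf Z) ^ 2) \<in> O(\<lambda>Z. sqrt Z * ln (ln Z) / ln Z ^ 2)"
    unfolding Yf_def r_def using S K by real_asymp
  finally have V1: "(\<lambda>Z. V (Yf Z) - S * Yf Z / (2 * ln (Yf Z))) \<in> O(\<lambda>Z. sqrt Z * ln (ln Z) / ln Z ^ 2)" .
  have V2: "(\<lambda>Z. S * Yf Z / (2 * ln (Yf Z)) - 2 * sqrt S * sqrt Z / ln Z) \<in> O(\<lambda>Z. sqrt Z * ln (ln Z) / ln Z ^ 2)"
  proof -
    have "S * (2 * sqrt (Z / S)) = 2 * sqrt S * sqrt Z" for Z
      using S by (simp add: real_sqrt_divide field_simps)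
    then have "S * Yf Z / (2 * ln (Yf Z)) - 2 * sqrt S * sqrt Z / ln Z = sqrt S * (sqrt Z / sqrt (1 + K * r Z) / ln (Yf Z) - 2 * sqrt Z / ln Z)" for Z
      unfolding Yf_def by (simp add: algebra_simps)
    moreover have "(\<lambda>Z. sqrt Z / sqrt (1 + K * r Z) / ln (Yf Z) - 2 * sqrt Z / ln Z) \<in> O(\<lambda>Z. sqrt Z * ln (ln Z) / ln Z ^ 2)"
      unfolding Yf_def r_def using S K by real_asymp
    ultimately show ?thesis using S by simp
  qed
  have "(\<lambda>Z. (V (Yf Z) - S * Yf Z / (2 * ln (Yf Z))) + (S * Yf Z / (2 * ln (Yf Z)) - 2 * sqrt S * sqrt Z / ln Z)) \<in> O(\<lambda>Z. sqrt Z * ln (ln Z) / ln Z ^ 2)"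
    by (intro sum_in_bigo V1 V2)
  then have "(\<lambda>Z. V (Yf Z) - 2 * sqrt log_step_S * sqrt Z / ln Z) \<in> O(\<lambda>Z. sqrt Z * ln (ln Z) / ln Z ^ 2)"
    by (simp add: S_def)
  moreover have "\<forall>\<^sub>F Z in at_top. \<exists>n\<ge>1. ln (real n) \<le> Z \<and> f (f n) > 0 \<and> ln (real (f (f n))) \<ge> V (Yf Z)"
    using XiX filterlim_iff[THEN iffD1, OF Ylim, rule_format, OF ex_ev]
    by eventually_elim (meson order_trans)
  ultimately show ?thesis by (intro exI[of _ "\<lambda>Z. V (Yf Z)"] conjI)
qed

theorem max_asymp:
  "\<exists>E :: real \<Rightarrow> real.
     E \<in> O[at_top](\<lambda>x. ln (ln (ln x)) / ln (ln x)) \<and>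
     (\<forall>\<^sub>F x :: real in at_top.
        (MAX n \<in> {n :: nat. 1 \<le> n \<and> real n \<le> x}. ext_ln (f (f n)))
          = ereal (sqrt (ln x) / ln (ln x) * (c_const / sqrt 2 + E x)))"
proof -
  define g where "g = (\<lambda>Z. 2 * sqrt log_step_S * sqrt Z / ln Z)"
  define er where "er = (\<lambda>Z::real. sqrt Z * ln (ln Z) / ln Z ^ 2)"
  obtain U where U: "(\<lambda>Z. U Z - g Z) \<in> O(er)"
    and Uev: "\<forall>\<^sub>F Z in at_top. \<forall>n\<ge>1. ln (real n) \<le> Z \<longrightarrow> f (f n) > 0 \<longrightarrow> ln (real (f (f n))) \<le> U Z"
    using upper_asymp unfolding g_def er_def by blast
  obtain V where V: "(\<lambda>Z. V Z - g Z) \<in> O(er)"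
    and Vev: "\<forall>\<^sub>F Z in at_top. \<exists>n\<ge>1. ln (real n) \<le> Z \<and> f (f n) > 0 \<and> ln (real (f (f n))) \<ge> V Z"
    using lower_asymp unfolding g_def er_def by blast
  define Mx where "Mx = (\<lambda>x. MAX n \<in> {n :: nat. 1 \<le> n \<and> real n \<le> x}. ext_ln (f (f n)))"
  define m where "m = (\<lambda>x. real_of_ereal (Mx x))"
  have ev: "\<forall>\<^sub>F x in at_top. Mx x = ereal (m x) \<and> V (ln x) \<le> m x \<and> m x \<le> U (ln x)"
    using filterlim_iff[THEN iffD1, OF ln_at_top, rule_format, OF Uev] filterlim_iff[THEN iffD1, OF ln_at_top, rule_format, OF Vev]
      eventually_gt_at_top[of 0]
  proof eventually_elim
    case (elim x)
    let ?N = "{n :: nat. 1 \<le> n \<and> real n \<le> x}"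
    have fin: "finite ?N" by (rule finite_subset[of _ "{..nat \<lfloor>x\<rfloor>}"]) (auto simp: le_nat_floor)
    obtain n0 where n0: "n0 \<ge> 1" "ln (real n0) \<le> ln x" "f (f n0) > 0" "ln (real (f (f n0))) \<ge> V (ln x)"
      using elim(2) by blast
    then have "real n0 \<le> x" using elim(3) by simp
    with n0 have n0N: "n0 \<in> ?N" by simp
    have "Mx x \<in> (\<lambda>n. ext_ln (f (f n))) ` ?N" unfolding Mx_def using fin n0N by (intro Max_in) auto
    then obtain n1 where n1: "n1 \<ge> 1" "real n1 \<le> x" "Mx x = ext_ln (f (f n1))" by auto
    have ge: "ext_ln (f (f n0)) \<le> Mx x" unfolding Mx_def using fin n0N by (intro Max_ge) auto
    \<comment> \<open>The value at \<open>n0\<close> is finite, so the maximum is not the value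
      \<open>-\<infinity>\<close> at a vanishing iterate.\<close>
    then have "f (f n1) > 0" using n1(3) n0(3) by (cases "f (f n1) = 0") (auto simp: ext_ln_def)
    then have M: "Mx x = ereal (ln (real (f (f n1))))" using n1(3) by (simp add: ext_ln_def)
    then have m: "m x = ln (real (f (f n1)))" by (simp add: m_def)
    have "ln (real n1) \<le> ln x" using n1 elim(3) by simp
    then have "m x \<le> U (ln x)" using elim(1) n1(1) \<open>f (f n1) > 0\<close> m by simp
    moreover have "V (ln x) \<le> m x" using ge n0(3,4) unfolding M m by (simp add: ext_ln_def)
    ultimately show ?case using M m by simp
  qed
  define E where "E = (\<lambda>x. m x * ln (ln x) / sqrt (ln x) - c_const / sqrt 2)"
  have cc: "c_const / sqrt 2 = 2 * sqrt log_step_S"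
  proof -
    have "c_const = sqrt (8 * log_step_S)" by (simp add: c_const_def log_step_S_def log_step_def)
    also have "\<dots> = sqrt (4 * log_step_S * 2)" by (simp add: mult_ac)
    also have "\<dots> = 2 * sqrt log_step_S * sqrt 2" by (simp only: real_sqrt_mult real_sqrt_four)
    finally have h: "c_const = 2 * sqrt log_step_S * sqrt 2" .
    show ?thesis unfolding h by simp
  qed
  have UV: "(\<lambda>x. \<bar>U (ln x) - g (ln x)\<bar> + \<bar>V (ln x) - g (ln x)\<bar>) \<in> O(\<lambda>x. er (ln x))"
    using landau_o.big.compose[OF U ln_at_top] landau_o.big.compose[OF V ln_at_top] by (intro sum_in_bigo) auto
  have "(\<lambda>x. m x - g (ln x)) \<in> O(\<lambda>x. \<bar>U (ln x) - g (ln x)\<bar> + \<bar>V (ln x) - g (ln x)\<bar>)"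
  proof (rule bigoI[where c = 1])
    show "\<forall>\<^sub>F x in at_top. norm (m x - g (ln x)) \<le> 1 * norm (\<bar>U (ln x) - g (ln x)\<bar> + \<bar>V (ln x) - g (ln x)\<bar>)"
      using ev by eventually_elim (auto simp: abs_le_iff)
  qed
  then have mg: "(\<lambda>x. m x - g (ln x)) \<in> O(\<lambda>x. er (ln x))" using UV by (rule landau_o.big_trans)
  have pos: "\<forall>\<^sub>F x::real in at_top. ln x > 0 \<and> ln (ln x) > 0" by (intro eventually_conj) real_asymp+
  have "(\<lambda>x. (m x - g (ln x)) * (ln (ln x) / sqrt (ln x))) \<in> O(\<lambda>x. er (ln x) * (ln (ln x) / sqrt (ln x)))"
    using mg by (rule landau_o.big.mult_right)
  also have "O(\<lambda>x. er (ln x) * (ln (ln x) / sqrt (ln x))) = O(\<lambda>x. ln (ln (ln x)) / ln (ln x))"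
  proof (rule landau_o.big.cong)
    show "\<forall>\<^sub>F x in at_top. er (ln x) * (ln (ln x) / sqrt (ln x)) = ln (ln (ln x)) / ln (ln x)"
      using pos by eventually_elim (simp add: er_def power2_eq_square)
  qed
  finally have E: "E \<in> O(\<lambda>x. ln (ln (ln x)) / ln (ln x))"
  proof (rule landau_o.big.in_cong[THEN iffD1, rotated])
    show "\<forall>\<^sub>F x in at_top. (m x - g (ln x)) * (ln (ln x) / sqrt (ln x)) = E x"
      using pos
    proof eventually_elim
      case (elim x)
      then have "sqrt (ln x) \<noteq> 0" "ln (ln x) \<noteq> 0" by auto
      then have "g (ln x) * (ln (ln x) / sqrt (ln x)) = 2 * sqrt log_step_S"
        by (simp add: g_def del: real_sqrt_eq_zero_cancel_iff ln_eq_zero_iff)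
      then show ?case by (simp add: E_def cc left_diff_distrib diff_divide_distrib)
    qed
  qed
  have "\<forall>\<^sub>F x in at_top. Mx x = ereal (sqrt (ln x) / ln (ln x) * (c_const / sqrt 2 + E x))"
    using ev pos
  proof eventually_elim
    case (elim x)
    then have "sqrt (ln x) \<noteq> 0" "ln (ln x) \<noteq> 0" by auto
    then have "sqrt (ln x) / ln (ln x) * (c_const / sqrt 2 + E x) = m x"
      by (simp add: E_def del: real_sqrt_eq_zero_cancel_iff ln_eq_zero_iff)
    with elim show ?case by simp
  qed
  with E show ?thesis unfolding Mx_def by blast
qed

end

section \<open>The maximal order\<close>

lemma real_char_of_quad_char:
  assumes "quad_char d ch M" "d \<noteq> 1"
  shows "real_char (\<lambda>n. real_of_int (ch n)) M"
proof
  have ic: "int_char ch M" using assms unfolding quad_char_def by blast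
  obtain a where a: "ch a = -1" using assms unfolding quad_char_def by blast
  show "M > 0" "real_of_int (ch 1) = 1" using ic by (auto simp: int_char_def)
  fix m n
  show "real_of_int (ch (n + M)) = real_of_int (ch n)" using ic by (simp add: int_char_def)
  show "real_of_int (ch (m * n)) = real_of_int (ch m) * real_of_int (ch n)"
    using ic by (simp add: int_char_def)
  have "ch n \<in> {-1, 0, 1}" using ic unfolding int_char_def by blast
  then show "real_of_int (ch n) \<in> {-1, 0, 1}" by auto
  show "(\<Sum>n<M. real_of_int (ch n)) = 0"
    using int_char_sum_period[OF ic a] by (simp flip: of_int_sum)
qed

text \<open>Completing the square turns a root of \<open>g\<close> modulo an odd prime into a square
  root of \<open>d\<close>, and conversely.\<close>

lemma (in quad_arith) is_split_iff_Legendre: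
  assumes "prime p" "p > 2" "\<not> int p dvd d"
  shows "is_split p \<longleftrightarrow> Legendre d (int p) = 1"
proof -
  have pr: "prime (int p)" using assms(1) by simp
  have p2: "\<not> int p dvd 2" using assms(2) zdvd_imp_le[of "int p" 2] by auto
  have p4: "\<not> int p dvd 4" using prime_dvd_mult_iff[OF pr, of 2 2] p2 by simp
  have odd: "odd (int p)" using assms prime_odd_nat by simp
  have disc: "disc = 4 * d \<or> disc = d" using te by (auto simp: disc_def)
  have nd: "\<not> int p dvd disc" using disc assms(3) p4 prime_dvd_mult_iff[OF pr] by auto
  have "(\<exists>b. int p dvd g b) \<longleftrightarrow> QuadRes (int p) d"
  proof
    assume "\<exists>b. int p dvd g b"
    then obtain b where b: "int p dvd g b" by blast
    show "QuadRes (int p) d"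
      using te
    proof
      assume "t = 0 \<and> e = d \<and> d mod 4 \<in> {2, 3}"
      then have "[b\<^sup>2 = d] (mod int p)" using b by (simp add: cong_iff_dvd_diff power2_eq_square)
      then show ?thesis unfolding QuadRes_def by blast
    next
      assume te1: "t = 1 \<and> 4 * e + 1 = d"
      have "(2 * b + 1)\<^sup>2 - d = 4 * g b" using te1 by (simp add: power2_eq_square algebra_simps)
      then have "int p dvd (2 * b + 1)\<^sup>2 - d" using b by (simp only: dvd_mult)
      then have "[(2 * b + 1)\<^sup>2 = d] (mod int p)" by (simp only: cong_iff_dvd_diff)
      then show ?thesis unfolding QuadRes_def by blast
    qed
  next
    assume "QuadRes (int p) d"
    then obtain y where y: "[y\<^sup>2 = d] (mod int p)" unfolding QuadRes_def by blast
    show "\<exists>b. int p dvd g b"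
      using te
    proof
      assume "t = 0 \<and> e = d \<and> d mod 4 \<in> {2, 3}"
      then have "int p dvd g y" using y by (simp add: cong_iff_dvd_diff power2_eq_square)
      then show ?thesis by blast
    next
      assume te1: "t = 1 \<and> 4 * e + 1 = d"
      \<comment> \<open>Solving \<open>z = 2 * b + 1\<close> for \<open>b\<close> needs an odd
        square root; adding the odd prime \<open>p\<close> changes the parity of
        \<open>y\<close>.\<close>
      obtain z where z: "[z\<^sup>2 = d] (mod int p)" "odd z"
      proof (cases "odd y")
        case True then show ?thesis using that y by blast
      next
        case False
        have "[(y + int p)\<^sup>2 = y\<^sup>2] (mod int p)" by (intro cong_pow) (simp add: cong_def)
        from cong_trans[OF this y] show ?thesis by (rule that) (use False odd in simp)
      qed
      obtain b where b: "z = 2 * b + 1" using z(2) by (rule oddE)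
      have "z\<^sup>2 - d = 4 * g b" using te1 unfolding b by (simp add: power2_eq_square algebra_simps)
      then have "int p dvd 4 * g b" using z(1) by (metis cong_iff_dvd_diff)
      then have "int p dvd g b" using prime_dvd_mult_iff[OF pr] p4 by blast
      then show ?thesis by blast
    qed
  qed
  moreover have "Legendre d (int p) = 1 \<longleftrightarrow> QuadRes (int p) d"
    using assms(3) by (simp add: Legendre_def cong_0_iff)
  ultimately show ?thesis using assms(1) nd by (simp add: is_split_def)
qed

lemma bounded_diff_count:
  fixes A B :: "nat \<Rightarrow> bool"
  assumes "finite F" "\<And>p. p \<notin> F \<Longrightarrow> A p \<longleftrightarrow> B p"
  shows "\<bar>real (card {p. A p \<and> real p \<le> x}) - real (card {p. B p \<and> real p \<le> x})\<bar> \<le> real (card F)"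
proof -
  have fin: "finite {p. C p \<and> real p \<le> x}" for C :: "nat \<Rightarrow> bool"
    by (rule finite_subset[of _ "{..nat \<lfloor>x\<rfloor>}"]) (auto simp: le_nat_floor)
  have le: "card {p. C p \<and> real p \<le> x} \<le> card {p. D p \<and> real p \<le> x} + card F"
    if "\<And>p. p \<notin> F \<Longrightarrow> C p \<longleftrightarrow> D p" for C D :: "nat \<Rightarrow> bool"
  proof -
    have "card {p. C p \<and> real p \<le> x} \<le> card ({p. D p \<and> real p \<le> x} \<union> F)"
      using fin assms(1) that by (intro card_mono) auto
    also have "\<dots> \<le> card {p. D p \<and> real p \<le> x} + card F" by (rule card_Un_le)
    finally show ?thesis .
  qed
  show ?thesis using le[of A B] le[of B A] assms(2) by (simp add: abs_le_iff)
qed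

theorem theorem3p1:
  fixes K :: "'a :: field_char_0 set"
  assumes "quadratic_field K"
  shows "\<exists>E :: real \<Rightarrow> real.
           E \<in> O[at_top](\<lambda>x. ln (ln (ln x)) / ln (ln x)) \<and>
           (\<forall>\<^sub>F x :: real in at_top.
              (MAX n \<in> {n :: nat. 1 \<le> n \<and> real n \<le> x}. ext_ln (ideal_count K (ideal_count K n)))
                = ereal (sqrt (ln x) / ln (ln x) * (c_const / sqrt 2 + E x)))"
proof -
  obtain om t e d where qi: "quad_int K om t e" and d: "squarefree d" "d \<noteq> 1"
    and te: "(t = 0 \<and> e = d \<and> d mod 4 \<in> {2,3}) \<or> (t = 1 \<and> 4 * e + 1 = d)"
    by (rule quadratic_field_integers[OF assms])
  interpret qi: quad_int K om t e by (rule qi)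
  interpret qa: quad_arith t e d by unfold_locales (rule d te)+
  obtain ch M where qc: "quad_char d ch M" using quad_char_exists[OF d(1)] by blast
  interpret rc: real_char "\<lambda>n. real_of_int (ch n)" M by (rule real_char_of_quad_char[OF qc d(2)])
  define P where "P = {p. qa.is_split p}"
  have count_pos: "ideal_count K n = card (hnf_pairs t e n)" if "n > 0" for n
    by (rule qi.ideal_count_eq[OF that])
  interpret sc: split_counting P "ideal_count K"
  proof
    show "prime p" if "p \<in> P" for p using that by (simp add: P_def qa.is_split_def)
    show "ideal_count K 0 = 0" by (simp add: ideal_count_def)
    show "ideal_count K 1 = 1" using count_pos[of 1] qa.count_1 by simp
    show "ideal_count K (m * n) = ideal_count K m * ideal_count K n" if "coprime m n" "m > 0" "n > 0" for m n
      using card_hnf_pairs_mult[OF that, of t e] that by (simp add: count_pos)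
    show "ideal_count K (p ^ a) = a + 1" if "p \<in> P" for p a
    proof -
      have sp: "qa.is_split p" using that by (simp add: P_def)
      then have "p ^ a > 0" by (simp add: qa.is_split_def prime_gt_0_nat)
      then show ?thesis using qa.count_split[OF sp] count_pos by simp
    qed
    show "ideal_count K (p ^ a) \<le> 1" if "prime p" "p \<notin> P" for p a
    proof -
      have sp: "\<not> qa.is_split p" using that by (simp add: P_def)
      have "p ^ a > 0" using that(1) by (simp add: prime_gt_0_nat)
      then show ?thesis using qa.count_nonsplit[OF that(1) sp] count_pos by simp
    qed
  qed
  have "d \<noteq> 0" using d(1) by (metis not_squarefree_0)
  \<comment> \<open>Away from the divisors of \<open>2 * d\<close>, a finite set, the split primes
    are those with \<open>ch p = 1\<close>; the two counting functions differ by a bounded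
    amount.\<close>
  define F where "F = {p. p dvd nat \<bar>2 * d\<bar>}"
  have finF: "finite F" unfolding F_def by (rule finite_divisors_nat) (use \<open>d \<noteq> 0\<close> in simp)
  have iff: "(p \<in> P) \<longleftrightarrow> (prime p \<and> real_of_int (ch p) = 1)" if "p \<notin> F" for p
  proof (cases "prime p")
    case True
    have nd: "\<not> int p dvd 2 * d" using that unfolding F_def by (simp add: nat_abs_dvd_iff dvd_nat_abs_iff)
    then have "\<not> int p dvd d" "p \<noteq> 2" by auto
    moreover have "p > 2" using \<open>p \<noteq> 2\<close> prime_ge_2_nat[OF True] by simp
    ultimately have "ch p = Legendre d (int p)" "qa.is_split p \<longleftrightarrow> Legendre d (int p) = 1"
      using qc True qa.is_split_iff_Legendre unfolding quad_char_def by blast+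
    then show ?thesis using True by (simp add: P_def)
  qed (simp add: P_def qa.is_split_def)
  have diff: "\<bar>sc.pP x - real (card (rc.split_primes x))\<bar> \<le> real (card F)" for x
    using bounded_diff_count[OF finF iff] unfolding sc.pP_def rc.split_primes_def by (simp add: conj_assoc)
  have "(\<lambda>x. sc.pP x - real (card (rc.split_primes x))) \<in> O(\<lambda>_. 1 :: real)"
    by (rule bigoI[where c = "real (card F)"]) (simp add: diff)
  also have "(\<lambda>_. 1 :: real) \<in> O(\<lambda>x. x * ln (ln x) / ln x ^ 2)" by real_asymp
  finally have "(\<lambda>x. (sc.pP x - real (card (rc.split_primes x))) + (real (card (rc.split_primes x)) - x / (2 * ln x)))
      \<in> O(\<lambda>x. x * ln (ln x) / ln x ^ 2)"
    using rc.split_primes_asymp by (rule sum_in_bigo)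
  then have count: "(\<lambda>x. sc.pP x - x / (2 * ln x)) \<in> O(\<lambda>x. x * ln (ln x) / ln x ^ 2)" by simp
  interpret split_counting_asymp P "ideal_count K" by unfold_locales (rule count)
  show ?thesis by (rule max_asymp)
qed

end
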